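(* Let $h\in\mathcal L^\infty$. Then there exists an infinite Hankel vector moment sequence $(\{\alpha_n\}_{n\in\mathcal I},Y,A)$ such that, with $\alpha=\alpha_{(1,0)}+\alpha_{(0,1)}$, $$h(z)=\langle(A-z_Y)^{-1}\alpha,\alpha\rangle\quad(z\in\Pi^2)\qquad\text{and}\qquad \operatorname{rank}(a^1+a^2)<\infty,$$ where $a^1_{m,n}=\langle Y\alpha_n,\alpha_m\rangle$ and $a^2_{m,n}=\langle(1-Y)\alpha_n,\alpha_m\rangle$ for $m,n\in\mathcal I$, if and only if $h$ is a rational function.
   Context: $\Pi$ is the open upper half-plane; a Pick function of two variables is a holomorphic map $\Pi^2\to\overline\Pi$. For a pair $n=(n_1,n_2)$ of non-negative integers, $|n|=n_1+n_2$, $z^n=z_1^{n_1}z_2^{n_2}$; $e_1=(1,0)$, $e_2=(0,1)$; $\mathcal I$ is the set of pairs of non-negative integers excluding $(0,0)$. Inner products are linear in the first entry; $\|\cdot\|$ on $\mathbb C^2$ is the Euclidean norm. A positive contraction is a bounded self-adjoint $Y$ with $0\le Y\le1$, and $z_Y=z_1Y+z_2(1-Y)$. $\mathcal L^\infty$ is the set of Pick functions $h$ of two variables having non-tangential asymptotic expansions of all orders at infinity with real coefficients and value $0$ at infinity: there are real numbers $\rho_n$ ($n\in\mathcal I$) such that for every $k\ge1$ and every $c>0$, $\|z\|^k\big(h(z)-\sum_{1\le|n|\le k}\rho_n/z^n\big)\to0$ as $\|z\|\to\infty$ within $\{z\in\Pi^2:\|z\|\le c\min\{\operatorname{Im} z_1,\operatorname{Im}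 z_2\}\}$. An infinite Hankel vector moment sequence (HVMS) is a triple $(\{\alpha_n\}_{n\in\mathcal I},Y,A)$ where $\{\alpha_n\}_{n\in\mathcal I}$ are vectors in a Hilbert space $\mathcal H$; $Y$ is a positive contraction on $\mathcal H$ with $Y\alpha_{(0,l)}=0$ and $(1-Y)\alpha_{(l,0)}=0$ for all $l\ge1$; $A$ is a densely defined self-adjoint operator on $\mathcal H$ with $\alpha_n\in\mathrm{Dom}(A)$ and $A\alpha_n=Y\alpha_{n+e_1}+(1-Y)\alpha_{n+e_2}$ for every $n\in\mathcal I$. The rank of the infinite matrix $a^1+a^2$, whose $(m,n)$ entry is $\langle\alpha_n,\alpha_m\rangle$, is the dimension of the span of its columns. *)

theory Defs
  imports
    "HOL-Analysis.Analysis"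
    "HOL-Computational_Algebra.Polynomial"
    "HOL-Library.Function_Algebras"
begin

section \<open>Complex Hilbert spaces\<close>

text \<open>
  A complex Hilbert space is a complete real inner product space carrying a complex scalar
  multiplication and a complex inner product, linear in the first entry, whose real part is
  the real inner product. Norm, topology, closure and boundedness are those of the underlying
  real space.
\<close>

class complex_hilbert = real_inner + complete_space +
  fixes scaleC :: "complex \<Rightarrow> 'a \<Rightarrow> 'a" (infixr \<open>*\<^sub>C\<close> 75)
    and cinner :: "'a \<Rightarrow> 'a \<Rightarrow> complex"
  assumes scaleC_add_right: "a *\<^sub>C (x + y) = a *\<^sub>C x + a *\<^sub>C y"
    and scaleC_add_left: "(a + b) *\<^sub>C x = a *\<^sub>C x + b *\<^sub>C x"
    and scaleC_scaleC: "a *\<^sub>C (b *\<^sub>C x) = (a * b) *\<^sub>C x"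
    and scaleR_scaleC: "r *\<^sub>R x = complex_of_real r *\<^sub>C x"
    and cinner_add_left: "cinner (x + y) z = cinner x z + cinner y z"
    and cinner_scaleC_left: "cinner (a *\<^sub>C x) y = a * cinner x y"
    and cinner_commute: "cinner x y = cnj (cinner y x)"
    and inner_eq_Re_cinner: "inner x y = Re (cinner x y)"

lemma cinner_self: "cinner x x = complex_of_real ((norm x)\<^sup>2)" for x :: "'a::complex_hilbert"
proof (rule complex_eqI)
  show "Re (cinner x x) = Re (complex_of_real ((norm x)\<^sup>2))"
    by (simp add: power2_norm_eq_inner inner_eq_Re_cinner)
  have "Im (cinner x x) = - Im (cinner x x)"
    using arg_cong[OF cinner_commute[of x x], of Im] by simp
  then show "Im (cinner x x) = Im (complex_of_real ((norm x)\<^sup>2))" by simp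
qed

subsection \<open>The space of square-summable complex sequences\<close>

typedef ell2 = "{f :: nat \<Rightarrow> complex. summable (\<lambda>i. (cmod (f i))\<^sup>2)}"
  by (rule exI[of _ "\<lambda>_. 0"]) simp

setup_lifting type_definition_ell2

lemma sq_summable_add:
  assumes "summable (\<lambda>i. (cmod (f i))\<^sup>2)" "summable (\<lambda>i. (cmod (g i))\<^sup>2)"
  shows "summable (\<lambda>i. (cmod (f i + g i))\<^sup>2)"
proof (rule summable_comparison_test')
  show "summable (\<lambda>i. 2 * (cmod (f i))\<^sup>2 + 2 * (cmod (g i))\<^sup>2)"
    by (intro summable_add summable_mult assms)
  fix i
  have "(cmod (f i + g i))\<^sup>2 \<le> (cmod (f i) + cmod (g i))\<^sup>2"
    by (intro power_mono norm_triangle_ineq) auto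
  also have "\<dots> \<le> 2 * (cmod (f i))\<^sup>2 + 2 * (cmod (g i))\<^sup>2"
    using sum_squares_bound[of "cmod (f i)" "cmod (g i)"] by (simp add: power2_sum)
  finally show "norm ((cmod (f i + g i))\<^sup>2) \<le> 2 * (cmod (f i))\<^sup>2 + 2 * (cmod (g i))\<^sup>2"
    by simp
qed

lemma sq_summable_scale:
  assumes "summable (\<lambda>i. (cmod (f i))\<^sup>2)"
  shows "summable (\<lambda>i. (cmod (c * f i))\<^sup>2)"
  using summable_mult[OF assms, of "(cmod c)\<^sup>2"] by (simp add: norm_mult power_mult_distrib)

lemma sq_summable_prod:
  assumes "summable (\<lambda>i. (cmod (f i))\<^sup>2)" "summable (\<lambda>i. (cmod (g i))\<^sup>2)"
  shows "summable (\<lambda>i. f i * cnj (g i))"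
proof (rule summable_comparison_test')
  show "summable (\<lambda>i. (cmod (f i))\<^sup>2 + (cmod (g i))\<^sup>2)"
    by (intro summable_add assms)
  fix i
  show "norm (f i * cnj (g i)) \<le> (cmod (f i))\<^sup>2 + (cmod (g i))\<^sup>2"
    using sum_squares_bound[of "cmod (f i)" "cmod (g i)"]
      mult_nonneg_nonneg[of "cmod (f i)" "cmod (g i)"]
    by (simp add: norm_mult del: mult_nonneg_nonneg)
qed

instantiation ell2 :: real_inner
begin

lift_definition zero_ell2 :: ell2 is "\<lambda>_. 0" by simp
lift_definition plus_ell2 :: "ell2 \<Rightarrow> ell2 \<Rightarrow> ell2" is "\<lambda>f g i. f i + g i"
  by (rule sq_summable_add)
lift_definition ell2_scaleC :: "complex \<Rightarrow> ell2 \<Rightarrow> ell2" is "\<lambda>c f i. c * f i"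
  by (rule sq_summable_scale)
lift_definition uminus_ell2 :: "ell2 \<Rightarrow> ell2" is "\<lambda>f i. - f i" by simp
lift_definition minus_ell2 :: "ell2 \<Rightarrow> ell2 \<Rightarrow> ell2" is "\<lambda>f g i. f i - g i"
  subgoal for f g using sq_summable_add[of f "\<lambda>i. - g i"] by simp
  done
lift_definition ell2_cinner :: "ell2 \<Rightarrow> ell2 \<Rightarrow> complex" is "\<lambda>f g. \<Sum>i. f i * cnj (g i)" .

definition scaleR_ell2 :: "real \<Rightarrow> ell2 \<Rightarrow> ell2" where "scaleR_ell2 r x = ell2_scaleC (complex_of_real r) x"
definition inner_ell2 :: "ell2 \<Rightarrow> ell2 \<Rightarrow> real" where "inner_ell2 x y = Re (ell2_cinner x y)"
definition norm_ell2 :: "ell2 \<Rightarrow> real" where "norm_ell2 x = sqrt (inner x x)"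
definition dist_ell2 :: "ell2 \<Rightarrow> ell2 \<Rightarrow> real" where "dist_ell2 x y = norm (x - y)"
definition sgn_ell2 :: "ell2 \<Rightarrow> ell2" where "sgn_ell2 x = inverse (norm x) *\<^sub>R x"
definition uniformity_ell2 :: "(ell2 \<times> ell2) filter"
  where "uniformity_ell2 = (INF e\<in>{0<..}. principal {(x, y). dist x y < e})"
definition open_ell2 :: "ell2 set \<Rightarrow> bool"
  where "open_ell2 U = (\<forall>x\<in>U. eventually (\<lambda>(x', y). x' = x \<longrightarrow> y \<in> U) uniformity)"

lemma ell2_inner_eq: "inner x x = (\<Sum>i. (cmod (Rep_ell2 x i))\<^sup>2)" for x :: ell2
proof -
  have s: "summable (\<lambda>i. (cmod (Rep_ell2 x i))\<^sup>2)" using Rep_ell2[of x] by simp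
  have "ell2_cinner x x = (\<Sum>i. complex_of_real ((cmod (Rep_ell2 x i))\<^sup>2))"
    by (simp only: ell2_cinner.rep_eq complex_norm_square)
  also have "\<dots> = complex_of_real (\<Sum>i. (cmod (Rep_ell2 x i))\<^sup>2)"
    by (rule suminf_of_real[OF s, symmetric])
  finally show ?thesis by (simp add: inner_ell2_def)
qed

lemma ell2_cinner_add: "ell2_cinner (x + y) z = ell2_cinner x z + ell2_cinner y z" for x y z :: ell2
proof (transfer)
  fix x y z :: "nat \<Rightarrow> complex"
  assume "summable (\<lambda>i. (cmod (x i))\<^sup>2)" "summable (\<lambda>i. (cmod (y i))\<^sup>2)"
    "summable (\<lambda>i. (cmod (z i))\<^sup>2)"
  then show "(\<Sum>i. (x i + y i) * cnj (z i)) = (\<Sum>i. x i * cnj (z i)) + (\<Sum>i. y i * cnj (z i))"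
    by (subst suminf_add) (auto intro!: sq_summable_prod simp: algebra_simps)
qed

lemma ell2_cinner_scale: "ell2_cinner (ell2_scaleC a x) y = a * ell2_cinner x y" for x y :: ell2
proof (transfer)
  fix a and x y :: "nat \<Rightarrow> complex"
  assume "summable (\<lambda>i. (cmod (x i))\<^sup>2)" "summable (\<lambda>i. (cmod (y i))\<^sup>2)"
  then show "(\<Sum>i. a * x i * cnj (y i)) = a * (\<Sum>i. x i * cnj (y i))"
    by (subst suminf_mult[symmetric]) (auto intro!: sq_summable_prod simp: algebra_simps)
qed

lemma ell2_cinner_commute: "ell2_cinner x y = cnj (ell2_cinner y x)" for x y :: ell2
proof (transfer)
  fix x y :: "nat \<Rightarrow> complex"
  assume a: "summable (\<lambda>i. (cmod (x i))\<^sup>2)" "summable (\<lambda>i. (cmod (y i))\<^sup>2)"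
  then have "(\<lambda>i. y i * cnj (x i)) sums (\<Sum>i. y i * cnj (x i))"
    by (intro summable_sums sq_summable_prod)
  then have "(\<lambda>i. cnj (y i * cnj (x i))) sums cnj (\<Sum>i. y i * cnj (x i))"
    by (simp only: sums_cnj)
  then show "(\<Sum>i. x i * cnj (y i)) = cnj (\<Sum>i. y i * cnj (x i))"
    by (intro sums_unique[symmetric]) (simp add: mult.commute)
qed

lemma ell2_partial_sum_le: "(\<Sum>i<k. (cmod (Rep_ell2 x i))\<^sup>2) \<le> (norm x)\<^sup>2" for x :: ell2
proof -
  have s: "summable (\<lambda>i. (cmod (Rep_ell2 x i))\<^sup>2)" using Rep_ell2[of x] by simp
  have "(norm x)\<^sup>2 = (\<Sum>i. (cmod (Rep_ell2 x i))\<^sup>2)"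
    unfolding norm_ell2_def ell2_inner_eq by (simp add: suminf_nonneg[OF s])
  then show ?thesis using sum_le_suminf[OF s, of "{..<k}"] by simp
qed

lemma ell2_norm_le:
  fixes x :: ell2
  assumes "0 \<le> e" "\<And>k. (\<Sum>i<k. (cmod (Rep_ell2 x i))\<^sup>2) \<le> e\<^sup>2"
  shows "norm x \<le> e"
proof -
  have s: "summable (\<lambda>i. (cmod (Rep_ell2 x i))\<^sup>2)" using Rep_ell2[of x] by simp
  have "inner x x \<le> e\<^sup>2" unfolding ell2_inner_eq by (rule suminf_le_const[OF s assms(2)])
  then show ?thesis unfolding norm_ell2_def using assms(1) real_le_lsqrt by blast
qed

lemma ell2_coord_le: "cmod (Rep_ell2 x i) \<le> norm x" for x :: ell2
proof -
  have "(cmod (Rep_ell2 x i))\<^sup>2 \<le> (\<Sum>j<Suc i. (cmod (Rep_ell2 x j))\<^sup>2)"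
    by (simp add: sum_nonneg)
  also have "\<dots> \<le> (norm x)\<^sup>2" by (rule ell2_partial_sum_le)
  finally show ?thesis
    by (rule power2_le_imp_le) (simp add: norm_ell2_def ell2_inner_eq suminf_nonneg
      Rep_ell2[simplified])
qed

instance
proof
  fix x y z :: ell2 and a b :: complex and r s :: real
  show "x + y + z = x + (y + z)" by transfer (simp add: add.assoc)
  show "x + y = y + x" by transfer (simp add: add.commute)
  show "0 + x = x" by transfer simp
  show "- x + x = 0" by transfer simp
  show "x - y = x + - y" by transfer simp
  have 1: "ell2_scaleC a (x + y) = ell2_scaleC a x + ell2_scaleC a y" for a :: complex and x y :: ell2
    by transfer (simp add: algebra_simps)
  have 2: "ell2_scaleC (a + b) x = ell2_scaleC a x + ell2_scaleC b x" for a b :: complex and x :: ell2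
    by transfer (simp add: algebra_simps)
  have 3: "ell2_scaleC a (ell2_scaleC b x) = ell2_scaleC (a * b) x" for a b :: complex and x :: ell2
    by transfer (simp add: algebra_simps)
  show "r *\<^sub>R (x + y) = r *\<^sub>R x + r *\<^sub>R y" by (simp add: scaleR_ell2_def 1)
  show "(r + s) *\<^sub>R x = r *\<^sub>R x + s *\<^sub>R x" by (simp add: scaleR_ell2_def 2)
  show "r *\<^sub>R s *\<^sub>R x = (r * s) *\<^sub>R x" by (simp add: scaleR_ell2_def 3)
  show "1 *\<^sub>R x = x" unfolding scaleR_ell2_def by transfer simp
  show "dist x y = norm (x - y)" by (rule dist_ell2_def)
  show "sgn x = inverse (norm x) *\<^sub>R x" by (rule sgn_ell2_def)
  show "(uniformity :: (ell2 \<times> ell2) filter) = (INF e\<in>{0<..}. principal {(x, y). dist x y < e})"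
    by (rule uniformity_ell2_def)
  show "open U = (\<forall>x\<in>U. eventually (\<lambda>(x', y). x' = x \<longrightarrow> y \<in> U) uniformity)" for U :: "ell2 set"
    by (rule open_ell2_def)
  show "inner x y = inner y x"
    unfolding inner_ell2_def by (subst ell2_cinner_commute) simp
  show "inner (x + y) z = inner x z + inner y z" by (simp add: inner_ell2_def ell2_cinner_add)
  show "inner (r *\<^sub>R x) y = r * inner x y"
    by (simp add: inner_ell2_def scaleR_ell2_def ell2_cinner_scale)
  have s: "summable (\<lambda>i. (cmod (Rep_ell2 x i))\<^sup>2)" using Rep_ell2[of x] by simp
  show "0 \<le> inner x x" unfolding ell2_inner_eq by (rule suminf_nonneg[OF s]) simp
  have "inner x x = 0 \<longleftrightarrow> (\<forall>i. Rep_ell2 x i = 0)"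
    unfolding ell2_inner_eq by (subst suminf_eq_zero_iff[OF s]) auto
  also have "\<dots> \<longleftrightarrow> x = 0" by transfer auto
  finally show "inner x x = 0 \<longleftrightarrow> x = 0" .
  show "norm x = sqrt (inner x x)" by (rule norm_ell2_def)
qed

end

instance ell2 :: complete_space
proof
  fix X :: "nat \<Rightarrow> ell2"
  assume X: "Cauchy X"
  have dist_eq: "dist (X m) (X n) = norm (X m - X n)" for m n by (rule dist_ell2_def)
  have "Cauchy (\<lambda>n. Rep_ell2 (X n) i)" for i
  proof (rule CauchyI)
    fix e :: real assume "0 < e"
    then obtain N where N: "\<And>m n. N \<le> m \<Longrightarrow> N \<le> n \<Longrightarrow> norm (X m - X n) < e"
      using X unfolding Cauchy_def dist_eq by blast
    show "\<exists>N. \<forall>m\<ge>N. \<forall>n\<ge>N. norm (Rep_ell2 (X m) i - Rep_ell2 (X n) i) < e"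
      using ell2_coord_le[of "X _ - X _" i] N unfolding minus_ell2.rep_eq
      by (meson le_less_trans)
  qed
  then have "\<forall>i. \<exists>l. (\<lambda>n. Rep_ell2 (X n) i) \<longlonglongrightarrow> l"
    using Cauchy_convergent convergent_def by blast
  then obtain g where g: "\<And>i. (\<lambda>n. Rep_ell2 (X n) i) \<longlonglongrightarrow> g i" by metis
  have bound: "\<exists>N. \<forall>m\<ge>N. \<forall>k. (\<Sum>i<k. (cmod (Rep_ell2 (X m) i - g i))\<^sup>2) \<le> e\<^sup>2"
    if e: "0 < e" for e :: real
  proof -
    obtain N where N: "\<And>m n. N \<le> m \<Longrightarrow> N \<le> n \<Longrightarrow> norm (X m - X n) < e"
      using X e unfolding Cauchy_def dist_eq by blast
    have "(\<Sum>i<k. (cmod (Rep_ell2 (X m) i - g i))\<^sup>2) \<le> e\<^sup>2" if m: "N \<le> m" for m k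
    proof (rule LIMSEQ_le_const2)
      show "(\<lambda>n. \<Sum>i<k. (cmod (Rep_ell2 (X m) i - Rep_ell2 (X n) i))\<^sup>2)
          \<longlonglongrightarrow> (\<Sum>i<k. (cmod (Rep_ell2 (X m) i - g i))\<^sup>2)"
        by (intro tendsto_intros g)
      have "(\<Sum>i<k. (cmod (Rep_ell2 (X m) i - Rep_ell2 (X n) i))\<^sup>2) \<le> e\<^sup>2" if n: "N \<le> n" for n
      proof -
        have nn: "0 \<le> norm (X m - X n)"
          using ell2_coord_le[of "X m - X n" 0] norm_ge_zero order_trans by blast
        have "(norm (X m - X n))\<^sup>2 \<le> e\<^sup>2"
          using N[OF m n] nn by (intro power_mono) auto
        then show ?thesis
          using ell2_partial_sum_le[of "X m - X n" k] by (simp add: minus_ell2.rep_eq)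
      qed
      then show "\<exists>M. \<forall>n\<ge>M. (\<Sum>i<k. (cmod (Rep_ell2 (X m) i - Rep_ell2 (X n) i))\<^sup>2) \<le> e\<^sup>2"
        by blast
    qed
    then show ?thesis by blast
  qed
  have sm: "summable (\<lambda>i. (cmod (g i - Rep_ell2 (X m) i))\<^sup>2)"
    if "\<forall>k. (\<Sum>i<k. (cmod (Rep_ell2 (X m) i - g i))\<^sup>2) \<le> e\<^sup>2" for m and e :: real
    by (rule summableI_nonneg_bounded[of _ "e\<^sup>2"]) (use that in \<open>auto simp: norm_minus_commute\<close>)
  obtain m1 where "\<forall>k. (\<Sum>i<k. (cmod (Rep_ell2 (X m1) i - g i))\<^sup>2) \<le> 1\<^sup>2"
    using bound[of 1] by auto
  from sm[OF this] have "summable (\<lambda>i. (cmod (g i - Rep_ell2 (X m1) i + Rep_ell2 (X m1) i))\<^sup>2)"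
    by (rule sq_summable_add) (use Rep_ell2[of "X m1"] in simp)
  then have "summable (\<lambda>i. (cmod (g i))\<^sup>2)" by simp
  then have G: "Rep_ell2 (Abs_ell2 g) = g" by (simp add: Abs_ell2_inverse)
  have "X \<longlonglongrightarrow> Abs_ell2 g"
  proof (rule metric_LIMSEQ_I)
    fix r :: real assume r: "0 < r"
    then obtain N where N: "\<forall>m\<ge>N. \<forall>k. (\<Sum>i<k. (cmod (Rep_ell2 (X m) i - g i))\<^sup>2) \<le> (r/2)\<^sup>2"
      using bound[of "r/2"] by auto
    have "norm (X m - Abs_ell2 g) < r" if "N \<le> m" for m
    proof -
      have "norm (X m - Abs_ell2 g) \<le> r/2"
        by (rule ell2_norm_le) (use r N that in \<open>auto simp: minus_ell2.rep_eq G\<close>)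
      then show ?thesis using r by simp
    qed
    then show "\<exists>N. \<forall>m\<ge>N. dist (X m) (Abs_ell2 g) < r"
      unfolding dist_ell2_def by blast
  qed
  then show "convergent X" unfolding convergent_def by blast
qed

instantiation ell2 :: complex_hilbert
begin

definition scaleC_ell2 :: "complex \<Rightarrow> ell2 \<Rightarrow> ell2" where "scaleC_ell2 = ell2_scaleC"
definition cinner_ell2 :: "ell2 \<Rightarrow> ell2 \<Rightarrow> complex" where "cinner_ell2 = ell2_cinner"

instance
proof
  fix x y z :: ell2 and a b :: complex and r :: real
  show "a *\<^sub>C (x + y) = a *\<^sub>C x + a *\<^sub>C y"
    unfolding scaleC_ell2_def by transfer (simp add: algebra_simps)
  show "(a + b) *\<^sub>C x = a *\<^sub>C x + b *\<^sub>C x"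
    unfolding scaleC_ell2_def by transfer (simp add: algebra_simps)
  show "a *\<^sub>C (b *\<^sub>C x) = (a * b) *\<^sub>C x"
    unfolding scaleC_ell2_def by transfer (simp add: algebra_simps)
  show "r *\<^sub>R x = complex_of_real r *\<^sub>C x" by (simp add: scaleC_ell2_def scaleR_ell2_def)
  show "cinner (x + y) z = cinner x z + cinner y z"
    by (simp add: cinner_ell2_def ell2_cinner_add)
  show "cinner (a *\<^sub>C x) y = a * cinner x y"
    by (simp add: cinner_ell2_def scaleC_ell2_def ell2_cinner_scale)
  show "cinner x y = cnj (cinner y x)" unfolding cinner_ell2_def by (rule ell2_cinner_commute)
  show "inner x y = Re (cinner x y)" by (simp add: cinner_ell2_def inner_ell2_def)
qed

end

section \<open>Operators\<close>

text \<open>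
  An unbounded operator is given by its domain \<open>D\<close> and a function \<open>A\<close>
  whose values outside \<open>D\<close> are irrelevant.
\<close>

definition clinear_on :: "'a::complex_hilbert set \<Rightarrow> ('a \<Rightarrow> 'a) \<Rightarrow> bool" where
  "clinear_on D A \<longleftrightarrow> 0 \<in> D \<and>
     (\<forall>x\<in>D. \<forall>y\<in>D. x + y \<in> D \<and> A (x + y) = A x + A y) \<and>
     (\<forall>c. \<forall>x\<in>D. c *\<^sub>C x \<in> D \<and> A (c *\<^sub>C x) = c *\<^sub>C A x)"

definition op_graph :: "'a::complex_hilbert set \<Rightarrow> ('a \<Rightarrow> 'a) \<Rightarrow> ('a \<times> 'a) set" where
  "op_graph D A = {(x, A x) |x. x \<in> D}"

definition adjoint_graph :: "'a::complex_hilbert set \<Rightarrow> ('a \<Rightarrow> 'a) \<Rightarrow> ('a \<times> 'a) set" where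
  "adjoint_graph D A = {(y, w). \<forall>x\<in>D. cinner (A x) y = cinner x w}"

definition densely_defined_self_adjoint :: "'a::complex_hilbert set \<Rightarrow> ('a \<Rightarrow> 'a) \<Rightarrow> bool" where
  "densely_defined_self_adjoint D A \<longleftrightarrow>
     clinear_on D A \<and> closure D = UNIV \<and> adjoint_graph D A = op_graph D A"

definition positive_contraction :: "('a::complex_hilbert \<Rightarrow> 'a) \<Rightarrow> bool" where
  "positive_contraction Y \<longleftrightarrow>
     bounded_linear Y \<and> (\<forall>c x. Y (c *\<^sub>C x) = c *\<^sub>C Y x) \<and>
     (\<forall>x y. cinner (Y x) y = cinner x (Y y)) \<and>
     (\<forall>x. 0 \<le> Re (cinner (Y x) x) \<and> Re (cinner (Y x) x) \<le> Re (cinner x x))"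

definition z_op :: "('a::complex_hilbert \<Rightarrow> 'a) \<Rightarrow> complex \<times> complex \<Rightarrow> 'a \<Rightarrow> 'a" where
  "z_op Y z x = fst z *\<^sub>C Y x + snd z *\<^sub>C (x - Y x)"

text \<open>
  For self-adjoint \<open>A\<close>, a positive contraction \<open>Y\<close> and \<open>z\<close> in the product of two
  upper half-planes, \<open>A - z\<^sub>Y\<close> is automatically a bijection from \<open>D\<close> onto the whole space,
  since the imaginary part of \<open>z\<^sub>Y\<close> is bounded below by \<open>min (Im z\<^sub>1) (Im z\<^sub>2) > 0\<close>.
\<close>

definition resolvent ::
  "'a::complex_hilbert set \<Rightarrow> ('a \<Rightarrow> 'a) \<Rightarrow> ('a \<Rightarrow> 'a) \<Rightarrow> complex \<times> complex \<Rightarrow> 'a \<Rightarrow> 'a" where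
  "resolvent D A Y z = the_inv_into D (\<lambda>x. A x - z_op Y z x)"

section \<open>Hankel vector moment sequences\<close>

definition index_set :: "(nat \<times> nat) set" where
  "index_set = UNIV - {(0, 0)}"

text \<open>The value of \<open>\<alpha>\<close> at \<open>(0, 0)\<close> is irrelevant.\<close>

definition infinite_HVMS ::
  "(nat \<times> nat \<Rightarrow> 'a::complex_hilbert) \<Rightarrow> ('a \<Rightarrow> 'a) \<Rightarrow> 'a set \<Rightarrow> ('a \<Rightarrow> 'a) \<Rightarrow> bool" where
  "infinite_HVMS \<alpha> Y D A \<longleftrightarrow>
     positive_contraction Y \<and>
     (\<forall>l\<ge>1. Y (\<alpha> (0, l)) = 0 \<and> \<alpha> (l, 0) - Y (\<alpha> (l, 0)) = 0) \<and>
     densely_defined_self_adjoint D A \<and>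
     (\<forall>n\<in>index_set. \<alpha> n \<in> D \<and>
        A (\<alpha> n) = Y (\<alpha> (n + (1, 0))) + (\<alpha> (n + (0, 1)) - Y (\<alpha> (n + (0, 1)))))"

definition gram1 ::
  "(nat \<times> nat \<Rightarrow> 'a::complex_hilbert) \<Rightarrow> ('a \<Rightarrow> 'a) \<Rightarrow> nat \<times> nat \<Rightarrow> nat \<times> nat \<Rightarrow> complex" where
  "gram1 \<alpha> Y m n = cinner (Y (\<alpha> n)) (\<alpha> m)"

definition gram2 ::
  "(nat \<times> nat \<Rightarrow> 'a::complex_hilbert) \<Rightarrow> ('a \<Rightarrow> 'a) \<Rightarrow> nat \<times> nat \<Rightarrow> nat \<times> nat \<Rightarrow> complex" where
  "gram2 \<alpha> Y m n = cinner (\<alpha> n - Y (\<alpha> n)) (\<alpha> m)"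

interpretation cfun: vector_space "\<lambda>(c::complex) (f :: nat \<times> nat \<Rightarrow> complex) m. c * f m"
  by unfold_locales (auto simp: fun_eq_iff algebra_simps)

text \<open>
  Columns are functions on \<open>index_set\<close>, represented as functions on all pairs that vanish
  at \<open>(0, 0)\<close>.
\<close>

definition matrix_column :: "(nat \<times> nat \<Rightarrow> nat \<times> nat \<Rightarrow> complex) \<Rightarrow> nat \<times> nat \<Rightarrow> nat \<times> nat \<Rightarrow> complex" where
  "matrix_column M n = (\<lambda>m. if m \<in> index_set then M m n else 0)"

definition finite_rank :: "(nat \<times> nat \<Rightarrow> nat \<times> nat \<Rightarrow> complex) \<Rightarrow> bool" where
  "finite_rank M \<longleftrightarrow>
     (\<exists>B. finite B \<and> cfun.span (matrix_column M ` index_set) = cfun.span B)"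

section \<open>Pick functions of two variables\<close>

definition upper_half_plane :: "complex set" where
  "upper_half_plane = {w. 0 < Im w}"

abbreviation bi_upper :: "(complex \<times> complex) set" where
  "bi_upper \<equiv> upper_half_plane \<times> upper_half_plane"

text \<open>Holomorphic means complex differentiable; the derivative is the
  complex-linear map \<open>(u, v) \<mapsto> a u + b v\<close>.\<close>

definition holomorphic2_on :: "(complex \<times> complex \<Rightarrow> complex) \<Rightarrow> (complex \<times> complex) set \<Rightarrow> bool" where
  "holomorphic2_on h S \<longleftrightarrow>
     (\<forall>z\<in>S. \<exists>a b. (h has_derivative (\<lambda>(u, v). a * u + b * v)) (at z within S))"

text \<open>Values of \<open>h\<close> outside \<open>bi_upper\<close> are irrelevant.\<close>

definition pick2 :: "(complex \<times> complex \<Rightarrow> complex) \<Rightarrow> bool" where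
  "pick2 h \<longleftrightarrow> holomorphic2_on h bi_upper \<and> (\<forall>z\<in>bi_upper. 0 \<le> Im (h z))"

definition nontangential_region :: "real \<Rightarrow> (complex \<times> complex) set" where
  "nontangential_region c = {z \<in> bi_upper. norm z \<le> c * min (Im (fst z)) (Im (snd z))}"

definition L_infinity :: "(complex \<times> complex \<Rightarrow> complex) set" where
  "L_infinity = {h. pick2 h \<and> (\<exists>\<rho> :: nat \<times> nat \<Rightarrow> real. \<forall>k\<ge>(1::nat). \<forall>c>0.
     ((\<lambda>z. complex_of_real (norm z ^ k) *
          (h z - (\<Sum>n | 1 \<le> fst n + snd n \<and> fst n + snd n \<le> k.
                    complex_of_real (\<rho> n) / (fst z ^ fst n * snd z ^ snd n))))
       \<longlongrightarrow> 0) (inf at_infinity (principal (nontangential_region c))))}"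

lemma finite_multi_indices: "finite {n :: nat \<times> nat. 1 \<le> fst n + snd n \<and> fst n + snd n \<le> k}"
  by (rule finite_subset[of _ "{..k} \<times> {..k}"]) auto

text \<open>
  Polynomials in two variables are polynomials in \<open>z\<^sub>2\<close> with coefficients in
  \<open>\<complex>[z\<^sub>1]\<close>. A rational function is a quotient of such polynomials with nonzero denominator;
  \<open>h\<close> is rational if it equals the quotient wherever the denominator does not vanish.
\<close>

definition poly2 :: "complex poly poly \<Rightarrow> complex \<times> complex \<Rightarrow> complex" where
  "poly2 p z = poly (poly p [:snd z:]) (fst z)"

definition rational2 :: "(complex \<times> complex \<Rightarrow> complex) \<Rightarrow> bool" where
  "rational2 h \<longleftrightarrow>
     (\<exists>p q. q \<noteq> 0 \<and> (\<forall>z\<in>bi_upper. poly2 q z \<noteq> 0 \<longrightarrow> h z = poly2 p z / poly2 q z))"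

end

theory Submission
  imports Defs "HOL-Complex_Analysis.Complex_Analysis" "HOL-Computational_Algebra.Fundamental_Theorem_Algebra"
begin

text \<open>
  If the rank is finite, the moment vectors span a finite-dimensional space. Along the rays
  \<open>z = \<i> t b\<close> with \<open>b\<close> in the positive quadrant the resolvent vector stays in that space, since
  \<open>A\<close> and \<open>b\<^sub>Y\<close> act on the moment vectors like a shift. There \<open>h\<close> is obtained from a linear
  system with polynomial coefficients, and the identity theorem extends the fraction to \<open>\<Pi>\<^sup>2\<close>.

  Conversely, a Cayley transform turns a rational \<open>h\<close> with real coefficients into a rational inner
  function \<open>f\<close> on the bidisk. A trace estimate shows that multiplication by \<open>f\<close> is isometric on the
  Hardy space. The model space \<open>H\<^sup>2 \<ominus> f H\<^sup>2\<close> is the sum of its largest \<open>z\<^sub>1\<close>-invariant subspace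
  and an orthogonal complement that turns out to be \<open>z\<^sub>2\<close>-invariant; the wandering subspaces of
  both parts are finite-dimensional and give
  \<open>1 - f(\<zeta>) f(\<eta>)\<^sup>* = (1 - \<zeta>\<^sub>1 \<eta>\<^sub>1\<^sup>*) K\<^sub>1(\<zeta>, \<eta>) + (1 - \<zeta>\<^sub>2 \<eta>\<^sub>2\<^sup>*) K\<^sub>2(\<zeta>, \<eta>)\<close> with kernels
  of finite rank. Transported back to \<open>\<Pi>\<^sup>2\<close>, a lurking isometry argument yields \<open>Y\<close>, \<open>A\<close> and \<open>\<alpha>\<close> on
  a finite-dimensional space with \<open>h(z) = \<langle>(A - z\<^sub>Y)\<^sup>-\<^sup>1 \<alpha>, \<alpha>\<rangle>\<close>.

  The moment vectors are the coefficients of the homogeneous layers in the expansion of the resolvent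
  vector. A priori these layers, with coordinates \<open>\<sigma>\<^sub>j(s)\<close> in the eigenbasis of \<open>Y\<close>, are rational with
  poles where \<open>y\<^sub>j + s (1 - y\<^sub>j) = 0\<close>. But the asymptotic expansion of \<open>h\<close> makes
  \<open>\<Sum>\<^sub>j |\<sigma>\<^sub>j(s)|\<^sup>2 / (y\<^sub>j + s (1 - y\<^sub>j))\<close> a polynomial divided by \<open>s\<close>, and since the terms are
  nonnegative no pole can cancel: each \<open>\<sigma>\<^sub>j\<close> vanishes there.
\<close>

section \<open>Complex Hilbert spaces\<close>

text \<open>The isometry of multiplication by \<open>f\<close> is obtained from a trace because
  \<open>p\<close> may vanish on the torus, where boundary values of \<open>f\<close> are delicate.
  Finite dimension rests on \<open>p (0, 0)\<close> being nonzero: extreme coefficients of elements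
  of the model space then satisfy linear recurrences, so finitely many functionals separate the
  wandering subspaces. The base point of the Cayley transform is chosen to guarantee this. The
  reality of the expansion makes \<open>h\<close> a quotient a/b of real polynomials; then (h -
  \<i>)/(h + \<i>) is conj(u)/u with u = a + \<i> b, and the Cayley transform turns conjugation of
  coefficients into reflection. The value 0 at infinity enters through vectors x(z) that tend to 0
  along the diagonal ray: this makes h(z) linear in x(z), which provides \<alpha> and keeps
  \<open>A\<close> well defined, where a lurking isometry could otherwise yield only a linear
  relation.\<close>

instance complex_hilbert \<subseteq> banach ..

lemma scaleC_one [simp]: "1 *\<^sub>C x = x" for x :: "'a::complex_hilbert"
  using scaleR_scaleC[of 1 x] by simp

interpretation ch: vector_space "scaleC :: complex \<Rightarrow> 'a::complex_hilbert \<Rightarrow> 'a"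
  by unfold_locales (auto simp: scaleC_add_right scaleC_add_left scaleC_scaleC)

lemma cinner_scaleC_right [simp]: "cinner x (a *\<^sub>C y) = cnj a * cinner x y"
  for x y :: "'a::complex_hilbert"
  by (subst (1 2) cinner_commute) (simp add: cinner_scaleC_left)

lemma cinner_add_right: "cinner x (y + z) = cinner x y + cinner x z"
  for x y z :: "'a::complex_hilbert"
  by (subst (1 2 3) cinner_commute) (simp add: cinner_add_left)

lemma cinner_zero_left [simp]: "cinner 0 x = 0" for x :: "'a::complex_hilbert"
  using cinner_add_left[of 0 0 x] by simp

lemma cinner_zero_right [simp]: "cinner x 0 = 0" for x :: "'a::complex_hilbert"
  using cinner_add_right[of x 0 0] by simp

lemma cinner_minus_left [simp]: "cinner (- x) y = - cinner x y" for x y :: "'a::complex_hilbert"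
  using cinner_add_left[of x "- x" y] by (simp add: add_eq_0_iff)

lemma cinner_minus_right [simp]: "cinner x (- y) = - cinner x y" for x y :: "'a::complex_hilbert"
  using cinner_add_right[of x y "- y"] by (simp add: add_eq_0_iff)

lemma cinner_diff_left: "cinner (x - y) z = cinner x z - cinner y z" for x y z :: "'a::complex_hilbert"
  using cinner_add_left[of x "- y" z] by simp

lemma cinner_diff_right: "cinner x (y - z) = cinner x y - cinner x z" for x y z :: "'a::complex_hilbert"
  using cinner_add_right[of x y "- z"] by simp

lemmas cinner_simps = cinner_add_left cinner_add_right cinner_diff_left cinner_diff_right
  cinner_scaleC_left cinner_scaleC_right

lemma cinner_sum_left: "cinner (\<Sum>i\<in>I. f i) x = (\<Sum>i\<in>I. cinner (f i) x)" for x :: "'a::complex_hilbert"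
  by (induction I rule: infinite_finite_induct) (auto simp: cinner_add_left)

lemma cinner_sum_right: "cinner x (\<Sum>i\<in>I. f i) = (\<Sum>i\<in>I. cinner x (f i))" for x :: "'a::complex_hilbert"
  by (induction I rule: infinite_finite_induct) (auto simp: cinner_add_right)

lemma cinner_self_eq_0 [simp]: "cinner x x = 0 \<longleftrightarrow> x = 0" for x :: "'a::complex_hilbert"
  by (simp add: cinner_self)

lemma cinner_eq_0_sym: "cinner x y = 0 \<longleftrightarrow> cinner y x = 0" for x y :: "'a::complex_hilbert"
  by (metis cinner_commute complex_cnj_zero)

lemma norm_scaleC [simp]: "norm (a *\<^sub>C x) = cmod a * norm x" for x :: "'a::complex_hilbert"
proof -
  have "complex_of_real ((norm (a *\<^sub>C x))\<^sup>2) = (a * cnj a) * cinner x x"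
    unfolding cinner_self[symmetric] by (simp add: cinner_scaleC_left)
  also have "\<dots> = complex_of_real ((cmod a * norm x)\<^sup>2)"
    by (simp only: complex_norm_square[symmetric] cinner_self) (simp add: power_mult_distrib)
  finally show ?thesis
    by (metis of_real_eq_iff norm_ge_zero mult_nonneg_nonneg power2_eq_iff_nonneg)
qed

lemma cmod_cinner_le: "cmod (cinner x y) \<le> norm x * norm y" for x y :: "'a::complex_hilbert"
proof (cases "cinner x y = 0")
  case False
  let ?c = "cinner x y"
  \<comment> \<open>A unimodular factor that rotates the inner product onto its modulus, so that the
    real Cauchy-Schwarz inequality applies.\<close>
  define u where "u = cnj ?c / cmod ?c"
  have u: "cmod u = 1" using False by (simp add: u_def norm_divide)
  have "u * ?c = cmod ?c"
    using False complex_norm_square[of ?c] by (simp add: u_def field_simps power2_eq_square)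
  then have "inner (u *\<^sub>C x) y = cmod ?c"
    by (simp add: inner_eq_Re_cinner cinner_scaleC_left)
  moreover have "inner (u *\<^sub>C x) y \<le> norm (u *\<^sub>C x) * norm y" by (rule norm_cauchy_schwarz)
  ultimately show ?thesis using u by simp
qed simp

lemma bounded_linear_cinner_left: "bounded_linear (\<lambda>x. cinner x y)" for y :: "'a::complex_hilbert"
  by (rule bounded_linear_intro[of _ "norm y"])
    (auto simp: cinner_add_left scaleR_scaleC cinner_scaleC_left cmod_cinner_le scaleR_conv_of_real)

lemma bounded_linear_cinner_right: "bounded_linear (\<lambda>x. cinner y x)" for y :: "'a::complex_hilbert"
  by (rule bounded_linear_intro[of _ "norm y"])
    (auto simp: cinner_add_right scaleR_scaleC cmod_cinner_le scaleR_conv_of_real mult.commute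
      intro: order_trans[OF cmod_cinner_le])

lemmas tendsto_cinner_right = bounded_linear.tendsto[OF bounded_linear_cinner_right]

lemma norm_sq_eq_Re_cinner: "(norm x)\<^sup>2 = Re (cinner x x)" for x :: "'a::complex_hilbert"
  by (simp add: cinner_self)

lemma norm_sq_add: "(norm (x + y))\<^sup>2 = (norm x)\<^sup>2 + (norm y)\<^sup>2 + 2 * Re (cinner x y)"
  for x y :: "'a::complex_hilbert"
proof -
  have "Re (cinner y x) = Re (cinner x y)" by (subst cinner_commute) simp
  then show ?thesis unfolding norm_sq_eq_Re_cinner by (simp add: cinner_simps)
qed

lemma norm_sq_diff: "(norm (x - y))\<^sup>2 = (norm x)\<^sup>2 + (norm y)\<^sup>2 - 2 * Re (cinner x y)"
  for x y :: "'a::complex_hilbert"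
  using norm_sq_add[of x "- y"] by simp

lemma cinner_span_eq_0:
  assumes "y \<in> ch.span B" "\<And>b. b \<in> B \<Longrightarrow> cinner x b = 0"
  shows "cinner x y = 0"
  using assms(1)
proof (induction rule: ch.span_induct_alt)
  case base show ?case by simp
next
  case (step c b z) then show ?case using assms(2) by (simp add: cinner_simps)
qed

subsection \<open>Orthogonal projections\<close>

definition orthonormal :: "'a::complex_hilbert set \<Rightarrow> bool" where
  "orthonormal E \<longleftrightarrow> (\<forall>x\<in>E. \<forall>y\<in>E. cinner x y = (if x = y then 1 else 0))"

definition proj_on :: "'a::complex_hilbert set \<Rightarrow> 'a \<Rightarrow> 'a" where
  "proj_on E x = (\<Sum>e\<in>E. cinner x e *\<^sub>C e)"

lemma proj_on_in_span: "proj_on E x \<in> ch.span E"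
  unfolding proj_on_def by (intro ch.span_sum ch.span_scale ch.span_base)

lemma proj_on_add: "proj_on E (x + y) = proj_on E x + proj_on E y"
  by (simp add: proj_on_def cinner_add_left scaleC_add_left sum.distrib)

lemma proj_on_scaleC: "proj_on E (c *\<^sub>C x) = c *\<^sub>C proj_on E x"
  by (simp add: proj_on_def cinner_scaleC_left ch.scale_sum_right)

lemma proj_on_diff: "proj_on E (x - y) = proj_on E x - proj_on E y"
  by (simp add: proj_on_def cinner_diff_left ch.scale_left_diff_distrib sum_subtractf)

lemma cinner_proj_on_swap: "cinner (proj_on E x) y = cinner x (proj_on E y)"
proof -
  have "cinner e y = cnj (cinner y e)" for e by (rule cinner_commute)
  then show ?thesis
    by (simp add: proj_on_def cinner_sum_left cinner_sum_right cinner_scaleC_left mult.commute)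
qed

lemma proj_on_orthogonal:
  assumes "finite E" "orthonormal E" "y \<in> ch.span E"
  shows "cinner (x - proj_on E x) y = 0"
proof (rule cinner_span_eq_0[OF assms(3)])
  fix b assume b: "b \<in> E"
  have "cinner (proj_on E x) b = (\<Sum>e\<in>E. cinner x e * (if e = b then 1 else 0))"
    unfolding proj_on_def cinner_sum_left cinner_scaleC_left
    using assms(2) b by (intro sum.cong) (auto simp: orthonormal_def)
  also have "\<dots> = (\<Sum>e\<in>E. if e = b then cinner x e else 0)" by (intro sum.cong) auto
  also have "\<dots> = cinner x b" using assms(1) b by simp
  finally show "cinner (x - proj_on E x) b = 0" by (simp add: cinner_diff_left)
qed

lemma proj_on_eq:
  assumes "finite E" "orthonormal E" "x \<in> ch.span E"
  shows "proj_on E x = x"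
proof -
  have "x - proj_on E x \<in> ch.span E" using assms(3) proj_on_in_span by (rule ch.span_diff)
  then have "cinner (x - proj_on E x) (x - proj_on E x) = 0" by (rule proj_on_orthogonal[OF assms(1,2)])
  then show ?thesis by simp
qed

lemma norm_proj_on:
  assumes "finite E" "orthonormal E"
  shows "(norm (proj_on E x))\<^sup>2 = (\<Sum>e\<in>E. (cmod (cinner x e))\<^sup>2)"
proof -
  have "cinner (proj_on E x) (proj_on E x) = cinner x (proj_on E x)"
    using proj_on_orthogonal[OF assms proj_on_in_span, of x x] by (simp add: cinner_diff_left)
  also have "\<dots> = (\<Sum>e\<in>E. complex_of_real ((cmod (cinner x e))\<^sup>2))"
    unfolding proj_on_def cinner_sum_right cinner_scaleC_right
    by (simp only: complex_norm_square mult.commute)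
  finally show ?thesis unfolding norm_sq_eq_Re_cinner by simp
qed

lemma norm_diff_proj_on:
  assumes "finite E" "orthonormal E"
  shows "(norm (x - proj_on E x))\<^sup>2 = (norm x)\<^sup>2 - (\<Sum>e\<in>E. (cmod (cinner x e))\<^sup>2)"
proof -
  have "cinner x (proj_on E x) = cinner (proj_on E x) (proj_on E x)"
    using proj_on_orthogonal[OF assms proj_on_in_span, of x x] by (simp add: cinner_diff_left)
  then show ?thesis unfolding norm_sq_diff norm_proj_on[OF assms, symmetric]
    by (simp add: norm_sq_eq_Re_cinner)
qed

lemma norm_proj_on_le:
  assumes "finite E" "orthonormal E"
  shows "norm (proj_on E x) \<le> norm x"
proof -
  have "(norm (proj_on E x))\<^sup>2 \<le> (norm x)\<^sup>2"
    using norm_diff_proj_on[OF assms, of x] norm_proj_on[OF assms, of x]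
      zero_le_power2[of "norm (x - proj_on E x)"] by linarith
  then show ?thesis by (rule power2_le_imp_le) simp
qed

lemma orthonormal_independent:
  assumes "orthonormal E"
  shows "\<not> ch.dependent E"
proof
  assume "ch.dependent E"
  then obtain t u v where t: "finite t" "t \<subseteq> E" "(\<Sum>v\<in>t. u v *\<^sub>C v) = 0" "v \<in> t" "u v \<noteq> 0"
    unfolding ch.dependent_explicit by blast
  have "0 = cinner (\<Sum>v\<in>t. u v *\<^sub>C v) v" by (simp add: t)
  also have "\<dots> = (\<Sum>w\<in>t. if w = v then u w else 0)"
    unfolding cinner_sum_left cinner_scaleC_left
    using assms t by (intro sum.cong refl) (auto simp: orthonormal_def subset_iff)
  also have "\<dots> = u v" using t by simp
  finally show False using t by simp
qed

lemma orthonormal_insert: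
  assumes "orthonormal E" "norm w = 1" "\<And>e. e \<in> E \<Longrightarrow> cinner w e = 0"
  shows "orthonormal (insert w E)"
proof -
  have w: "cinner w w = 1" using assms(2) by (simp add: cinner_self)
  have E: "cinner e w = 0" if "e \<in> E" for e using assms(3)[OF that] cinner_eq_0_sym by blast
  show ?thesis using assms w E by (auto simp: orthonormal_def)
qed

lemma orthonormal_basis_exists:
  fixes B :: "'a::complex_hilbert set"
  assumes "finite B"
  shows "\<exists>E. finite E \<and> orthonormal E \<and> ch.span E = ch.span B"
  using assms
proof (induction B)
  case empty
  show ?case by (rule exI[of _ "{}"]) (simp add: orthonormal_def)
next
  case (insert b B)
  then obtain E where E: "finite E" "orthonormal E" "ch.span E = ch.span B" by blast
  let ?w = "b - proj_on E b"
  show ?case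
  proof (cases "?w = 0")
    case True
    then have "b \<in> ch.span B" using proj_on_in_span[of E b] E by simp
    then show ?thesis using E by (intro exI[of _ E]) (simp add: ch.span_redundant)
  next
    case False
    define e where "e = (1 / norm ?w) *\<^sub>C ?w"
    have ne: "norm e = 1" using False by (simp add: e_def norm_divide)
    have orth: "cinner e v = 0" if "v \<in> E" for v
      using proj_on_orthogonal[OF E(1,2), of v b] that
      by (simp add: e_def cinner_scaleC_left ch.span_base)
    have be: "b = (norm ?w) *\<^sub>C e + proj_on E b"
      using False by (simp add: e_def)
    have "ch.span (insert e E) = ch.span (insert b B)"
    proof
      have "e \<in> ch.span (insert b B)"
        unfolding e_def using proj_on_in_span[of E b] E(3) ch.span_mono[of B "insert b B"]
        by (intro ch.span_scale ch.span_diff) (auto intro: ch.span_base)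
      moreover have "E \<subseteq> ch.span (insert b B)"
        using E(3) ch.span_superset[of E] ch.span_mono[of B "insert b B"] by auto
      ultimately show "ch.span (insert e E) \<subseteq> ch.span (insert b B)"
        by (intro ch.span_minimal) auto
      have "b \<in> ch.span (insert e E)"
        proof (subst be, rule ch.span_add)
        show "(norm ?w) *\<^sub>C e \<in> ch.span (insert e E)" by (intro ch.span_scale ch.span_base) simp
        show "proj_on E b \<in> ch.span (insert e E)"
          using proj_on_in_span[of E b] ch.span_mono[OF subset_insertI, of E e] by blast
      qed
      moreover have "B \<subseteq> ch.span (insert e E)"
        using E(3) ch.span_superset[of B] ch.span_mono[of E "insert e E"] by auto
      ultimately show "ch.span (insert b B) \<subseteq> ch.span (insert e E)"
        by (intro ch.span_minimal) auto
    qed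
    then show ?thesis using orthonormal_insert[OF E(2) ne orth] E(1)
      by (intro exI[of _ "insert e E"]) auto
  qed
qed

text \<open>A minimizing sequence for the distance to \<open>S\<close> is Cauchy by the
  parallelogram law, because midpoints stay in \<open>S\<close>; at the limit, no move inside
  \<open>S\<close> can decrease the distance.\<close>

lemma projection_theorem:
  fixes S :: "'a::complex_hilbert set" and x :: 'a
  assumes S: "ch.subspace S" and cl: "closed S"
  obtains s where "s \<in> S" "\<And>y. y \<in> S \<Longrightarrow> cinner (x - s) y = 0"
proof -
  define d where "d = (INF s\<in>S. (norm (x - s))\<^sup>2)"
  have S0: "0 \<in> S" using S by (rule ch.subspace_0)
  have bdd: "bdd_below ((\<lambda>s. (norm (x - s))\<^sup>2) ` S)" by (rule bdd_belowI[of _ 0]) auto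
  have dle: "d \<le> (norm (x - s))\<^sup>2" if "s \<in> S" for s
    unfolding d_def by (rule cINF_lower[OF bdd that])
  have "\<exists>s\<in>S. (norm (x - s))\<^sup>2 < d + 1 / real (Suc n)" for n
  proof -
    have "(INF s\<in>S. (norm (x - s))\<^sup>2) < d + 1 / real (Suc n)" unfolding d_def[symmetric] by simp
    then show ?thesis using cINF_less_iff[OF _ bdd] S0 by blast
  qed
  then obtain X where X: "\<And>n. X n \<in> S" "\<And>n. (norm (x - X n))\<^sup>2 < d + 1 / real (Suc n)" by metis
  have mid: "(norm (X m - X n))\<^sup>2 \<le> 2 / real (Suc m) + 2 / real (Suc n)" for m n
  proof -
    have "(1/2) *\<^sub>C (X m + X n) \<in> S" using S X(1) by (simp add: ch.subspace_add ch.subspace_scale)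
    from dle[OF this] have 1: "4 * d \<le> (norm (2 *\<^sub>C (x - (1/2) *\<^sub>C (X m + X n))))\<^sup>2"
      by (simp add: power_mult_distrib)
    have "2 *\<^sub>C (x - (1/2) *\<^sub>C (X m + X n)) = (x - X m) + (x - X n)"
    proof -
      have "2 *\<^sub>C x = x + x" using scaleC_add_left[of 1 1 x] by simp
      then show ?thesis by (simp add: ch.scale_right_diff_distrib)
    qed
    with 1 have "4 * d \<le> (norm ((x - X m) + (x - X n)))\<^sup>2" by simp
    moreover have "(norm ((x - X m) + (x - X n)))\<^sup>2 + (norm ((x - X m) - (x - X n)))\<^sup>2 =
        2 * (norm (x - X m))\<^sup>2 + 2 * (norm (x - X n))\<^sup>2"
      unfolding norm_sq_add norm_sq_diff by simp
    moreover have "norm ((x - X m) - (x - X n)) = norm (X m - X n)"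
      by (simp add: norm_minus_commute)
    ultimately show ?thesis using X(2)[of m] X(2)[of n] by simp
  qed
  have "Cauchy X"
  proof (rule metric_CauchyI)
    fix e :: real assume e: "0 < e"
    obtain N where N: "4 / e\<^sup>2 < real (Suc N)" using reals_Archimedean2[of "4 / e\<^sup>2"]
      by (metis less_trans lessI of_nat_less_iff)
    have "dist (X m) (X n) < e" if "N \<le> m" "N \<le> n" for m n
    proof -
      have "2 / real (Suc m) \<le> 2 / real (Suc N)" "2 / real (Suc n) \<le> 2 / real (Suc N)"
        using that by (auto intro!: divide_left_mono)
      then have "(norm (X m - X n))\<^sup>2 \<le> 4 / real (Suc N)" using mid[of m n] by linarith
      also have "\<dots> < e\<^sup>2" using N e by (simp add: field_simps)
      finally show ?thesis using e by (simp add: dist_norm power_less_imp_less_base)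
    qed
    then show "\<exists>M. \<forall>m\<ge>M. \<forall>n\<ge>M. dist (X m) (X n) < e" by blast
  qed
  then obtain s where s: "X \<longlonglongrightarrow> s" using Cauchy_convergent convergent_def by blast
  have sS: "s \<in> S" by (rule closed_sequentially[OF cl X(1) s])
  have "(norm (x - s))\<^sup>2 \<le> d"
  proof (rule LIMSEQ_le)
    show "(\<lambda>n. (norm (x - X n))\<^sup>2) \<longlonglongrightarrow> (norm (x - s))\<^sup>2" by (intro tendsto_intros s)
    have "(\<lambda>n. d + 1 / real (Suc n)) \<longlonglongrightarrow> d + 0"
      by (intro tendsto_add tendsto_const) (rule LIMSEQ_Suc[OF lim_1_over_n])
    then show "(\<lambda>n. d + 1 / real (Suc n)) \<longlonglongrightarrow> d" by simp
    show "\<exists>N. \<forall>n\<ge>N. (norm (x - X n))\<^sup>2 \<le> d + 1 / real (Suc n)" using X(2) less_imp_le by blast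
  qed
  then have ds: "(norm (x - s))\<^sup>2 \<le> (norm (x - t))\<^sup>2" if "t \<in> S" for t
    using dle[OF that] by linarith
  have "cinner (x - s) y = 0" if y: "y \<in> S" for y
  proof (cases "y = 0")
    case False
    \<comment> \<open>The best coefficient along \<open>y\<close>: a nonzero value would give a
      point of \<open>S\<close> strictly closer to \<open>x\<close> than \<open>s\<close>.\<close>
    define c where "c = cinner (x - s) y / (norm y)\<^sup>2"
    have "s + c *\<^sub>C y \<in> S" using S sS y by (simp add: ch.subspace_add ch.subspace_scale)
    from ds[OF this] have "(norm (x - s))\<^sup>2 \<le> (norm ((x - s) - c *\<^sub>C y))\<^sup>2"
      by (simp add: algebra_simps)
    then have "2 * Re (cinner (x - s) (c *\<^sub>C y)) \<le> (norm (c *\<^sub>C y))\<^sup>2"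
      unfolding norm_sq_diff[of "x - s"] by linarith
    moreover have "(norm (c *\<^sub>C y))\<^sup>2 = (cmod c)\<^sup>2 * (norm y)\<^sup>2" by (simp add: power_mult_distrib)
    moreover have "Re (cinner (x - s) (c *\<^sub>C y)) = (cmod c)\<^sup>2 * (norm y)\<^sup>2"
    proof -
      have "cinner (x - s) y = c * complex_of_real ((norm y)\<^sup>2)" using False by (simp add: c_def)
      then have "cinner (x - s) (c *\<^sub>C y) = (c * cnj c) * complex_of_real ((norm y)\<^sup>2)"
        unfolding cinner_scaleC_right by (simp add: mult_ac)
      also have "\<dots> = complex_of_real ((cmod c)\<^sup>2 * (norm y)\<^sup>2)"
        unfolding complex_norm_square[symmetric] by simp
      finally show ?thesis by (simp only: Re_complex_of_real)
    qed
    ultimately have "(cmod c)\<^sup>2 * (norm y)\<^sup>2 \<le> 0" by linarith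
    then have "c = 0" using False by (simp add: mult_le_0_iff)
    then show ?thesis using False by (simp add: c_def)
  qed simp
  with sS show ?thesis using that by blast
qed

subsection \<open>Finite-dimensional subspaces\<close>

text \<open>Passing to the kernel of one functional costs at most one vector. This is how the
  wandering subspaces of the model space become finite-dimensional.\<close>

lemma finite_span_if_separated:
  fixes L :: "'a::complex_hilbert set" and l :: "nat \<Rightarrow> 'a \<Rightarrow> complex"
  assumes "ch.subspace L"
    and "\<And>i x y. l i (x + y) = l i x + l i y" "\<And>i c x. l i (c *\<^sub>C x) = c * l i x"
    and "\<And>x. x \<in> L \<Longrightarrow> (\<forall>i<d. l i x = 0) \<Longrightarrow> x = 0"
  shows "\<exists>B. finite B \<and> B \<subseteq> L \<and> L \<subseteq> ch.span B"
  using assms(1,4)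
proof (induction d arbitrary: L)
  case 0
  then show ?case by (intro exI[of _ "{}"]) auto
next
  case (Suc d)
  have ldiff: "l i (x - y) = l i x - l i y" for i x y
    using assms(2)[of i "x - y" y] by simp
  show ?case
  proof (cases "\<exists>x0\<in>L. l d x0 \<noteq> 0")
    case False
    then show ?thesis using Suc by (metis less_antisym)
  next
    case True
    then obtain x0 where x0: "x0 \<in> L" "l d x0 \<noteq> 0" by blast
    let ?L = "{x\<in>L. l d x = 0}"
    have "ch.subspace ?L"
      unfolding ch.subspace_def using Suc.prems(1) assms(2,3) assms(3)[of d 0]
      by (auto simp: ch.subspace_add ch.subspace_scale ch.subspace_0)
    moreover have "x = 0" if "x \<in> ?L" "\<forall>i<d. l i x = 0" for x
      using Suc.prems(2)[of x] that by (auto simp: less_Suc_eq)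
    ultimately have "\<exists>B. finite B \<and> B \<subseteq> ?L \<and> ?L \<subseteq> ch.span B"
      by (rule Suc.IH)
    then obtain B where B: "finite B" "B \<subseteq> ?L" "?L \<subseteq> ch.span B"
      by (elim exE conjE)
    have "x \<in> ch.span (insert x0 B)" if x: "x \<in> L" for x
    proof -
      let ?c = "l d x / l d x0"
      have "x - ?c *\<^sub>C x0 \<in> ?L"
        using x x0 Suc.prems(1) by (simp add: ch.subspace_diff ch.subspace_scale ldiff assms(3))
      then have "x - ?c *\<^sub>C x0 \<in> ch.span B" using B(3) by blast
      then show ?thesis unfolding ch.span_insert by blast
    qed
    then show ?thesis using B x0 by (intro exI[of _ "insert x0 B"]) auto
  qed
qed

text \<open>This is p(T) v when \<open>u\<close> is the orbit of \<open>v\<close> under T. It is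
  formulated for sequences since it is also applied to vectors tied only by a relation A u_k = b
  u_(k+1).\<close>

definition poly_comb :: "(nat \<Rightarrow> 'a::complex_hilbert) \<Rightarrow> complex poly \<Rightarrow> 'a" where
  "poly_comb u p = (\<Sum>k\<le>degree p. coeff p k *\<^sub>C u k)"

lemma poly_comb_eq: "degree p \<le> n \<Longrightarrow> poly_comb u p = (\<Sum>k\<le>n. coeff p k *\<^sub>C u k)"
  unfolding poly_comb_def by (rule sum.mono_neutral_left) (auto simp: coeff_eq_0)

lemma poly_comb_pCons: "poly_comb u (pCons a p) = a *\<^sub>C u 0 + poly_comb (\<lambda>k. u (Suc k)) p"
proof -
  have "poly_comb u (pCons a p) = (\<Sum>k\<le>Suc (degree p). coeff (pCons a p) k *\<^sub>C u k)"
    by (rule poly_comb_eq) (rule degree_pCons_le)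
  also have "\<dots> = a *\<^sub>C u 0 + (\<Sum>k\<le>degree p. coeff p k *\<^sub>C u (Suc k))"
    by (subst sum.atMost_Suc_shift) simp
  finally show ?thesis by (simp add: poly_comb_def)
qed

lemma poly_comb_add: "poly_comb u (p + q) = poly_comb u p + poly_comb u q"
proof -
  let ?n = "max (degree p) (degree q)"
  have "poly_comb u (p + q) = (\<Sum>k\<le>?n. coeff (p + q) k *\<^sub>C u k)"
    by (rule poly_comb_eq) (rule degree_add_le_max)
  then show ?thesis
    by (simp add: poly_comb_eq[of p ?n] poly_comb_eq[of q ?n] scaleC_add_left sum.distrib)
qed

lemma poly_comb_smult: "poly_comb u (smult c p) = c *\<^sub>C poly_comb u p"
  using poly_comb_eq[of "smult c p" "degree p" u]
  by (simp add: poly_comb_def ch.scale_sum_right)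

lemma poly_comb_diff: "poly_comb u (p - q) = poly_comb u p - poly_comb u q"
  using poly_comb_add[of u "p - q" q] by simp

lemma poly_comb_in_span: "(\<And>k. u k \<in> ch.span B) \<Longrightarrow> poly_comb u p \<in> ch.span B"
  unfolding poly_comb_def by (intro ch.span_sum ch.span_scale)

lemma poly_comb_linear_factor:
  "poly_comb u ([:- c, 1:] * p) = poly_comb (\<lambda>k. u (Suc k)) p - c *\<^sub>C poly_comb u p"
proof -
  have "[:- c, 1:] * p = pCons 0 p - smult c p" by simp
  then show ?thesis by (simp only: poly_comb_diff poly_comb_pCons poly_comb_smult) simp
qed

lemma minimal_annihilating_poly:
  assumes "finite B" "\<And>k. u k \<in> ch.span B"
  shows "\<exists>p. p \<noteq> 0 \<and> poly_comb u p = 0 \<and>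
    (\<forall>q. q \<noteq> 0 \<longrightarrow> degree q < degree p \<longrightarrow> poly_comb u q \<noteq> 0)"
proof -
  \<comment> \<open>Linear dependence is a notion for sets, so a repetition among the vectors is
    treated apart; it gives a difference of two monomials.\<close>
  have "\<exists>p. p \<noteq> 0 \<and> poly_comb u p = 0"
  proof (cases "inj_on u {..card B}")
    case False
    then obtain i j where ij: "u i = u j" "i \<noteq> j" unfolding inj_on_def by blast
    have m: "poly_comb u (monom 1 i) = u i" for i
      unfolding poly_comb_eq[OF degree_monom_le]
      by (subst sum.remove[of _ i]) (auto intro!: sum.neutral)
    have "monom 1 i - monom (1::complex) j \<noteq> 0" using ij(2) by (auto simp: monom_eq_iff')
    then show ?thesis using ij(1) m poly_comb_diff[of u "monom 1 i" "monom 1 j"]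
      by (intro exI[of _ "monom 1 i - monom 1 j"]) simp
  next
    case True
    let ?U = "u ` {..card B}"
    have "ch.dependent ?U"
    proof (rule ccontr)
      assume "\<not> ch.dependent ?U"
      then have "card ?U \<le> card B" using ch.independent_span_bound[of B ?U] assms by auto
      then show False by (simp add: card_image[OF True])
    qed
    then obtain f where f: "\<exists>v\<in>?U. f v \<noteq> 0" "(\<Sum>v\<in>?U. f v *\<^sub>C v) = 0"
      using ch.dependent_finite[of ?U] by auto
    define p where "p = (\<Sum>k\<le>card B. monom (f (u k)) k)"
    have cp: "coeff p k = (if k \<le> card B then f (u k) else 0)" for k
      by (simp add: p_def coeff_sum)
    have "degree p \<le> card B" by (rule degree_le) (simp add: cp)
    then have "poly_comb u p = (\<Sum>k\<le>card B. f (u k) *\<^sub>C u k)" by (simp add: poly_comb_eq cp)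
    also have "\<dots> = 0" using f(2) by (simp add: sum.reindex[OF True])
    finally have "poly_comb u p = 0" .
    moreover have "p \<noteq> 0" using f(1) cp by (auto simp: poly_eq_iff)
    ultimately show ?thesis by blast
  qed
  then obtain p where "p \<noteq> 0 \<and> poly_comb u p = 0"
    "\<forall>q. q \<noteq> 0 \<and> poly_comb u q = 0 \<longrightarrow> degree p \<le> degree q"
    using ex_has_least_nat[of "\<lambda>p. p \<noteq> 0 \<and> poly_comb u p = 0" _ degree] by blast
  then show ?thesis by (intro exI[of _ p]) (auto simp: not_le[symmetric])
qed

text \<open>Krylov argument: a root \<open>c\<close> of the minimal polynomial along the orbit of
  \<open>v\<close> leaves a cofactor \<open>q\<close> of smaller degree, so q(T) v is nonzero and
  killed by T - c.\<close>

lemma eigenvector_exists: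
  fixes T :: "'a::complex_hilbert \<Rightarrow> 'a"
  assumes add: "\<And>x y. T (x + y) = T x + T y" and scale: "\<And>c x. T (c *\<^sub>C x) = c *\<^sub>C T x"
    and fin: "finite B" and L: "ch.subspace L" "L \<subseteq> ch.span B" "\<And>x. x \<in> L \<Longrightarrow> T x \<in> L"
    and v: "v \<in> L" "v \<noteq> 0"
  obtains w c where "w \<in> L" "norm w = 1" "T w = c *\<^sub>C w"
proof -
  define u where "u k = (T ^^ k) v" for k
  have uL: "u k \<in> L" for k by (induction k) (auto simp: u_def v L(3))
  have T0: "T 0 = 0" using scale[of 0 0] by simp
  have Tsum: "T (sum f I) = (\<Sum>i\<in>I. T (f i))" for f :: "nat \<Rightarrow> 'a" and I
    by (induction I rule: infinite_finite_induct) (auto simp: add T0)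
  have Tcomb: "T (poly_comb u p) = poly_comb (\<lambda>k. u (Suc k)) p" for p
    by (simp add: poly_comb_def Tsum scale u_def)
  have "u k \<in> ch.span B" for k using uL L(2) by blast
  from minimal_annihilating_poly[of B u, OF fin this]
  obtain p where p: "p \<noteq> 0" "poly_comb u p = 0"
    "\<And>q. q \<noteq> 0 \<Longrightarrow> degree q < degree p \<Longrightarrow> poly_comb u q \<noteq> 0"
    by (elim exE conjE) auto
  have "degree p \<noteq> 0"
  proof
    assume "degree p = 0"
    then obtain a where a: "p = [:a:]" by (rule degree_eq_zeroE)
    then have "a *\<^sub>C v = 0" using p(2) by (simp add: poly_comb_def u_def)
    then show False using a p(1) v(2) by (simp add: ch.scale_eq_0_iff)
  qed
  then obtain c where "poly p c = 0"
    using fundamental_theorem_of_algebra[of p] constant_degree[of p] by auto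
  then obtain q where q: "p = [:- c, 1:] * q" unfolding poly_eq_0_iff_dvd by (rule dvdE)
  have q0: "q \<noteq> 0" using p(1) q by auto
  have "degree q < degree p" using q0 by (subst q, subst degree_mult_eq) auto
  then have ne: "poly_comb u q \<noteq> 0" using p(3) q0 by blast
  let ?w = "poly_comb u q"
  have wL: "?w \<in> L" unfolding poly_comb_def
    using L(1) uL by (intro ch.subspace_sum ch.subspace_scale)
  have "T ?w = c *\<^sub>C ?w" using p(2) unfolding q poly_comb_linear_factor Tcomb by simp
  then have "T ((1 / norm ?w) *\<^sub>C ?w) = c *\<^sub>C ((1 / norm ?w) *\<^sub>C ?w)"
    by (simp add: scale mult.commute)
  moreover have "(1 / norm ?w) *\<^sub>C ?w \<in> L" using L(1) wL by (rule ch.subspace_scale)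
  moreover have "norm ((1 / norm ?w) *\<^sub>C ?w) = 1" using ne by (simp add: norm_divide)
  ultimately show ?thesis using that by blast
qed

text \<open>An orthonormal set of eigenvectors of maximal size must span: by symmetry its complement
  is invariant, and a nonzero complement would contribute one more eigenvector.\<close>

lemma eigenbasis_exists:
  fixes T :: "'a::complex_hilbert \<Rightarrow> 'a"
  assumes add: "\<And>x y. T (x + y) = T x + T y" and scale: "\<And>c x. T (c *\<^sub>C x) = c *\<^sub>C T x"
    and sym: "\<And>x y. cinner (T x) y = cinner x (T y)"
    and fin: "finite B" and inv: "\<And>x. x \<in> ch.span B \<Longrightarrow> T x \<in> ch.span B"
  obtains E ev where "finite E" "orthonormal E" "ch.span E = ch.span B"
    "\<And>e. e \<in> E \<Longrightarrow> T e = complex_of_real (ev e) *\<^sub>C e"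
proof -
  let ?P = "\<lambda>E. finite E \<and> orthonormal E \<and> E \<subseteq> ch.span B \<and> (\<forall>e\<in>E. \<exists>c. T e = c *\<^sub>C e)"
  have bound: "card E \<le> card B" if "?P E" for E
    using ch.independent_span_bound[OF fin orthonormal_independent[of E]] that by auto
  have "?P {}" by (simp add: orthonormal_def)
  moreover have "\<forall>F. ?P F \<longrightarrow> card F < Suc (card B)"
    by (intro allI impI le_imp_less_Suc bound)
  ultimately have "\<exists>E. ?P E \<and> (\<forall>F. ?P F \<longrightarrow> card F \<le> card E)" by (rule Lattices_Big.ex_has_greatest_nat)
  then obtain E where E: "?P E" and Emax: "\<And>F. ?P F \<Longrightarrow> card F \<le> card E" by (elim exE conjE) auto
  have Efin: "finite E" and Eo: "orthonormal E" and EB: "E \<subseteq> ch.span B"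
    and Eev: "\<And>e. e \<in> E \<Longrightarrow> \<exists>c. T e = c *\<^sub>C e"
    using E by (elim conjE; assumption | blast)+
  have "ch.span B \<subseteq> ch.span E"
  proof (rule ccontr)
    assume "\<not> ch.span B \<subseteq> ch.span E"
    then obtain x where x: "x \<in> ch.span B" "x \<notin> ch.span E" by blast
    define L where "L = {y \<in> ch.span B. \<forall>e\<in>E. cinner y e = 0}"
    have "ch.subspace L" unfolding L_def ch.subspace_def
      by (auto simp: cinner_simps intro: ch.span_add ch.span_scale ch.span_zero)
    moreover have "T y \<in> L" if "y \<in> L" for y
    proof -
      have "cinner (T y) e = 0" if e: "e \<in> E" for e
      proof -
        obtain c where "T e = c *\<^sub>C e" using Eev[OF e] by blast
        then show ?thesis using \<open>y \<in> L\<close> e by (simp add: sym L_def)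
      qed
      then show ?thesis using that inv by (simp add: L_def)
    qed
    moreover have "x - proj_on E x \<in> L"
    proof -
      have "proj_on E x \<in> ch.span B"
        using proj_on_in_span[of E x] ch.span_minimal[OF EB] by (auto simp: ch.subspace_span)
      then show ?thesis unfolding L_def using x(1) proj_on_orthogonal[OF Efin Eo]
        by (auto intro: ch.span_diff ch.span_base)
    qed
    moreover have "x - proj_on E x \<noteq> 0" using x(2) proj_on_in_span[of E x] by auto
    ultimately obtain w c where w: "w \<in> L" "norm w = 1" "T w = c *\<^sub>C w"
      using eigenvector_exists[OF add scale fin, of L] unfolding L_def by blast
    have "w \<notin> E" using w(1,2) unfolding L_def by (auto simp: cinner_self)
    moreover have "?P (insert w E)"
      using Efin Eo EB Eev w by (auto simp: L_def intro!: orthonormal_insert)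
    from Emax[OF this] have "card (insert w E) \<le> card E" .
    ultimately show False using Efin by simp
  qed
  moreover have "ch.span E \<subseteq> ch.span B" using EB by (rule ch.span_minimal) (rule ch.subspace_span)
  ultimately have "ch.span E = ch.span B" by blast
  moreover have "\<exists>r. T e = complex_of_real r *\<^sub>C e" if e: "e \<in> E" for e
  proof -
    obtain c where c: "T e = c *\<^sub>C e" using Eev[OF e] by blast
    have "cinner e e = 1" using Eo e by (auto simp: orthonormal_def)
    then have "c = cnj c" using sym[of e e] by (simp add: c cinner_scaleC_left)
    then have "c = complex_of_real (Re c)" by (simp add: complex_eq_iff)
    then show ?thesis using c by metis
  qed
  then obtain ev where "\<And>e. e \<in> E \<Longrightarrow> T e = complex_of_real (ev e) *\<^sub>C e" by metis
  ultimately show ?thesis using that Efin Eo by blast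
qed

section \<open>Operator pencils\<close>

lemma clinear_on_sum:
  assumes "clinear_on D A" "\<And>i. i \<in> I \<Longrightarrow> f i \<in> D"
  shows "(\<Sum>i\<in>I. c i *\<^sub>C f i) \<in> D \<and> A (\<Sum>i\<in>I. c i *\<^sub>C f i) = (\<Sum>i\<in>I. c i *\<^sub>C A (f i))"
proof -
  have "A 0 = 0" using assms(1) ch.scale_zero_left[of "A 0"] ch.scale_zero_left[of 0]
    unfolding clinear_on_def by metis
  then show ?thesis using assms
    by (induction I rule: infinite_finite_induct) (auto simp: clinear_on_def)
qed

lemma clinear_on_diff:
  assumes "clinear_on D A" "x \<in> D" "y \<in> D"
  shows "x - y \<in> D" "A (x - y) = A x - A y"
proof -
  have "- y \<in> D \<and> A (- y) = - A y"
    using assms ch.scale_minus_left[of 1 y] ch.scale_minus_left[of 1 "A y"]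
    unfolding clinear_on_def by (metis scaleC_one)
  then show "x - y \<in> D" "A (x - y) = A x - A y"
    using assms unfolding clinear_on_def by (metis diff_conv_add_uminus)+
qed

lemma self_adjoint_symmetric:
  assumes "densely_defined_self_adjoint D A" "x \<in> D" "y \<in> D"
  shows "cinner (A x) y = cinner x (A y)"
proof -
  have "(y, A y) \<in> adjoint_graph D A"
    using assms unfolding densely_defined_self_adjoint_def op_graph_def by blast
  then show ?thesis using assms(2) by (simp add: adjoint_graph_def)
qed

lemma positive_contraction_linear:
  assumes "positive_contraction Y"
  shows "Y (x + y) = Y x + Y y" "Y (x - y) = Y x - Y y" "Y (c *\<^sub>C x) = c *\<^sub>C Y x" "Y 0 = 0"
    "Y (sum f I) = (\<Sum>i\<in>I. Y (f i))"
proof -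
  have l: "linear Y" using assms
    by (simp add: positive_contraction_def bounded_linear.linear)
  show "Y (x + y) = Y x + Y y" "Y (x - y) = Y x - Y y" "Y 0 = 0" "Y (sum f I) = (\<Sum>i\<in>I. Y (f i))"
    using l by (simp_all add: linear_add linear_diff linear_0 linear_sum)
  show "Y (c *\<^sub>C x) = c *\<^sub>C Y x" using assms by (simp add: positive_contraction_def)
qed

lemma z_op_add: "positive_contraction Y \<Longrightarrow> z_op Y z (x + y) = z_op Y z x + z_op Y z y"
  by (simp add: z_op_def positive_contraction_linear algebra_simps scaleC_add_right
      ch.scale_right_diff_distrib)

lemma z_op_scaleC: "positive_contraction Y \<Longrightarrow> z_op Y z (c *\<^sub>C x) = c *\<^sub>C z_op Y z x"
  by (simp add: z_op_def positive_contraction_linear algebra_simps scaleC_add_right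
      ch.scale_right_diff_distrib scaleC_scaleC)

lemma z_op_diff: "positive_contraction Y \<Longrightarrow> z_op Y z (x - y) = z_op Y z x - z_op Y z y"
  using z_op_add[of Y z "x - y" y] by simp

lemma z_op_sum:
  assumes "positive_contraction Y"
  shows "z_op Y z (\<Sum>i\<in>I. c i *\<^sub>C f i) = (\<Sum>i\<in>I. c i *\<^sub>C z_op Y z (f i))"
proof -
  have "z_op Y z 0 = 0" using z_op_diff[OF assms, of z 0 0] by simp
  then show ?thesis
    by (induction I rule: infinite_finite_induct) (auto simp: z_op_add z_op_scaleC assms)
qed

text \<open>The quadratic form of \<open>z_op\<close> combines the two coordinates of
  \<open>z\<close> with the nonnegative weights of \<open>Y\<close> and \<open>1 - Y\<close> at
  \<open>x\<close>, which add up to the squared norm.\<close>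

lemma Im_cinner_z_op:
  assumes "positive_contraction Y"
  shows "min (Im (fst z)) (Im (snd z)) * (norm x)\<^sup>2 \<le> Im (cinner (z_op Y z x) x)"
proof -
  let ?y = "Re (cinner (Y x) x)"
  have y: "0 \<le> ?y" "?y \<le> (norm x)\<^sup>2"
    using assms by (auto simp: positive_contraction_def norm_sq_eq_Re_cinner)
  have "cinner (Y x) x = cnj (cinner (Y x) x)"
    using assms cinner_commute[of "Y x" x] by (simp add: positive_contraction_def)
  then have "cinner (Y x) x = complex_of_real ?y" by (simp add: complex_eq_iff)
  then have "cinner (z_op Y z x) x = fst z * complex_of_real ?y + snd z * complex_of_real ((norm x)\<^sup>2 - ?y)"
    by (simp add: z_op_def cinner_simps cinner_self)
  then have "Im (cinner (z_op Y z x) x) = Im (fst z) * ?y + Im (snd z) * ((norm x)\<^sup>2 - ?y)"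
    by simp
  moreover have "min (Im (fst z)) (Im (snd z)) * ?y \<le> Im (fst z) * ?y"
    "min (Im (fst z)) (Im (snd z)) * ((norm x)\<^sup>2 - ?y) \<le> Im (snd z) * ((norm x)\<^sup>2 - ?y)"
    using y by (auto intro!: mult_right_mono)
  ultimately show ?thesis by (simp add: algebra_simps)
qed

lemma pencil_lower_bound:
  assumes "positive_contraction Y" "cinner (A x) x = cinner x (A x)"
  shows "min (Im (fst z)) (Im (snd z)) * norm x \<le> norm (A x - z_op Y z x)"
proof (cases "x = 0")
  case False
  have "Im (cinner (A x) x) = 0"
    using assms(2) cinner_commute[of "A x" x] by (metis Reals_cnj_iff complex_is_Real_iff)
  then have "min (Im (fst z)) (Im (snd z)) * (norm x)\<^sup>2 \<le> - Im (cinner (A x - z_op Y z x) x)"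
    using Im_cinner_z_op[OF assms(1), of z x] by (simp add: cinner_diff_left)
  also have "\<dots> \<le> cmod (cinner (A x - z_op Y z x) x)"
    using abs_Im_le_cmod[of "cinner (A x - z_op Y z x) x"] by linarith
  also have "\<dots> \<le> norm (A x - z_op Y z x) * norm x" by (rule cmod_cinner_le)
  finally show ?thesis using False by (simp add: power2_eq_square)
qed simp

text \<open>At a nonzero \<open>x\<close> the form has strictly negative imaginary part. The
  condition concerns the form at \<open>x\<close> alone, because a system tested only against a
  subspace provides no more.\<close>

lemma pencil_kernel_trivial:
  assumes "positive_contraction Y" "z \<in> bi_upper" "cinner (A x) x = cinner x (A x)"
    and "cinner (A x - z_op Y z x) x = 0"
  shows "x = 0"
proof (rule ccontr)
  assume x: "x \<noteq> 0"
  have "Im (cinner (A x) x) = 0"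
    using assms(3) cinner_commute[of "A x" x] by (metis Reals_cnj_iff complex_is_Real_iff)
  then have "min (Im (fst z)) (Im (snd z)) * (norm x)\<^sup>2 \<le> 0"
    using Im_cinner_z_op[OF assms(1), of z x] assms(4) by (simp add: cinner_diff_left)
  moreover have "0 < min (Im (fst z)) (Im (snd z))"
    using assms(2) by (auto simp: upper_half_plane_def)
  ultimately show False using x by (simp add: mult_le_0_iff)
qed

text \<open>The pencil is injective on \<open>D\<close>, so its inverse can be read off at any
  vector for which a preimage is exhibited.\<close>

lemma resolvent_eq:
  assumes A: "clinear_on D A" "\<And>x y. x \<in> D \<Longrightarrow> y \<in> D \<Longrightarrow> cinner (A x) y = cinner x (A y)"
    and Y: "positive_contraction Y" and z: "z \<in> bi_upper"
    and x: "x \<in> D" "A x - z_op Y z x = v"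
  shows "resolvent D A Y z v = x"
proof -
  have "inj_on (\<lambda>x. A x - z_op Y z x) D"
  proof (rule inj_onI)
    fix x y assume xy: "x \<in> D" "y \<in> D" "A x - z_op Y z x = A y - z_op Y z y"
    have d: "x - y \<in> D" by (rule clinear_on_diff[OF A(1) xy(1,2)])
    have "A (x - y) - z_op Y z (x - y) = (A x - z_op Y z x) - (A y - z_op Y z y)"
      unfolding clinear_on_diff(2)[OF A(1) xy(1,2)] z_op_diff[OF Y] by (simp add: algebra_simps)
    then have "A (x - y) - z_op Y z (x - y) = 0" using xy(3) by simp
    then have "x - y = 0" using pencil_kernel_trivial[of Y z A "x - y", OF Y z A(2)[OF d d]] by simp
    then show "x = y" by simp
  qed
  from the_inv_into_f_f[OF this x(1)] show ?thesis unfolding resolvent_def by (simp only: x(2))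
qed

section \<open>Polynomial functions of two variables\<close>

definition is_poly2 :: "(complex \<times> complex \<Rightarrow> complex) \<Rightarrow> bool" where
  "is_poly2 f \<longleftrightarrow> (\<exists>p. f = poly2 p)"

lemma is_poly2_const [simp]: "is_poly2 (\<lambda>z. c)"
  unfolding is_poly2_def by (rule exI[of _ "[:[:c:]:]"]) (simp add: poly2_def fun_eq_iff)

lemma is_poly2_fst [simp]: "is_poly2 fst"
  unfolding is_poly2_def by (rule exI[of _ "[:[:0, 1:]:]"]) (simp add: poly2_def fun_eq_iff)

lemma is_poly2_snd [simp]: "is_poly2 snd"
  unfolding is_poly2_def by (rule exI[of _ "[:0, 1:]"]) (simp add: poly2_def fun_eq_iff)

lemma is_poly2_add:
  assumes "is_poly2 f" "is_poly2 g"
  shows "is_poly2 (\<lambda>z. f z + g z)"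
proof -
  obtain p q where "f = poly2 p" "g = poly2 q" using assms is_poly2_def by blast
  then show ?thesis unfolding is_poly2_def
    by (intro exI[of _ "p + q"]) (simp add: poly2_def fun_eq_iff)
qed

lemma is_poly2_mult:
  assumes "is_poly2 f" "is_poly2 g"
  shows "is_poly2 (\<lambda>z. f z * g z)"
proof -
  obtain p q where "f = poly2 p" "g = poly2 q" using assms is_poly2_def by blast
  then show ?thesis unfolding is_poly2_def
    by (intro exI[of _ "p * q"]) (simp add: poly2_def fun_eq_iff)
qed

lemma is_poly2_diff:
  assumes "is_poly2 f" "is_poly2 g"
  shows "is_poly2 (\<lambda>z. f z - g z)"
  using is_poly2_add[OF assms(1) is_poly2_mult[OF is_poly2_const[of "- 1"] assms(2)]] by simp

lemma is_poly2_sum: "(\<And>i. i \<in> I \<Longrightarrow> is_poly2 (f i)) \<Longrightarrow> is_poly2 (\<lambda>z. \<Sum>i\<in>I. f i z)"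
  by (induction I rule: infinite_finite_induct) (auto intro: is_poly2_add)

text \<open>Gaussian elimination without division keeps all coefficients polynomial; the pivots are
  chosen nonzero at \<open>z0\<close>.\<close>

lemma polynomial_linear_system:
  fixes G :: "'i \<Rightarrow> 'j \<Rightarrow> complex \<times> complex \<Rightarrow> complex"
  assumes "finite J" "\<And>i j. i \<in> I \<Longrightarrow> j \<in> J \<Longrightarrow> is_poly2 (G i j)" "\<And>i. i \<in> I \<Longrightarrow> is_poly2 (r i)"
    and "\<And>x. (\<And>i. i \<in> I \<Longrightarrow> (\<Sum>j\<in>J. G i j z0 * x j) = 0) \<Longrightarrow> \<forall>j\<in>J. x j = 0"
  shows "\<exists>q p. is_poly2 q \<and> q z0 \<noteq> 0 \<and> (\<forall>j\<in>J. is_poly2 (p j)) \<and>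
    (\<forall>z x. (\<forall>i\<in>I. (\<Sum>j\<in>J. G i j z * x j) = r i z) \<longrightarrow> (\<forall>j\<in>J. q z * x j = p j z))"
  using assms
proof (induction J arbitrary: G r)
  case empty
  show ?case by (rule exI[of _ "\<lambda>_. 1"]) auto
next
  case (insert j0 J)
  \<comment> \<open>Otherwise the unit vector at \<open>j0\<close> would solve the homogeneous
    system at \<open>z0\<close>.\<close>
  have "\<exists>i0\<in>I. G i0 j0 z0 \<noteq> 0"
  proof (rule ccontr)
    assume "\<not> ?thesis"
    then have "(\<Sum>j\<in>insert j0 J. G i j z0 * (if j = j0 then 1 else 0)) = 0" if "i \<in> I" for i
      using that by (intro sum.neutral) auto
    from insert.prems(3)[OF this] show False by auto
  qed
  then obtain i0 where i0: "i0 \<in> I" "G i0 j0 z0 \<noteq> 0" by blast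
  define G' where "G' i j z = G i0 j0 z * G i j z - G i j0 z * G i0 j z" for i j z
  define r' where "r' i z = G i0 j0 z * r i z - G i j0 z * r i0 z" for i z
  have elim: "(\<Sum>j\<in>J. G' i j z * x j) =
      G i0 j0 z * (\<Sum>j\<in>J. G i j z * x j) - G i j0 z * (\<Sum>j\<in>J. G i0 j z * x j)" for i z x
    by (simp add: G'_def sum_distrib_left sum_subtractf algebra_simps)
  have "\<exists>q p. is_poly2 q \<and> q z0 \<noteq> 0 \<and> (\<forall>j\<in>J. is_poly2 (p j)) \<and>
    (\<forall>z x. (\<forall>i\<in>I. (\<Sum>j\<in>J. G' i j z * x j) = r' i z) \<longrightarrow> (\<forall>j\<in>J. q z * x j = p j z))"
  proof (rule insert.IH)
    show "is_poly2 (G' i j)" if "i \<in> I" "j \<in> J" for i j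
      unfolding G'_def[abs_def] using that insert.prems(1) i0(1)
      by (intro is_poly2_diff is_poly2_mult) auto
    show "is_poly2 (r' i)" if "i \<in> I" for i
      unfolding r'_def[abs_def] using that insert.prems(1,2) i0(1)
      by (intro is_poly2_diff is_poly2_mult) auto
    fix x assume x: "\<And>i. i \<in> I \<Longrightarrow> (\<Sum>j\<in>J. G' i j z0 * x j) = 0"
    define x' where "x' = x(j0 := - (\<Sum>j\<in>J. G i0 j z0 * x j) / G i0 j0 z0)"
    have J: "(\<Sum>j\<in>J. G i j z0 * x' j) = (\<Sum>j\<in>J. G i j z0 * x j)" for i
      using insert.hyps(2) by (intro sum.cong) (auto simp: x'_def)
    have "(\<Sum>j\<in>insert j0 J. G i j z0 * x' j) = 0" if i: "i \<in> I" for i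
    proof -
      have "G i0 j0 z0 * (\<Sum>j\<in>insert j0 J. G i j z0 * x' j) = (\<Sum>j\<in>J. G' i j z0 * x j)"
        using insert.hyps i0 unfolding elim sum.insert[OF insert.hyps] J
        by (simp add: x'_def field_simps)
      then show ?thesis using x[OF i] i0 by simp
    qed
    from insert.prems(3)[OF this] show "\<forall>j\<in>J. x j = 0"
      using insert.hyps(2) by (auto simp: x'_def split: if_splits)
  qed
  then obtain q p where qp: "is_poly2 q" "q z0 \<noteq> 0" "\<forall>j\<in>J. is_poly2 (p j)"
    "\<And>z x. (\<forall>i\<in>I. (\<Sum>j\<in>J. G' i j z * x j) = r' i z) \<Longrightarrow> (\<forall>j\<in>J. q z * x j = p j z)"
    by blast
  \<comment> \<open>Back substitution: the new denominator is \<open>q\<close> times the pivot; for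
    \<open>j0\<close> the pivot equation is multiplied by \<open>q\<close> and the known products q
    x_j = p_j are inserted.\<close>
  define p' where "p' j z = (if j = j0 then q z * r i0 z - (\<Sum>j\<in>J. G i0 j z * p j z)
      else p j z * G i0 j0 z)" for j z
  have "is_poly2 (p' j)" if "j \<in> insert j0 J" for j
    unfolding p'_def[abs_def] using that qp insert.prems(1,2) i0(1)
    by (cases "j = j0") (auto intro!: is_poly2_diff is_poly2_mult is_poly2_sum)
  moreover have "is_poly2 (\<lambda>z. q z * G i0 j0 z)"
    using qp insert.prems(1) i0 by (intro is_poly2_mult) auto
  moreover have "q z * G i0 j0 z * x j = p' j z"
    if sol: "\<forall>i\<in>I. (\<Sum>j\<in>insert j0 J. G i j z * x j) = r i z" and j: "j \<in> insert j0 J" for z x j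
  proof -
    have s: "r i z = G i j0 z * x j0 + (\<Sum>j\<in>J. G i j z * x j)" if "i \<in> I" for i
      using sol that insert.hyps by simp
    have "(\<Sum>j\<in>J. G' i j z * x j) = r' i z" if "i \<in> I" for i
      unfolding elim r'_def s[OF that] s[OF i0(1)] by (simp add: algebra_simps)
    then have q: "q z * x j = p j z" if "j \<in> J" for j using qp(4) that by blast
    show ?thesis
    proof (cases "j = j0")
      case True
      have "(\<Sum>j\<in>J. G i0 j z * p j z) = q z * (\<Sum>j\<in>J. G i0 j z * x j)"
        unfolding sum_distrib_left by (intro sum.cong) (auto simp: q[symmetric])
      then show ?thesis using True s[OF i0(1)] by (simp add: p'_def algebra_simps)
    next
      case False
      then show ?thesis using q[of j] j by (simp add: p'_def)
    qed
  qed
  ultimately show ?case using qp(2) i0(2)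
    by (intro exI[of _ "\<lambda>z. q z * G i0 j0 z"] exI[of _ p']) auto
qed

section \<open>Holomorphic functions on the product of two half-planes\<close>

lemma open_upper_half_plane: "open upper_half_plane"
  unfolding upper_half_plane_def by (rule open_halfspace_Im_gt)

lemma connected_upper_half_plane: "connected upper_half_plane"
  unfolding upper_half_plane_def by (rule convex_connected[OF convex_halfspace_Im_gt])

lemma holomorphic2_on_slices:
  assumes h: "holomorphic2_on h (S \<times> T)"
  shows "b \<in> T \<Longrightarrow> (\<lambda>x. h (x, b)) holomorphic_on S"
    and "a \<in> S \<Longrightarrow> (\<lambda>y. h (a, y)) holomorphic_on T"
proof -
  show "(\<lambda>x. h (x, b)) holomorphic_on S" if b: "b \<in> T"
    unfolding holomorphic_on_def
  proof
    fix x assume x: "x \<in> S"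
    obtain u v where d: "(h has_derivative (\<lambda>(s, t). u * s + v * t)) (at (x, b) within S \<times> T)"
      using h x b unfolding holomorphic2_on_def by blast
    have g: "((\<lambda>x. (x, b)) has_derivative (\<lambda>s. (s, 0))) (at x within S)"
      by (auto intro!: derivative_eq_intros)
    have "((\<lambda>x. h (x, b)) has_derivative (\<lambda>s. u * s)) (at x within S)"
    proof -
      have "(\<lambda>x. (x, b)) ` S \<subseteq> S \<times> T" using b by auto
      from has_derivative_in_compose[OF g has_derivative_subset[OF d this]]
      show ?thesis by simp
    qed
    then show "(\<lambda>x. h (x, b)) field_differentiable at x within S"
      unfolding field_differentiable_def has_field_derivative_def by (rule exI)
  qed
  show "(\<lambda>y. h (a, y)) holomorphic_on T" if a: "a \<in> S"
    unfolding holomorphic_on_def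
  proof
    fix y assume y: "y \<in> T"
    obtain u v where d: "(h has_derivative (\<lambda>(s, t). u * s + v * t)) (at (a, y) within S \<times> T)"
      using h y a unfolding holomorphic2_on_def by blast
    have g: "((\<lambda>y. (a, y)) has_derivative (\<lambda>s. (0, s))) (at y within T)"
      by (auto intro!: derivative_eq_intros)
    have "((\<lambda>y. h (a, y)) has_derivative (\<lambda>s. v * s)) (at y within T)"
    proof -
      have "(\<lambda>y. (a, y)) ` T \<subseteq> S \<times> T" using a by auto
      from has_derivative_in_compose[OF g has_derivative_subset[OF d this]]
      show ?thesis by simp
    qed
    then show "(\<lambda>y. h (a, y)) field_differentiable at y within T"
      unfolding field_differentiable_def has_field_derivative_def by (rule exI)
  qed
qed

lemma holomorphic_zero_on_imaginary_axis:
  assumes "f holomorphic_on upper_half_plane" "\<And>s. 0 < s \<Longrightarrow> f (\<i> * of_real s) = 0"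
    "w \<in> upper_half_plane"
  shows "f w = 0"
proof (rule analytic_continuation[OF assms(1) open_upper_half_plane connected_upper_half_plane])
  show "(\<lambda>s. \<i> * complex_of_real s) ` {0<..} \<subseteq> upper_half_plane"
    by (auto simp: upper_half_plane_def)
  show "\<i> \<in> upper_half_plane" by (simp add: upper_half_plane_def)
  show "\<i> islimpt (\<lambda>s. \<i> * complex_of_real s) ` {0<..}"
    unfolding islimpt_approachable
  proof (intro allI impI)
    fix e :: real assume "0 < e"
    then show "\<exists>x'\<in>(\<lambda>s. \<i> * complex_of_real s) ` {0<..}. x' \<noteq> \<i> \<and> dist x' \<i> < e"
      by (intro bexI[of _ "\<i> * complex_of_real (1 + e/2)"] image_eqI[of _ _ "1 + e/2"])
        (auto simp: dist_norm algebra_simps norm_mult complex_eq_iff)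
  qed
qed (use assms(2,3) in auto)

text \<open>The identity theorem, applied in one variable and then in the other; the resolvent is
  computed at just these points.\<close>

lemma holomorphic2_zero_on_imaginary_axes:
  assumes h: "holomorphic2_on h bi_upper"
    and 0: "\<And>s t. 0 < s \<Longrightarrow> 0 < t \<Longrightarrow> h (\<i> * of_real s, \<i> * of_real t) = 0"
    and z: "z \<in> bi_upper"
  shows "h z = 0"
proof -
  have ax: "h (w, \<i> * of_real t) = 0" if t: "0 < t" and w: "w \<in> upper_half_plane" for w t
  proof (rule holomorphic_zero_on_imaginary_axis[OF holomorphic2_on_slices(1)[OF h] 0 w])
    show "\<i> * complex_of_real t \<in> upper_half_plane" using t by (simp add: upper_half_plane_def)
  qed (use t in simp_all)
  have "h (w, y) = 0" if "w \<in> upper_half_plane" "y \<in> upper_half_plane" for w y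
    by (rule holomorphic_zero_on_imaginary_axis[OF holomorphic2_on_slices(2)[OF h that(1)]
          ax[OF _ that(1)] that(2)])
  then show ?thesis using z by auto
qed

section \<open>Finite rank implies rationality\<close>

text \<open>Finite rank means that, tested against all moment vectors, each \<alpha>_n acts like
  some \<open>v\<close> in the span of finitely many of them. The difference lies in the span of the
  moment vectors and is orthogonal to all of them, hence vanishes.\<close>

lemma finite_span_from_gram_rank:
  fixes \<alpha> :: "nat \<times> nat \<Rightarrow> 'a::complex_hilbert"
  assumes "finite_rank (\<lambda>m n. cinner (\<alpha> n) (\<alpha> m))"
  obtains B where "finite B" "B \<subseteq> \<alpha> ` index_set" "\<alpha> ` index_set \<subseteq> ch.span B" "\<not> ch.dependent B"
proof -
  define col where "col = matrix_column (\<lambda>m n. cinner (\<alpha> n) (\<alpha> m))"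
  obtain C where C: "finite C" "cfun.span (col ` index_set) = cfun.span C"
    using assms unfolding finite_rank_def col_def by blast
  obtain Bc where Bc: "Bc \<subseteq> col ` index_set" "\<not> cfun.dependent Bc" "col ` index_set \<subseteq> cfun.span Bc"
    using cfun.maximal_independent_subset[of "col ` index_set"] by blast
  have "Bc \<subseteq> cfun.span C" using Bc(1) C(2) cfun.span_superset by blast
  then have "finite Bc" using cfun.independent_span_bound[OF C(1) Bc(2)] by simp
  then obtain N where N: "N \<subseteq> index_set" "finite N" "Bc = col ` N"
    using Bc(1) by (meson finite_subset_image)
  have rep: "\<exists>v\<in>ch.span (\<alpha> ` N). \<forall>m\<in>index_set. g m = cinner v (\<alpha> m)"
    if "g \<in> cfun.span (col ` N)" for g
    using that
  proof (induction rule: cfun.span_induct_alt)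
    case base
    then show ?case by (intro bexI[of _ 0]) (auto simp: ch.span_zero)
  next
    case (step c x y)
    then obtain n v where nv: "n \<in> N" "x = col n" "v \<in> ch.span (\<alpha> ` N)"
      "\<forall>m\<in>index_set. y m = cinner v (\<alpha> m)" by blast
    then show ?case
      by (intro bexI[of _ "c *\<^sub>C \<alpha> n + v"])
        (auto simp: col_def matrix_column_def cinner_simps intro!: ch.span_add ch.span_scale
          intro: ch.span_base)
  qed
  have sub: "\<alpha> n \<in> ch.span (\<alpha> ` N)" if n: "n \<in> index_set" for n
  proof -
    have "col n \<in> cfun.span (col ` N)" using Bc(3) n N(3) by blast
    then obtain v where v: "v \<in> ch.span (\<alpha> ` N)" "\<forall>m\<in>index_set. col n m = cinner v (\<alpha> m)"
      using rep by blast
    have "\<alpha> n - v \<in> ch.span (\<alpha> ` index_set)"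
      using v(1) ch.span_mono[OF image_mono[OF N(1)], of \<alpha>] n
      by (intro ch.span_diff) (auto intro: ch.span_base)
    moreover have "cinner (\<alpha> n - v) b = 0" if "b \<in> \<alpha> ` index_set" for b
      using v(2) that by (auto simp: col_def matrix_column_def cinner_diff_left)
    ultimately have "cinner (\<alpha> n - v) (\<alpha> n - v) = 0" by (rule cinner_span_eq_0)
    then show ?thesis using v(1) by simp
  qed
  \<comment> \<open>The basis is taken among the moment vectors themselves, so that in the
    application it lies in the domain of \<open>A\<close>.\<close>
  obtain B where B: "B \<subseteq> \<alpha> ` index_set" "\<not> ch.dependent B" "\<alpha> ` index_set \<subseteq> ch.span B"
    using ch.maximal_independent_subset[of "\<alpha> ` index_set"] by blast
  have "B \<subseteq> ch.span (\<alpha> ` N)" using B(1) sub by blast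
  then have "finite B" using ch.independent_span_bound[OF finite_imageI[OF N(2)] B(2)] by simp
  then show ?thesis using that B by blast
qed

text \<open>On the imaginary axes the resolvent does not leave the span of the moment vectors: with
  \<open>b = s Y + t (1 - Y)\<close> the vectors \<open>u\<^sub>k = \<Sum>\<^bsub>|n| = k + 1\<^esub> \<alpha>\<^sub>n / (s\<^bsup>n1\<^esup> t\<^bsup>n2\<^esup>)\<close> satisfy
  \<open>b u\<^sub>0 = \<alpha>\<close> and \<open>A u\<^sub>k = b u\<^bsub>k+1\<^esub>\<close>.\<close>

lemma HVMS_resolvent_in_span:
  fixes \<alpha> :: "nat \<times> nat \<Rightarrow> 'a::complex_hilbert"
  assumes hvms: "infinite_HVMS \<alpha> Y D A"
    and B: "finite B" "\<alpha> ` index_set \<subseteq> ch.span B"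
    and st: "0 < s" "0 < t"
  obtains x where "x \<in> ch.span (\<alpha> ` index_set)" "x \<in> D"
    "A x - z_op Y (\<i> * complex_of_real s, \<i> * complex_of_real t) x = \<alpha> (1, 0) + \<alpha> (0, 1)"
proof -
  have Y: "positive_contraction Y" and sa: "densely_defined_self_adjoint D A"
    and Y0: "\<And>l. 1 \<le> l \<Longrightarrow> Y (\<alpha> (0, l)) = 0" "\<And>l. 1 \<le> l \<Longrightarrow> Y (\<alpha> (l, 0)) = \<alpha> (l, 0)"
    and D: "\<And>n. n \<in> index_set \<Longrightarrow> \<alpha> n \<in> D"
    and A: "\<And>n. n \<in> index_set \<Longrightarrow>
      A (\<alpha> n) = Y (\<alpha> (n + (1, 0))) + (\<alpha> (n + (0, 1)) - Y (\<alpha> (n + (0, 1))))"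
    using hvms unfolding infinite_HVMS_def by auto
  have lin: "clinear_on D A" using sa by (simp add: densely_defined_self_adjoint_def)
  define S T where "S = complex_of_real s" and "T = complex_of_real t"
  have S0: "S \<noteq> 0" "T \<noteq> 0" using st by (auto simp: S_def T_def)
  define w where "w = (S, T)"
  define z where "z = (\<i> * S, \<i> * T)"
  have zw: "z_op Y z x = \<i> *\<^sub>C z_op Y w x" for x
    by (simp add: z_op_def z_def w_def scaleC_add_right scaleC_scaleC)
  have zU: "z \<in> bi_upper" using st by (simp add: z_def S_def T_def upper_half_plane_def)
  \<comment> \<open>Layer \<open>k\<close> collects the indices of total degree
    \<open>k + 1\<close>; \<open>c j k\<close> is the weight of the index
    \<open>(j, Suc k - j)\<close>.\<close>
  define c where "c j k = 1 / (S ^ j * T ^ (Suc k - j))" for j k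
  define u where "u k = (\<Sum>j\<le>Suc k. c j k *\<^sub>C \<alpha> (j, Suc k - j))" for k
  have idx: "(j, Suc k - j) \<in> index_set" for j k by (auto simp: index_set_def)
  have uD: "u k \<in> D" for k
    unfolding u_def using clinear_on_sum[OF lin, of "{..Suc k}" "\<lambda>j. \<alpha> (j, Suc k - j)" "\<lambda>j. c j k"] D[OF idx]
    by blast
  have Au: "A (u k) = z_op Y w (u (Suc k))" for k
  proof -
    have "A (u k) = (\<Sum>j\<le>Suc k. c j k *\<^sub>C A (\<alpha> (j, Suc k - j)))"
      unfolding u_def using clinear_on_sum[OF lin, of "{..Suc k}" "\<lambda>j. \<alpha> (j, Suc k - j)" "\<lambda>j. c j k"] D[OF idx]
      by blast
    also have "\<dots> = (\<Sum>j\<le>Suc k. c j k *\<^sub>C Y (\<alpha> (Suc j, Suc k - j))) +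
       (\<Sum>j\<le>Suc k. c j k *\<^sub>C (\<alpha> (j, Suc (Suc k) - j) - Y (\<alpha> (j, Suc (Suc k) - j))))"
      unfolding sum.distrib[symmetric]
      by (intro sum.cong refl) (simp add: A[OF idx] scaleC_add_right Suc_diff_le)
    \<comment> \<open>The reindexed sum has an additional term \<open>j = 0\<close>, which
      \<open>Y\<close> annihilates; in the companion sum the additional top term is annihilated by
      \<open>1 - Y\<close>.\<close>
    also have "(\<Sum>j\<le>Suc k. c j k *\<^sub>C Y (\<alpha> (Suc j, Suc k - j))) =
        (\<Sum>j\<le>Suc (Suc k). (S * c j (Suc k)) *\<^sub>C Y (\<alpha> (j, Suc (Suc k) - j)))"
      unfolding sum.atMost_Suc_shift[of _ "Suc k"]
      using Y0(1)[of "Suc (Suc k)"] S0 by (simp add: c_def)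
    also have "(\<Sum>j\<le>Suc k. c j k *\<^sub>C (\<alpha> (j, Suc (Suc k) - j) - Y (\<alpha> (j, Suc (Suc k) - j)))) =
        (\<Sum>j\<le>Suc (Suc k). (T * c j (Suc k)) *\<^sub>C (\<alpha> (j, Suc (Suc k) - j) - Y (\<alpha> (j, Suc (Suc k) - j))))"
    proof -
      have "T * c j (Suc k) = c j k" if "j \<le> Suc k" for j
        using that S0 by (simp add: c_def Suc_diff_le)
      then show ?thesis unfolding sum.atMost_Suc[of _ "Suc k"] using Y0(2)[of "Suc (Suc k)"]
        by (simp del: sum.atMost_Suc)
    qed
    also have "(\<Sum>j\<le>Suc (Suc k). (S * c j (Suc k)) *\<^sub>C Y (\<alpha> (j, Suc (Suc k) - j))) +
        (\<Sum>j\<le>Suc (Suc k). (T * c j (Suc k)) *\<^sub>C (\<alpha> (j, Suc (Suc k) - j) - Y (\<alpha> (j, Suc (Suc k) - j)))) =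
      (\<Sum>j\<le>Suc (Suc k). c j (Suc k) *\<^sub>C z_op Y w (\<alpha> (j, Suc (Suc k) - j)))"
      unfolding sum.distrib[symmetric]
      by (intro sum.cong refl) (simp add: z_op_def w_def scaleC_add_right scaleC_scaleC mult.commute)
    also have "\<dots> = z_op Y w (u (Suc k))" unfolding u_def by (simp only: z_op_sum[OF Y])
    finally show ?thesis .
  qed
  have u0: "z_op Y w (u 0) = \<alpha> (1, 0) + \<alpha> (0, 1)"
  proof -
    have "u 0 = (1 / T) *\<^sub>C \<alpha> (0, 1) + (1 / S) *\<^sub>C \<alpha> (1, 0)"
      by (simp add: u_def c_def)
    then show ?thesis
      using Y0[of 1] S0 by (simp add: z_op_add[OF Y] z_op_scaleC[OF Y]) (simp add: z_op_def w_def scaleC_scaleC)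
  qed
  have uB: "u k \<in> ch.span B" for k
    unfolding u_def using B(2) idx by (intro ch.span_sum ch.span_scale) blast
  have uI: "u k \<in> ch.span (\<alpha> ` index_set)" for k
    unfolding u_def using idx by (intro ch.span_sum ch.span_scale ch.span_base) blast
  have pD: "poly_comb u p \<in> D" for p
    unfolding poly_comb_def
    using clinear_on_sum[OF lin, of "{..degree p}" u "coeff p"] uD by blast
  have Ap: "A (poly_comb u p) = z_op Y w (poly_comb (\<lambda>k. u (Suc k)) p)" for p
    unfolding poly_comb_def using clinear_on_sum[OF lin, of "{..degree p}" u "coeff p"] uD
    by (simp add: Au z_op_sum[OF Y])
  from minimal_annihilating_poly[of B u, OF B(1) uB]
  obtain p where p: "p \<noteq> 0" "poly_comb u p = 0"
    "\<And>q. q \<noteq> 0 \<Longrightarrow> degree q < degree p \<Longrightarrow> poly_comb u q \<noteq> 0"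
    by (elim exE conjE) auto
  \<comment> \<open>Let \<open>q\<close> be the quotient of p - p(\<i>) by X - \<i>. Since A u_k = b
    u_(k+1), the pencil A - \<i> b maps q(u) to b applied to (p - p(\<i>))(u) = - p(\<i>) u_0, a
    multiple of the wanted right-hand side.\<close>
  define r where "r = p - [:poly p \<i>:]"
  have "poly r \<i> = 0" by (simp add: r_def)
  then obtain q where q: "r = [:- \<i>, 1:] * q" unfolding poly_eq_0_iff_dvd by (rule dvdE)
  have key: "A (poly_comb u q) - z_op Y z (poly_comb u q) = - (poly p \<i> *\<^sub>C (\<alpha> (1, 0) + \<alpha> (0, 1)))"
  proof -
    have "poly_comb u [:a:] = a *\<^sub>C u 0" for a by (simp add: poly_comb_def)
    then have "poly_comb (\<lambda>k. u (Suc k)) q - \<i> *\<^sub>C poly_comb u q = - (poly p \<i> *\<^sub>C u 0)"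
      unfolding poly_comb_linear_factor[symmetric] q[symmetric] r_def poly_comb_diff p(2) by simp
    from arg_cong[OF this, of "z_op Y w"]
    have "z_op Y w (poly_comb (\<lambda>k. u (Suc k)) q) - z_op Y w (\<i> *\<^sub>C poly_comb u q) =
        z_op Y w ((- poly p \<i>) *\<^sub>C u 0)"
      by (simp add: z_op_diff[OF Y])
    then show ?thesis unfolding Ap z_op_scaleC[OF Y] u0 zw by simp
  qed
  \<comment> \<open>If \<open>p\<close> vanished at \<i>, then \<open>poly_comb u q\<close> would
    lie in the kernel of the pencil and \<open>q\<close>, of smaller degree, would contradict the
    minimality of \<open>p\<close>.\<close>
  have pi: "poly p \<i> \<noteq> 0"
  proof
    assume pi: "poly p \<i> = 0"
    then have pq: "p = [:- \<i>, 1:] * q" using q by (simp add: r_def)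
    have q0: "q \<noteq> 0" using p(1) pq by auto
    have "degree q < degree p" using q0 by (subst pq, subst degree_mult_eq) auto
    moreover have "poly_comb u q = 0"
      using pencil_kernel_trivial[OF Y zU, of A "poly_comb u q"]
        self_adjoint_symmetric[OF sa pD pD] key pi by simp
    ultimately show False using p(3) q0 by blast
  qed
  define x where "x = (- 1 / poly p \<i>) *\<^sub>C poly_comb u q"
  have "x \<in> D" using lin pD unfolding x_def clinear_on_def by blast
  moreover have "x \<in> ch.span (\<alpha> ` index_set)"
    unfolding x_def using uI by (intro ch.span_scale poly_comb_in_span)
  moreover have "A x - z_op Y z x = \<alpha> (1, 0) + \<alpha> (0, 1)"
  proof -
    have "A x = (- 1 / poly p \<i>) *\<^sub>C A (poly_comb u q)"
      using lin pD unfolding x_def clinear_on_def by blast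
    then have "A x - z_op Y z x = (- 1 / poly p \<i>) *\<^sub>C (A (poly_comb u q) - z_op Y z (poly_comb u q))"
      by (simp only: x_def z_op_scaleC[OF Y] ch.scale_right_diff_distrib)
    then show ?thesis unfolding key using pi by (simp add: scaleC_scaleC)
  qed
  ultimately show ?thesis using that unfolding z_def S_def T_def by blast
qed

lemma has_derivative_poly:
  fixes f :: "complex \<times> complex \<Rightarrow> complex"
  assumes "is_poly2 f"
  shows "\<exists>a b. (f has_derivative (\<lambda>(u, v). a * u + b * v)) (at z within S)"
proof -
  have const: "\<exists>a b. ((\<lambda>z. poly p (fst z)) has_derivative (\<lambda>(u, v). a * u + b * v)) (at z within S)"
    for p :: "complex poly"
  proof -
    have "(poly p has_field_derivative poly (pderiv p) (fst z)) (at (fst z))" by (rule poly_DERIV)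
    then have "((\<lambda>z. poly p (fst z)) has_derivative (\<lambda>w. poly (pderiv p) (fst z) * fst w)) (at z within S)"
      unfolding has_field_derivative_def
      by (intro has_derivative_compose[of fst fst z S "poly p"] has_derivative_fst has_derivative_ident)
    moreover have "(\<lambda>w. poly (pderiv p) (fst z) * fst w) =
        (\<lambda>(u, v). poly (pderiv p) (fst z) * u + 0 * (v::complex))" by (auto simp: fun_eq_iff)
    ultimately show ?thesis by metis
  qed
  obtain p where f: "f = poly2 p" using assms is_poly2_def by blast
  have "\<exists>a b. (poly2 p has_derivative (\<lambda>(u, v). a * u + b * v)) (at z within S)"
  proof (induction p)
    case 0
    have "poly2 0 = (\<lambda>_. 0)" by (simp add: poly2_def fun_eq_iff)
    moreover have "(\<lambda>(u::complex, v::complex). 0 * u + 0 * v) = (\<lambda>_. 0)" by auto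
    ultimately show ?case by (metis has_derivative_const)
  next
    case (pCons c p)
    obtain a b where ab: "(poly2 p has_derivative (\<lambda>(u, v). a * u + b * v)) (at z within S)"
      using pCons.IH by blast
    obtain a' b' where c: "((\<lambda>z. poly c (fst z)) has_derivative (\<lambda>(u, v). a' * u + b' * v)) (at z within S)"
      using const by blast
    have eq: "poly2 (pCons c p) = (\<lambda>z. poly c (fst z) + snd z * poly2 p z)"
      by (simp add: poly2_def fun_eq_iff)
    have "(poly2 (pCons c p) has_derivative (\<lambda>w. (case w of (u, v) \<Rightarrow> a' * u + b' * v) +
        (snd z * (case w of (u, v) \<Rightarrow> a * u + b * v) + snd w * poly2 p z))) (at z within S)"
      unfolding eq
      by (rule has_derivative_add[OF c has_derivative_mult[OF has_derivative_snd[OF has_derivative_ident] ab]])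
    moreover have "(\<lambda>w. (case w of (u, v) \<Rightarrow> a' * u + b' * v) +
        (snd z * (case w of (u, v) \<Rightarrow> a * u + b * v) + snd w * poly2 p z)) =
      (\<lambda>(u, v). (a' + snd z * a) * u + (b' + snd z * b + poly2 p z) * v)"
      by (auto simp: fun_eq_iff algebra_simps)
    ultimately show ?case by metis
  qed
  then show ?thesis unfolding f .
qed

lemma holomorphic2_on_poly_combination:
  assumes h: "holomorphic2_on h S" and "is_poly2 q" "is_poly2 p"
  shows "holomorphic2_on (\<lambda>z. q z * h z - p z) S"
  unfolding holomorphic2_on_def
proof
  fix z assume "z \<in> S"
  then obtain a b where h: "(h has_derivative (\<lambda>(u, v). a * u + b * v)) (at z within S)"
    using h unfolding holomorphic2_on_def by blast
  obtain c d where q: "(q has_derivative (\<lambda>(u, v). c * u + d * v)) (at z within S)"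
    using has_derivative_poly[OF assms(2)] by blast
  obtain e f where p: "(p has_derivative (\<lambda>(u, v). e * u + f * v)) (at z within S)"
    using has_derivative_poly[OF assms(3)] by blast
  have "((\<lambda>z. q z * h z - p z) has_derivative (\<lambda>w. (q z * (case w of (u, v) \<Rightarrow> a * u + b * v) +
      (case w of (u, v) \<Rightarrow> c * u + d * v) * h z) - (case w of (u, v) \<Rightarrow> e * u + f * v))) (at z within S)"
    by (rule has_derivative_diff[OF has_derivative_mult[OF q h] p])
  moreover have "(\<lambda>w. (q z * (case w of (u, v) \<Rightarrow> a * u + b * v) +
      (case w of (u, v) \<Rightarrow> c * u + d * v) * h z) - (case w of (u, v) \<Rightarrow> e * u + f * v)) =
    (\<lambda>(u, v). (q z * a + c * h z - e) * u + (q z * b + d * h z - f) * v)"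
    by (auto simp: fun_eq_iff algebra_simps)
  ultimately show "\<exists>a b. ((\<lambda>z. q z * h z - p z) has_derivative (\<lambda>(u, v). a * u + b * v)) (at z within S)"
    by metis
qed

lemma rational2_if_poly_multiple:
  assumes "is_poly2 q" "is_poly2 p" "q z0 \<noteq> 0" "\<And>z. z \<in> bi_upper \<Longrightarrow> q z * h z = p z"
  shows "rational2 h"
proof -
  obtain P Q where PQ: "p = poly2 P" "q = poly2 Q" using assms is_poly2_def by metis
  have "Q \<noteq> 0" using assms(3) PQ by (auto simp: poly2_def)
  moreover have "h z = poly2 P z / poly2 Q z" if "z \<in> bi_upper" "poly2 Q z \<noteq> 0" for z
    using assms(4)[OF that(1)] that(2) PQ by (simp add: field_simps)
  ultimately show ?thesis unfolding rational2_def by blast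
qed

theorem rational2_if_finite_rank_HVMS:
  fixes \<alpha> :: "nat \<times> nat \<Rightarrow> 'a::complex_hilbert"
  assumes hol: "holomorphic2_on h bi_upper"
    and hvms: "infinite_HVMS \<alpha> Y D A"
    and rep: "\<And>z. z \<in> bi_upper \<Longrightarrow>
      h z = cinner (resolvent D A Y z (\<alpha> (1, 0) + \<alpha> (0, 1))) (\<alpha> (1, 0) + \<alpha> (0, 1))"
    and rank: "finite_rank (\<lambda>m n. gram1 \<alpha> Y m n + gram2 \<alpha> Y m n)"
  shows "rational2 h"
proof -
  have Y: "positive_contraction Y" and sa: "densely_defined_self_adjoint D A"
    and D: "\<And>n. n \<in> index_set \<Longrightarrow> \<alpha> n \<in> D"
    using hvms unfolding infinite_HVMS_def by auto
  have lin: "clinear_on D A" using sa by (simp add: densely_defined_self_adjoint_def)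
  have "(\<lambda>m n. gram1 \<alpha> Y m n + gram2 \<alpha> Y m n) = (\<lambda>m n. cinner (\<alpha> n) (\<alpha> m))"
    by (simp add: gram1_def gram2_def cinner_diff_left fun_eq_iff)
  then obtain B where B: "finite B" "B \<subseteq> \<alpha> ` index_set" "\<alpha> ` index_set \<subseteq> ch.span B"
    "\<not> ch.dependent B"
    using rank finite_span_from_gram_rank[of \<alpha>] by metis
  have BD: "b \<in> D" if "b \<in> B" for b using B(2) D that by blast
  have spanB: "ch.span (\<alpha> ` index_set) \<subseteq> ch.span B"
    using B(3) by (rule ch.span_minimal) (rule ch.subspace_span)
  define a where "a = \<alpha> (1, 0) + \<alpha> (0, 1)"
  \<comment> \<open>The pencil may leave the span of \<open>B\<close>, so it is only tested against
    \<open>B\<close>. The resulting square system is nonsingular at (\<i>, \<i>), because a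
    homogeneous solution makes the quadratic form vanish.\<close>
  define G where "G i j z = cinner (A j - z_op Y z j) i" for i j :: 'a and z
  have Gpoly: "is_poly2 (G i j)" for i j
  proof -
    have "G i j = (\<lambda>z. cinner (A j) i - (fst z * cinner (Y j) i + snd z * cinner (j - Y j) i))"
      by (simp add: G_def z_op_def cinner_diff_left cinner_add_left cinner_scaleC_left fun_eq_iff)
    then show ?thesis by (auto intro!: is_poly2_diff is_poly2_add is_poly2_mult)
  qed
  have Gsum: "(\<Sum>j\<in>B. G i j z * x j) = cinner (A v - z_op Y z v) i"
    and vD: "v \<in> D" if v: "v = (\<Sum>j\<in>B. x j *\<^sub>C j)" for i z x v
  proof -
    have "v \<in> D \<and> A v = (\<Sum>j\<in>B. x j *\<^sub>C A j)"
      unfolding v by (rule clinear_on_sum[OF lin BD])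
    then show "v \<in> D" "(\<Sum>j\<in>B. G i j z * x j) = cinner (A v - z_op Y z v) i"
      by (auto simp: v z_op_sum[OF Y] G_def cinner_diff_left cinner_sum_left cinner_scaleC_left
        sum_subtractf algebra_simps)
  qed
  have "\<exists>q p. is_poly2 q \<and> q (\<i>, \<i>) \<noteq> 0 \<and> (\<forall>j\<in>B. is_poly2 (p j)) \<and>
    (\<forall>z x. (\<forall>i\<in>B. (\<Sum>j\<in>B. G i j z * x j) = (\<lambda>_. cinner a i) z) \<longrightarrow> (\<forall>j\<in>B. q z * x j = p j z))"
  proof (rule polynomial_linear_system)
    fix x assume x: "\<And>i. i \<in> B \<Longrightarrow> (\<Sum>j\<in>B. G i j (\<i>, \<i>) * x j) = 0"
    define v where "v = (\<Sum>j\<in>B. x j *\<^sub>C j)"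
    have "v \<in> ch.span B" unfolding v_def by (intro ch.span_sum ch.span_scale ch.span_base)
    then have "cinner (A v - z_op Y (\<i>, \<i>) v) v = 0"
      by (rule cinner_span_eq_0) (use x Gsum[OF v_def] in auto)
    moreover have "cinner (A v) v = cinner v (A v)"
      using self_adjoint_symmetric[OF sa vD[OF v_def] vD[OF v_def]] .
    moreover have "(\<i>, \<i>) \<in> bi_upper" by (simp add: upper_half_plane_def)
    ultimately have "v = 0" using pencil_kernel_trivial[of Y "(\<i>, \<i>)" A v] Y by blast
    then show "\<forall>j\<in>B. x j = 0"
      using B(1,4) unfolding v_def ch.dependent_finite[OF B(1)] by blast
  qed (use B(1) Gpoly in auto)
  then obtain q p where q: "is_poly2 q" "q (\<i>, \<i>) \<noteq> 0" and p: "\<forall>j\<in>B. is_poly2 (p j)"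
    and qp: "\<And>z x. (\<forall>i\<in>B. (\<Sum>j\<in>B. G i j z * x j) = cinner a i) \<Longrightarrow> (\<forall>j\<in>B. q z * x j = p j z)"
    by blast
  define P where "P z = (\<Sum>j\<in>B. p j z * cinner j a)" for z
  have Pp: "is_poly2 P" unfolding P_def[abs_def] using p by (intro is_poly2_sum is_poly2_mult) auto
  have "q z * h z - P z = 0" if z: "z \<in> bi_upper" for z
  proof (rule holomorphic2_zero_on_imaginary_axes[OF holomorphic2_on_poly_combination[OF hol q(1) Pp] _ z])
    fix s t :: real assume st: "0 < s" "0 < t"
    let ?z = "(\<i> * complex_of_real s, \<i> * complex_of_real t)"
    obtain v where v: "v \<in> ch.span (\<alpha> ` index_set)" "v \<in> D" "A v - z_op Y ?z v = a"
      using HVMS_resolvent_in_span[OF hvms B(1,3) st] unfolding a_def by blast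
    have zU: "?z \<in> bi_upper" using st by (simp add: upper_half_plane_def)
    have "resolvent D A Y ?z a = v"
      by (rule resolvent_eq[OF lin self_adjoint_symmetric[OF sa] Y zU v(2,3)])
    then have hz: "h ?z = cinner v a" using rep[OF zU] by (simp add: a_def)
    have "v \<in> ch.span B" using v(1) spanB by blast
    then obtain x where x: "v = (\<Sum>j\<in>B. x j *\<^sub>C j)" using ch.span_finite[OF B(1)] by auto
    have "\<forall>j\<in>B. q ?z * x j = p j ?z" using qp Gsum[OF x] v(3) by simp
    then have "q ?z * (\<Sum>j\<in>B. x j * cinner j a) = P ?z"
      unfolding P_def sum_distrib_left by (intro sum.cong) (auto simp: mult.assoc[symmetric])
    then show "q ?z * h ?z - P ?z = 0" unfolding hz
      by (subst x) (simp add: cinner_sum_left cinner_scaleC_left)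
  qed
  then show ?thesis using rational2_if_poly_multiple[OF q(1) Pp q(2)] by simp
qed

section \<open>Power series on the bidisk\<close>

lemma taylor_bounded_disk:
  assumes f: "f holomorphic_on ball 0 1" and b: "\<And>x. x \<in> ball 0 1 \<Longrightarrow> cmod (f x) \<le> 1"
  defines "c \<equiv> \<lambda>k. (deriv ^^ k) f 0 / fact k"
  shows "cmod (c k) \<le> 1" and "x \<in> ball 0 1 \<Longrightarrow> (\<lambda>k. c k * x ^ k) sums f x"
proof -
  have bnd: "cmod (c k) * r ^ k \<le> 1" if r: "0 < r" "r < 1" for r
  proof -
    have "cmod ((deriv ^^ k) f 0) \<le> fact k * 1 / r ^ k"
    proof (rule Cauchy_inequality)
      show "f holomorphic_on ball 0 r" using r by (intro holomorphic_on_subset[OF f]) auto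
      show "continuous_on (cball 0 r) f"
        using r by (intro continuous_on_subset[OF holomorphic_on_imp_continuous_on[OF f]]) auto
    qed (use r b in auto)
    then show ?thesis using r by (simp add: c_def norm_divide field_simps)
  qed
  show "cmod (c k) \<le> 1"
  proof (rule tendsto_upperbound)
    show "((\<lambda>r. cmod (c k) * r ^ k) \<longlongrightarrow> cmod (c k)) (at_left (1::real))"
      by (rule tendsto_eq_intros refl | simp)+
    show "\<forall>\<^sub>F r in at_left 1. cmod (c k) * r ^ k \<le> 1"
      unfolding eventually_at_left_field using bnd by (intro exI[of _ 0]) auto
  qed simp
  show "(\<lambda>k. c k * x ^ k) sums f x" if "x \<in> ball 0 1"
    using holomorphic_power_series[OF f that] by (simp add: c_def)
qed

lemma taylor_tail_bound:
  fixes c :: "nat \<Rightarrow> complex"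
  assumes "\<And>k. cmod (c k) \<le> 1" "(\<lambda>k. c k * y ^ k) sums s" "cmod y < 1"
  shows "cmod (s - (\<Sum>l<m. c l * y ^ l)) \<le> cmod y ^ m / (1 - cmod y)"
proof -
  have s: "(\<lambda>k. c (k + m) * y ^ (k + m)) sums (s - (\<Sum>l<m. c l * y ^ l))"
    by (rule sums_split_initial_segment[OF assms(2)])
  have g: "(\<lambda>k. cmod y ^ m * cmod y ^ k) sums (cmod y ^ m * (1 / (1 - cmod y)))"
    using assms(3) by (intro sums_mult geometric_sums) auto
  have "cmod (s - (\<Sum>l<m. c l * y ^ l)) \<le> cmod y ^ m * (1 / (1 - cmod y))"
    unfolding sums_unique[OF s] sums_unique[OF g]
  proof (rule norm_suminf_le)
    fix k
    have "cmod (c (k + m) * y ^ (k + m)) \<le> 1 * (cmod y ^ (k + m))"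
      unfolding norm_mult norm_power by (intro mult_right_mono assms(1)) auto
    then show "cmod (c (k + m) * y ^ (k + m)) \<le> cmod y ^ m * cmod y ^ k"
      by (simp add: power_add mult.commute)
  qed (rule sums_summable[OF g])
  then show ?thesis by simp
qed

lemma has_sum_geometric2:
  fixes r s :: real
  assumes "0 \<le> r" "r < 1" "0 \<le> s" "s < 1"
  shows "((\<lambda>a. r ^ fst a * s ^ snd a) has_sum (1 / (1 - r) * (1 / (1 - s)))) (UNIV :: (nat \<times> nat) set)"
proof -
  have r: "((\<lambda>j. r ^ j) has_sum 1 / (1 - r)) UNIV" and s: "((\<lambda>j. s ^ j) has_sum 1 / (1 - s)) UNIV"
    using assms by (auto intro!: norm_summable_imp_has_sum geometric_sums)
  have "((\<lambda>(j, k). r ^ j * s ^ k) has_sum 1 / (1 - r) * (1 / (1 - s))) (SIGMA j:UNIV. UNIV)"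
  proof (rule has_sum_SigmaI)
    show "((\<lambda>k. (\<lambda>(j, k). r ^ j * s ^ k) (j, k)) has_sum r ^ j * (1 / (1 - s))) UNIV" for j :: nat
      using has_sum_cmult_right[OF s, of "r ^ j"] by simp
    show "((\<lambda>j. r ^ j * (1 / (1 - s))) has_sum 1 / (1 - r) * (1 / (1 - s))) UNIV"
      by (rule has_sum_cmult_left[OF r])
    show "(\<lambda>(j, k). r ^ j * s ^ k) summable_on (SIGMA j:UNIV. (UNIV :: nat set))"
    proof (rule summable_on_SigmaI)
      show "((\<lambda>k. (\<lambda>(j, k). r ^ j * s ^ k) (j, k)) has_sum r ^ j * (1 / (1 - s))) UNIV" for j :: nat
        using has_sum_cmult_right[OF s, of "r ^ j"] by simp
      show "(\<lambda>j. r ^ j * (1 / (1 - s))) summable_on UNIV"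
        using has_sum_cmult_left[OF r] summable_on_def by blast
    qed (use assms in auto)
  qed
  then show ?thesis by (simp add: case_prod_unfold)
qed

lemma double_series_abs_summable:
  fixes c :: "nat \<times> nat \<Rightarrow> complex"
  assumes "\<And>a. cmod (c a) \<le> C" "cmod x < 1" "cmod y < 1"
  shows "(\<lambda>a. norm (c a * (x ^ fst a * y ^ snd a))) summable_on UNIV"
proof (rule Infinite_Sum.abs_summable_on_comparison_test')
  show "(\<lambda>a. C * (cmod x ^ fst a * cmod y ^ snd a)) summable_on (UNIV :: (nat \<times> nat) set)"
    using has_sum_geometric2[of "cmod x" "cmod y"] assms(2,3)
    by (intro summable_on_cmult_right) (auto simp: summable_on_def)
  show "norm (c a * (x ^ fst a * y ^ snd a)) \<le> C * (cmod x ^ fst a * cmod y ^ snd a)" for a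
    using assms(1)[of a] by (simp add: norm_mult norm_power mult_right_mono)
qed

text \<open>The coefficient \<open>C k\<close> of the k-th power of y is a limit, uniform in x, of
  F(x, y_n) minus its first \<open>k\<close> terms, divided by y_n^k, along a sequence y_n tending
  to 0. By induction on \<open>k\<close> it is holomorphic and bounded by 1, and can itself be
  expanded.\<close>

lemma double_taylor:
  fixes F :: "complex \<times> complex \<Rightarrow> complex"
  assumes h1: "\<And>y. y \<in> ball 0 1 \<Longrightarrow> (\<lambda>x. F (x, y)) holomorphic_on ball 0 1"
    and h2: "\<And>x. x \<in> ball 0 1 \<Longrightarrow> (\<lambda>y. F (x, y)) holomorphic_on ball 0 1"
    and b: "\<And>z. z \<in> ball 0 1 \<times> ball 0 1 \<Longrightarrow> cmod (F z) \<le> 1"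
  obtains c :: "nat \<times> nat \<Rightarrow> complex" where "\<And>a. cmod (c a) \<le> 1"
    "\<And>z. z \<in> ball 0 1 \<times> ball 0 1 \<Longrightarrow> ((\<lambda>a. c a * (fst z ^ fst a * snd z ^ snd a)) has_sum F z) UNIV"
proof -
  define C where "C k x = (deriv ^^ k) (\<lambda>y. F (x, y)) 0 / fact k" for k x
  have C1: "cmod (C k x) \<le> 1" if "x \<in> ball 0 1" for k x
    unfolding C_def using taylor_bounded_disk(1)[OF h2[OF that]] b that by simp
  have Cs: "(\<lambda>k. C k x * y ^ k) sums F (x, y)" if "x \<in> ball 0 1" "y \<in> ball 0 1" for x y
    unfolding C_def using taylor_bounded_disk(2)[OF h2[OF that(1)] _ that(2)] b that by simp
  have hol: "C k holomorphic_on ball 0 1" for k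
  proof (induction k rule: less_induct)
    case (less k)
    \<comment> \<open>The offset 2 keeps the modulus at most 1/2, so that the geometric tail costs
      only a factor 2.\<close>
    define y where "y n = complex_of_real (1 / real (n + 2))" for n
    have y: "y n \<noteq> 0" "cmod (y n) \<le> 1/2" "y n \<in> ball 0 1" for n
      unfolding y_def norm_of_real mem_ball_0 of_real_eq_0_iff by (auto simp: field_simps)
    define f where "f n x = (F (x, y n) - (\<Sum>l<k. C l x * y n ^ l)) / y n ^ k" for n x
    have err: "cmod (f n x - C k x) \<le> 2 * cmod (y n)" if x: "x \<in> ball 0 1" for n x
    proof -
      have "cmod (F (x, y n) - (\<Sum>l<Suc k. C l x * y n ^ l)) \<le> cmod (y n) ^ Suc k / (1 - cmod (y n))"
        using y x by (intro taylor_tail_bound Cs C1) auto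
      also have "\<dots> \<le> cmod (y n) ^ Suc k / (1/2)"
        using y(2)[of n] by (intro divide_left_mono) auto
      finally have "cmod (F (x, y n) - (\<Sum>l<Suc k. C l x * y n ^ l)) \<le> 2 * cmod (y n) * cmod (y n) ^ k"
        by simp
      moreover have "F (x, y n) - (\<Sum>l<Suc k. C l x * y n ^ l) = (f n x - C k x) * y n ^ k"
      proof -
        have "f n x * y n ^ k = F (x, y n) - (\<Sum>l<k. C l x * y n ^ l)" using y(1)[of n] by (simp add: f_def)
        then show ?thesis by (simp add: left_diff_distrib)
      qed
      ultimately show ?thesis using y(1)[of n] by (simp add: norm_mult norm_power)
    qed
    show ?case
    proof (rule holomorphic_uniform_sequence[of _ f])
      show "f n holomorphic_on ball 0 1" for n
        unfolding f_def[abs_def] using y less by (intro holomorphic_intros h1) auto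
      fix x :: complex assume "x \<in> ball 0 1"
      then obtain d where d: "0 < d" "cball x d \<subseteq> ball 0 1"
        using open_contains_cball[of "ball (0::complex) 1"] open_ball by blast
      have "uniform_limit (cball x d) f (C k) sequentially"
      proof (rule uniform_limitI)
        fix e :: real assume e: "0 < e"
        have "(\<lambda>n. 1 / real (n + 2)) \<longlonglongrightarrow> 0"
          by (rule LIMSEQ_ignore_initial_segment[OF lim_1_over_n])
        then have "(\<lambda>n. 2 * cmod (y n)) \<longlonglongrightarrow> 2 * 0"
          unfolding y_def norm_of_real by (intro tendsto_mult tendsto_const tendsto_rabs_zero)
        from order_tendstoD(2)[OF this, of e] e
        have "\<forall>\<^sub>F n in sequentially. 2 * cmod (y n) < e" by simp
        then show "\<forall>\<^sub>F n in sequentially. \<forall>x\<in>cball x d. dist (f n x) (C k x) < e"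
        proof eventually_elim
          case (elim n)
          show ?case
          proof
            fix x' assume "x' \<in> cball x d"
            then have "x' \<in> ball 0 1" using d by blast
            from err[OF this, of n] elim show "dist (f n x') (C k x') < e" by (simp add: dist_norm)
          qed
        qed
      qed
      then show "\<exists>d>0. cball x d \<subseteq> ball 0 1 \<and> uniform_limit (cball x d) f (C k) sequentially"
        using d by blast
    qed simp
  qed
  define c where "c a = (deriv ^^ fst a) (C (snd a)) 0 / fact (fst a)" for a
  have c1: "cmod (c a) \<le> 1" for a
    unfolding c_def using taylor_bounded_disk(1)[OF hol C1] by blast
  have cs: "(\<lambda>j. c (j, k) * x ^ j) sums C k x" if "x \<in> ball 0 1" for x k
    unfolding c_def using taylor_bounded_disk(2)[OF hol C1 that] by simp
  have "((\<lambda>a. c a * (x ^ fst a * y ^ snd a)) has_sum F (x, y)) UNIV"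
    if x: "x \<in> ball 0 1" and y: "y \<in> ball 0 1" for x y
  proof -
    let ?f = "\<lambda>a. c a * (x ^ fst a * y ^ snd a)"
    let ?g = "\<lambda>(k, j). ?f (j, k)"
    have "(\<lambda>a. norm (?f a)) summable_on UNIV" using double_series_abs_summable[OF c1] x y by auto
    then have "?f summable_on UNIV" by (rule abs_summable_summable)
    then obtain S where S: "(?f has_sum S) UNIV" unfolding summable_on_def by blast
    have "bij_betw (\<lambda>(k, j). (j, k)) (SIGMA k:UNIV. UNIV) (UNIV :: (nat \<times> nat) set)"
      by (rule bij_betwI[of _ _ _ "\<lambda>(k, j). (j, k)"]) auto
    from has_sum_reindex_bij_betw[OF this, of ?f] S
    have S': "(?g has_sum S) (SIGMA k:UNIV. UNIV)" by (simp add: case_prod_unfold)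
    have "((\<lambda>j. ?g (k, j)) has_sum C k x * y ^ k) UNIV" for k
    proof -
      have "((\<lambda>j. c (j, k) * x ^ j) has_sum C k x) UNIV"
      proof (rule norm_summable_imp_has_sum[OF _ cs[OF x]])
        show "summable (\<lambda>j. norm (c (j, k) * x ^ j))"
        proof (rule summable_comparison_test'[of "\<lambda>j. cmod x ^ j" 0])
          show "summable (\<lambda>j. cmod x ^ j)" using x by (intro summable_geometric) auto
          show "norm (norm (c (j, k) * x ^ j)) \<le> cmod x ^ j" for j
            using c1[of "(j, k)"] by (simp add: norm_mult norm_power mult_left_le_one_le)
        qed
      qed
      from has_sum_cmult_left[OF this, of "y ^ k"] show ?thesis by (simp add: mult.assoc)
    qed
    from has_sum_SigmaD[OF S' this] have "((\<lambda>k. C k x * y ^ k) has_sum S) UNIV" .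
    then have "(\<lambda>k. C k x * y ^ k) sums S" by (rule has_sum_imp_sums)
    then have "S = F (x, y)" using Cs[OF x y] sums_unique2 by blast
    then show ?thesis using S by simp
  qed
  then show ?thesis using that[of c] c1 by auto
qed

lemma power_series_zero:
  fixes a :: "nat \<Rightarrow> complex"
  assumes "\<And>x. x \<in> ball 0 1 \<Longrightarrow> (\<lambda>n. a n * x ^ n) sums 0"
  shows "a n = 0"
proof (rule ccontr)
  assume n: "a n \<noteq> 0"
  have "a 0 = 0"
    using sums_unique2[OF assms[of 0] powser_sums_zero[of a]] by simp
  then have "0 < n" using n by (cases n) auto
  from powser_0_nonzero[of 1 0 a "\<lambda>_. 0", OF _ _ _ n this] obtain s where
    "0 < s" "\<And>z::complex. z \<in> cball 0 s - {0} \<Longrightarrow> (0::complex) \<noteq> 0"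
    using assms by auto
  from this(2)[of "complex_of_real s"] this(1) show False by auto
qed

lemma double_series_zero:
  fixes c :: "nat \<times> nat \<Rightarrow> complex"
  assumes bd: "\<And>a. cmod (c a) \<le> C"
    and 0: "\<And>z. z \<in> ball 0 1 \<times> ball 0 1 \<Longrightarrow> ((\<lambda>a. c a * (fst z ^ fst a * snd z ^ snd a)) has_sum 0) UNIV"
  shows "c a = 0"
proof -
  have inner: "((\<lambda>k. c (j, k) * y ^ k) has_sum (\<Sum>\<^sub>\<infinity>k. c (j, k) * y ^ k)) UNIV" if y: "y \<in> ball 0 1" for j y
  proof -
    have "(\<lambda>k. norm (c (j, k) * y ^ k)) summable_on UNIV"
    proof (rule Infinite_Sum.abs_summable_on_comparison_test')
      have "summable (\<lambda>k. norm (C * cmod y ^ k))"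
        using y unfolding norm_mult norm_power by (intro summable_mult summable_geometric) auto
      then show "(\<lambda>k. C * cmod y ^ k) summable_on UNIV" by (rule norm_summable_imp_summable_on)
      show "norm (c (j, k) * y ^ k) \<le> C * cmod y ^ k" for k
        using bd[of "(j, k)"] by (simp add: norm_mult norm_power mult_right_mono)
    qed
    then show ?thesis by (rule has_sum_infsum[OF abs_summable_summable])
  qed
  have "(\<Sum>\<^sub>\<infinity>k. c (j, k) * y ^ k) = 0" if y: "y \<in> ball 0 1" for j y
  proof (rule power_series_zero)
    fix x :: complex assume x: "x \<in> ball 0 1"
    have "((\<lambda>a. c a * (x ^ fst a * y ^ snd a)) has_sum 0) (SIGMA j:UNIV. UNIV)"
      using 0[of "(x, y)"] x y by simp
    moreover have "((\<lambda>k. c (j, k) * (x ^ fst (j, k) * y ^ snd (j, k))) has_sum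
        (\<Sum>\<^sub>\<infinity>k. c (j, k) * y ^ k) * x ^ j) UNIV" for j
      using has_sum_cmult_left[OF inner[OF y, of j], of "x ^ j"] by (simp add: mult_ac)
    ultimately have "((\<lambda>j. (\<Sum>\<^sub>\<infinity>k. c (j, k) * y ^ k) * x ^ j) has_sum 0) UNIV"
      by (rule has_sum_SigmaD)
    then show "(\<lambda>j. (\<Sum>\<^sub>\<infinity>k. c (j, k) * y ^ k) * x ^ j) sums 0" by (rule has_sum_imp_sums)
  qed
  then have "(\<lambda>k. c (j, k) * y ^ k) sums 0" if "y \<in> ball 0 1" for j y
    using has_sum_imp_sums[OF inner[OF that, of j]] that by simp
  then have "c (j, k) = 0" for j k by (rule power_series_zero[of "\<lambda>k. c (j, k)"])
  then show ?thesis by (cases a) auto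
qed

subsection \<open>Multiplication by polynomials\<close>

definition shift_coeff :: "nat \<times> nat \<Rightarrow> (nat \<times> nat \<Rightarrow> complex) \<Rightarrow> nat \<times> nat \<Rightarrow> complex" where
  "shift_coeff b c a = (if fst b \<le> fst a \<and> snd b \<le> snd a then c (fst a - fst b, snd a - snd b) else 0)"

definition conv_coeff :: "(nat \<times> nat) set \<Rightarrow> (nat \<times> nat \<Rightarrow> complex) \<Rightarrow> (nat \<times> nat \<Rightarrow> complex) \<Rightarrow>
    nat \<times> nat \<Rightarrow> complex" where
  "conv_coeff B p c a = (\<Sum>b\<in>B. p b * shift_coeff b c a)"

lemma has_sum_shift_coeff:
  assumes "((\<lambda>a. c a * (x ^ fst a * y ^ snd a)) has_sum S) UNIV"
  shows "((\<lambda>a. shift_coeff b c a * (x ^ fst a * y ^ snd a)) has_sum (x ^ fst b * y ^ snd b * S)) UNIV"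
proof -
  let ?h = "\<lambda>a::nat \<times> nat. a + b"
  let ?g = "\<lambda>a. shift_coeff b c a * (x ^ fst a * y ^ snd a)"
  have "((?g \<circ> ?h) has_sum (x ^ fst b * y ^ snd b * S)) UNIV"
    using has_sum_cmult_right[OF assms, of "x ^ fst b * y ^ snd b"]
    by (simp add: o_def shift_coeff_def power_add mult_ac)
  then have "(?g has_sum (x ^ fst b * y ^ snd b * S)) (range ?h)"
    by (subst has_sum_reindex) (auto simp: inj_def)
  moreover have "?g a = 0" if "a \<notin> range ?h" for a
  proof -
    have "\<not> (fst b \<le> fst a \<and> snd b \<le> snd a)"
    proof
      assume "fst b \<le> fst a \<and> snd b \<le> snd a"
      then have "a = ?h (fst a - fst b, snd a - snd b)" by (auto simp: prod_eq_iff)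
      then show False using that by blast
    qed
    then show ?thesis unfolding shift_coeff_def by (simp only: if_False mult_zero_left)
  qed
  ultimately show ?thesis by (subst has_sum_cong_neutral[where g = ?g and T = "range ?h"]) auto
qed

lemma has_sum_conv_coeff:
  assumes "((\<lambda>a. c a * (x ^ fst a * y ^ snd a)) has_sum S) UNIV" "finite B"
  shows "((\<lambda>a. conv_coeff B p c a * (x ^ fst a * y ^ snd a)) has_sum
    ((\<Sum>b\<in>B. p b * (x ^ fst b * y ^ snd b)) * S)) UNIV"
proof -
  have "((\<lambda>a. \<Sum>b\<in>B. p b * (shift_coeff b c a * (x ^ fst a * y ^ snd a))) has_sum
      (\<Sum>b\<in>B. p b * (x ^ fst b * y ^ snd b * S))) UNIV"
    using assms(2)
    by (induction B) (auto intro!: has_sum_add has_sum_cmult_right has_sum_shift_coeff[OF assms(1)])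
  then show ?thesis by (simp add: conv_coeff_def sum_distrib_right mult.assoc)
qed

lemma conv_coeff_bound:
  assumes "\<And>a. cmod (c a) \<le> 1"
  shows "cmod (conv_coeff B p c a) \<le> (\<Sum>b\<in>B. cmod (p b))"
  unfolding conv_coeff_def
proof (rule sum_norm_le)
  fix b
  have "cmod (shift_coeff b c a) \<le> 1" using assms by (simp add: shift_coeff_def)
  then show "norm (p b * shift_coeff b c a) \<le> cmod (p b)"
    by (simp add: norm_mult mult_left_le)
qed

subsection \<open>Contractive multipliers\<close>

text \<open>Orthogonality of the characters of the cyclic group of order \<open>N\<close>: distinct
  exponents below \<open>N\<close> give distinct powers of \<open>w\<close>.\<close>

lemma parseval_roots_of_unity:
  fixes g :: "nat \<Rightarrow> complex"
  assumes "0 < N"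
  defines "w \<equiv> exp (2 * of_real pi * \<i> / of_nat N)"
  shows "(\<Sum>s<N. (cmod (\<Sum>j<N. g j * (w ^ s) ^ j))\<^sup>2) = N * (\<Sum>j<N. (cmod (g j))\<^sup>2)"
proof -
  have wn: "cmod w = 1" by (simp add: w_def)
  then have wc: "cnj w = 1 / w"
    by (metis complex_div_cnj mult_1 div_by_1 one_power2 of_real_1 power_one)
  have w0: "w \<noteq> 0" using wn by auto
  have orth: "(\<Sum>s<N. (w ^ s) ^ j * cnj ((w ^ s) ^ l)) = (if j = l then of_nat N else 0)"
    if "j < N" "l < N" for j l
  proof -
    define q where "q = w ^ j / w ^ l"
    have t: "(w ^ s) ^ j * cnj ((w ^ s) ^ l) = q ^ s" for s
      by (simp add: q_def wc power_divide flip: power_mult) (simp add: mult.commute)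
    have wN: "w ^ N = 1" using assms(1) by (simp add: w_def flip: exp_of_nat_mult)
    have "(w ^ k) ^ N = 1" for k by (metis wN power_mult mult.commute power_one)
    then have qN: "q ^ N = 1" by (simp add: q_def power_divide)
    show ?thesis
    proof (cases "j = l")
      case True
      then show ?thesis unfolding t using w0 by (simp add: q_def)
    next
      case False
      have "w ^ k = exp (2 * of_real pi * \<i> * of_nat k / of_nat N)" for k
        by (simp add: w_def flip: exp_of_nat_mult) (simp add: mult_ac)
      then have "w ^ j \<noteq> w ^ l"
        using complex_root_unity_eq[of N j l] assms(1) that False by (simp add: cong_def mod_less)
      then have "q \<noteq> 1" using w0 by (simp add: q_def)
      then have "(\<Sum>s<N. q ^ s) = 0" using qN by (simp add: geometric_sum)
      then show ?thesis unfolding t using False by simp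
    qed
  qed
  have "complex_of_real (\<Sum>s<N. (cmod (\<Sum>j<N. g j * (w ^ s) ^ j))\<^sup>2) =
      (\<Sum>s<N. (\<Sum>j<N. g j * (w ^ s) ^ j) * cnj (\<Sum>l<N. g l * (w ^ s) ^ l))"
    by (simp only: of_real_sum complex_norm_square)
  also have "\<dots> = (\<Sum>s<N. \<Sum>j<N. \<Sum>l<N. g j * cnj (g l) * ((w ^ s) ^ j * cnj ((w ^ s) ^ l)))"
    by (simp add: sum_product mult_ac)
  also have "\<dots> = (\<Sum>j<N. \<Sum>l<N. \<Sum>s<N. g j * cnj (g l) * ((w ^ s) ^ j * cnj ((w ^ s) ^ l)))"
    by (subst sum.swap, rule sum.cong[OF refl], subst sum.swap, rule refl)
  also have "\<dots> = (\<Sum>j<N. \<Sum>l<N. g j * cnj (g l) * (if j = l then of_nat N else 0))"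
    by (intro sum.cong refl) (simp only: sum_distrib_left[symmetric] orth lessThan_iff)
  also have "\<dots> = (\<Sum>j<N. g j * cnj (g j) * of_nat N)" by (simp add: if_distrib cong: if_cong)
  also have "\<dots> = complex_of_real (N * (\<Sum>j<N. (cmod (g j))\<^sup>2))"
    by (simp only: complex_norm_square[symmetric]) (simp add: sum_distrib_left mult.commute)
  finally show ?thesis by (simp only: of_real_eq_iff)
qed

lemma parseval_roots_of_unity2:
  fixes g :: "nat \<times> nat \<Rightarrow> complex"
  assumes N: "0 < N"
  defines "w \<equiv> exp (2 * of_real pi * \<i> / of_nat N)"
  shows "(\<Sum>s<N. \<Sum>t<N. (cmod (\<Sum>a\<in>{..<N} \<times> {..<N}. g a * ((w ^ s) ^ fst a * (w ^ t) ^ snd a)))\<^sup>2) =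
    (real N)\<^sup>2 * (\<Sum>a\<in>{..<N} \<times> {..<N}. (cmod (g a))\<^sup>2)"
proof -
  have "(\<Sum>a\<in>{..<N} \<times> {..<N}. g a * ((w ^ s) ^ fst a * (w ^ t) ^ snd a)) =
      (\<Sum>j<N. (\<Sum>k<N. g (j, k) * (w ^ t) ^ k) * (w ^ s) ^ j)" for s t
  proof -
    have "(\<Sum>j<N. (\<Sum>k<N. g (j, k) * (w ^ t) ^ k) * (w ^ s) ^ j) =
        (\<Sum>j<N. \<Sum>k<N. g (j, k) * ((w ^ s) ^ j * (w ^ t) ^ k))"
      by (simp add: sum_distrib_left sum_distrib_right mult_ac)
    then show ?thesis by (simp add: sum.cartesian_product case_prod_unfold)
  qed
  then have "(\<Sum>s<N. \<Sum>t<N. (cmod (\<Sum>a\<in>{..<N} \<times> {..<N}. g a * ((w ^ s) ^ fst a * (w ^ t) ^ snd a)))\<^sup>2) =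
      (\<Sum>t<N. \<Sum>s<N. (cmod (\<Sum>j<N. (\<Sum>k<N. g (j, k) * (w ^ t) ^ k) * (w ^ s) ^ j))\<^sup>2)"
    by (subst sum.swap) simp
  also have "\<dots> = (\<Sum>t<N. N * (\<Sum>j<N. (cmod (\<Sum>k<N. g (j, k) * (w ^ t) ^ k))\<^sup>2))"
    unfolding w_def by (subst parseval_roots_of_unity[OF N]) (rule refl)
  also have "\<dots> = N * (\<Sum>j<N. \<Sum>t<N. (cmod (\<Sum>k<N. g (j, k) * (w ^ t) ^ k))\<^sup>2)"
    unfolding sum_distrib_left[symmetric] by (subst sum.swap) (rule refl)
  also have "\<dots> = N * (\<Sum>j<N. N * (\<Sum>k<N. (cmod (g (j, k)))\<^sup>2))"
    unfolding w_def by (subst parseval_roots_of_unity[OF N]) (rule refl)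
  also have "\<dots> = (real N)\<^sup>2 * (\<Sum>a\<in>{..<N} \<times> {..<N}. (cmod (g a))\<^sup>2)"
    by (simp add: sum_distrib_left power2_eq_square sum.Sigma mult.assoc case_prod_unfold)
  finally show ?thesis .
qed

text \<open>Averaging \<open>|p F|\<^sup>2 \<le> |p|\<^sup>2\<close> over the \<open>N\<close>-th roots of unity on circles of radius \<open>r < 1\<close>.\<close>

lemma contractive_multiplier:
  fixes c p :: "nat \<times> nat \<Rightarrow> complex"
  assumes c1: "\<And>a. cmod (c a) \<le> 1"
    and F: "\<And>z. z \<in> ball 0 1 \<times> ball 0 1 \<Longrightarrow> ((\<lambda>a. c a * (fst z ^ fst a * snd z ^ snd a)) has_sum F z) UNIV"
    and b: "\<And>z. z \<in> ball 0 1 \<times> ball 0 1 \<Longrightarrow> cmod (F z) \<le> 1"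
    and B: "finite B"
  shows "(\<Sum>a\<in>{..<K} \<times> {..<K}. (cmod (conv_coeff B p c a))\<^sup>2) \<le> (\<Sum>b\<in>B. (cmod (p b))\<^sup>2)"
proof -
  let ?G = "conv_coeff B p c"
  define M where "M = (\<Sum>b\<in>B. cmod (p b))"
  define f where "f x y = (\<Sum>b\<in>B. p b * (x ^ fst b * y ^ snd b))" for x y
  have M0: "0 \<le> M" by (simp add: M_def sum_nonneg)
  have step: "(\<Sum>a\<in>{..<K} \<times> {..<K}. (cmod (?G a))\<^sup>2 * (r ^ fst a * r ^ snd a)\<^sup>2) \<le> (\<Sum>b\<in>B. (cmod (p b))\<^sup>2)"
    if r: "0 < r" "r < 1" for r :: real
  proof -
    define T where "T L = (\<Sum>a\<in>{..<L} \<times> {..<L}. r ^ fst a * r ^ snd a)" for L :: nat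
    define tot where "tot = 1 / (1 - r) * (1 / (1 - r))"
    \<comment> \<open>Bounds, on the torus of radius \<open>r\<close>, the part of the product
      series outside the box of side \<open>L\<close>; its coefficients are at most
      \<open>M\<close>.\<close>
    define \<epsilon> where "\<epsilon> L = M * (tot - T L)" for L
    have hs: "((\<lambda>a. r ^ fst a * r ^ snd a) has_sum tot) (UNIV :: (nat \<times> nat) set)"
      unfolding tot_def using r by (intro has_sum_geometric2) auto
    have T_eq: "T L = (\<Sum>j<L. r ^ j) * (\<Sum>j<L. r ^ j)" for L
      by (simp add: T_def sum_product sum.Sigma case_prod_unfold)
    have "(\<lambda>L. \<Sum>j<L. r ^ j) \<longlonglongrightarrow> 1 / (1 - r)" using geometric_sums[of r] r by (simp add: sums_def)
    then have "T \<longlonglongrightarrow> tot" unfolding T_eq tot_def by (intro tendsto_mult)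
    then have \<epsilon>lim: "\<epsilon> \<longlonglongrightarrow> 0" unfolding \<epsilon>_def by (auto intro!: tendsto_eq_intros)
    have key: "(\<Sum>a\<in>{..<K} \<times> {..<K}. (cmod (?G a))\<^sup>2 * (r ^ fst a * r ^ snd a)\<^sup>2) \<le>
        (\<Sum>b\<in>B. (cmod (p b))\<^sup>2) + 2 * \<epsilon> L * M + (\<epsilon> L)\<^sup>2" if L: "K \<le> L" for L
    proof -
      \<comment> \<open>Larger than every exponent in the box of side \<open>L\<close> and in
        \<open>B\<close>: exponents then stay distinct modulo \<open>N\<close> and the discrete
        averages are exact.\<close>
      define N where "N = Suc (L + Max (insert 0 (fst ` B)) + Max (insert 0 (snd ` B)))"
      define w where "w = exp (2 * of_real pi * \<i> / of_nat N)"
      have N: "0 < N" "L \<le> N" by (auto simp: N_def)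
      have BN: "B \<subseteq> {..<N} \<times> {..<N}"
      proof
        fix b assume "b \<in> B"
        then have "fst b \<le> Max (insert 0 (fst ` B))" "snd b \<le> Max (insert 0 (snd ` B))"
          using B by auto
        then show "b \<in> {..<N} \<times> {..<N}" by (auto simp: N_def mem_Times_iff)
      qed
      have wn: "cmod (w ^ s) = 1" for s by (simp add: w_def norm_power)
      define X where "X s = complex_of_real r * w ^ s" for s
      have X: "cmod (X s) = r" for s using r wn by (simp add: X_def norm_mult)
      define GL where "GL s t = (\<Sum>a\<in>{..<L} \<times> {..<L}. ?G a * (X s ^ fst a * X t ^ snd a))" for s t
      have \<epsilon>0: "0 \<le> \<epsilon> L" unfolding \<epsilon>_def T_def using M0 r
        by (intro mult_nonneg_nonneg M0) (auto intro!: finite_sum_le_has_sum[OF hs])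
      have GLb: "cmod (GL s t) \<le> cmod (f (X s) (X t)) + \<epsilon> L" for s t
      proof -
        let ?t = "\<lambda>a. ?G a * (X s ^ fst a * X t ^ snd a)"
        let ?D = "{..<L} \<times> {..<L}"
        have XU: "(X s, X t) \<in> ball 0 1 \<times> ball 0 1" using X r by simp
        have 1: "(?t has_sum f (X s) (X t) * F (X s, X t)) UNIV"
          using has_sum_conv_coeff[OF F[OF XU, simplified] B, of p] by (simp add: f_def)
        have 2: "(?t has_sum (f (X s) (X t) * F (X s, X t) - GL s t)) (UNIV - ?D)"
          unfolding GL_def by (intro has_sum_Diff 1 has_sum_finite) auto
        have 3: "((\<lambda>a. M * (r ^ fst a * r ^ snd a)) has_sum \<epsilon> L) (UNIV - ?D)"
          unfolding \<epsilon>_def T_def by (intro has_sum_cmult_right has_sum_Diff hs has_sum_finite) auto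
        have nb: "norm (?t a) \<le> M * (r ^ fst a * r ^ snd a)" for a
          unfolding norm_mult norm_power X M_def
          using r by (intro mult_right_mono conv_coeff_bound c1) auto
        have "(\<lambda>a. norm (?t a)) summable_on (UNIV - ?D)"
          by (rule Infinite_Sum.abs_summable_on_comparison_test'[OF _ nb]) (use 3 summable_on_def in blast)
        then obtain n where n: "((\<lambda>a. norm (?t a)) has_sum n) (UNIV - ?D)"
          unfolding summable_on_def by blast
        have "cmod (f (X s) (X t) * F (X s, X t) - GL s t) \<le> n" by (rule norm_has_sum_bound[OF n 2])
        also have "n \<le> \<epsilon> L" by (rule has_sum_mono[OF n 3 nb])
        finally have "cmod (GL s t) \<le> cmod (f (X s) (X t) * F (X s, X t)) + \<epsilon> L"
          using norm_triangle_ineq2[of "GL s t" "f (X s) (X t) * F (X s, X t)"]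
          by (simp add: norm_minus_commute)
        also have "cmod (f (X s) (X t) * F (X s, X t)) \<le> cmod (f (X s) (X t))"
          using b[OF XU] by (simp add: norm_mult mult_left_le)
        finally show ?thesis by simp
      qed
      have fM: "cmod (f (X s) (X t)) \<le> M" for s t
        unfolding f_def M_def
      proof (rule sum_norm_le)
        fix b :: "nat \<times> nat"
        have "r ^ fst b * r ^ snd b \<le> 1" using r by (intro mult_le_one power_le_one) auto
        then show "norm (p b * (X s ^ fst b * X t ^ snd b)) \<le> cmod (p b)"
          using X by (simp add: norm_mult norm_power mult_left_le)
      qed
      have avg: "(\<Sum>s<N. \<Sum>t<N. (cmod (\<Sum>a\<in>E. e a * (X s ^ fst a * X t ^ snd a)))\<^sup>2) =
          (real N)\<^sup>2 * (\<Sum>a\<in>E. (cmod (e a))\<^sup>2 * (r ^ fst a * r ^ snd a)\<^sup>2)"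
        if E: "E \<subseteq> {..<N} \<times> {..<N}" for E and e :: "nat \<times> nat \<Rightarrow> complex"
      proof -
        define g where "g a = (if a \<in> E then e a * (of_real r ^ fst a * of_real r ^ snd a) else 0)" for a
        have "(\<Sum>a\<in>E. e a * (X s ^ fst a * X t ^ snd a)) =
            (\<Sum>a\<in>{..<N} \<times> {..<N}. g a * ((w ^ s) ^ fst a * (w ^ t) ^ snd a))" for s t
          using E by (intro sum.mono_neutral_cong_left) (auto simp: g_def X_def power_mult_distrib)
        moreover have "(\<Sum>a\<in>{..<N} \<times> {..<N}. (cmod (g a))\<^sup>2) =
            (\<Sum>a\<in>E. (cmod (e a))\<^sup>2 * (r ^ fst a * r ^ snd a)\<^sup>2)"
          using E r by (intro sum.mono_neutral_cong_right)
            (auto simp: g_def norm_mult norm_power power_mult_distrib)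
        ultimately show ?thesis using parseval_roots_of_unity2[OF N(1), of g] by (simp add: w_def)
      qed
      have "(real N)\<^sup>2 * (\<Sum>a\<in>{..<L} \<times> {..<L}. (cmod (?G a))\<^sup>2 * (r ^ fst a * r ^ snd a)\<^sup>2) =
          (\<Sum>s<N. \<Sum>t<N. (cmod (GL s t))\<^sup>2)"
        unfolding GL_def using N(2) by (subst avg) auto
      also have "\<dots> \<le> (\<Sum>s<N. \<Sum>t<N. (cmod (f (X s) (X t)))\<^sup>2 + (2 * \<epsilon> L * M + (\<epsilon> L)\<^sup>2))"
      proof (intro sum_mono)
        fix s t
        have "(cmod (GL s t))\<^sup>2 \<le> (cmod (f (X s) (X t)) + \<epsilon> L)\<^sup>2" by (intro power_mono GLb) auto
        also have "\<dots> = (cmod (f (X s) (X t)))\<^sup>2 + 2 * \<epsilon> L * cmod (f (X s) (X t)) + (\<epsilon> L)\<^sup>2"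
          by (simp add: power2_sum)
        also have "2 * \<epsilon> L * cmod (f (X s) (X t)) \<le> 2 * \<epsilon> L * M"
          using \<epsilon>0 by (intro mult_left_mono fM) auto
        finally show "(cmod (GL s t))\<^sup>2 \<le> (cmod (f (X s) (X t)))\<^sup>2 + (2 * \<epsilon> L * M + (\<epsilon> L)\<^sup>2)" by simp
      qed
      also have "\<dots> = (\<Sum>s<N. \<Sum>t<N. (cmod (f (X s) (X t)))\<^sup>2) + (real N)\<^sup>2 * (2 * \<epsilon> L * M + (\<epsilon> L)\<^sup>2)"
        by (simp add: sum.distrib power2_eq_square[of "real N"] mult.assoc)
      also have "(\<Sum>s<N. \<Sum>t<N. (cmod (f (X s) (X t)))\<^sup>2) =
          (real N)\<^sup>2 * (\<Sum>b\<in>B. (cmod (p b))\<^sup>2 * (r ^ fst b * r ^ snd b)\<^sup>2)"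
        unfolding f_def by (rule avg[OF BN])
      also have "\<dots> + (real N)\<^sup>2 * (2 * \<epsilon> L * M + (\<epsilon> L)\<^sup>2) =
          (real N)\<^sup>2 * ((\<Sum>b\<in>B. (cmod (p b))\<^sup>2 * (r ^ fst b * r ^ snd b)\<^sup>2) + (2 * \<epsilon> L * M + (\<epsilon> L)\<^sup>2))"
        by (rule distrib_left[symmetric])
      finally have "(\<Sum>a\<in>{..<L} \<times> {..<L}. (cmod (?G a))\<^sup>2 * (r ^ fst a * r ^ snd a)\<^sup>2) \<le>
          (\<Sum>b\<in>B. (cmod (p b))\<^sup>2 * (r ^ fst b * r ^ snd b)\<^sup>2) + (2 * \<epsilon> L * M + (\<epsilon> L)\<^sup>2)"
        by (rule mult_left_le_imp_le) (use N(1) in simp)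
      moreover have "(\<Sum>b\<in>B. (cmod (p b))\<^sup>2 * (r ^ fst b * r ^ snd b)\<^sup>2) \<le> (\<Sum>b\<in>B. (cmod (p b))\<^sup>2)"
      proof (rule sum_mono)
        fix b :: "nat \<times> nat"
        have "r ^ fst b * r ^ snd b \<le> 1" using r by (intro mult_le_one power_le_one) auto
        then have "(r ^ fst b * r ^ snd b)\<^sup>2 \<le> 1" using r by (intro power_le_one) auto
        then show "(cmod (p b))\<^sup>2 * (r ^ fst b * r ^ snd b)\<^sup>2 \<le> (cmod (p b))\<^sup>2" by (simp add: mult_left_le)
      qed
      moreover have "(\<Sum>a\<in>{..<K} \<times> {..<K}. (cmod (?G a))\<^sup>2 * (r ^ fst a * r ^ snd a)\<^sup>2) \<le>
          (\<Sum>a\<in>{..<L} \<times> {..<L}. (cmod (?G a))\<^sup>2 * (r ^ fst a * r ^ snd a)\<^sup>2)"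
        using L by (intro sum_mono2) auto
      ultimately show ?thesis by simp
    qed
    show ?thesis
    proof (rule LIMSEQ_le_const)
      have "(\<lambda>L. (\<Sum>b\<in>B. (cmod (p b))\<^sup>2) + 2 * \<epsilon> L * M + (\<epsilon> L)\<^sup>2) \<longlonglongrightarrow>
          (\<Sum>b\<in>B. (cmod (p b))\<^sup>2) + 2 * 0 * M + 0\<^sup>2"
        by (intro tendsto_intros \<epsilon>lim)
      then show "(\<lambda>L. (\<Sum>b\<in>B. (cmod (p b))\<^sup>2) + 2 * \<epsilon> L * M + (\<epsilon> L)\<^sup>2) \<longlonglongrightarrow> (\<Sum>b\<in>B. (cmod (p b))\<^sup>2)"
        by simp
    qed (use key in blast)
  qed
  show ?thesis
  proof (rule tendsto_upperbound)
    show "((\<lambda>r. \<Sum>a\<in>{..<K} \<times> {..<K}. (cmod (?G a))\<^sup>2 * (r ^ fst a * r ^ snd a)\<^sup>2) \<longlongrightarrow>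
        (\<Sum>a\<in>{..<K} \<times> {..<K}. (cmod (?G a))\<^sup>2)) (at_left (1::real))"
      by (rule tendsto_eq_intros refl | simp)+
    show "\<forall>\<^sub>F r in at_left 1. (\<Sum>a\<in>{..<K} \<times> {..<K}. (cmod (?G a))\<^sup>2 * (r ^ fst a * r ^ snd a)\<^sup>2) \<le>
        (\<Sum>b\<in>B. (cmod (p b))\<^sup>2)"
      unfolding eventually_at_left_field using step by (intro exI[of _ 0]) auto
  qed simp
qed

section \<open>Doubly commuting shifts\<close>

lemma eq_if_cinner_eq:
  fixes x y :: "'a::complex_hilbert"
  assumes "\<And>z. cinner x z = cinner y z"
  shows "x = y"
proof -
  have "cinner (x - y) (x - y) = 0" using assms by (simp add: cinner_diff_left)
  then show ?thesis by simp
qed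

text \<open>The inner product separates points, so possessing an adjoint forces linearity. The
  shifts below, given together with their adjoints, inherit it this way.\<close>

lemma adjoint_linear:
  assumes "\<And>x y. cinner (T x) y = cinner x (T' y)"
  shows "T (x + y) = T x + T y" "T (c *\<^sub>C x) = c *\<^sub>C T x" "T 0 = 0"
  by (rule eq_if_cinner_eq, simp add: assms cinner_simps)+

lemma adjoint_sum:
  assumes "\<And>x y. cinner (T x) y = cinner x (T' y)"
  shows "T (\<Sum>i\<in>I. c i *\<^sub>C g i) = (\<Sum>i\<in>I. c i *\<^sub>C T (g i))"
  by (rule eq_if_cinner_eq) (simp add: assms cinner_sum_left cinner_scaleC_left)

lemma adjoint_funpow:
  fixes T T' :: "'a::complex_hilbert \<Rightarrow> 'a"
  assumes "\<And>x y. cinner (T x) y = cinner x (T' y)"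
  shows "cinner ((T ^^ k) x) y = cinner x ((T' ^^ k) y)"
proof (induction k arbitrary: y)
  case (Suc k)
  have "cinner ((T ^^ Suc k) x) y = cinner ((T ^^ k) x) (T' y)" by (simp add: assms)
  then show ?case using Suc.IH by (simp add: funpow_swap1)
qed simp

lemma commute_funpow: "(\<And>x. T (S x) = S (T x)) \<Longrightarrow> (T ^^ k) (S x) = S ((T ^^ k) x)"
  by (induction k) auto

text \<open>Each value is solved from the \<open>m\<close> preceding ones. Recurrences of this kind
  reduce infinitely many vanishing coefficients to finitely many conditions.\<close>

lemma linear_recurrence_zero:
  fixes g q :: "nat \<Rightarrow> complex"
  assumes "q 0 \<noteq> 0" "\<And>l. l < m \<Longrightarrow> g l = 0" "\<And>l. m \<le> l \<Longrightarrow> (\<Sum>i\<le>m. q i * g (l - i)) = 0"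
  shows "g l = 0"
proof (induction l rule: less_induct)
  case (less l)
  show ?case
  proof (cases "l < m")
    case False
    have "(\<Sum>i\<le>m. q i * g (l - i)) = q 0 * g l + (\<Sum>i\<in>{..m} - {0}. q i * g (l - i))"
      by (subst sum.remove[of _ 0]) auto
    also have "(\<Sum>i\<in>{..m} - {0}. q i * g (l - i)) = 0"
      using False less by (intro sum.neutral) auto
    finally show ?thesis using assms(1,3) False by simp
  qed (use assms in auto)
qed

text \<open>Abstract Hardy space of the bidisk: \<open>V1\<close>, \<open>V2\<close> are
  multiplication by the coordinates, \<open>U1\<close>, \<open>U2\<close> the backward shifts
  adjoint to them, and \<open>e0\<close> is the constant 1. The relations \<open>VU12\<close> and
  \<open>VU21\<close> say that the shifts doubly commute, \<open>complete\<close> that polynomials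
  are dense.\<close>

locale bishift =
  fixes V1 V2 U1 U2 :: "'a::complex_hilbert \<Rightarrow> 'a" and e0 :: 'a
  assumes adj1: "cinner (V1 x) y = cinner x (U1 y)" and adj2: "cinner (V2 x) y = cinner x (U2 y)"
    and UV1: "U1 (V1 x) = x" and UV2: "U2 (V2 x) = x"
    and VV: "V1 (V2 x) = V2 (V1 x)" and VU12: "V1 (U2 x) = U2 (V1 x)" and VU21: "V2 (U1 x) = U1 (V2 x)"
    and vac1: "U1 e0 = 0" and vac2: "U2 e0 = 0" and norm_e0: "norm e0 = 1"
    and complete: "(\<And>j k. cinner x ((V1 ^^ j) ((V2 ^^ k) e0)) = 0) \<Longrightarrow> x = 0"
begin

lemma adj1': "cinner (U1 x) y = cinner x (V1 y)"
  by (metis adj1 cinner_commute)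

lemma adj2': "cinner (U2 x) y = cinner x (V2 y)"
  by (metis adj2 cinner_commute)

lemmas lin = adjoint_linear[OF adj1] adjoint_linear[OF adj2] adjoint_linear[OF adj1'] adjoint_linear[OF adj2']

text \<open>The product of \<open>g\<close> with the monomial of exponent \<open>a\<close>; thus
  \<open>E\<close> runs through the monomials.\<close>

definition orbit :: "'a \<Rightarrow> nat \<times> nat \<Rightarrow> 'a" where
  "orbit g a = (V1 ^^ fst a) ((V2 ^^ snd a) g)"

abbreviation E :: "nat \<times> nat \<Rightarrow> 'a" where "E \<equiv> orbit e0"

lemma orbit_0 [simp]: "orbit g (0, 0) = g" by (simp add: orbit_def)

lemma V1_orbit: "V1 (orbit g a) = orbit g (Suc (fst a), snd a)"
  by (simp add: orbit_def)

lemma V2_orbit: "V2 (orbit g a) = orbit g (fst a, Suc (snd a))"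
  using commute_funpow[of V1 V2 "fst a" "(V2 ^^ snd a) g"] VV by (simp add: orbit_def)

lemma V1_pow_orbit: "(V1 ^^ k) (orbit g a) = orbit g (k + fst a, snd a)"
  by (induction k) (auto simp: V1_orbit)

lemma V2_pow_orbit: "(V2 ^^ k) (orbit g a) = orbit g (fst a, k + snd a)"
  by (induction k) (auto simp: V2_orbit)

lemma orbit_orbit: "orbit (orbit g a) b = orbit g (a + b)"
  by (subst (1) orbit_def) (simp add: V1_pow_orbit V2_pow_orbit plus_prod_def add.commute)

lemma orbit_sum: "orbit (\<Sum>i\<in>I. c i *\<^sub>C g i) a = (\<Sum>i\<in>I. c i *\<^sub>C orbit (g i) a)"
proof -
  have "(V1 ^^ k) (\<Sum>i\<in>I. c i *\<^sub>C g i) = (\<Sum>i\<in>I. c i *\<^sub>C (V1 ^^ k) (g i))" for k g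
    by (induction k) (auto simp: adjoint_sum[OF adj1])
  moreover have "(V2 ^^ k) (\<Sum>i\<in>I. c i *\<^sub>C g i) = (\<Sum>i\<in>I. c i *\<^sub>C (V2 ^^ k) (g i))" for k g
    by (induction k) (auto simp: adjoint_sum[OF adj2])
  ultimately show ?thesis by (simp add: orbit_def)
qed

lemma cinner_V1: "cinner (V1 x) (V1 y) = cinner x y" by (simp add: adj1 UV1)
lemma cinner_V2: "cinner (V2 x) (V2 y) = cinner x y" by (simp add: adj2 UV2)

lemma cinner_V1_pow: "cinner ((V1 ^^ k) x) ((V1 ^^ k) y) = cinner x y"
  by (induction k) (auto simp: cinner_V1)

lemma cinner_V2_pow: "cinner ((V2 ^^ k) x) ((V2 ^^ k) y) = cinner x y"
  by (induction k) (auto simp: cinner_V2)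

lemma cinner_orbit_same: "cinner (orbit x a) (orbit y a) = cinner x y"
  by (simp add: orbit_def cinner_V1_pow cinner_V2_pow)

lemma norm_orbit: "norm (orbit g a) = norm g"
proof -
  have "(norm (orbit g a))\<^sup>2 = (norm g)\<^sup>2" unfolding norm_sq_eq_Re_cinner cinner_orbit_same by (rule refl)
  then show ?thesis by simp
qed

lemma U1_E: "U1 (E a) = (if fst a = 0 then 0 else E (fst a - 1, snd a))"
proof (cases "fst a")
  case 0
  have "U1 ((V2 ^^ k) e0) = 0" for k
    by (induction k) (auto simp: VU21[symmetric] vac1 lin)
  then show ?thesis using 0 by (simp add: orbit_def)
next
  case (Suc j)
  then show ?thesis by (simp add: orbit_def UV1)
qed

lemma U2_E: "U2 (E a) = (if snd a = 0 then 0 else E (fst a, snd a - 1))"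
proof (cases "snd a")
  case 0
  have "U2 ((V1 ^^ k) e0) = 0" for k
    by (induction k) (auto simp: VU12[symmetric] vac2 lin)
  then show ?thesis using 0 by (simp add: orbit_def)
next
  case (Suc k)
  have "E a = V2 (E (fst a, k))" using Suc by (cases a) (simp add: V2_orbit)
  then show ?thesis using Suc by (simp add: UV2)
qed

lemma U1_pow_E: "(U1 ^^ k) (E a) = (if fst a < k then 0 else E (fst a - k, snd a))"
  by (induction k) (auto simp: U1_E lin)

lemma U2_pow_E: "(U2 ^^ k) (E a) = (if snd a < k then 0 else E (fst a, snd a - k))"
  by (induction k) (auto simp: U2_E lin)

lemma E_orthonormal: "cinner (E a) (E b) = (if a = b then 1 else 0)"
proof -
  have e: "cinner e0 e0 = 1" using norm_e0 by (simp add: cinner_self)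
  have "cinner (E a) (E b) = cinner e0 ((U2 ^^ snd a) ((U1 ^^ fst a) (E b)))"
    by (subst (1) orbit_def) (simp add: adjoint_funpow[OF adj1] adjoint_funpow[OF adj2])
  also have "\<dots> = (if fst b < fst a \<or> snd b < snd a then 0 else cinner e0 (E (fst b - fst a, snd b - snd a)))"
  proof -
    have "(U2 ^^ k) 0 = 0" for k by (induction k) (auto simp: lin)
    then show ?thesis by (simp add: U1_pow_E U2_pow_E)
  qed
  also have "\<dots> = (if a = b then 1 else 0)"
  proof -
    have "cinner e0 (E c) = 0" if "c \<noteq> (0, 0)" for c
    proof (cases "fst c = 0")
      case False
      then have "E c = V1 (E (fst c - 1, snd c))" by (simp add: V1_orbit)
      then show ?thesis by (simp add: adj1'[symmetric] vac1)
    next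
      case True
      then have "E c = V2 (E (fst c, snd c - 1))" using that by (cases c) (simp add: V2_orbit)
      then show ?thesis by (simp add: adj2'[symmetric] vac2)
    qed
    then show ?thesis using e by (auto simp: prod_eq_iff)
  qed
  finally show ?thesis .
qed

lemma complete_E: "(\<And>a. cinner x (E a) = 0) \<Longrightarrow> x = 0"
  by (rule complete) (use orbit_def in force)

text \<open>The \<open>E (0, k)\<close> are the powers of the second coordinate alone. A series free
  of them is divisible by the first coordinate, and \<open>U1\<close> is the division.\<close>

lemma V1_U1_if:
  assumes "\<And>k. cinner F (E (0, k)) = 0"
  shows "V1 (U1 F) = F"
proof -
  have "cinner (V1 (U1 F) - F) (E a) = 0" for a
    using assms[of "snd a"] by (cases a) (auto simp: cinner_diff_left adj1 adj1' U1_E V1_orbit lin)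
  then show ?thesis using complete_E by fastforce
qed

lemma V2_U2_if:
  assumes "\<And>j. cinner F (E (j, 0)) = 0"
  shows "V2 (U2 F) = F"
proof -
  have "cinner (V2 (U2 F) - F) (E a) = 0" for a
    using assms[of "fst a"] by (cases a) (auto simp: cinner_diff_left adj2 adj2' U2_E V2_orbit lin)
  then show ?thesis using complete_E by fastforce
qed

end

text \<open>The data of a rational inner function \<open>f\<close>: multiplication by \<open>f\<close> is contractive, and
  \<open>f\<close> is the quotient of the reflection of \<open>p\<close> by \<open>p\<close>.\<close>

locale rational_inner = bishift V1 V2 U1 U2 e0
  for V1 V2 U1 U2 :: "'a::complex_hilbert \<Rightarrow> 'a" and e0 :: 'a +
  fixes f :: 'a and n m :: nat and p :: "nat \<times> nat \<Rightarrow> complex" and \<epsilon> :: complex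
  assumes contractive: "finite A \<Longrightarrow>
      (norm (\<Sum>a\<in>A. c a *\<^sub>C orbit f a))\<^sup>2 \<le> (\<Sum>a\<in>A. (cmod (c a))\<^sup>2)"
    and p0: "p (0, 0) \<noteq> 0" and eps: "cmod \<epsilon> = 1"
    and pf: "(\<Sum>c\<in>{..n} \<times> {..m}. p c *\<^sub>C orbit f c) =
      (\<Sum>c\<in>{..n} \<times> {..m}. (\<epsilon> * cnj (p (n - fst c, m - snd c))) *\<^sub>C orbit e0 c)"
begin

abbreviation Box :: "(nat \<times> nat) set" where "Box \<equiv> {..n} \<times> {..m}"

text \<open>Coefficients of the reflected polynomial. Below, \<open>P b\<close> and
  \<open>Pt b\<close> are \<open>p\<close> and its reflection times the monomial of exponent
  \<open>b\<close>, so that multiplication by \<open>f\<close> maps the first to the second.\<close>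

definition pt :: "nat \<times> nat \<Rightarrow> complex" where
  "pt c = \<epsilon> * cnj (p (n - fst c, m - snd c))"

definition P :: "nat \<times> nat \<Rightarrow> 'a" where "P b = (\<Sum>c\<in>Box. p c *\<^sub>C E (c + b))"
definition Pt :: "nat \<times> nat \<Rightarrow> 'a" where "Pt b = (\<Sum>c\<in>Box. pt c *\<^sub>C E (c + b))"

lemma Pt_eq: "Pt b = (\<Sum>c\<in>Box. p c *\<^sub>C orbit f (c + b))"
proof -
  have "Pt b = orbit (\<Sum>c\<in>Box. pt c *\<^sub>C E c) b"
    unfolding Pt_def orbit_sum by (simp add: orbit_orbit)
  also have "\<dots> = orbit (\<Sum>c\<in>Box. p c *\<^sub>C orbit f c) b" unfolding pf pt_def by (rule refl)
  finally show ?thesis by (simp add: orbit_sum orbit_orbit)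
qed

text \<open>On the torus a polynomial and its reflection have the same modulus. In coefficients:
  inner products depend only on differences of exponents, and reversing the box exchanges the two
  exponents.\<close>

lemma cinner_P_Pt: "cinner (Pt b) (Pt b') = cinner (P b) (P b')"
proof -
  let ?r = "\<lambda>c::nat \<times> nat. (n - fst c, m - snd c)"
  let ?d = "\<lambda>c d. if c + b = d + b' then 1 else (0::complex)"
  have r: "(\<Sum>c\<in>Box. g (?r c)) = (\<Sum>c\<in>Box. g c)" for g :: "nat \<times> nat \<Rightarrow> complex"
    by (rule sum.reindex_bij_witness[of _ ?r ?r]) auto
  have e: "\<epsilon> * cnj \<epsilon> = 1" using eps by (simp add: complex_norm_square[symmetric])
  have "cinner (Pt b) (Pt b') = (\<Sum>c\<in>Box. \<Sum>d\<in>Box. pt c * cnj (pt d) * ?d c d)"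
    by (simp only: Pt_def cinner_sum_left)
      (simp add: cinner_sum_right cinner_scaleC_left E_orthonormal sum_distrib_left mult_ac)
  also have "\<dots> = (\<Sum>c\<in>Box. \<Sum>d\<in>Box. cnj (p (?r c)) * p (?r d) * ?d c d)"
  proof (intro sum.cong refl)
    fix c d
    have "pt c * cnj (pt d) = (\<epsilon> * cnj \<epsilon>) * (cnj (p (?r c)) * p (?r d))" by (simp add: pt_def mult_ac)
    then show "pt c * cnj (pt d) * ?d c d = cnj (p (?r c)) * p (?r d) * ?d c d" by (simp add: e)
  qed
  also have "\<dots> = (\<Sum>c\<in>Box. \<Sum>d\<in>Box. cnj (p (?r c)) * p (?r d) * ?d (?r d) (?r c))"
  proof (intro sum.cong refl)
    fix c d assume "c \<in> Box" "d \<in> Box"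
    then have "c + b = d + b' \<longleftrightarrow> ?r d + b = ?r c + b'" by (auto simp: prod_eq_iff)
    then show "cnj (p (?r c)) * p (?r d) * ?d c d = cnj (p (?r c)) * p (?r d) * ?d (?r d) (?r c)"
      by simp
  qed
  also have "\<dots> = (\<Sum>c\<in>Box. \<Sum>d\<in>Box. cnj (p c) * p d * ?d d c)"
    by (subst r[of "\<lambda>c. \<Sum>d\<in>Box. cnj (p c) * p (?r d) * ?d (?r d) c"],
        rule sum.cong[OF refl], rule r)
  also have "\<dots> = (\<Sum>d\<in>Box. \<Sum>c\<in>Box. p d * cnj (p c) * ?d d c)"
    by (subst sum.swap) (simp add: mult.commute)
  also have "\<dots> = cinner (P b) (P b')"
    by (simp only: P_def cinner_sum_left)
      (simp add: cinner_sum_right cinner_scaleC_left E_orthonormal sum_distrib_left mult_ac)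
  finally show ?thesis .
qed

text \<open>The lowest term of \<open>P b\<close> sits at exponent \<open>b\<close> with coefficient
  \<open>p (0, 0)\<close>, so a vanishing combination is peeled off by increasing total
  degree.\<close>

lemma P_coefficients_zero:
  assumes B: "finite B" and 0: "(\<Sum>b\<in>B. x b *\<^sub>C P b) = 0" and b: "b \<in> B"
  shows "x b = 0"
  using b
proof (induction "fst b + snd b" arbitrary: b rule: less_induct)
  case less
  have "0 = cinner (\<Sum>b\<in>B. x b *\<^sub>C P b) (E b)" by (simp add: 0)
  also have "\<dots> = (\<Sum>b'\<in>B. x b' * (\<Sum>c\<in>Box. p c * (if c + b' = b then 1 else 0)))"
    by (simp add: cinner_sum_left cinner_scaleC_left P_def E_orthonormal)
  also have "\<dots> = x b * (\<Sum>c\<in>Box. p c * (if c + b = b then 1 else 0)) +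
     (\<Sum>b'\<in>B - {b}. x b' * (\<Sum>c\<in>Box. p c * (if c + b' = b then 1 else 0)))"
    by (rule sum.remove[OF B less.prems])
  also have "(\<Sum>b'\<in>B - {b}. x b' * (\<Sum>c\<in>Box. p c * (if c + b' = b then 1 else 0))) = 0"
  proof (rule sum.neutral, rule ballI)
    fix b' assume b': "b' \<in> B - {b}"
    show "x b' * (\<Sum>c\<in>Box. p c * (if c + b' = b then 1 else 0)) = 0"
    proof (cases "\<exists>c. c + b' = b")
      case True
      then have "fst b' + snd b' < fst b + snd b" using b' by (auto simp: prod_eq_iff)
      then show ?thesis using less.hyps b' by simp
    next
      case False
      then have "c + b' \<noteq> b" for c by blast
      then show ?thesis by simp
    qed
  qed
  also have "(\<Sum>c\<in>Box. p c * (if c + b = b then 1 else 0)) = (\<Sum>c\<in>Box. if c = (0, 0) then p c else 0)"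
    by (intro sum.cong) (auto simp: prod_eq_iff)
  also have "\<dots> = p (0, 0)" by simp
  finally show ?case using p0 by simp
qed

text \<open>The defect form \<open>\<langle>x, y\<rangle> - \<langle>f x, f y\<rangle>\<close> on polynomials of degree less than \<open>K\<close> in both
  variables is positive, dominated by the inner product and vanishes on the multiples of \<open>p\<close>, a
  subspace of codimension \<open>O(K)\<close>. Hence its trace, which is \<open>K\<^sup>2 (1 - \<parallel>f\<parallel>\<^sup>2)\<close>, is \<open>O(K)\<close>.\<close>

lemma defect_trace:
  assumes K: "n \<le> K" "m \<le> K"
  shows "(real K)\<^sup>2 * (1 - (norm f)\<^sup>2) \<le> (real K)\<^sup>2 - real (K - n) * real (K - m)"
proof -
  let ?A = "{..<K} \<times> {..<K}" and ?B = "{..<K - n} \<times> {..<K - m}"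
  have inj: "inj_on E ?A"
  proof (rule inj_onI)
    fix a b assume "E a = E b"
    then show "a = b" using E_orthonormal[of a b] E_orthonormal[of a a] by (auto split: if_splits)
  qed
  have onA: "orthonormal (E ` ?A)"
    unfolding orthonormal_def using E_orthonormal inj by (auto dest: inj_onD)
  have finA: "finite (E ` ?A)" by simp
  have bessel: "(\<Sum>a\<in>?A. (cmod (cinner x (E a)))\<^sup>2) = (norm (proj_on (E ` ?A) x))\<^sup>2" for x
    using norm_proj_on[OF finA onA, of x] by (simp add: sum.reindex[OF inj])
  \<comment> \<open>Multiplication by \<open>f\<close>, preceded by the projection onto polynomials
    of degree below \<open>K\<close> in each variable.\<close>
  define L where "L x = (\<Sum>a\<in>?A. cinner x (E a) *\<^sub>C orbit f a)" for x
  have L_add: "L (x + y) = L x + L y" for x y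
    by (simp add: L_def cinner_add_left scaleC_add_left sum.distrib)
  have L_scale: "L (c *\<^sub>C x) = c *\<^sub>C L x" for c x
    by (simp add: L_def cinner_scaleC_left ch.scale_sum_right)
  have L_contr: "(norm (L x))\<^sup>2 \<le> (norm x)\<^sup>2" for x
  proof -
    have "(norm (L x))\<^sup>2 \<le> (\<Sum>a\<in>?A. (cmod (cinner x (E a)))\<^sup>2)" unfolding L_def by (rule contractive) simp
    also have "\<dots> \<le> (norm x)\<^sup>2"
      unfolding bessel by (intro power_mono norm_proj_on_le finA onA) simp
    finally show ?thesis .
  qed
  have LP: "L (P b) = Pt b" if b: "b \<in> ?B" for b
  proof -
    have "L (P b) = (\<Sum>a\<in>?A. \<Sum>c\<in>Box. (p c * (if c + b = a then 1 else 0)) *\<^sub>C orbit f a)"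
      by (simp add: L_def P_def cinner_sum_left cinner_scaleC_left E_orthonormal ch.scale_sum_left)
    also have "\<dots> = (\<Sum>c\<in>Box. \<Sum>a\<in>?A. (p c * (if c + b = a then 1 else 0)) *\<^sub>C orbit f a)"
      by (rule sum.swap)
    also have "\<dots> = (\<Sum>c\<in>Box. p c *\<^sub>C orbit f (c + b))"
    proof (rule sum.cong[OF refl])
      fix c assume "c \<in> Box"
      then have cb: "c + b \<in> ?A" using b by (auto simp: mem_Times_iff)
      have "(\<Sum>a\<in>?A. (p c * (if c + b = a then 1 else 0)) *\<^sub>C orbit f a) =
          (\<Sum>a\<in>?A. if a = c + b then p c *\<^sub>C orbit f a else 0)"
        by (intro sum.cong) auto
      also have "\<dots> = p c *\<^sub>C orbit f (c + b)" using cb by (subst sum.delta) auto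
      finally show "(\<Sum>a\<in>?A. (p c * (if c + b = a then 1 else 0)) *\<^sub>C orbit f a) = p c *\<^sub>C orbit f (c + b)" .
    qed
    finally show ?thesis by (simp only: Pt_eq)
  qed
  have PA: "P b \<in> ch.span (E ` ?A)" if "b \<in> ?B" for b
    unfolding P_def using that
    by (intro ch.span_sum ch.span_scale ch.span_base imageI) (auto simp: mem_Times_iff)
  let ?W = "ch.span (P ` ?B)"
  have L_iso: "cinner (L x) (L y) = cinner x y" if "x \<in> ?W" "y \<in> ?W" for x y
  proof -
    have 1: "cinner (L x) (Pt b) = cinner x (P b)" if b: "b \<in> ?B" for b
      using \<open>x \<in> ?W\<close>
    proof (induction rule: ch.span_induct_alt)
      case base show ?case using L_scale[of 0 0] by simp
    next
      case (step c x y)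
      then show ?case using b by (auto simp: L_add L_scale cinner_simps LP cinner_P_Pt)
    qed
    show ?thesis using \<open>y \<in> ?W\<close>
    proof (induction rule: ch.span_induct_alt)
      case base show ?case using L_scale[of 0 0] by simp
    next
      case (step c z y)
      then show ?case using 1 by (auto simp: L_add L_scale cinner_simps LP)
    qed
  qed
  \<comment> \<open>A positive form that vanishes on the diagonal at \<open>w\<close> vanishes
    against every \<open>y\<close>; this is seen by adding multiples of \<open>w\<close> to
    \<open>y\<close>.\<close>
  have defect: "cinner (L w) (L y) = cinner w y" if w: "w \<in> ?W" for w y
  proof -
    define d where "d = cinner w y - cinner (L w) (L y)"
    define \<delta> where "\<delta> = (norm y)\<^sup>2 - (norm (L y))\<^sup>2"
    have dn: "(norm (L w))\<^sup>2 = (norm w)\<^sup>2" unfolding norm_sq_eq_Re_cinner using L_iso[OF w w] by simp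
    have q: "0 \<le> \<delta> + 2 * Re (c * d)" for c
    proof -
      have "(norm (L (c *\<^sub>C w + y)))\<^sup>2 \<le> (norm (c *\<^sub>C w + y))\<^sup>2" by (rule L_contr)
      then show ?thesis
        unfolding L_add L_scale norm_sq_add norm_scaleC power_mult_distrib dn
        by (simp add: cinner_scaleC_left d_def \<delta>_def algebra_simps)
    qed
    have "d = 0"
    proof (rule ccontr)
      assume d: "d \<noteq> 0"
      have "Re (complex_of_real t * cnj d * d) = t * (cmod d)\<^sup>2" for t
      proof -
        have "complex_of_real t * cnj d * d = complex_of_real (t * (cmod d)\<^sup>2)"
          unfolding of_real_mult complex_norm_square by (simp add: mult_ac)
        then show ?thesis by (simp only: Re_complex_of_real)
      qed
      then have "0 \<le> \<delta> + 2 * (t * (cmod d)\<^sup>2)" for t using q[of "complex_of_real t * cnj d"] by simp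
      \<comment> \<open>This \<open>t\<close> turns the bound into \<open>- \<delta> - 2\<close>,
        which is negative.\<close>
      from this[of "- (\<delta> + 1) / (cmod d)\<^sup>2"] have "0 \<le> \<delta> + 2 * (- (\<delta> + 1))" using d by simp
      moreover have "0 \<le> \<delta>" using q[of 0] by simp
      ultimately show False by simp
    qed
    then show ?thesis by (simp add: d_def)
  qed
  obtain W where W: "finite W" "orthonormal W" "ch.span W = ?W"
    using orthonormal_basis_exists[of "P ` ?B"] by auto
  have cardW: "card W = (K - n) * (K - m)"
  proof -
    have injP: "inj_on P ?B"
    proof (rule inj_onI, rule ccontr)
      fix a b assume ab: "a \<in> ?B" "b \<in> ?B" "P a = P b" "a \<noteq> b"
      let ?x = "\<lambda>c. if c = a then 1 else if c = b then - 1 else (0::complex)"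
      have "(\<Sum>c\<in>{a, b}. ?x c *\<^sub>C P c) = 0" using ab by simp
      from P_coefficients_zero[OF _ this, of a] show False by simp
    qed
    have "\<not> ch.dependent (P ` ?B)"
    proof
      assume "ch.dependent (P ` ?B)"
      then obtain u where u: "\<exists>v\<in>P ` ?B. u v \<noteq> 0" "(\<Sum>v\<in>P ` ?B. u v *\<^sub>C v) = 0"
        using ch.dependent_finite[of "P ` ?B"] by auto
      have "(\<Sum>b\<in>?B. u (P b) *\<^sub>C P b) = 0" using u(2) by (simp add: sum.reindex[OF injP])
      from P_coefficients_zero[OF _ this] u(1) show False by auto
    qed
    then have "card (P ` ?B) = card W"
      using ch.dim_eq_card[of "P ` ?B" "P ` ?B"] ch.dim_eq_card[of W "P ` ?B"]
        orthonormal_independent[OF W(2)] W(3) by simp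
    then show ?thesis by (simp add: card_image[OF injP] card_cartesian_product)
  qed
  have LE: "L (E a) = orbit f a" if "a \<in> ?A" for a
  proof -
    have "L (E a) = (\<Sum>b\<in>?A. if b = a then orbit f b else 0)"
      unfolding L_def by (intro sum.cong) (auto simp: E_orthonormal)
    then show ?thesis using that by (simp add: sum.delta')
  qed
  \<comment> \<open>The diagonal entry of the defect form at \<open>E a\<close> is at most the
    squared distance of \<open>E a\<close> from the null subspace, since subtracting a null vector
    leaves the form unchanged.\<close>
  have main: "1 - (norm f)\<^sup>2 \<le> 1 - (\<Sum>e\<in>W. (cmod (cinner (E a) e))\<^sup>2)" if a: "a \<in> ?A" for a
  proof -
    define w where "w = proj_on W (E a)"
    have w: "w \<in> ?W" unfolding w_def W(3)[symmetric] by (rule proj_on_in_span)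
    have nE: "norm (E a) = 1" using norm_orbit norm_e0 by simp
    have "(norm (L (E a - w)))\<^sup>2 = (norm (L (E a)))\<^sup>2 + (norm w)\<^sup>2 - 2 * Re (cinner w (E a))"
    proof -
      have "L (E a - w) = L (E a) - L w"
        using L_add[of "E a - w" w] by simp
      moreover have "(norm (L w))\<^sup>2 = (norm w)\<^sup>2"
        unfolding norm_sq_eq_Re_cinner using L_iso[OF w w] by simp
      moreover have "Re (cinner (L (E a)) (L w)) = Re (cinner w (E a))"
        using defect[OF w, of "E a"] cinner_commute[of "L (E a)" "L w"] by simp
      ultimately show ?thesis by (simp add: norm_sq_diff)
    qed
    moreover have "(norm (E a - w))\<^sup>2 = 1 + (norm w)\<^sup>2 - 2 * Re (cinner w (E a))"
      using cinner_commute[of "E a" w] by (simp add: norm_sq_diff nE)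
    ultimately have "1 - (norm f)\<^sup>2 = (norm (E a - w))\<^sup>2 - (norm (L (E a - w)))\<^sup>2"
      by (simp add: LE[OF a] norm_orbit)
    also have "\<dots> \<le> (norm (E a - w))\<^sup>2" by simp
    finally show ?thesis unfolding w_def norm_diff_proj_on[OF W(1,2)] nE by simp
  qed
  have "(\<Sum>a\<in>?A. 1 - (norm f)\<^sup>2) \<le> (\<Sum>a\<in>?A. 1 - (\<Sum>e\<in>W. (cmod (cinner (E a) e))\<^sup>2))"
    by (rule sum_mono[OF main])
  also have "\<dots> = (real K)\<^sup>2 - (\<Sum>e\<in>W. \<Sum>a\<in>?A. (cmod (cinner (E a) e))\<^sup>2)"
    by (subst sum.swap) (simp add: sum_subtractf power2_eq_square)
  \<comment> \<open>Summed over the monomials of the box, each unit vector of \<open>W\<close>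
    contributes 1, which brings in the dimension of \<open>W\<close>.\<close>
  also have "(\<Sum>e\<in>W. \<Sum>a\<in>?A. (cmod (cinner (E a) e))\<^sup>2) = (\<Sum>e\<in>W. 1)"
  proof (rule sum.cong[OF refl])
    fix e assume e: "e \<in> W"
    have "e \<in> ?W" using e W(3) ch.span_superset by blast
    moreover have "?W \<subseteq> ch.span (E ` ?A)" by (rule ch.span_minimal) (use PA ch.subspace_span in auto)
    ultimately have "proj_on (E ` ?A) e = e" using proj_on_eq[OF finA onA] by blast
    moreover have "cmod (cinner (E a) e) = cmod (cinner e (E a))" for a
      by (metis cinner_commute complex_mod_cnj)
    moreover have "norm e = 1"
    proof -
      have "cinner e e = 1" using W(2) e by (simp add: orthonormal_def)
      then have "(norm e)\<^sup>2 = 1" unfolding norm_sq_eq_Re_cinner by simp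
      then show ?thesis by (metis norm_ge_zero power2_eq_1_iff abs_of_nonneg abs_1 abs_minus)
    qed
    ultimately show "(\<Sum>a\<in>?A. (cmod (cinner (E a) e))\<^sup>2) = 1" using bessel[of e] by simp
  qed
  finally show ?thesis using cardW by (simp add: power2_eq_square)
qed

text \<open>Were the norm below 1, the left side of the trace bound would grow like
  \<open>K^2\<close> and the right side only like \<open>K\<close>.\<close>

lemma norm_f: "norm f = 1"
proof -
  have "(norm f)\<^sup>2 \<le> 1" using contractive[of "{(0, 0)}" "\<lambda>_. 1"] by simp
  moreover have "1 \<le> (norm f)\<^sup>2"
  proof (rule ccontr)
    define \<delta> where "\<delta> = 1 - (norm f)\<^sup>2"
    assume "\<not> 1 \<le> (norm f)\<^sup>2"
    then have \<delta>: "0 < \<delta>" by (simp add: \<delta>_def)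
    obtain k :: nat where k: "real (n + m) / \<delta> < k" using reals_Archimedean2 by blast
    define K where "K = k + n + m + 1"
    have K: "n \<le> K" "m \<le> K" "0 < K" by (auto simp: K_def)
    have "real (n + m) < \<delta> * k" using k \<delta> by (simp add: field_simps)
    also have "\<dots> \<le> \<delta> * K" using \<delta> by (intro mult_left_mono) (auto simp: K_def)
    finally have "real (n + m) < \<delta> * K" .
    then have "K * real (n + m) < K * (\<delta> * K)" using K(3) by (intro mult_strict_left_mono) auto
    moreover have "(real K)\<^sup>2 * \<delta> \<le> (real K)\<^sup>2 - (real K - n) * (real K - m)"
      using defect_trace[OF K(1,2)] K by (simp add: \<delta>_def of_nat_diff)
    moreover have "(real K)\<^sup>2 - (real K - n) * (real K - m) = K * real (n + m) - real n * real m"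
      by (simp add: power2_eq_square algebra_simps)
    moreover have "0 \<le> real n * real m" by simp
    moreover have "K * (\<delta> * K) = (real K)\<^sup>2 * \<delta>" by (simp add: power2_eq_square)
    ultimately show False by linarith
  qed
  ultimately have "(norm f)\<^sup>2 = 1" by simp
  then show ?thesis by (metis norm_ge_zero power2_eq_1_iff abs_of_nonneg abs_1 abs_minus)
qed

text \<open>Unit vectors whose combinations are bounded by the square sum of the coefficients must
  be orthogonal. Hence multiplication by \<open>f\<close> is isometric.\<close>

lemma f_orthonormal: "cinner (orbit f a) (orbit f b) = (if a = b then 1 else 0)"
proof (cases "a = b")
  case True
  then show ?thesis by (simp add: cinner_self norm_orbit norm_f)
next
  case False
  define d where "d = cinner (orbit f a) (orbit f b)"
  have q: "2 * Re (cnj c * d) \<le> 0" for c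
  proof -
    have "(norm (\<Sum>x\<in>{a, b}. (if x = a then 1 else c) *\<^sub>C orbit f x))\<^sup>2 \<le>
        (\<Sum>x\<in>{a, b}. (cmod (if x = a then 1 else c))\<^sup>2)"
      by (rule contractive) simp
    then have "(norm (orbit f a + c *\<^sub>C orbit f b))\<^sup>2 \<le> 1 + (cmod c)\<^sup>2" using False by auto
    then show ?thesis
      unfolding norm_sq_add norm_scaleC norm_orbit norm_f by (simp add: d_def)
  qed
  have "cnj d * d = complex_of_real ((cmod d)\<^sup>2)"
    unfolding complex_norm_square by (simp add: mult.commute)
  then have "Re (cnj d * d) = (cmod d)\<^sup>2" by (simp only: Re_complex_of_real)
  then have "(cmod d)\<^sup>2 \<le> 0" using q[of d] by simp
  then show ?thesis using False by (simp add: d_def)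
qed

end

section \<open>The canonical decomposition of the model space\<close>

text \<open>When \<open>r\<close> is the reproducing kernel of the invariant subspace
  \<open>L\<close>, then \<open>t\<close> is the one of the wandering subspace, the complement of
  \<open>V L\<close> in \<open>L\<close>. The eigenvalue relation for the backward shift turns the
  shift into a scalar factor.\<close>

lemma shift_invariant_kernel:
  fixes V U :: "'a::complex_hilbert \<Rightarrow> 'a" and L :: "'a set"
  assumes L: "ch.subspace L" "\<And>x. x \<in> L \<Longrightarrow> V x \<in> L"
    and adj: "\<And>x y. cinner (V x) y = cinner x (U y)" and UV: "\<And>x. U (V x) = x"
    and r: "\<And>\<eta>. \<eta> \<in> I \<Longrightarrow> r \<eta> \<in> L" "\<And>\<eta> F. \<eta> \<in> I \<Longrightarrow> F \<in> L \<Longrightarrow> cinner F (r \<eta>) = cinner F (k \<eta>)"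
    and k: "\<And>\<eta>. \<eta> \<in> I \<Longrightarrow> U (k \<eta>) = cnj (c \<eta>) *\<^sub>C k \<eta>"
  defines "t \<equiv> \<lambda>\<eta>. r \<eta> - cnj (c \<eta>) *\<^sub>C V (r \<eta>)"
  shows "\<eta> \<in> I \<Longrightarrow> t \<eta> \<in> {F \<in> L. \<forall>G\<in>L. cinner F (V G) = 0}"
    and "\<eta> \<in> I \<Longrightarrow> \<zeta> \<in> I \<Longrightarrow> cinner (t \<eta>) (t \<zeta>) = (1 - c \<zeta> * cnj (c \<eta>)) * cinner (r \<eta>) (r \<zeta>)"
proof -
  have iso: "cinner (V x) (V y) = cinner x y" for x y by (simp add: adj UV)
  have orth: "cinner (t \<eta>) (V G) = 0" if \<eta>: "\<eta> \<in> I" and G: "G \<in> L" for \<eta> G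
  proof -
    have "cinner (V G) (r \<eta>) = cinner G (U (k \<eta>))" using r(2)[OF \<eta> L(2)[OF G]] by (simp add: adj)
    also have "\<dots> = c \<eta> * cinner G (r \<eta>)" using k[OF \<eta>] r(2)[OF \<eta> G] by simp
    finally have "cinner (r \<eta>) (V G) = cnj (c \<eta>) * cinner (r \<eta>) G"
      by (metis cinner_commute complex_cnj_mult)
    then show ?thesis by (simp add: t_def cinner_diff_left cinner_scaleC_left iso)
  qed
  show "t \<eta> \<in> {F \<in> L. \<forall>G\<in>L. cinner F (V G) = 0}" if "\<eta> \<in> I"
    using orth[OF that] r(1)[OF that] L unfolding t_def
    by (auto intro!: ch.subspace_diff ch.subspace_scale)
  show "cinner (t \<eta>) (t \<zeta>) = (1 - c \<zeta> * cnj (c \<eta>)) * cinner (r \<eta>) (r \<zeta>)" if \<eta>: "\<eta> \<in> I" and \<zeta>: "\<zeta> \<in> I"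
  proof -
    have "cinner (t \<eta>) (t \<zeta>) = cinner (t \<eta>) (r \<zeta>)"
      using orth[OF \<eta> r(1)[OF \<zeta>]] by (subst (2) t_def) (simp add: cinner_diff_right)
    also have "\<dots> = cinner (r \<eta>) (r \<zeta>) - cnj (c \<eta>) * cinner (V (r \<eta>)) (r \<zeta>)"
      by (simp add: t_def cinner_diff_left cinner_scaleC_left)
    also have "cinner (V (r \<eta>)) (r \<zeta>) = cinner (r \<eta>) (U (k \<zeta>))"
      using r(2)[OF \<zeta> L(2)[OF r(1)[OF \<eta>]]] by (simp add: adj)
    also have "\<dots> = c \<zeta> * cinner (r \<eta>) (r \<zeta>)" using k[OF \<zeta>] r(2)[OF \<zeta> r(1)[OF \<eta>]] by simp
    finally show ?thesis by (simp add: algebra_simps)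
  qed
qed

abbreviation bidisk :: "(complex \<times> complex) set" where "bidisk \<equiv> ball 0 1 \<times> ball 0 1"

lemma has_sum_delta:
  fixes g :: "'i \<Rightarrow> complex"
  shows "((\<lambda>a. g a * (if a = b then 1 else 0)) has_sum g b) UNIV"
proof -
  have "((\<lambda>a. g a) has_sum (\<Sum>a\<in>{b}. g a)) {b}" by (rule has_sum_finite) simp
  then have "(g has_sum g b) {b}" by simp
  moreover have "((\<lambda>a. g a * (if a = b then 1 else 0)) has_sum g b) UNIV \<longleftrightarrow> (g has_sum g b) {b}"
    by (rule has_sum_cong_neutral) auto
  ultimately show ?thesis by blast
qed

lemma has_sum_geometric_complex2:
  fixes u v :: complex
  assumes "cmod u < 1" "cmod v < 1"
  shows "((\<lambda>a. u ^ fst a * v ^ snd a) has_sum (1 / ((1 - u) * (1 - v)))) (UNIV :: (nat \<times> nat) set)"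
proof -
  have g: "((\<lambda>j. w ^ j) has_sum 1 / (1 - w)) UNIV" if "cmod w < 1" for w :: complex
    by (rule norm_summable_imp_has_sum[OF _ geometric_sums[OF that]])
      (simp add: norm_power summable_geometric that)
  have "(\<lambda>a. norm ((1::complex) * (u ^ fst a * v ^ snd a))) summable_on (UNIV :: (nat \<times> nat) set)"
    by (rule double_series_abs_summable[of "\<lambda>_. 1" 1]) (use assms in auto)
  from abs_summable_summable[OF this]
  have "(\<lambda>a. u ^ fst a * v ^ snd a) summable_on (UNIV :: (nat \<times> nat) set)" by simp
  then obtain S where S: "((\<lambda>a. u ^ fst a * v ^ snd a) has_sum S) (UNIV :: (nat \<times> nat) set)"
    unfolding summable_on_def by blast
  then have S': "((\<lambda>a. u ^ fst a * v ^ snd a) has_sum S) (SIGMA j:(UNIV::nat set). (UNIV :: nat set))" by simp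
  have "((\<lambda>j. u ^ j * (1 / (1 - v))) has_sum S) UNIV"
    by (rule has_sum_SigmaD[OF S']) (use has_sum_cmult_right[OF g[OF assms(2)]] in simp)
  moreover have "((\<lambda>j. u ^ j * (1 / (1 - v))) has_sum (1 / (1 - u) * (1 / (1 - v)))) UNIV"
    by (rule has_sum_cmult_left[OF g[OF assms(1)]])
  ultimately have "S = 1 / (1 - u) * (1 / (1 - v))" by (rule has_sum_unique)
  then show ?thesis using S by simp
qed

context bishift
begin

definition wt :: "complex \<times> complex \<Rightarrow> nat \<times> nat \<Rightarrow> complex" where
  "wt \<eta> a = cnj (fst \<eta>) ^ fst a * cnj (snd \<eta>) ^ snd a"

text \<open>The product of \<open>g\<close> with the Szego kernel at \<eta>. For \<open>e0\<close>
  it is the Szego kernel itself, which evaluates at \<eta> and is an eigenvector of both backward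
  shifts.\<close>

definition ker :: "'a \<Rightarrow> complex \<times> complex \<Rightarrow> 'a" where
  "ker g \<eta> = (\<Sum>\<^sub>\<infinity>a. wt \<eta> a *\<^sub>C orbit g a)"

lemma ker_has_sum:
  assumes "\<eta> \<in> bidisk"
  shows "((\<lambda>a. wt \<eta> a *\<^sub>C orbit g a) has_sum ker g \<eta>) UNIV"
proof -
  have "((\<lambda>a. cmod (fst \<eta>) ^ fst a * cmod (snd \<eta>) ^ snd a) has_sum
      (1 / (1 - cmod (fst \<eta>)) * (1 / (1 - cmod (snd \<eta>))))) (UNIV :: (nat \<times> nat) set)"
    by (rule has_sum_geometric2) (use assms in auto)
  from has_sum_cmult_left[OF this, of "norm g"]
  have "(\<lambda>a. norm (wt \<eta> a *\<^sub>C orbit g a)) summable_on UNIV"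
    by (auto simp: summable_on_def wt_def norm_mult norm_power norm_orbit)
  then show ?thesis unfolding ker_def by (rule has_sum_infsum[OF abs_summable_summable])
qed

lemma cinner_ker_has_sum:
  assumes "\<eta> \<in> bidisk"
  shows "((\<lambda>a. wt \<eta> a * cinner (orbit g a) y) has_sum cinner (ker g \<eta>) y) UNIV"
  using has_sum_bounded_linear[OF bounded_linear_cinner_left ker_has_sum[OF assms]]
  by (simp add: cinner_scaleC_left o_def)

abbreviation k :: "complex \<times> complex \<Rightarrow> 'a" where "k \<equiv> ker e0"

lemma cinner_k_E: "\<eta> \<in> bidisk \<Longrightarrow> cinner (k \<eta>) (E b) = wt \<eta> b"
  using cinner_ker_has_sum[of \<eta> e0 "E b"] has_sum_delta[of "wt \<eta>" b]
  by (auto simp: E_orthonormal intro: has_sum_unique)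

lemma U1_k: "\<eta> \<in> bidisk \<Longrightarrow> U1 (k \<eta>) = cnj (fst \<eta>) *\<^sub>C k \<eta>"
proof -
  assume \<eta>: "\<eta> \<in> bidisk"
  have "cinner (U1 (k \<eta>) - cnj (fst \<eta>) *\<^sub>C k \<eta>) (E a) = 0" for a
    by (simp add: cinner_simps adj1' V1_orbit cinner_k_E[OF \<eta>]) (simp add: wt_def)
  then show ?thesis using complete_E by fastforce
qed

lemma U2_k: "\<eta> \<in> bidisk \<Longrightarrow> U2 (k \<eta>) = cnj (snd \<eta>) *\<^sub>C k \<eta>"
proof -
  assume \<eta>: "\<eta> \<in> bidisk"
  have "cinner (U2 (k \<eta>) - cnj (snd \<eta>) *\<^sub>C k \<eta>) (E a) = 0" for a
    by (simp add: cinner_simps adj2' V2_orbit cinner_k_E[OF \<eta>]) (simp add: wt_def)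
  then show ?thesis using complete_E by fastforce
qed

lemma cinner_orbit_k:
  assumes \<eta>: "\<eta> \<in> bidisk"
  shows "cinner (orbit g a) (k \<eta>) = cnj (wt \<eta> a) * cinner g (k \<eta>)"
proof -
  have 1: "(U1 ^^ j) (k \<eta>) = (cnj (fst \<eta>) ^ j) *\<^sub>C k \<eta>" for j
    by (induction j) (auto simp: U1_k[OF \<eta>] lin scaleC_scaleC mult.commute)
  have 2: "(U2 ^^ j) (k \<eta>) = (cnj (snd \<eta>) ^ j) *\<^sub>C k \<eta>" for j
    by (induction j) (auto simp: U2_k[OF \<eta>] lin scaleC_scaleC mult.commute)
  have "(U2 ^^ j) (c *\<^sub>C x) = c *\<^sub>C (U2 ^^ j) x" for j c x by (induction j) (auto simp: lin)
  then show ?thesis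
    by (simp add: orbit_def adjoint_funpow[OF adj1] adjoint_funpow[OF adj2] 1 2 wt_def)
qed

lemma cinner_k_k:
  assumes "\<eta> \<in> bidisk" "\<zeta> \<in> bidisk"
  shows "cinner (k \<eta>) (k \<zeta>) = 1 / ((1 - fst \<zeta> * cnj (fst \<eta>)) * (1 - snd \<zeta> * cnj (snd \<eta>)))"
proof -
  have "cmod (fst \<zeta> * cnj (fst \<eta>)) < 1" "cmod (snd \<zeta> * cnj (snd \<eta>)) < 1"
  proof -
    have "a * b < 1" if "0 \<le> a" "a < 1" "0 \<le> b" "b < 1" for a b :: real
      using mult_strict_mono'[of a 1 b 1] that by simp
    then show "cmod (fst \<zeta> * cnj (fst \<eta>)) < 1" "cmod (snd \<zeta> * cnj (snd \<eta>)) < 1"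
      using assms by (auto simp: norm_mult)
  qed
  from has_sum_geometric_complex2[OF this]
  have "((\<lambda>a. wt \<eta> a * cnj (wt \<zeta> a)) has_sum
      (1 / ((1 - fst \<zeta> * cnj (fst \<eta>)) * (1 - snd \<zeta> * cnj (snd \<eta>))))) UNIV"
    by (simp add: wt_def power_mult_distrib mult_ac)
  moreover have "((\<lambda>a. wt \<eta> a * cnj (wt \<zeta> a)) has_sum cinner (k \<eta>) (k \<zeta>)) UNIV"
  proof -
    have "cinner e0 (k \<zeta>) = 1"
      using cinner_k_E[OF assms(2), of "(0, 0)"] cinner_commute[of e0 "k \<zeta>"] by (simp add: wt_def)
    then show ?thesis
      using cinner_ker_has_sum[OF assms(1), of e0 "k \<zeta>"] by (simp add: cinner_orbit_k[OF assms(2)])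
  qed
  ultimately show ?thesis by (simp add: has_sum_unique)
qed

lemma evaluation_has_sum:
  assumes "\<zeta> \<in> bidisk"
  shows "((\<lambda>a. cinner g (E a) * (fst \<zeta> ^ fst a * snd \<zeta> ^ snd a)) has_sum cinner g (k \<zeta>)) UNIV"
proof -
  have "((\<lambda>a. cnj (wt \<zeta> a * cinner (E a) g)) has_sum cnj (cinner (k \<zeta>) g)) UNIV"
    unfolding has_sum_cnj_iff by (rule cinner_ker_has_sum[OF assms])
  moreover have "cnj (wt \<zeta> a * cinner (E a) g) = cinner g (E a) * (fst \<zeta> ^ fst a * snd \<zeta> ^ snd a)" for a
    using cinner_commute[of g "E a"] by (simp add: wt_def)
  moreover have "cnj (cinner (k \<zeta>) g) = cinner g (k \<zeta>)" by (rule cinner_commute[symmetric])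
  ultimately show ?thesis by simp
qed

end

context rational_inner
begin

text \<open>\<open>HH\<close> is the model space, \<open>SS\<close> its largest
  \<open>V1\<close>-invariant subspace and \<open>MM\<close> the complement of \<open>SS\<close> in
  \<open>HH\<close>; \<open>N1\<close> and \<open>N2\<close> are the wandering subspaces of
  \<open>SS\<close> under \<open>V1\<close> and of \<open>MM\<close> under
  \<open>V2\<close>.\<close>

definition HH :: "'a set" where "HH = {F. \<forall>a. cinner F (orbit f a) = 0}"
definition SS :: "'a set" where "SS = {F. \<forall>j. (V1 ^^ j) F \<in> HH}"
definition MM :: "'a set" where "MM = {F \<in> HH. \<forall>G\<in>SS. cinner F G = 0}"
definition N1 :: "'a set" where "N1 = {F \<in> SS. \<forall>G\<in>SS. cinner F (V1 G) = 0}"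
definition N2 :: "'a set" where "N2 = {F \<in> MM. \<forall>G\<in>MM. cinner F (V2 G) = 0}"

lemma V1_pow_lin: "(V1 ^^ j) (x + y) = (V1 ^^ j) x + (V1 ^^ j) y" "(V1 ^^ j) (c *\<^sub>C x) = c *\<^sub>C (V1 ^^ j) x"
  "(V1 ^^ j) 0 = 0"
  by (induction j) (auto simp: lin)

lemma subspaces: "ch.subspace HH" "ch.subspace SS" "ch.subspace MM" "ch.subspace N1" "ch.subspace N2"
  unfolding ch.subspace_def HH_def SS_def MM_def N1_def N2_def
  by (auto simp: cinner_simps V1_pow_lin)

lemma closed_SS: "closed SS"
proof -
  have "SS = (\<Inter>j. \<Inter>a. {F. cinner F ((U1 ^^ j) (orbit f a)) = 0})"
    by (auto simp: SS_def HH_def adjoint_funpow[OF adj1])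
  moreover have "closed {F. cinner F v = 0}" for v :: 'a
    by (intro closed_Collect_eq linear_continuous_on bounded_linear_cinner_left continuous_on_const)
  ultimately show ?thesis by (simp add: closed_INT)
qed

lemma SS_subset_HH: "SS \<subseteq> HH"
proof
  fix F assume "F \<in> SS"
  then have "(V1 ^^ 0) F \<in> HH" unfolding SS_def by blast
  then show "F \<in> HH" by simp
qed

lemma V1_SS: "F \<in> SS \<Longrightarrow> V1 F \<in> SS"
proof -
  assume F: "F \<in> SS"
  have "(V1 ^^ j) (V1 F) = (V1 ^^ Suc j) F" for j by (simp add: funpow_swap1)
  then show ?thesis using F by (simp add: SS_def del: funpow.simps)
qed

lemma U1_HH: "F \<in> HH \<Longrightarrow> U1 F \<in> HH"
  by (simp add: HH_def adj1' V1_orbit)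

lemma U2_HH: "F \<in> HH \<Longrightarrow> U2 F \<in> HH"
  by (simp add: HH_def adj2' V2_orbit)

lemma U2_SS: "F \<in> SS \<Longrightarrow> U2 F \<in> SS"
proof -
  assume F: "F \<in> SS"
  have "(V1 ^^ j) (U2 F) = U2 ((V1 ^^ j) F)" for j by (rule commute_funpow[of V1 U2, OF VU12])
  then show ?thesis using F U2_HH by (simp add: SS_def)
qed

text \<open>The functions \<open>u(z\<^sub>1) (f - f(z\<^sub>1, 0)) / z\<^sub>2\<close> belong to \<open>SS\<close>; this makes the orthogonal
  complement of \<open>SS\<close> in the model space invariant under \<open>V2\<close>.\<close>

lemma U2_orbit_f_SS: "U2 (orbit f (j, 0)) \<in> SS"
proof -
  have "(V1 ^^ i) (U2 (orbit f (j, 0))) = U2 (orbit f (i + j, 0))" for i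
    using commute_funpow[of V1 U2 i "orbit f (j, 0)", OF VU12] by (simp add: V1_pow_orbit)
  moreover have "U2 (orbit f (l, 0)) \<in> HH" for l
    by (auto simp: HH_def adj2' V2_orbit f_orthonormal)
  ultimately show ?thesis by (simp add: SS_def)
qed

text \<open>Moved across the inner product, \<open>V2\<close> becomes \<open>U2\<close>, which maps
  both \<open>SS\<close> and the vectors \<open>orbit f (j, 0)\<close> into
  \<open>SS\<close>.\<close>

lemma V2_MM:
  assumes "F \<in> MM"
  shows "V2 F \<in> MM"
proof -
  have F: "F \<in> HH" "\<And>G. G \<in> SS \<Longrightarrow> cinner F G = 0" using assms by (auto simp: MM_def)
  have "cinner (V2 F) (orbit f a) = 0" for a
  proof (cases "snd a")
    case 0
    then have "orbit f a = orbit f (fst a, 0)" by (cases a) simp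
    then show ?thesis using F(2)[OF U2_orbit_f_SS, of "fst a"] by (simp add: adj2)
  next
    case (Suc l)
    then have "orbit f a = V2 (orbit f (fst a, l))" by (cases a) (simp add: V2_orbit)
    then show ?thesis using F(1) by (simp add: cinner_V2 HH_def)
  qed
  moreover have "cinner (V2 F) G = 0" if "G \<in> SS" for G
    using F(2)[OF U2_SS[OF that]] by (simp add: adj2)
  ultimately show ?thesis by (simp add: MM_def HH_def)
qed

lemma V2_pow_MM: "F \<in> MM \<Longrightarrow> (V2 ^^ j) F \<in> MM"
  by (induction j) (auto intro: V2_MM)

lemma pt_corner: "pt (n, c2) = \<epsilon> * cnj (p (0, m - c2))" "pt (c1, m) = \<epsilon> * cnj (p (n - c1, 0))"
  by (simp_all add: pt_def)

lemma eps_nonzero: "\<epsilon> \<noteq> 0" using eps by auto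

lemma cinner_V1_pow_E: "cinner ((V1 ^^ j) F) (E a) = (if fst a < j then 0 else cinner F (E (fst a - j, snd a)))"
  by (simp add: adjoint_funpow[OF adj1] U1_pow_E)

lemma cinner_V2_pow_E: "cinner ((V2 ^^ j) F) (E a) = (if snd a < j then 0 else cinner F (E (fst a, snd a - j)))"
  by (simp add: adjoint_funpow[OF adj2] U2_pow_E)

lemma HH_D: "F \<in> HH \<Longrightarrow> cinner F (orbit f a) = 0"
  unfolding HH_def by blast

lemma HH_Pt: "F \<in> HH \<Longrightarrow> cinner F (Pt b) = 0"
  by (simp add: HH_D Pt_eq cinner_sum_right)

lemma sum_reflect: "(\<Sum>i\<le>N. g (N - i)) = (\<Sum>i\<le>N. g i)" for g :: "nat \<Rightarrow> complex" and N :: nat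
  by (rule sum.reindex_bij_witness[of _ "\<lambda>i. N - i" "\<lambda>i. N - i"]) auto

text \<open>The vector V1^n F is still orthogonal to multiples of the reflected polynomial. Only the
  part of top degree \<open>n\<close> in the first variable is seen, with coefficients conj(p(0, j))
  in reverse order up to \<epsilon>; so the coefficients of \<open>F\<close> at
  \<open>E (0, l)\<close> satisfy a recurrence with leading coefficient
  \<open>p (0, 0)\<close>.\<close>

lemma SS_column_zero:
  assumes F: "F \<in> SS" and 0: "\<And>l. l < m \<Longrightarrow> cinner F (E (0, l)) = 0"
  shows "cinner F (E (0, l)) = 0"
proof (rule linear_recurrence_zero[where q = "\<lambda>i. p (0, i)" and g = "\<lambda>l. cinner F (E (0, l))" and m = m])
  fix l assume l: "m \<le> l"
  have "0 = cinner ((V1 ^^ n) F) (Pt (0, l - m))" using F HH_Pt by (simp add: SS_def)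
  also have "\<dots> = (\<Sum>c\<in>Box. cnj (pt c) * (if fst c < n then 0 else cinner F (E (0, snd c + (l - m)))))"
    unfolding Pt_def cinner_sum_right cinner_scaleC_right cinner_V1_pow_E
    by (intro sum.cong) auto
  also have "\<dots> = (\<Sum>i\<le>n. \<Sum>j\<le>m. cnj (pt (i, j)) * (if i < n then 0 else cinner F (E (0, j + (l - m)))))"
    by (simp add: sum.cartesian_product case_prod_unfold)
  also have "\<dots> = (\<Sum>j\<le>m. cnj (pt (n, j)) * cinner F (E (0, j + (l - m))))"
  proof -
    have "(\<Sum>i\<le>n. \<Sum>j\<le>m. cnj (pt (i, j)) * (if i < n then 0 else cinner F (E (0, j + (l - m))))) =
        (\<Sum>i\<in>{n}. \<Sum>j\<le>m. cnj (pt (i, j)) * (if i < n then 0 else cinner F (E (0, j + (l - m)))))"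
      by (rule sum.mono_neutral_right) auto
    then show ?thesis by simp
  qed
  also have "\<dots> = cnj \<epsilon> * (\<Sum>j\<le>m. p (0, m - j) * cinner F (E (0, l - (m - j))))"
    using l unfolding sum_distrib_left by (intro sum.cong) (auto simp: pt_corner add.commute)
  finally show "(\<Sum>i\<le>m. p (0, i) * cinner F (E (0, l - i))) = 0"
    using eps_nonzero sum_reflect[of "\<lambda>i. p (0, i) * cinner F (E (0, l - i))" m] by simp
qed (use p0 0 in auto)

text \<open>The same recurrence with the variables exchanged; it is available because the powers of
  \<open>V2\<close> stay in \<open>MM\<close>.\<close>

lemma MM_row_zero:
  assumes F: "F \<in> MM" and 0: "\<And>l. l < n \<Longrightarrow> cinner F (E (l, 0)) = 0"
  shows "cinner F (E (l, 0)) = 0"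
proof (rule linear_recurrence_zero[where q = "\<lambda>i. p (i, 0)" and g = "\<lambda>l. cinner F (E (l, 0))" and m = n])
  fix l assume l: "n \<le> l"
  have "(V2 ^^ m) F \<in> HH" using V2_pow_MM[OF F] by (simp add: MM_def)
  then have "0 = cinner ((V2 ^^ m) F) (Pt (l - n, 0))" using HH_Pt by simp
  also have "\<dots> = (\<Sum>c\<in>Box. cnj (pt c) * (if snd c < m then 0 else cinner F (E (fst c + (l - n), 0))))"
    unfolding Pt_def cinner_sum_right cinner_scaleC_right cinner_V2_pow_E
    by (intro sum.cong) auto
  also have "\<dots> = (\<Sum>i\<le>n. \<Sum>j\<le>m. cnj (pt (i, j)) * (if j < m then 0 else cinner F (E (i + (l - n), 0))))"
    by (simp add: sum.cartesian_product case_prod_unfold)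
  also have "\<dots> = (\<Sum>i\<le>n. cnj (pt (i, m)) * cinner F (E (i + (l - n), 0)))"
  proof (rule sum.cong[OF refl])
    fix i
    have "(\<Sum>j\<le>m. cnj (pt (i, j)) * (if j < m then 0 else cinner F (E (i + (l - n), 0)))) =
        (\<Sum>j\<in>{m}. cnj (pt (i, j)) * (if j < m then 0 else cinner F (E (i + (l - n), 0))))"
      by (rule sum.mono_neutral_right) auto
    then show "(\<Sum>j\<le>m. cnj (pt (i, j)) * (if j < m then 0 else cinner F (E (i + (l - n), 0)))) =
      cnj (pt (i, m)) * cinner F (E (i + (l - n), 0))" by simp
  qed
  also have "\<dots> = cnj \<epsilon> * (\<Sum>i\<le>n. p (n - i, 0) * cinner F (E (l - (n - i), 0)))"
    using l unfolding sum_distrib_left by (intro sum.cong) (auto simp: pt_corner add.commute)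
  finally show "(\<Sum>i\<le>n. p (i, 0) * cinner F (E (l - i, 0))) = 0"
    using eps_nonzero sum_reflect[of "\<lambda>i. p (i, 0) * cinner F (E (l - i, 0))" n] by simp
qed (use p0 0 in auto)

text \<open>Such an \<open>F\<close> is divisible by the first coordinate, with quotient in
  \<open>SS\<close>; hence it lies in \<open>V1 SS\<close> and is orthogonal to it.\<close>

lemma N1_separated:
  assumes "F \<in> N1" "\<forall>l<m. cinner F (E (0, l)) = 0"
  shows "F = 0"
proof -
  have F: "F \<in> SS" "\<And>G. G \<in> SS \<Longrightarrow> cinner F (V1 G) = 0" using assms(1) by (auto simp: N1_def)
  have eq: "V1 (U1 F) = F" by (rule V1_U1_if, rule SS_column_zero) (use F assms(2) in auto)
  have "(V1 ^^ j) (U1 F) \<in> HH" for j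
  proof (cases j)
    case 0
    then show ?thesis using F(1) SS_subset_HH U1_HH by auto
  next
    case (Suc i)
    then have "(V1 ^^ j) (U1 F) = (V1 ^^ i) F" by (simp only: funpow_Suc_right o_def eq)
    then show ?thesis using F(1) by (simp add: SS_def)
  qed
  then have "U1 F \<in> SS" by (simp add: SS_def)
  from F(2)[OF this] show ?thesis by (simp add: eq)
qed

text \<open>Here F = V2 G, and orthogonality to \<open>V2 MM\<close> puts \<open>G\<close> into
  \<open>SS\<close>. Then every V1^j F is orthogonal to \<open>orbit f (i, Suc l)\<close>; its
  products with \<open>orbit f (i, 0)\<close> for i < j depend on j - i only and obey a recurrence
  of order \<open>n\<close>, for which the second family of conditions supplies the initial values.
  So \<open>F\<close> lies in \<open>SS\<close> and in its complement.\<close>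

lemma N2_separated:
  assumes F2: "F \<in> N2" and 0: "\<forall>l<n. cinner F (E (l, 0)) = 0"
    and d0: "\<forall>l<n. cinner ((V1 ^^ Suc l) F) f = 0"
  shows "F = 0"
proof -
  have F: "F \<in> MM" "\<And>G. G \<in> MM \<Longrightarrow> cinner F (V2 G) = 0" using F2 by (auto simp: N2_def)
  have FH: "F \<in> HH" using F(1) by (simp add: MM_def)
  define G where "G = U2 F"
  have eq: "V2 G = F" unfolding G_def by (rule V2_U2_if, rule MM_row_zero) (use F 0 in auto)
  have GH: "G \<in> HH" using FH U2_HH by (simp add: G_def)
  have GM: "cinner G G' = 0" if "G' \<in> MM" for G' using F(2)[OF that] by (simp add: G_def adj2')
  obtain s where s: "s \<in> SS" "\<And>y. y \<in> SS \<Longrightarrow> cinner (G - s) y = 0"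
    using projection_theorem[OF subspaces(2) closed_SS] by blast
  have "G - s \<in> MM"
    unfolding MM_def using s GH SS_subset_HH subspaces(1) by (auto intro: ch.subspace_diff)
  then have "cinner (G - s) (G - s) = 0"
    using GM s cinner_eq_0_sym[of "G - s" s] by (simp add: cinner_diff_left)
  then have GS: "G \<in> SS" using s(1) by simp
  have VG: "cinner ((V1 ^^ j) F) (V2 x) = cinner ((V1 ^^ j) G) x" for j x
  proof -
    have "(V1 ^^ j) F = V2 ((V1 ^^ j) G)"
      unfolding eq[symmetric] by (rule commute_funpow[of V1 V2, OF VV])
    then show ?thesis by (simp add: cinner_V2)
  qed
  have VG0: "cinner ((V1 ^^ j) F) (orbit f (i, Suc l)) = 0" for i j l
  proof -
    have "orbit f (i, Suc l) = V2 (orbit f (i, l))" by (simp add: V2_orbit)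
    then show ?thesis using GS VG by (simp add: SS_def HH_def)
  qed
  have Vj: "cinner ((V1 ^^ j) F) (orbit f (i, 0)) = cinner ((V1 ^^ (j - i)) F) f" if "i \<le> j" for i j
  proof -
    have "(V1 ^^ j) F = (V1 ^^ i) ((V1 ^^ (j - i)) F)"
      using that by (simp add: funpow_add[symmetric, THEN fun_cong, simplified o_def])
    moreover have "orbit f (i, 0) = (V1 ^^ i) f" by (simp add: orbit_def)
    ultimately show ?thesis by (simp add: cinner_V1_pow)
  qed
  define g where "g l = cinner ((V1 ^^ Suc l) F) f" for l
  have g: "g l = 0" for l
  proof (rule linear_recurrence_zero[where q = "\<lambda>i. cnj (p (i, 0))" and m = n])
    fix l assume l: "n \<le> l"
    \<comment> \<open>Exponents in \<open>Pt (0, 0)\<close> have first entry at most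
      \<open>n\<close>, below \<open>Suc l\<close>, so the product vanishes. Expanding the same
      vector in multiples of \<open>f\<close> yields the recurrence.\<close>
    have "0 = cinner ((V1 ^^ Suc l) F) (Pt (0, 0))"
      unfolding Pt_def cinner_sum_right cinner_scaleC_right cinner_V1_pow_E
      using l by (intro sum.neutral[symmetric]) auto
    also have "\<dots> = (\<Sum>c\<in>Box. cnj (p c) * cinner ((V1 ^^ Suc l) F) (orbit f c))"
      by (simp add: Pt_eq cinner_sum_right zero_prod_def[symmetric])
    also have "\<dots> = (\<Sum>i\<le>n. \<Sum>j\<le>m. cnj (p (i, j)) * cinner ((V1 ^^ Suc l) F) (orbit f (i, j)))"
      by (simp add: sum.cartesian_product case_prod_unfold)
    also have "\<dots> = (\<Sum>i\<le>n. cnj (p (i, 0)) * g (l - i))"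
    proof (rule sum.cong[OF refl])
      fix i assume i: "i \<in> {..n}"
      have "(\<Sum>j\<le>m. cnj (p (i, j)) * cinner ((V1 ^^ Suc l) F) (orbit f (i, j))) =
          (\<Sum>j\<in>{0}. cnj (p (i, j)) * cinner ((V1 ^^ Suc l) F) (orbit f (i, j)))"
      proof (rule sum.mono_neutral_right)
        show "\<forall>j\<in>{..m} - {0}. cnj (p (i, j)) * cinner ((V1 ^^ Suc l) F) (orbit f (i, j)) = 0"
        proof
          fix j assume "j \<in> {..m} - {0}"
          then obtain j' where "j = Suc j'" by (cases j) auto
          then show "cnj (p (i, j)) * cinner ((V1 ^^ Suc l) F) (orbit f (i, j)) = 0"
            by (simp only: VG0) simp
        qed
      qed auto
      also have "\<dots> = cnj (p (i, 0)) * g (l - i)"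
        using i l Vj[of i "Suc l"] by (simp add: g_def Suc_diff_le)
      finally show "(\<Sum>j\<le>m. cnj (p (i, j)) * cinner ((V1 ^^ Suc l) F) (orbit f (i, j))) =
          cnj (p (i, 0)) * g (l - i)" .
    qed
    finally show "(\<Sum>i\<le>n. cnj (p (i, 0)) * g (l - i)) = 0" by simp
  qed (use p0 d0 in \<open>auto simp: g_def\<close>)
  have "cinner ((V1 ^^ j) F) (orbit f a) = 0" for j a
  proof (cases "snd a")
    case (Suc l)
    then have "orbit f a = orbit f (fst a, Suc l)" by (cases a) simp
    then show ?thesis using VG0 by simp
  next
    case 0
    then have a: "orbit f a = orbit f (fst a, 0)" by (cases a) simp
    show ?thesis
    proof (cases "fst a < j")
      case True
      have "Suc (j - fst a - 1) = j - fst a" using True by simp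
      then have "cinner ((V1 ^^ (j - fst a)) F) f = g (j - fst a - 1)" by (simp only: g_def)
      then show ?thesis using True a Vj[of "fst a" j] g by simp
    next
      case False
      have "orbit f (fst a, 0) = (V1 ^^ j) (orbit f (fst a - j, 0))" using False by (simp add: V1_pow_orbit)
      then show ?thesis using FH a by (simp add: cinner_V1_pow HH_def)
    qed
  qed
  then have "F \<in> SS" by (simp add: SS_def HH_def)
  then have "cinner F F = 0" using F(1) by (simp add: MM_def)
  then show ?thesis by simp
qed

theorem agler_decomposition:
  obtains B1 B2 :: "'a set" and t1 t2 :: "complex \<times> complex \<Rightarrow> 'a" where "finite B1" "finite B2" "\<And>x y. x \<in> B1 \<Longrightarrow> y \<in> B2 \<Longrightarrow> cinner x y = 0"
    "\<And>\<eta>. \<eta> \<in> bidisk \<Longrightarrow> t1 \<eta> \<in> ch.span B1" "\<And>\<eta>. \<eta> \<in> bidisk \<Longrightarrow> t2 \<eta> \<in> ch.span B2"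
    "\<And>\<eta> \<zeta>. \<eta> \<in> bidisk \<Longrightarrow> \<zeta> \<in> bidisk \<Longrightarrow> 1 - cinner f (k \<zeta>) * cnj (cinner f (k \<eta>)) =
      (1 - fst \<zeta> * cnj (fst \<eta>)) * cinner (t1 \<eta>) (t1 \<zeta>) + (1 - snd \<zeta> * cnj (snd \<eta>)) * cinner (t2 \<eta>) (t2 \<zeta>)"
proof -
  define \<phi> where "\<phi> \<zeta> = cinner f (k \<zeta>)" for \<zeta>
  have "\<exists>B. finite B \<and> B \<subseteq> N1 \<and> N1 \<subseteq> ch.span B"
    by (rule finite_span_if_separated[where l = "\<lambda>i x. cinner x (E (0, i))" and d = m])
      (use subspaces N1_separated in \<open>auto simp: cinner_simps\<close>)
  then obtain B1 where B1: "finite B1" "B1 \<subseteq> N1" "N1 \<subseteq> ch.span B1" by blast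
  have "\<exists>B. finite B \<and> B \<subseteq> N2 \<and> N2 \<subseteq> ch.span B"
  proof (rule finite_span_if_separated[where d = "n + n" and
        l = "\<lambda>i x. if i < n then cinner x (E (i, 0)) else cinner ((V1 ^^ Suc (i - n)) x) f"])
    fix x assume x: "x \<in> N2" "\<forall>i<n + n. (if i < n then cinner x (E (i, 0)) else cinner ((V1 ^^ Suc (i - n)) x) f) = 0"
    have "cinner x (E (l, 0)) = 0" if "l < n" for l using x(2)[rule_format, of l] that by simp
    moreover have "cinner ((V1 ^^ Suc l) x) f = 0" if "l < n" for l
      using x(2)[rule_format, of "n + l"] that by simp
    ultimately show "x = 0" using N2_separated[OF x(1)] by blast
  qed (use subspaces in \<open>auto simp: cinner_simps V1_pow_lin lin\<close>)
  then obtain B2 where B2: "finite B2" "B2 \<subseteq> N2" "N2 \<subseteq> ch.span B2" by blast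
  have orth: "cinner x y = 0" if "x \<in> B2" "y \<in> B1" for x y
    using B1(2) B2(2) that unfolding N1_def N2_def MM_def by blast
  \<comment> \<open>Reproducing kernel of the model space: the Szego kernel minus its part in the
    range of multiplication by \<open>f\<close>.\<close>
  define kH where "kH \<eta> = k \<eta> - cnj (\<phi> \<eta>) *\<^sub>C ker f \<eta>" for \<eta>
  have kf: "cinner F (ker f \<eta>) = 0" if "F \<in> HH" "\<eta> \<in> bidisk" for F \<eta>
  proof -
    have "cinner (orbit f a) F = 0" for a
      using HH_D[OF that(1)] cinner_eq_0_sym by blast
    then have "((\<lambda>_. 0) has_sum cinner (ker f \<eta>) F) (UNIV :: (nat \<times> nat) set)"
      using cinner_ker_has_sum[OF that(2), of f F] by simp
    then have "cinner (ker f \<eta>) F = 0" by (rule has_sum_unique) (simp add: has_sum_0)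
    then show ?thesis using cinner_eq_0_sym by blast
  qed
  have kHH: "kH \<eta> \<in> HH" if \<eta>: "\<eta> \<in> bidisk" for \<eta>
  proof -
    have "cinner (kH \<eta>) (orbit f b) = 0" for b
    proof -
      have "cinner (ker f \<eta>) (orbit f b) = wt \<eta> b"
        using cinner_ker_has_sum[OF \<eta>, of f "orbit f b"] has_sum_delta[of "wt \<eta>" b]
        by (auto simp: f_orthonormal intro: has_sum_unique)
      moreover have "cinner (k \<eta>) (orbit f b) = wt \<eta> b * cnj (\<phi> \<eta>)"
        using cinner_orbit_k[OF \<eta>, of f b] cinner_commute[of "k \<eta>" "orbit f b"] by (simp add: \<phi>_def)
      ultimately show ?thesis by (simp add: kH_def cinner_diff_left cinner_scaleC_left)
    qed
    then show ?thesis by (simp add: HH_def)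
  qed
  have kHrep: "cinner F (kH \<eta>) = cinner F (k \<eta>)" if "F \<in> HH" "\<eta> \<in> bidisk" for F \<eta>
    using kf[OF that] by (simp add: kH_def cinner_diff_right)
  have "\<exists>s. s \<in> SS \<and> (\<forall>y\<in>SS. cinner (kH \<eta> - s) y = 0)" for \<eta>
    using projection_theorem[OF subspaces(2) closed_SS, of "kH \<eta>"] by metis
  then obtain s where s: "\<And>\<eta>. s \<eta> \<in> SS" "\<And>\<eta> y. y \<in> SS \<Longrightarrow> cinner (kH \<eta> - s \<eta>) y = 0" by metis
  define r where "r \<eta> = kH \<eta> - s \<eta>" for \<eta>
  have sr: "cinner x (r \<eta>) = 0" if "x \<in> SS" for x \<eta>
    using s(2)[OF that] cinner_eq_0_sym unfolding r_def by blast
  have rM: "r \<eta> \<in> MM" if "\<eta> \<in> bidisk" for \<eta>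
  proof -
    have "s \<eta> \<in> HH" using s(1)[of \<eta>] SS_subset_HH by blast
    then have "kH \<eta> - s \<eta> \<in> HH" by (rule ch.subspace_diff[OF subspaces(1) kHH[OF that]])
    then show ?thesis unfolding MM_def r_def using s(2) by blast
  qed
  have srep: "cinner F (s \<eta>) = cinner F (k \<eta>)" if "F \<in> SS" "\<eta> \<in> bidisk" for F \<eta>
    using sr[OF that(1), of \<eta>] kHrep[OF _ that(2), of F] SS_subset_HH that(1)
    by (auto simp: r_def cinner_diff_right)
  have rrep: "cinner F (r \<eta>) = cinner F (k \<eta>)" if "F \<in> MM" "\<eta> \<in> bidisk" for F \<eta>
    using that kHrep[of F \<eta>] s(1)[of \<eta>] by (auto simp: MM_def r_def cinner_diff_right)
  define t1 where "t1 \<eta> = s \<eta> - cnj (fst \<eta>) *\<^sub>C V1 (s \<eta>)" for \<eta>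
  define t2 where "t2 \<eta> = r \<eta> - cnj (snd \<eta>) *\<^sub>C V2 (r \<eta>)" for \<eta>
  note T1' = shift_invariant_kernel[where I = bidisk and c = fst and k = k and r = s, OF subspaces(2) V1_SS adj1 UV1 s(1) srep U1_k,
      folded t1_def]
  note T2' = shift_invariant_kernel[where I = bidisk and c = snd and k = k and r = r, OF subspaces(3) V2_MM adj2 UV2 rM rrep U2_k,
      folded t2_def]
  have T1: "t1 \<eta> \<in> N1" "cinner (t1 \<eta>) (t1 \<zeta>) = (1 - fst \<zeta> * cnj (fst \<eta>)) * cinner (s \<eta>) (s \<zeta>)"
    and T2: "t2 \<eta> \<in> N2" "cinner (t2 \<eta>) (t2 \<zeta>) = (1 - snd \<zeta> * cnj (snd \<eta>)) * cinner (r \<eta>) (r \<zeta>)"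
    if \<eta>: "\<eta> \<in> bidisk" and \<zeta>: "\<zeta> \<in> bidisk" for \<eta> \<zeta>
    unfolding N1_def N2_def
    by (rule T1'(1) T1'(2) T2'(1) T2'(2); (assumption | rule \<eta> \<zeta>))+
  \<comment> \<open>The kernel of \<open>HH\<close> is the sum of those of \<open>SS\<close> and
    \<open>MM\<close>. After multiplication by both disk factors, \<open>t1\<close> absorbs the
    first and \<open>t2\<close> the second, so the \<open>V1\<close>-invariant part is left with the
    factor of the second variable and conversely; this is why the indices are exchanged at the
    end.\<close>
  have key: "1 - \<phi> \<zeta> * cnj (\<phi> \<eta>) = (1 - fst \<zeta> * cnj (fst \<eta>)) * cinner (t2 \<eta>) (t2 \<zeta>) +
      (1 - snd \<zeta> * cnj (snd \<eta>)) * cinner (t1 \<eta>) (t1 \<zeta>)"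
    if \<eta>: "\<eta> \<in> bidisk" and \<zeta>: "\<zeta> \<in> bidisk" for \<eta> \<zeta>
  proof -
    define u v where "u = 1 - fst \<zeta> * cnj (fst \<eta>)" and "v = 1 - snd \<zeta> * cnj (snd \<eta>)"
    have uv: "u \<noteq> 0" "v \<noteq> 0"
    proof -
      have "cmod (x * cnj y) < 1" if "cmod x < 1" "cmod y < 1" for x y
        using mult_strict_mono'[of "cmod x" 1 "cmod y" 1] that by (simp add: norm_mult)
      then have "x * cnj y \<noteq> 1" if "cmod x < 1" "cmod y < 1" for x y using that by fastforce
      then show "u \<noteq> 0" "v \<noteq> 0" using \<eta> \<zeta> by (auto simp: u_def v_def)
    qed
    have g: "cinner (k \<eta>) (k \<zeta>) = 1 / (u * v)" unfolding u_def v_def by (rule cinner_k_k[OF \<eta> \<zeta>])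
    have gf: "cinner (ker f \<eta>) (k \<zeta>) = \<phi> \<zeta> * cinner (k \<eta>) (k \<zeta>)"
    proof -
      have "((\<lambda>a. wt \<eta> a * (cnj (wt \<zeta> a) * \<phi> \<zeta>)) has_sum cinner (ker f \<eta>) (k \<zeta>)) UNIV"
        using cinner_ker_has_sum[OF \<eta>, of f "k \<zeta>"] by (simp add: cinner_orbit_k[OF \<zeta>] \<phi>_def)
      moreover have "((\<lambda>a. \<phi> \<zeta> * (wt \<eta> a * cinner (E a) (k \<zeta>))) has_sum \<phi> \<zeta> * cinner (k \<eta>) (k \<zeta>)) UNIV"
        by (intro has_sum_cmult_right cinner_ker_has_sum \<eta>)
      moreover have "cinner e0 (k \<zeta>) = 1"
        using cinner_k_E[OF \<zeta>, of "(0, 0)"] cinner_commute[of e0 "k \<zeta>"] by (simp add: wt_def)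
      ultimately show ?thesis by (auto simp: cinner_orbit_k[OF \<zeta>] mult_ac intro: has_sum_unique)
    qed
    have "cinner (kH \<eta>) (kH \<zeta>) = cinner (kH \<eta>) (k \<zeta>)" by (rule kHrep[OF kHH[OF \<eta>] \<zeta>])
    also have "\<dots> = (1 - \<phi> \<zeta> * cnj (\<phi> \<eta>)) / (u * v)"
      by (simp add: kH_def cinner_diff_left cinner_scaleC_left gf g diff_divide_distrib mult_ac)
    finally have 1: "(1 - \<phi> \<zeta> * cnj (\<phi> \<eta>)) = u * v * cinner (kH \<eta>) (kH \<zeta>)" using uv by simp
    have "kH \<eta> = s \<eta> + r \<eta>" for \<eta> by (simp add: r_def)
    moreover have "cinner (r \<eta>) (s \<zeta>) = 0" using s(2)[OF s(1)] by (simp add: r_def)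
    ultimately have "cinner (kH \<eta>) (kH \<zeta>) = cinner (s \<eta>) (s \<zeta>) + cinner (r \<eta>) (r \<zeta>)"
      using sr[OF s(1)] by (simp add: cinner_simps)
    with 1 have "1 - \<phi> \<zeta> * cnj (\<phi> \<eta>) = u * (v * cinner (r \<eta>) (r \<zeta>)) + v * (u * cinner (s \<eta>) (s \<zeta>))"
      by (simp only: distrib_left mult_ac add.commute)
    then show ?thesis unfolding T1(2)[OF \<eta> \<zeta>] T2(2)[OF \<eta> \<zeta>] by (simp only: u_def v_def)
  qed
  show ?thesis
  proof (rule that[of B2 B1 t2 t1])
    show "t2 \<eta> \<in> ch.span B2" if "\<eta> \<in> bidisk" for \<eta> using T2(1)[OF that that] B2(3) by blast
    show "t1 \<eta> \<in> ch.span B1" if "\<eta> \<in> bidisk" for \<eta> using T1(1)[OF that that] B1(3) by blast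
  qed (use B1 B2 orth key in \<open>auto simp: \<phi>_def\<close>)
qed

end

section \<open>Moment sequences from finite-dimensional realizations\<close>

lemma sum_multi_indices:
  fixes g :: "nat \<times> nat \<Rightarrow> complex"
  shows "(\<Sum>n | 1 \<le> fst n + snd n \<and> fst n + snd n \<le> K. g n) = (\<Sum>j<K. \<Sum>i\<le>Suc j. g (i, Suc j - i))"
proof (induction K)
  case (Suc K)
  let ?I = "\<lambda>K. {n::nat \<times> nat. 1 \<le> fst n + snd n \<and> fst n + snd n \<le> K}"
  let ?J = "(\<lambda>i. (i, Suc K - i)) ` {..Suc K}"
  have "?I (Suc K) = ?I K \<union> ?J"
  proof (rule set_eqI)
    fix n :: "nat \<times> nat"
    show "n \<in> ?I (Suc K) \<longleftrightarrow> n \<in> ?I K \<union> ?J"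
      by (cases n) (auto simp: image_iff)
  qed
  moreover have "?I K \<inter> ?J = {}" by auto
  ultimately have "sum g (?I (Suc K)) = sum g (?I K) + sum g ?J"
    using finite_multi_indices[of K] by (simp add: sum.union_disjoint)
  also have "sum g ?J = (\<Sum>i\<le>Suc K. g (i, Suc K - i))"
    by (subst sum.reindex) (auto simp: inj_on_def)
  finally show ?case using Suc.IH by simp
next
  case 0
  have "{n :: nat \<times> nat. 1 \<le> fst n + snd n \<and> fst n + snd n \<le> 0} = {}" by auto
  then show ?case by (simp only: sum.empty lessThan_0)
qed

text \<open>The first nonzero coefficient would survive multiplication by its power of t.\<close>

lemma asymptotic_coefficients_zero:
  fixes c :: "nat \<Rightarrow> complex"
  assumes "\<And>K. ((\<lambda>t. of_real (t ^ Suc K) * (\<Sum>j<Suc K. c j / (\<i> * of_real t) ^ Suc j)) \<longlongrightarrow> 0) at_top"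
  shows "c j = 0"
proof (induction j rule: less_induct)
  case (less j)
  have "(\<Sum>l<Suc j. c l / (\<i> * of_real t) ^ Suc l) = c j / (\<i> * of_real t) ^ Suc j" for t
    using less by simp
  then have "((\<lambda>t. of_real (t ^ Suc j) * (c j / (\<i> * of_real t) ^ Suc j)) \<longlongrightarrow> 0) at_top"
    using assms[of j] by simp
  moreover have "\<forall>\<^sub>F t in at_top. of_real (t ^ Suc j) * (c j / (\<i> * of_real t) ^ Suc j) = c j / \<i> ^ Suc j"
    using eventually_gt_at_top[of 0]
    by eventually_elim (simp add: power_mult_distrib del: power_Suc)
  ultimately have "((\<lambda>t::real. c j / \<i> ^ Suc j) \<longlongrightarrow> 0) at_top"
    by (rule Lim_transform_eventually)
  then have "c j / \<i> ^ Suc j = 0" by (simp add: tendsto_const_iff)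
  then show ?case by simp
qed

text \<open>Complex polynomials restricted to the real line, where conjugation keeps them
  polynomial. Identities between squared moduli can thus be continued from positive to negative
  arguments.\<close>

definition real_poly_fun :: "(real \<Rightarrow> complex) \<Rightarrow> bool" where
  "real_poly_fun f \<longleftrightarrow> (\<exists>p. \<forall>s. f s = poly p (of_real s))"

lemma real_poly_fun_poly: "real_poly_fun (\<lambda>s. poly p (of_real s))"
  unfolding real_poly_fun_def by blast

lemma real_poly_fun_mult:
  assumes "real_poly_fun f" "real_poly_fun g"
  shows "real_poly_fun (\<lambda>s. f s * g s)"
proof -
  obtain p q where "\<forall>s. f s = poly p (of_real s)" "\<forall>s. g s = poly q (of_real s)"
    using assms unfolding real_poly_fun_def by blast
  then show ?thesis unfolding real_poly_fun_def by (intro exI[of _ "p * q"]) simp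
qed

lemma real_poly_fun_add:
  assumes "real_poly_fun f" "real_poly_fun g"
  shows "real_poly_fun (\<lambda>s. f s + g s)"
proof -
  obtain p q where "\<forall>s. f s = poly p (of_real s)" "\<forall>s. g s = poly q (of_real s)"
    using assms unfolding real_poly_fun_def by blast
  then show ?thesis unfolding real_poly_fun_def by (intro exI[of _ "p + q"]) simp
qed

lemma real_poly_fun_const: "real_poly_fun (\<lambda>s. c)"
  using real_poly_fun_poly[of "[:c:]"] by simp

lemma real_poly_fun_id: "real_poly_fun of_real"
  unfolding real_poly_fun_def by (rule exI[of _ "[:0, 1:]"]) simp

lemma real_poly_fun_sum: "(\<And>i. i \<in> I \<Longrightarrow> real_poly_fun (f i)) \<Longrightarrow> real_poly_fun (\<lambda>s. \<Sum>i\<in>I. f i s)"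
  by (induction I rule: infinite_finite_induct) (auto intro: real_poly_fun_add real_poly_fun_const)

lemma real_poly_fun_prod: "(\<And>i. i \<in> I \<Longrightarrow> real_poly_fun (f i)) \<Longrightarrow> real_poly_fun (\<lambda>s. \<Prod>i\<in>I. f i s)"
  by (induction I rule: infinite_finite_induct) (auto intro: real_poly_fun_mult real_poly_fun_const)

lemma real_poly_fun_cnj: "real_poly_fun f \<Longrightarrow> real_poly_fun (\<lambda>s. cnj (f s))"
proof -
  assume "real_poly_fun f"
  then obtain p where p: "\<forall>s. f s = poly p (of_real s)" unfolding real_poly_fun_def by blast
  have "real_poly_fun (\<lambda>s. cnj (poly p (of_real s)))"
  proof (induction p)
    case 0
    show ?case by (simp add: real_poly_fun_const)
  next
    case (pCons a p)
    have "real_poly_fun (\<lambda>s. cnj a + of_real s * cnj (poly p (of_real s)))"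
      by (intro real_poly_fun_add real_poly_fun_mult real_poly_fun_const real_poly_fun_id pCons.IH)
    then show ?case by simp
  qed
  then show ?thesis using p by simp
qed

lemma real_poly_fun_eq_0:
  assumes "real_poly_fun f" "\<And>s. 0 < s \<Longrightarrow> f s = 0"
  shows "f s = 0"
proof -
  obtain p where p: "\<forall>s. f s = poly p (of_real s)" using assms(1) unfolding real_poly_fun_def by blast
  have "p = 0"
  proof (rule ccontr)
    assume "p \<noteq> 0"
    then have "finite {x. poly p x = 0}" by (rule poly_roots_finite)
    moreover have "complex_of_real ` {0<..} \<subseteq> {x. poly p x = 0}" using assms(2) p by auto
    ultimately have "finite (complex_of_real ` {0<..})" by (rule finite_subset[rotated])
    then have "finite {0::real<..}" by (rule finite_imageD) (auto simp: inj_on_def)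
    then show False using infinite_Ioi by blast
  qed
  then show ?thesis using p by simp
qed

text \<open>\<open>E\<close> is a finite eigenbasis of \<open>Y\<close> with eigenvalues
  \<open>ev\<close>; by \<open>A_sym\<close> and \<open>A_span\<close> the operator \<open>A\<close>
  vanishes on the orthogonal complement of its span. The expansion of \<open>h\<close> enters along
  the rays (\<i> t, \<i> t s).\<close>

locale finite_realization =
  fixes E :: "'a::complex_hilbert set" and ev :: "'a \<Rightarrow> real" and A Y :: "'a \<Rightarrow> 'a" and \<alpha> :: 'a
    and x :: "complex \<times> complex \<Rightarrow> 'a" and h :: "complex \<times> complex \<Rightarrow> complex"
    and \<rho> :: "nat \<times> nat \<Rightarrow> real"
  assumes finE: "finite E" and onE: "orthonormal E"
    and Y: "positive_contraction Y" and Y_e: "\<And>e. e \<in> E \<Longrightarrow> Y e = complex_of_real (ev e) *\<^sub>C e"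
    and A_add: "A (v + w) = A v + A w" and A_scale: "A (c *\<^sub>C v) = c *\<^sub>C A v"
    and A_sym: "cinner (A v) w = cinner v (A w)" and A_span: "A v \<in> ch.span E"
    and alpha_span: "\<alpha> \<in> ch.span E"
    and x_eq: "z \<in> bi_upper \<Longrightarrow> A (x z) - z_op Y z (x z) = \<alpha>"
    and h_eq: "z \<in> bi_upper \<Longrightarrow> h z = cinner (x z) \<alpha>"
    and asym: "0 < s \<Longrightarrow> 1 \<le> K \<Longrightarrow> ((\<lambda>t. complex_of_real (t ^ K) *
       (h (\<i> * of_real t, \<i> * of_real (t * s)) - (\<Sum>n | 1 \<le> fst n + snd n \<and> fst n + snd n \<le> K.
          complex_of_real (\<rho> n) / ((\<i> * of_real t) ^ fst n * (\<i> * of_real (t * s)) ^ snd n)))) \<longlongrightarrow> 0) at_top"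
begin

lemma ev_bounds: "e \<in> E \<Longrightarrow> 0 \<le> ev e \<and> ev e \<le> 1"
proof -
  assume e: "e \<in> E"
  then have "cinner e e = 1" using onE by (simp add: orthonormal_def)
  moreover have "0 \<le> Re (cinner (Y e) e) \<and> Re (cinner (Y e) e) \<le> Re (cinner e e)"
    using Y unfolding positive_contraction_def by blast
  ultimately show ?thesis by (simp add: Y_e[OF e] cinner_scaleC_left)
qed

lemma A_0: "A 0 = 0" using A_scale[of 0 0] by simp

lemma A_sum: "A (\<Sum>i\<in>I. c i *\<^sub>C g i) = (\<Sum>i\<in>I. c i *\<^sub>C A (g i))"
  by (induction I rule: infinite_finite_induct) (auto simp: A_add A_scale A_0)

lemma expand: "v \<in> ch.span E \<Longrightarrow> v = (\<Sum>e\<in>E. cinner v e *\<^sub>C e)"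
  using proj_on_eq[OF finE onE] by (simp add: proj_on_def)

lemma cinner_comb: "e \<in> E \<Longrightarrow> cinner (\<Sum>e\<in>E. c e *\<^sub>C e) e = c e"
proof -
  assume e: "e \<in> E"
  have "cinner (\<Sum>e\<in>E. c e *\<^sub>C e) e = (\<Sum>e'\<in>E. if e' = e then c e' else 0)"
    unfolding cinner_sum_left cinner_scaleC_left using onE e
    by (intro sum.cong) (auto simp: orthonormal_def)
  then show ?thesis using finE e by simp
qed

lemma A_comb: "A (\<Sum>e\<in>E. c e *\<^sub>C e) = (\<Sum>e\<in>E. (\<Sum>e'\<in>E. cinner (A e') e * c e') *\<^sub>C e)"
proof -
  have "A (\<Sum>e\<in>E. c e *\<^sub>C e) = (\<Sum>e\<in>E. cinner (A (\<Sum>e\<in>E. c e *\<^sub>C e)) e *\<^sub>C e)"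
    by (rule expand[OF A_span])
  then show ?thesis by (simp add: A_sum cinner_sum_left cinner_scaleC_left mult.commute)
qed

lemma Y_comb: "Y (\<Sum>e\<in>E. c e *\<^sub>C e) = (\<Sum>e\<in>E. (complex_of_real (ev e) * c e) *\<^sub>C e)"
  using Y_e by (simp add: positive_contraction_linear[OF Y] scaleC_scaleC mult.commute)

definition ell :: "real \<Rightarrow> real \<Rightarrow> real" where "ell y s = y + s * (1 - y)"

lemma ell_pos: "e \<in> E \<Longrightarrow> 0 < s \<Longrightarrow> 0 < ell (ev e) s"
  using ev_bounds[of e] unfolding ell_def
  by (cases "ev e = 0") (auto intro: add_pos_nonneg)

text \<open>Inverse of \<open>z_op Y (1, s)\<close> on the span of \<open>E\<close>. On a ray the
  resolvent vector has the Neumann expansion minus the sum of \<open>R s (w s j)\<close> divided by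
  (\<i> t)^(j+1).\<close>

definition R :: "real \<Rightarrow> 'a \<Rightarrow> 'a" where
  "R s v = (\<Sum>e\<in>E. (cinner v e / complex_of_real (ell (ev e) s)) *\<^sub>C e)"

definition w :: "real \<Rightarrow> nat \<Rightarrow> 'a" where "w s j = ((\<lambda>v. A (R s v)) ^^ j) \<alpha>"

lemma w_0: "w s 0 = \<alpha>" and w_Suc: "w s (Suc j) = A (R s (w s j))" by (simp_all add: w_def)

lemma w_span: "w s j \<in> ch.span E"
  by (cases j) (auto simp: w_0 w_Suc alpha_span A_span)

lemma z_op_R: "0 < s \<Longrightarrow> v \<in> ch.span E \<Longrightarrow> z_op Y (1, complex_of_real s) (R s v) = v"
proof -
  assume s: "0 < s" and v: "v \<in> ch.span E"
  have "z_op Y (1, complex_of_real s) e = complex_of_real (ell (ev e) s) *\<^sub>C e" if "e \<in> E" for e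
    using Y_e[OF that] by (simp add: z_op_def ell_def ch.scale_right_diff_distrib scaleC_scaleC
      scaleC_add_left ch.scale_left_diff_distrib algebra_simps)
  then have "z_op Y (1, complex_of_real s) (R s v) = (\<Sum>e\<in>E. cinner v e *\<^sub>C e)"
    unfolding R_def z_op_sum[OF Y]
    using ell_pos[OF _ s] by (intro sum.cong) (auto simp: scaleC_scaleC less_imp_neq[THEN not_sym])
  then show ?thesis using expand[OF v] by simp
qed

lemma R_sym: "cinner (R s v) u = cinner v (R s u)"
proof -
  have "cinner e u = cnj (cinner u e)" for e by (rule cinner_commute)
  then show ?thesis by (simp add: R_def cinner_sum_left cinner_sum_right cinner_scaleC_left mult_ac)
qed

text \<open>Symmetry of \<open>A\<close> and \<open>R s\<close> moves layers from one side to the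
  other, which is the Hankel property. The moment of order \<open>2 * k\<close> becomes a quadratic
  form at \<open>w s k\<close>.\<close>

lemma moments_shift: "cinner (R s (w s (k + j))) (w s i) = cinner (R s (w s k)) (w s (i + j))"
proof (induction j arbitrary: i)
  case (Suc j)
  have "cinner (R s (w s (k + Suc j))) (w s i) = cinner (R s (w s (k + j))) (w s (Suc i))"
    by (simp add: w_Suc R_sym A_sym)
  then show ?case using Suc.IH[of "Suc i"] by simp
qed simp

text \<open>The moments are the coefficients of the expansion of \<open>h\<close> along the ray
  \<open>(\<i> t, \<i> t s)\<close>, because asymptotic expansions are unique.\<close>

lemma moments:
  assumes s: "0 < s"
  shows "- cinner (R s (w s j)) \<alpha> = (\<Sum>i\<le>Suc j. complex_of_real (\<rho> (i, Suc j - i)) / complex_of_real s ^ (Suc j - i))"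
proof -
  define r where "r j = (\<Sum>i\<le>Suc j. complex_of_real (\<rho> (i, Suc j - i)) / complex_of_real s ^ (Suc j - i))" for j
  define g where "g j = - cinner (R s (w s j)) \<alpha>" for j
  define S where "S = complex_of_real s"
  have "g j - r j = 0"
  proof (rule asymptotic_coefficients_zero)
    fix K
    let ?T = "\<lambda>t. \<i> * complex_of_real t"
    let ?z = "\<lambda>t. (?T t, \<i> * complex_of_real (t * s))"
    \<comment> \<open>Remainder of the truncated Neumann series; by telescoping, the pencil maps it
      to the single term of order \<open>Suc K\<close>.\<close>
    define err where "err t = x (?z t) + (\<Sum>j<Suc K. (1 / ?T t ^ Suc j) *\<^sub>C R s (w s j))" for t
    have zU: "?z t \<in> bi_upper" if "0 < t" for t using that s by (simp add: upper_half_plane_def)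
    have zop: "z_op Y (?z t) v = ?T t *\<^sub>C z_op Y (1, S) v" for t v
      by (simp add: z_op_def S_def scaleC_add_right scaleC_scaleC mult.assoc)
    have err_eq: "A (err t) - z_op Y (?z t) (err t) = (1 / ?T t ^ Suc K) *\<^sub>C w s (Suc K)" if t: "0 < t" for t
    proof -
      have T0: "?T t \<noteq> 0" using t by simp
      have "A (\<Sum>j<L. (1 / ?T t ^ Suc j) *\<^sub>C R s (w s j)) -
          z_op Y (?z t) (\<Sum>j<L. (1 / ?T t ^ Suc j) *\<^sub>C R s (w s j)) = (1 / ?T t ^ L) *\<^sub>C w s L - \<alpha>" for L
      proof -
        have "A (\<Sum>j<L. (1 / ?T t ^ Suc j) *\<^sub>C R s (w s j)) -
          z_op Y (?z t) (\<Sum>j<L. (1 / ?T t ^ Suc j) *\<^sub>C R s (w s j)) =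
          (\<Sum>j<L. (1 / ?T t ^ Suc j) *\<^sub>C w s (Suc j) - (1 / ?T t ^ j) *\<^sub>C w s j)"
          unfolding A_sum z_op_sum[OF Y] zop
          using z_op_R[OF s w_span] T0
          by (simp add: sum_subtractf w_Suc S_def scaleC_scaleC)
        also have "\<dots> = (1 / ?T t ^ L) *\<^sub>C w s L - \<alpha>"
          using sum_lessThan_telescope[of "\<lambda>j. (1 / ?T t ^ j) *\<^sub>C w s j" L]
          by (simp add: w_0 del: power_Suc)
        finally show ?thesis .
      qed
      from this[of "Suc K"] show ?thesis
        using x_eq[OF zU[OF t]] unfolding err_def A_add z_op_add[OF Y] by (simp add: algebra_simps)
    qed
    define M where "M = norm (w s (Suc K)) * norm \<alpha> / min 1 s"
    have bound: "cmod (complex_of_real (t ^ Suc K) * cinner (err t) \<alpha>) \<le> M / t" if t: "0 < t" for t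
    proof -
      have "min (Im (fst (?z t))) (Im (snd (?z t))) * norm (err t) \<le> norm (A (err t) - z_op Y (?z t) (err t))"
        by (rule pencil_lower_bound[OF Y A_sym])
      also have "\<dots> = norm (w s (Suc K)) / t ^ Suc K"
        unfolding err_eq[OF t] using t by (simp add: norm_divide norm_mult norm_power del: power_Suc)
      also have "min (Im (fst (?z t))) (Im (snd (?z t))) = t * min 1 s"
        using t by (simp add: min_mult_distrib_left)
      finally have "t ^ Suc K * norm (err t) \<le> norm (w s (Suc K)) / (t * min 1 s)"
        using t s by (simp add: field_simps del: power_Suc)
      then have "t ^ Suc K * norm (err t) * norm \<alpha> \<le> norm (w s (Suc K)) / (t * min 1 s) * norm \<alpha>"
        by (rule mult_right_mono) simp
      also have "\<dots> = M / t" by (simp add: M_def)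
      finally have 1: "t ^ Suc K * (norm (err t) * norm \<alpha>) \<le> M / t" by (simp add: mult.assoc)
      have "t ^ Suc K * cmod (cinner (err t) \<alpha>) \<le> t ^ Suc K * (norm (err t) * norm \<alpha>)"
        using t by (intro mult_left_mono cmod_cinner_le) auto
      from order_trans[OF this 1] show ?thesis using t by (simp add: norm_mult norm_power del: power_Suc)
    qed
    have lim1: "((\<lambda>t. complex_of_real (t ^ Suc K) * cinner (err t) \<alpha>) \<longlongrightarrow> 0) at_top"
    proof (rule Lim_null_comparison)
      show "\<forall>\<^sub>F t in at_top. cmod (complex_of_real (t ^ Suc K) * cinner (err t) \<alpha>) \<le> M / t"
        using eventually_gt_at_top[of 0] by eventually_elim (rule bound)
      show "((\<lambda>t. M / t) \<longlongrightarrow> 0) at_top"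
        by (rule tendsto_divide_0[OF tendsto_const]) (rule filterlim_at_top_imp_at_infinity[OF filterlim_ident])
    qed
    have lim2: "((\<lambda>t. complex_of_real (t ^ Suc K) * (h (?z t) - (\<Sum>j<Suc K. r j / ?T t ^ Suc j))) \<longlongrightarrow> 0) at_top"
    proof -
      have "(\<Sum>n | 1 \<le> fst n + snd n \<and> fst n + snd n \<le> Suc K.
          complex_of_real (\<rho> n) / (?T t ^ fst n * (\<i> * of_real (t * s)) ^ snd n)) =
        (\<Sum>j<Suc K. r j / ?T t ^ Suc j)" for t
        unfolding sum_multi_indices
      proof (rule sum.cong[OF refl])
        fix j
        show "(\<Sum>i\<le>Suc j. complex_of_real (\<rho> (i, Suc j - i)) / (?T t ^ fst (i, Suc j - i) *
            (\<i> * of_real (t * s)) ^ snd (i, Suc j - i))) = r j / ?T t ^ Suc j"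
          unfolding r_def sum_divide_distrib
        proof (rule sum.cong[OF refl])
          fix i assume i: "i \<in> {..Suc j}"
          have "?T t ^ i * (\<i> * of_real (t * s)) ^ (Suc j - i) = ?T t ^ i * (?T t ^ (Suc j - i) * S ^ (Suc j - i))"
            by (simp add: S_def power_mult_distrib mult_ac)
          also have "\<dots> = ?T t ^ Suc j * S ^ (Suc j - i)"
            using i by (simp add: mult.assoc[symmetric] power_add[symmetric] del: power_Suc)
          finally show "complex_of_real (\<rho> (i, Suc j - i)) / (?T t ^ fst (i, Suc j - i) *
            (\<i> * of_real (t * s)) ^ snd (i, Suc j - i)) =
            complex_of_real (\<rho> (i, Suc j - i)) / complex_of_real s ^ (Suc j - i) / ?T t ^ Suc j"
            by (simp add: S_def mult.commute del: power_Suc)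
        qed
      qed
      then show ?thesis using asym[OF s, of "Suc K"] by simp
    qed
    have "\<forall>\<^sub>F t in at_top. complex_of_real (t ^ Suc K) * (h (?z t) - (\<Sum>j<Suc K. r j / ?T t ^ Suc j)) -
        complex_of_real (t ^ Suc K) * cinner (err t) \<alpha> =
        complex_of_real (t ^ Suc K) * (\<Sum>j<Suc K. (g j - r j) / ?T t ^ Suc j)"
      using eventually_gt_at_top[of 0]
    proof eventually_elim
      case (elim t)
      have "cinner (err t) \<alpha> = h (?z t) - (\<Sum>j<Suc K. g j / ?T t ^ Suc j)"
        unfolding err_def h_eq[OF zU[OF elim]] g_def
        by (simp add: cinner_add_left cinner_sum_left cinner_scaleC_left sum_negf del: sum.lessThan_Suc)
      then show ?case
        by (simp only: diff_divide_distrib sum_subtractf) (simp add: algebra_simps del: sum.lessThan_Suc power_Suc)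
    qed
    with tendsto_diff[OF lim2 lim1]
    show "((\<lambda>t. complex_of_real (t ^ Suc K) * (\<Sum>j<Suc K. (g j - r j) / ?T t ^ Suc j)) \<longlongrightarrow> 0) at_top"
      by (simp add: Lim_transform_eventually del: sum.lessThan_Suc power_Suc)
  qed
  then show ?thesis by (simp add: g_def r_def)
qed

definition lf :: "'a \<Rightarrow> complex poly" where "lf e = [:complex_of_real (ev e), 1 - complex_of_real (ev e):]"

text \<open>Coordinates of the homogeneous layers of the expansion of the resolvent vector in the
  eigenbasis of \<open>Y\<close>, as polynomials in \<open>s\<close>.\<close>

primrec sg :: "nat \<Rightarrow> 'a \<Rightarrow> complex poly" where
  "sg 0 e = [:cinner \<alpha> e:]"
| "sg (Suc k) e = (\<Sum>e'\<in>E. smult (cinner (A e') e) (pCons 0 (sg k e') div lf e'))"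

text \<open>Coordinates of a layer after applying \<open>R\<close>; \<open>div\<close> becomes exact
  division once \<open>lf_dvd\<close> is known. The factor X accounts for the normalization by s^k
  before and s^(k+1) after that application.\<close>

definition bt :: "nat \<Rightarrow> 'a \<Rightarrow> complex poly" where "bt k e = pCons 0 (sg k e) div lf e"

lemma lf_nonzero: "lf e \<noteq> 0" by (auto simp: lf_def)

lemma poly_lf: "poly (lf e) (of_real s) = of_real (ell (ev e) s)"
  by (simp add: lf_def ell_def)

text \<open>Divisibility is asked of the earlier layers only, so that the formula can be used within
  the induction that proves divisibility.\<close>

lemma w_eq:
  assumes s: "0 < s" and dv: "\<And>j e. j < k \<Longrightarrow> e \<in> E \<Longrightarrow> lf e dvd pCons 0 (sg j e)"
  shows "w s k = (\<Sum>e\<in>E. (poly (sg k e) (of_real s) / of_real s ^ k) *\<^sub>C e)"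
  using dv
proof (induction k)
  case 0
  then show ?case using expand[OF alpha_span] by (simp add: w_0)
next
  case (Suc k)
  have IH: "w s k = (\<Sum>e\<in>E. (poly (sg k e) (of_real s) / of_real s ^ k) *\<^sub>C e)"
    using Suc.prems by (intro Suc.IH) auto
  have "R s (w s k) = (\<Sum>e\<in>E. (poly (bt k e) (of_real s) / of_real s ^ Suc k) *\<^sub>C e)"
    unfolding R_def
  proof (rule sum.cong[OF refl])
    fix e assume e: "e \<in> E"
    have "lf e * bt k e = pCons 0 (sg k e)" using Suc.prems[of k e] e by (simp add: bt_def)
    from arg_cong[OF this, of "\<lambda>p. poly p (of_real s)"]
    have "of_real (ell (ev e) s) * poly (bt k e) (of_real s) = of_real s * poly (sg k e) (of_real s)"
      by (simp add: poly_lf)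
    moreover have "cinner (w s k) e = poly (sg k e) (of_real s) / of_real s ^ k"
      unfolding IH by (rule cinner_comb[OF e])
    ultimately have "cinner (w s k) e / complex_of_real (ell (ev e) s) = poly (bt k e) (of_real s) / of_real s ^ Suc k"
      using ell_pos[OF e s] s by (simp add: field_simps)
    then show "(cinner (w s k) e / complex_of_real (ell (ev e) s)) *\<^sub>C e =
        (poly (bt k e) (of_real s) / of_real s ^ Suc k) *\<^sub>C e" by simp
  qed
  then show ?case
    unfolding w_Suc by (simp only: A_comb) (simp add: poly_sum bt_def sum_divide_distrib)
qed

lemma lf_dvd: "e \<in> E \<Longrightarrow> lf e dvd pCons 0 (sg k e)"
proof (induction k arbitrary: e rule: less_induct)
  case (less k)
  note e0 = \<open>e \<in> E\<close>
  define q where "q e = sg k e" for e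
  \<comment> \<open>The moment of order \<open>2 * k\<close> is a sum of squares over
    \<open>E\<close>; multiplied by s^(2k+1) its asymptotic value is a polynomial.\<close>
  have ident: "(\<Sum>e\<in>E. (cmod (poly (q e) (of_real s)))\<^sup>2 * s / ell (ev e) s) =
      - (\<Sum>i\<le>Suc (2 * k). \<rho> (i, Suc (2 * k) - i) * s ^ i)" if s: "0 < s" for s
  proof -
    have wk: "w s k = (\<Sum>e\<in>E. (poly (q e) (of_real s) / of_real s ^ k) *\<^sub>C e)"
      unfolding q_def by (rule w_eq[OF s less.IH])
    have "cinner (R s (w s k)) (w s k) =
        (\<Sum>e\<in>E. complex_of_real ((cmod (poly (q e) (of_real s)))\<^sup>2 / s ^ (2 * k) / ell (ev e) s))"
      unfolding R_def cinner_sum_left cinner_scaleC_left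
    proof (rule sum.cong[OF refl])
      fix e assume e: "e \<in> E"
      have 1: "cinner (w s k) e = poly (q e) (of_real s) / of_real s ^ k"
        unfolding wk by (rule cinner_comb[OF e])
      have 2: "cinner e (w s k) = cnj (cinner (w s k) e)" by (rule cinner_commute)
      have "cinner (w s k) e / complex_of_real (ell (ev e) s) * cinner e (w s k) =
          (cinner (w s k) e * cnj (cinner (w s k) e)) / complex_of_real (ell (ev e) s)"
        unfolding 2 by simp
      also have "\<dots> = complex_of_real ((cmod (cinner (w s k) e))\<^sup>2 / ell (ev e) s)"
        by (simp only: complex_norm_square[symmetric] of_real_divide)
      also have "(cmod (cinner (w s k) e))\<^sup>2 = (cmod (poly (q e) (of_real s)))\<^sup>2 / s ^ (2 * k)"
        unfolding 1 using s by (simp add: norm_divide norm_power power_divide power_mult power2_eq_square power_mult_distrib)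
      finally show "cinner (w s k) e / complex_of_real (ell (ev e) s) * cinner e (w s k) =
          complex_of_real ((cmod (poly (q e) (of_real s)))\<^sup>2 / s ^ (2 * k) / ell (ev e) s)" .
    qed
    moreover have "cinner (R s (w s k)) (w s k) = cinner (R s (w s (k + k))) \<alpha>"
      using moments_shift[of s k k 0] by (simp add: w_0)
    moreover have "cinner (R s (w s (k + k))) \<alpha> =
        - (\<Sum>i\<le>Suc (k + k). complex_of_real (\<rho> (i, Suc (k + k) - i)) / complex_of_real s ^ (Suc (k + k) - i))"
      unfolding moments[OF s, of "k + k", symmetric] by simp
    ultimately have "complex_of_real (\<Sum>e\<in>E. (cmod (poly (q e) (of_real s)))\<^sup>2 / s ^ (2 * k) / ell (ev e) s) =
        - (\<Sum>i\<le>Suc (k + k). complex_of_real (\<rho> (i, Suc (k + k) - i)) / complex_of_real s ^ (Suc (k + k) - i))"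
      by (simp only: of_real_sum)
    also have "\<dots> = complex_of_real (- (\<Sum>i\<le>Suc (2 * k). \<rho> (i, Suc (2 * k) - i) / s ^ (Suc (2 * k) - i)))"
      by (simp add: mult_2 del: sum.atMost_Suc)
    finally have "(\<Sum>e\<in>E. (cmod (poly (q e) (of_real s)))\<^sup>2 / s ^ (2 * k) / ell (ev e) s) =
        - (\<Sum>i\<le>Suc (2 * k). \<rho> (i, Suc (2 * k) - i) / s ^ (Suc (2 * k) - i))"
      by (simp only: of_real_eq_iff)
    from arg_cong[OF this, of "\<lambda>u. s ^ Suc (2 * k) * u"]
    have "(\<Sum>e\<in>E. s ^ Suc (2 * k) * ((cmod (poly (q e) (of_real s)))\<^sup>2 / s ^ (2 * k) / ell (ev e) s)) =
        - (\<Sum>i\<le>Suc (2 * k). s ^ Suc (2 * k) * (\<rho> (i, Suc (2 * k) - i) / s ^ (Suc (2 * k) - i)))"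
      by (simp only: sum_distrib_left mult_minus_right)
    moreover have "s ^ Suc (2 * k) * (\<rho> (i, Suc (2 * k) - i) / s ^ (Suc (2 * k) - i)) = \<rho> (i, Suc (2 * k) - i) * s ^ i"
      if "i \<in> {..Suc (2 * k)}" for i
    proof -
      have "s ^ Suc (2 * k) = s ^ i * s ^ (Suc (2 * k) - i)"
        unfolding power_add[symmetric] using that by simp
      then show ?thesis using s by simp
    qed
    moreover have "s ^ Suc (2 * k) * (u / s ^ (2 * k) / v) = u * s / v" for u v :: real
      using s by simp
    ultimately show ?thesis by (simp del: sum.atMost_Suc power_Suc)
  qed
  define y0 where "y0 = ev e"
  \<comment> \<open>For eigenvalue 0 the linear form is X, present through \<open>pCons 0\<close>;
    for eigenvalue 1 it is constant. Only in between is there a root to be studied, and it is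
    negative.\<close>
  consider "y0 = 0" | "y0 = 1" | "0 < y0" "y0 < 1" using ev_bounds[OF e0] unfolding y0_def by linarith
  then show ?case
  proof cases
    case 1
    then have "lf e = [:0, 1:]" by (simp add: lf_def y0_def)
    moreover have "pCons 0 (sg k e) = [:0, 1:] * sg k e" by simp
    ultimately show ?thesis by (metis dvd_triv_left)
  next
    case 2
    then have "lf e = 1" by (simp add: lf_def y0_def)
    then show ?thesis by simp
  next
    case 3
    \<comment> \<open>Denominators are cleared with one factor per distinct eigenvalue; with
      repetitions, a multiple eigenvalue would make all terms vanish at the root.\<close>
    define \<Lambda> where "\<Lambda> = ev ` E"
    have \<Lambda>: "finite \<Lambda>" "\<And>e. e \<in> E \<Longrightarrow> ev e \<in> \<Lambda>" using finE by (auto simp: \<Lambda>_def)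
    define f where "f s = (\<Sum>e\<in>E. (poly (q e) (of_real s) * cnj (poly (q e) (of_real s)) * of_real s) *
          (\<Prod>y\<in>\<Lambda> - {ev e}. of_real y + of_real s * of_real (1 - y))) +
        (\<Sum>i\<le>Suc (2 * k). of_real (\<rho> (i, Suc (2 * k) - i)) * poly (monom 1 i) (of_real s)) *
          (\<Prod>y\<in>\<Lambda>. of_real y + of_real s * of_real (1 - y))" for s
    have fr: "f s = complex_of_real ((\<Sum>e\<in>E. (cmod (poly (q e) (of_real s)))\<^sup>2 * s * (\<Prod>y\<in>\<Lambda> - {ev e}. ell y s)) +
        (\<Sum>i\<le>Suc (2 * k). \<rho> (i, Suc (2 * k) - i) * s ^ i) * (\<Prod>y\<in>\<Lambda>. ell y s))" for s
      by (simp only: f_def ell_def complex_norm_square[symmetric] poly_monom of_real_add of_real_mult of_real_sum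
        of_real_prod of_real_power mult_1)
    have poly: "real_poly_fun f"
      unfolding f_def[abs_def]
      by (intro real_poly_fun_add real_poly_fun_mult real_poly_fun_sum real_poly_fun_prod real_poly_fun_cnj
        real_poly_fun_poly real_poly_fun_const real_poly_fun_id)
    have f0: "f s = 0" for s
    proof (rule real_poly_fun_eq_0[OF poly])
      fix s :: real assume s: "0 < s"
      have "(\<Sum>e\<in>E. (cmod (poly (q e) (of_real s)))\<^sup>2 * s * (\<Prod>y\<in>\<Lambda> - {ev e}. ell y s)) =
          (\<Sum>e\<in>E. (cmod (poly (q e) (of_real s)))\<^sup>2 * s / ell (ev e) s) * (\<Prod>y\<in>\<Lambda>. ell y s)"
        unfolding sum_distrib_right
      proof (rule sum.cong[OF refl])
        fix e assume e: "e \<in> E"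
        have "(\<Prod>y\<in>\<Lambda>. ell y s) = ell (ev e) s * (\<Prod>y\<in>\<Lambda> - {ev e}. ell y s)"
          using \<Lambda> e by (intro prod.remove) auto
        then show "(cmod (poly (q e) (of_real s)))\<^sup>2 * s * (\<Prod>y\<in>\<Lambda> - {ev e}. ell y s) =
          (cmod (poly (q e) (of_real s)))\<^sup>2 * s / ell (ev e) s * (\<Prod>y\<in>\<Lambda>. ell y s)"
          using ell_pos[OF e s] by simp
      qed
      then have "(\<Sum>e\<in>E. (cmod (poly (q e) (of_real s)))\<^sup>2 * s * (\<Prod>y\<in>\<Lambda> - {ev e}. ell y s)) +
        (\<Sum>i\<le>Suc (2 * k). \<rho> (i, Suc (2 * k) - i) * s ^ i) * (\<Prod>y\<in>\<Lambda>. ell y s) = 0"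
        unfolding ident[OF s] by (simp del: sum.atMost_Suc)
      then show "f s = 0" unfolding fr by (simp only: of_real_0)
    qed
    \<comment> \<open>Root of the linear form of \<open>y0\<close>. Only the terms with eigenvalue
      \<open>y0\<close> survive there, all with the same nonzero factor \<open>s0 * C\<close>, so
      each of the squares must vanish.\<close>
    define s0 where "s0 = - y0 / (1 - y0)"
    have s0: "s0 < 0" using 3 by (simp add: s0_def divide_neg_pos)
    have ell0: "ell y s0 = (y - y0) / (1 - y0)" for y using 3 by (simp add: ell_def s0_def field_simps)
    have "y0 \<in> \<Lambda>" using \<Lambda>(2)[OF e0] by (simp add: y0_def)
    then have "(\<Prod>y\<in>\<Lambda>. ell y s0) = 0" using \<Lambda>(1) ell0[of y0] by (auto intro: prod_zero)
    then have sum0: "(\<Sum>e\<in>E. (cmod (poly (q e) (of_real s0)))\<^sup>2 * s0 * (\<Prod>y\<in>\<Lambda> - {ev e}. ell y s0)) = 0"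
      using f0[of s0] unfolding fr of_real_eq_0_iff by simp
    define C where "C = (\<Prod>y\<in>\<Lambda> - {y0}. ell y s0)"
    have C: "C \<noteq> 0" unfolding C_def using \<Lambda>(1) 3 by (auto simp: ell0)
    have summand: "(cmod (poly (q e) (of_real s0)))\<^sup>2 * s0 * (\<Prod>y\<in>\<Lambda> - {ev e}. ell y s0) =
        s0 * C * (if ev e = y0 then (cmod (poly (q e) (of_real s0)))\<^sup>2 else 0)" if "e \<in> E" for e
    proof (cases "ev e = y0")
      case False
      then have "(\<Prod>y\<in>\<Lambda> - {ev e}. ell y s0) = 0"
        using \<open>y0 \<in> \<Lambda>\<close> \<Lambda>(1) ell0[of y0] by (intro prod_zero) auto
      then show ?thesis using False by simp
    qed (simp add: C_def)
    have "(\<Sum>e\<in>E. (cmod (poly (q e) (of_real s0)))\<^sup>2 * s0 * (\<Prod>y\<in>\<Lambda> - {ev e}. ell y s0)) =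
        s0 * C * (\<Sum>e\<in>E. if ev e = y0 then (cmod (poly (q e) (of_real s0)))\<^sup>2 else 0)"
      unfolding sum_distrib_left by (rule sum.cong[OF refl summand])
    then have "(\<Sum>e\<in>E. if ev e = y0 then (cmod (poly (q e) (of_real s0)))\<^sup>2 else 0) = 0"
      using sum0 s0 C by simp
    then have "\<forall>e\<in>E. (if ev e = y0 then (cmod (poly (q e) (of_real s0)))\<^sup>2 else 0) = 0"
      by (subst (asm) sum_nonneg_eq_0_iff) (auto simp: finE)
    then have "poly (q e) (of_real s0) = 0" using e0 by (auto simp: y0_def)
    then obtain q' where q': "sg k e = [:- complex_of_real s0, 1:] * q'"
      unfolding q_def poly_eq_0_iff_dvd by (rule dvdE)
    define c where "c = complex_of_real (1 - y0)"
    have c: "c \<noteq> 0" unfolding c_def of_real_eq_0_iff using 3 by simp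
    have "(1 - y0) * s0 = - y0" using 3 by (simp add: s0_def)
    then have cs: "c * complex_of_real s0 = - complex_of_real y0"
      unfolding c_def by (metis of_real_mult of_real_minus)
    have "lf e = smult c [:- complex_of_real s0, 1:]"
      by (simp add: lf_def y0_def[symmetric] cs) (simp add: c_def)
    moreover have "smult c [:- complex_of_real s0, 1:] dvd sg k e"
      unfolding q' by (rule smult_dvd[OF dvd_triv_left c])
    ultimately have "lf e dvd [:0, 1:] * sg k e" by (metis dvd_mult)
    then show ?thesis by simp
  qed
qed

lemma lf_bt: "e \<in> E \<Longrightarrow> lf e * bt k e = pCons 0 (sg k e)"
  using lf_dvd[of e k] by (simp add: bt_def)

lemma degree_sg_bt: "degree (sg k e) \<le> k" "e \<in> E \<Longrightarrow> degree (bt k e) \<le> Suc k"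
proof -
  have bt: "degree (bt k e) \<le> Suc k" if "degree (sg k e) \<le> k" "e \<in> E" for k e
  proof (cases "bt k e = 0")
    case False
    then have "degree (bt k e) \<le> degree (lf e * bt k e)"
      using lf_nonzero by (simp add: degree_mult_eq)
    also have "\<dots> \<le> Suc k" unfolding lf_bt[OF that(2)] using that(1) degree_pCons_le order_trans by fastforce
    finally show ?thesis .
  qed simp
  show sg: "degree (sg k e) \<le> k" for k e
  proof (induction k arbitrary: e)
    case (Suc k)
    have "degree (sg (Suc k) e) \<le> Suc k"
      unfolding sg.simps(2) bt_def[symmetric]
    proof (rule degree_sum_le[OF finE])
      fix e' assume "e' \<in> E"
      then show "degree (smult (cinner (A e') e) (bt k e')) \<le> Suc k"
        using bt[OF Suc.IH] degree_smult_le order_trans by blast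
    qed
    then show ?case .
  qed simp
  show "e \<in> E \<Longrightarrow> degree (bt k e) \<le> Suc k" using bt[OF sg] .
qed

text \<open>Coefficientwise the divisibility relation is the definition of a moment sequence in
  eigencoordinates: the extreme coefficients give the conditions at (0, l) and (l, 0), the others
  the relation for \<open>A\<close>.\<close>

lemma coeff_lf_bt:
  assumes e: "e \<in> E"
  shows "complex_of_real (ev e) * coeff (bt k e) 0 = 0"
    and "complex_of_real (ev e) * coeff (bt k e) (Suc i) + (1 - complex_of_real (ev e)) * coeff (bt k e) i = coeff (sg k e) i"
    and "(1 - complex_of_real (ev e)) * coeff (bt k e) (Suc k) = 0"
proof -
  have eq: "smult (complex_of_real (ev e)) (bt k e) + pCons 0 (smult (1 - complex_of_real (ev e)) (bt k e)) = pCons 0 (sg k e)"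
    using lf_bt[OF e, of k] by (simp add: lf_def)
  from arg_cong[OF eq, of "\<lambda>p. coeff p 0"] show "complex_of_real (ev e) * coeff (bt k e) 0 = 0" by simp
  show g: "complex_of_real (ev e) * coeff (bt k e) (Suc i) + (1 - complex_of_real (ev e)) * coeff (bt k e) i = coeff (sg k e) i" for i
    using arg_cong[OF eq, of "\<lambda>p. coeff p (Suc i)"] by simp
  have "coeff (bt k e) (Suc (Suc k)) = 0" "coeff (sg k e) (Suc k) = 0"
    using degree_sg_bt(1)[of k e] degree_sg_bt(2)[OF e, of k] by (auto intro!: coeff_eq_0)
  then show "(1 - complex_of_real (ev e)) * coeff (bt k e) (Suc k) = 0" using g[of "Suc k"] by simp
qed

text \<open>Layer \<open>k\<close> is \<open>bt k\<close> divided by s^(k+1), so the term in X^i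
  carries the power of 1/s with exponent k + 1 - i; this is the second index, and \<open>i\<close>
  the first.\<close>

definition avec :: "nat \<times> nat \<Rightarrow> 'a" where
  "avec n = (\<Sum>e\<in>E. coeff (bt (fst n + snd n - 1) e) (fst n) *\<^sub>C e)"

lemma comb_cong: "(\<And>e. e \<in> E \<Longrightarrow> c e = d e) \<Longrightarrow> (\<Sum>e\<in>E. c e *\<^sub>C e) = (\<Sum>e\<in>E. d e *\<^sub>C e)"
  by (rule sum.cong) auto

lemma avec_sum: "avec (1, 0) + avec (0, 1) = \<alpha>"
proof -
  have "coeff (bt 0 e) 1 + coeff (bt 0 e) 0 = cinner \<alpha> e" if e: "e \<in> E" for e
    using coeff_lf_bt(1,3)[OF e, of 0] coeff_lf_bt(2)[OF e, of 0 0] by (auto simp: algebra_simps)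
  then have "(\<Sum>e\<in>E. (coeff (bt 0 e) 1 + coeff (bt 0 e) 0) *\<^sub>C e) = (\<Sum>e\<in>E. cinner \<alpha> e *\<^sub>C e)"
    by (rule comb_cong)
  also have "\<dots> = \<alpha>" using expand[OF alpha_span] by simp
  finally show ?thesis by (simp add: avec_def scaleC_add_left sum.distrib)
qed

lemma infinite_HVMS_avec: "infinite_HVMS avec Y UNIV A"
  unfolding infinite_HVMS_def
proof (intro conjI ballI allI impI)
  show "positive_contraction Y" by (rule Y)
  show "densely_defined_self_adjoint UNIV A"
    unfolding densely_defined_self_adjoint_def
  proof (intro conjI)
    show "clinear_on UNIV A" by (simp add: clinear_on_def A_add A_scale)
    show "adjoint_graph UNIV A = op_graph UNIV A"
    proof (rule set_eqI)
      fix yw :: "'a \<times> 'a"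
      obtain y w where yw: "yw = (y, w)" by (cases yw)
      have "(\<forall>x. cinner (A x) y = cinner x w) \<longleftrightarrow> w = A y"
      proof
        assume "\<forall>x. cinner (A x) y = cinner x w"
        then have "\<forall>x. cinner x (A y - w) = 0" by (simp add: A_sym cinner_diff_right)
        then have "cinner (A y - w) (A y - w) = 0" by blast
        then show "w = A y" by simp
      qed (simp add: A_sym)
      then show "yw \<in> adjoint_graph UNIV A \<longleftrightarrow> yw \<in> op_graph UNIV A"
        by (auto simp: yw adjoint_graph_def op_graph_def)
    qed
  qed simp
next
  fix l :: nat assume l: "1 \<le> l"
  show "Y (avec (0, l)) = 0"
    unfolding avec_def Y_comb by (rule sum.neutral) (use coeff_lf_bt(1) in auto)
  have "avec (l, 0) - Y (avec (l, 0)) = (\<Sum>e\<in>E. ((1 - complex_of_real (ev e)) * coeff (bt (l - 1) e) l) *\<^sub>C e)"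
    unfolding avec_def Y_comb sum_subtractf[symmetric]
    by (intro sum.cong refl) (simp add: left_diff_distrib ch.scale_left_diff_distrib)
  also have "\<dots> = 0" by (rule sum.neutral) (use coeff_lf_bt(3)[of _ "l - 1"] l in auto)
  finally show "avec (l, 0) - Y (avec (l, 0)) = 0" .
next
  fix n :: "nat \<times> nat" assume n: "n \<in> index_set"
  show "avec n \<in> UNIV" by simp
  obtain i j where ij: "n = (i, j)" by (cases n)
  define k where "k = i + j - 1"
  have k: "i + j = Suc k" using n ij by (cases "i + j") (auto simp: k_def index_set_def)
  have "A (avec n) = (\<Sum>e\<in>E. (\<Sum>e'\<in>E. cinner (A e') e * coeff (bt k e') i) *\<^sub>C e)"
    unfolding avec_def A_comb by (simp add: ij k_def)
  also have "\<dots> = (\<Sum>e\<in>E. coeff (sg (Suc k) e) i *\<^sub>C e)"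
    by (simp add: coeff_sum bt_def[symmetric])
  also have "\<dots> = (\<Sum>e\<in>E. (complex_of_real (ev e) * coeff (bt (Suc k) e) (Suc i) +
      (coeff (bt (Suc k) e) i - complex_of_real (ev e) * coeff (bt (Suc k) e) i)) *\<^sub>C e)"
    using coeff_lf_bt(2)[of _ "Suc k" i] by (intro comb_cong) (simp add: algebra_simps)
  also have "\<dots> = Y (avec (n + (1, 0))) + (avec (n + (0, 1)) - Y (avec (n + (0, 1))))"
    unfolding avec_def Y_comb
    by (simp add: ij k sum.distrib sum_subtractf scaleC_add_left ch.scale_left_diff_distrib)
  finally show "A (avec n) = Y (avec (n + (1, 0))) + (avec (n + (0, 1)) - Y (avec (n + (0, 1))))" .
qed

text \<open>Every column is a combination of the finitely many columns of inner products of a basis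
  vector in \<open>E\<close> with the moment vectors.\<close>

lemma finite_rank_avec: "finite_rank (\<lambda>m n. gram1 avec Y m n + gram2 avec Y m n)"
proof -
  let ?M = "\<lambda>m n. gram1 avec Y m n + gram2 avec Y m n"
  have M: "?M m n = cinner (avec n) (avec m)" for m n
    by (simp add: gram1_def gram2_def cinner_diff_left)
  define c where "c e m = (if m \<in> index_set then cinner e (avec m) else 0)" for e m
  have col: "matrix_column ?M n = (\<Sum>e\<in>E. (\<lambda>m. coeff (bt (fst n + snd n - 1) e) (fst n) * c e m))" for n
  proof (rule ext)
    fix m
    have "(\<Sum>e\<in>E. (\<lambda>m. d e * c e m)) m = (\<Sum>e\<in>E. d e * c e m)" for d :: "'a \<Rightarrow> complex"
      using finE by (induction E rule: finite_induct) auto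
    then show "matrix_column ?M n m = (\<Sum>e\<in>E. (\<lambda>m. coeff (bt (fst n + snd n - 1) e) (fst n) * c e m)) m"
      by (simp only:) (auto simp: matrix_column_def M c_def avec_def[of n] cinner_sum_left cinner_scaleC_left)
  qed
  have cs: "(\<Sum>e\<in>E. (\<lambda>m. d e * c e m)) \<in> cfun.span (c ` E)" for d :: "'a \<Rightarrow> complex"
    by (rule cfun.span_sum, rule cfun.span_scale, rule cfun.span_base, rule imageI)
  have sub: "matrix_column ?M ` index_set \<subseteq> cfun.span (c ` E)"
    unfolding col by (rule image_subsetI) (rule cs)
  obtain B where B: "B \<subseteq> matrix_column ?M ` index_set" "\<not> cfun.dependent B"
    "matrix_column ?M ` index_set \<subseteq> cfun.span B"
    using cfun.maximal_independent_subset[of "matrix_column ?M ` index_set"] by blast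
  have "finite B"
    using cfun.independent_span_bound[OF finite_imageI[OF finE] B(2)] B(1) sub by blast
  moreover have "cfun.span (matrix_column ?M ` index_set) = cfun.span B"
  proof
    show "cfun.span (matrix_column ?M ` index_set) \<subseteq> cfun.span B"
      by (rule cfun.span_minimal[OF B(3) cfun.subspace_span])
    show "cfun.span B \<subseteq> cfun.span (matrix_column ?M ` index_set)" by (rule cfun.span_mono[OF B(1)])
  qed
  ultimately show ?thesis unfolding finite_rank_def by blast
qed

lemma representation:
  assumes z: "z \<in> bi_upper"
  shows "h z = cinner (resolvent UNIV A Y z (avec (1, 0) + avec (0, 1))) (avec (1, 0) + avec (0, 1))"
proof -
  have "resolvent UNIV A Y z \<alpha> = x z"
    by (rule resolvent_eq[OF _ A_sym Y z _ x_eq[OF z]]) (auto simp: clinear_on_def A_add A_scale)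
  then show ?thesis unfolding avec_sum using h_eq[OF z] by simp
qed

end

section \<open>Realizations from a kernel decomposition\<close>

text \<open>Vectors are added one at a time: the component of the new one orthogonal to the old span
  corrects its value without disturbing the others.\<close>

lemma interpolating_vector:
  fixes B :: "'a::complex_hilbert set"
  assumes "finite B" "\<not> ch.dependent B"
  shows "\<exists>v\<in>ch.span B. \<forall>b\<in>B. cinner b v = c b"
  using assms
proof (induction B)
  case empty
  then show ?case by (intro bexI[of _ 0]) (auto simp: ch.span_zero)
next
  case (insert b B)
  have b: "b \<notin> ch.span B" "\<not> ch.dependent B"
    using insert.prems insert.hyps(2) by (auto simp: ch.independent_insert)
  obtain v0 where v0: "v0 \<in> ch.span B" "\<forall>b\<in>B. cinner b v0 = c b" using insert.IH[OF b(2)] by blast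
  obtain E where E: "finite E" "orthonormal E" "ch.span E = ch.span B"
    using orthonormal_basis_exists[OF insert.hyps(1)] by blast
  define w where "w = b - proj_on E b"
  have pE: "proj_on E b \<in> ch.span B" using proj_on_in_span[of E b] E(3) by simp
  have w0: "w \<noteq> 0" using b(1) pE by (auto simp: w_def)
  have worth: "cinner w y = 0" if "y \<in> ch.span B" for y
    unfolding w_def using proj_on_orthogonal[OF E(1,2)] that E(3) by blast
  have bw: "cinner b w = (norm w)\<^sup>2"
  proof -
    have "cinner b w = cinner w w + cinner (proj_on E b) w"
      by (simp add: w_def cinner_diff_left)
    moreover have "cinner (proj_on E b) w = 0" using worth[OF pE] cinner_eq_0_sym by blast
    ultimately show ?thesis by (simp add: cinner_self)
  qed
  define l where "l = cnj ((c b - cinner b v0) / (norm w)\<^sup>2)"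
  let ?v = "v0 + l *\<^sub>C w"
  have mono: "ch.span B \<subseteq> ch.span (insert b B)" by (rule ch.span_mono) auto
  have "?v \<in> ch.span (insert b B)"
    unfolding w_def using v0(1) pE mono
    by (intro ch.span_add ch.span_scale ch.span_diff) (auto intro: ch.span_base)
  moreover have "cinner b ?v = c b"
    using w0 by (simp add: cinner_add_right bw l_def)
  moreover have "cinner b' ?v = c b'" if "b' \<in> B" for b'
  proof -
    have "cinner b' w = 0" using worth[of b'] that cinner_eq_0_sym by (metis ch.span_base)
    then show ?thesis using v0(2) that by (simp add: cinner_add_right)
  qed
  ultimately show ?case by blast
qed

text \<open>Let P project onto the first summand and x = x1 + x2. Once h(z) = <x(z), \<alpha>>, the
  kernel identity reads <z_P x(z) + \<alpha>, x(v)> = <x(z), v_P x(v) + \<alpha>>. So x(z) -> z_P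
  x(z) + \<alpha> compresses to a symmetric operator \<open>A\<close> on the span of the x(z), and
  (A - z_Y) x(z) = \<alpha> for the compression \<open>Y\<close> of P.\<close>

theorem HVMS_from_kernel:
  fixes x1 x2 :: "complex \<times> complex \<Rightarrow> 'a::complex_hilbert" and \<rho> :: "nat \<times> nat \<Rightarrow> real"
  assumes fin: "finite B1" "finite B2" and orth: "\<And>x y. x \<in> B1 \<Longrightarrow> y \<in> B2 \<Longrightarrow> cinner x y = 0"
    and x1: "\<And>z. z \<in> bi_upper \<Longrightarrow> x1 z \<in> ch.span B1" and x2: "\<And>z. z \<in> bi_upper \<Longrightarrow> x2 z \<in> ch.span B2"
    and ker: "\<And>z v. z \<in> bi_upper \<Longrightarrow> v \<in> bi_upper \<Longrightarrow> h z - cnj (h v) =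
      (fst z - cnj (fst v)) * cinner (x1 z) (x1 v) + (snd z - cnj (snd v)) * cinner (x2 z) (x2 v)"
    and asym: "\<And>s K. 0 < s \<Longrightarrow> 1 \<le> K \<Longrightarrow> ((\<lambda>t. complex_of_real (t ^ K) *
       (h (\<i> * of_real t, \<i> * of_real (t * s)) - (\<Sum>n | 1 \<le> fst n + snd n \<and> fst n + snd n \<le> K.
          complex_of_real (\<rho> n) / ((\<i> * of_real t) ^ fst n * (\<i> * of_real (t * s)) ^ snd n)))) \<longlongrightarrow> 0) at_top"
  shows "\<exists>(\<alpha> :: nat \<times> nat \<Rightarrow> 'a) Y D A. infinite_HVMS \<alpha> Y D A \<and>
    (\<forall>z\<in>bi_upper. h z = cinner (resolvent D A Y z (\<alpha> (1, 0) + \<alpha> (0, 1))) (\<alpha> (1, 0) + \<alpha> (0, 1))) \<and>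
    finite_rank (\<lambda>m n. gram1 \<alpha> Y m n + gram2 \<alpha> Y m n)"
proof -

  \<comment> \<open>The kernel identity in operator form\<close>
  define x where "x z = x1 z + x2 z" for z
  have span_orth: "cinner u v = 0" if "u \<in> ch.span B1" "v \<in> ch.span B2" for u v
  proof -
    have "cinner b v = 0" if "b \<in> B1" for b
      by (rule cinner_span_eq_0[OF \<open>v \<in> ch.span B2\<close>]) (use orth that in auto)
    then have "cinner v u = 0"
      by (intro cinner_span_eq_0[OF \<open>u \<in> ch.span B1\<close>]) (use cinner_eq_0_sym in blast)
    then show ?thesis using cinner_eq_0_sym by blast
  qed
  have span_orth': "cinner v u = 0" if "u \<in> ch.span B1" "v \<in> ch.span B2" for u v
    using span_orth[OF that] cinner_eq_0_sym by blast
  obtain E1 where E1: "finite E1" "orthonormal E1" "ch.span E1 = ch.span B1"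
    using orthonormal_basis_exists[OF fin(1)] by blast
  define P where "P = proj_on E1"
  have P_sym: "cinner (P u) v = cinner u (P v)" for u v unfolding P_def by (rule cinner_proj_on_swap)
  have Px: "P (x z) = x1 z" if z: "z \<in> bi_upper" for z
  proof -
    have "proj_on E1 (x1 z) = x1 z" using proj_on_eq[OF E1(1,2)] x1[OF z] E1(3) by blast
    moreover have "proj_on E1 (x2 z) = 0"
      unfolding proj_on_def
    proof (rule sum.neutral, rule ballI)
      fix e assume "e \<in> E1"
      then have "e \<in> ch.span B1" using E1(3) ch.span_base by blast
      then show "cinner (x2 z) e *\<^sub>C e = 0" using span_orth' x2[OF z] by simp
    qed
    ultimately show ?thesis by (simp add: P_def x_def proj_on_add)
  qed
  have ker': "h z - cnj (h v) = cinner (z_op P z (x z)) (x v) - cinner (x z) (z_op P v (x v))"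
    if z: "z \<in> bi_upper" and v: "v \<in> bi_upper" for z v
  proof -
    have "z_op P u (x u) = fst u *\<^sub>C x1 u + snd u *\<^sub>C x2 u" if "u \<in> bi_upper" for u
      unfolding z_op_def Px[OF that] by (simp add: x_def)
    then show ?thesis
      unfolding ker[OF z v] using z v span_orth[OF x1 x2] span_orth'[OF x1 x2]
      by (simp add: x_def cinner_simps algebra_simps)
  qed
  let ?X = "x ` bi_upper"
  obtain Bs where Bs: "Bs \<subseteq> ?X" "\<not> ch.dependent Bs" "?X \<subseteq> ch.span Bs"
    using ch.maximal_independent_subset[of ?X] by blast
  have Xfin: "?X \<subseteq> ch.span (B1 \<union> B2)"
    using x1 x2 ch.span_mono[of B1 "B1 \<union> B2"] ch.span_mono[of B2 "B1 \<union> B2"]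
    by (auto simp: x_def intro!: ch.span_add)
  have finBs: "finite Bs"
    using ch.independent_span_bound[of "B1 \<union> B2" Bs] fin Bs Xfin by auto
  have xS: "x z \<in> ch.span Bs" if "z \<in> bi_upper" for z using Bs(3) that by blast
  have span_ext: "u = v" if "u \<in> ch.span Bs" "v \<in> ch.span Bs" "\<And>z. z \<in> bi_upper \<Longrightarrow> cinner u (x z) = cinner v (x z)"
    for u v
  proof -
    have "u - v \<in> ch.span Bs" using that by (intro ch.span_diff)
    then have "cinner (u - v) (u - v) = 0"
      by (rule cinner_span_eq_0) (use Bs(1) that(3) in \<open>auto simp: cinner_diff_left\<close>)
    then show ?thesis by simp
  qed

  \<comment> \<open>Decay of \<open>h\<close> and \<open>x\<close> along the diagonal ray\<close>
  define T where "T t = (\<i> * complex_of_real t, \<i> * complex_of_real t)" for t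
  have TU: "T t \<in> bi_upper" if "0 < t" for t using that by (simp add: T_def upper_half_plane_def)
  have hT: "((\<lambda>t. h (T t)) \<longlongrightarrow> 0) at_top"
  proof -
    define a where "a = complex_of_real (\<rho> (0, 1)) / \<i> + complex_of_real (\<rho> (1, 0)) / \<i>"
    have S: "(\<Sum>n | 1 \<le> fst n + snd n \<and> fst n + snd n \<le> 1.
          complex_of_real (\<rho> n) / ((\<i> * of_real t) ^ fst n * (\<i> * of_real (t * 1)) ^ snd n)) = a / of_real t" for t
      unfolding sum_multi_indices a_def add_divide_distrib divide_divide_eq_left by simp
    have 1: "((\<lambda>t. complex_of_real t * (h (T t) - a / of_real t)) \<longlongrightarrow> 0) at_top"
      using asym[of 1 1] unfolding S by (simp add: T_def)
    have 2: "((\<lambda>t. 1 / complex_of_real t) \<longlongrightarrow> 0) at_top"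
      by (rule tendsto_divide_0[OF tendsto_const]) (simp add: filterlim_at_infinity_conv_norm_at_top filterlim_abs_real)
    have "((\<lambda>t. complex_of_real t * (h (T t) - a / of_real t) * (1 / complex_of_real t) + a * (1 / complex_of_real t))
      \<longlongrightarrow> 0 * 0 + a * 0) at_top"
      by (intro tendsto_intros 1 2)
    moreover have "\<forall>\<^sub>F t in at_top. complex_of_real t * (h (T t) - a / of_real t) * (1 / complex_of_real t) +
        a * (1 / complex_of_real t) = h (T t)"
      using eventually_gt_at_top[of 0] by eventually_elim (simp add: field_simps)
    ultimately show ?thesis by (simp add: Lim_transform_eventually)
  qed
  have xT: "((\<lambda>t. x (T t)) \<longlongrightarrow> 0) at_top"
  proof -
    have nx: "t * (norm (x (T t)))\<^sup>2 \<le> cmod (h (T t))" if t: "0 < t" for t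
    proof -
      have "h (T t) - cnj (h (T t)) = (2 * \<i> * of_real t) * (cinner (x1 (T t)) (x1 (T t)) + cinner (x2 (T t)) (x2 (T t)))"
        unfolding ker[OF TU[OF t] TU[OF t]] by (simp add: T_def algebra_simps)
      also have "cinner (x1 (T t)) (x1 (T t)) + cinner (x2 (T t)) (x2 (T t)) = cinner (x (T t)) (x (T t))"
        using span_orth[OF x1[OF TU[OF t]] x2[OF TU[OF t]]] span_orth'[OF x1[OF TU[OF t]] x2[OF TU[OF t]]]
        by (simp add: x_def cinner_simps)
      finally have "Im (h (T t)) = t * (norm (x (T t)))\<^sup>2"
        by (simp add: cinner_self complex_eq_iff flip: of_real_power)
      then show ?thesis using abs_Im_le_cmod[of "h (T t)"] by simp
    qed
    have "((\<lambda>t. (norm (x (T t)))\<^sup>2) \<longlongrightarrow> 0) at_top"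
    proof (rule Lim_null_comparison[OF _ tendsto_norm_zero[OF hT]])
      show "\<forall>\<^sub>F t in at_top. norm ((norm (x (T t)))\<^sup>2) \<le> cmod (h (T t))"
        using eventually_ge_at_top[of 1]
      proof eventually_elim
        case (elim t)
        then have "(norm (x (T t)))\<^sup>2 \<le> t * (norm (x (T t)))\<^sup>2" by (simp add: mult_right_mono[of 1 t, simplified])
        then show ?case using nx[of t] elim by simp
      qed
    qed
    from tendsto_real_sqrt[OF this] show ?thesis by (simp add: tendsto_norm_zero_iff)
  qed

  \<comment> \<open>The vector representing \<open>h\<close> as a linear functional of
    \<open>x\<close>\<close>
  have "\<forall>b\<in>Bs. \<exists>z\<in>bi_upper. b = x z" using Bs(1) by blast
  then obtain zb where zb: "\<And>b. b \<in> Bs \<Longrightarrow> zb b \<in> bi_upper" "\<And>b. b \<in> Bs \<Longrightarrow> b = x (zb b)" by metis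
  obtain \<alpha> where \<alpha>: "\<alpha> \<in> ch.span Bs" "\<forall>b\<in>Bs. cinner b \<alpha> = h (zb b)"
    using interpolating_vector[OF finBs Bs(2), of "\<lambda>b. h (zb b)"] by blast
  have h_eq: "h z = cinner (x z) \<alpha>" if z: "z \<in> bi_upper" for z
  proof -
    obtain c where c: "x z = (\<Sum>b\<in>Bs. c b *\<^sub>C b)" using xS[OF z] ch.span_finite[OF finBs] by auto
    \<comment> \<open>\<open>d\<close> measures how far \<open>h\<close> is from depending linearly
      on \<open>x\<close>. When every point is compared with \<open>T t\<close>, the terms
      containing \<open>z_op P (T t)\<close> cancel, and the rest tends to 0 together with
      \<open>h (T t)\<close> and \<open>x (T t)\<close>.\<close>
    define u where "u = (\<Sum>b\<in>Bs. c b *\<^sub>C z_op P (zb b) b) - z_op P z (x z)"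
    define d where "d = (\<Sum>b\<in>Bs. c b * h (zb b)) - h z"
    have dt: "d = ((\<Sum>b\<in>Bs. c b) - 1) * cnj (h (T t)) + cinner u (x (T t))" if t: "0 < t" for t
    proof -
      have 1: "c b * h (zb b) = c b * cnj (h (T t)) + c b * cinner (z_op P (zb b) b) (x (T t)) -
          c b * cinner b (z_op P (T t) (x (T t)))" if "b \<in> Bs" for b
      proof -
        have "h (zb b) = cnj (h (T t)) + cinner (z_op P (zb b) b) (x (T t)) - cinner b (z_op P (T t) (x (T t)))"
          using ker'[OF zb(1)[OF that] TU[OF t]] zb(2)[OF that, symmetric] by (simp add: algebra_simps)
        then show ?thesis by (simp only: distrib_left right_diff_distrib)
      qed
      have "(\<Sum>b\<in>Bs. c b * h (zb b)) = (\<Sum>b\<in>Bs. c b * cnj (h (T t)) + c b * cinner (z_op P (zb b) b) (x (T t)) -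
          c b * cinner b (z_op P (T t) (x (T t))))" by (rule sum.cong[OF refl 1])
      also have "\<dots> = (\<Sum>b\<in>Bs. c b) * cnj (h (T t)) + cinner (\<Sum>b\<in>Bs. c b *\<^sub>C z_op P (zb b) b) (x (T t)) -
          cinner (x z) (z_op P (T t) (x (T t)))"
        unfolding c by (simp add: sum.distrib sum_subtractf sum_distrib_right cinner_sum_left cinner_scaleC_left)
      finally have sum_eq: "(\<Sum>b\<in>Bs. c b * h (zb b)) = (\<Sum>b\<in>Bs. c b) * cnj (h (T t)) +
          cinner (\<Sum>b\<in>Bs. c b *\<^sub>C z_op P (zb b) b) (x (T t)) - cinner (x z) (z_op P (T t) (x (T t)))" .
      have hz: "h z = cnj (h (T t)) + cinner (z_op P z (x z)) (x (T t)) - cinner (x z) (z_op P (T t) (x (T t)))"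
        using ker'[OF z TU[OF t]] by (simp add: algebra_simps)
      show ?thesis unfolding d_def u_def cinner_diff_left sum_eq hz by (simp add: algebra_simps)
    qed
    have "((\<lambda>t. ((\<Sum>b\<in>Bs. c b) - 1) * cnj (h (T t)) + cinner u (x (T t))) \<longlongrightarrow>
        ((\<Sum>b\<in>Bs. c b) - 1) * cnj 0 + cinner u 0) at_top"
      by (intro tendsto_intros tendsto_cinner_right hT xT)
    moreover have "\<forall>\<^sub>F t in at_top. ((\<Sum>b\<in>Bs. c b) - 1) * cnj (h (T t)) + cinner u (x (T t)) = d"
      using eventually_gt_at_top[of 0] by eventually_elim (rule dt[symmetric])
    ultimately have "((\<lambda>t::real. d) \<longlongrightarrow> 0) at_top" by (simp add: Lim_transform_eventually)
    then have "d = 0" by (simp add: tendsto_const_iff)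
    moreover have "cinner (x z) \<alpha> = (\<Sum>b\<in>Bs. c b * h (zb b))"
      unfolding c cinner_sum_left cinner_scaleC_left using \<alpha>(2) by simp
    ultimately show ?thesis by (simp add: d_def)
  qed

  \<comment> \<open>Compression to the span of the vectors \<open>x z\<close>\<close>
  obtain E0 where E0: "finite E0" "orthonormal E0" "ch.span E0 = ch.span Bs"
    using orthonormal_basis_exists[OF finBs] by blast
  define Q where "Q = proj_on E0"
  have Q_span: "Q v \<in> ch.span Bs" for v using proj_on_in_span[of E0 v] E0(3) by (simp add: Q_def)
  have Q_id: "Q v = v" if "v \<in> ch.span Bs" for v using proj_on_eq[OF E0(1,2)] that E0(3) by (simp add: Q_def)
  have Q_sym: "cinner (Q u) v = cinner u (Q v)" for u v unfolding Q_def by (rule cinner_proj_on_swap)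
  have Q_lin: "Q (u + v) = Q u + Q v" "Q (c *\<^sub>C u) = c *\<^sub>C Q u" "Q (u - v) = Q u - Q v" for u v c
    by (simp_all add: Q_def proj_on_add proj_on_scaleC proj_on_diff)
  have P_lin: "P (u + v) = P u + P v" "P (c *\<^sub>C u) = c *\<^sub>C P u" "P (u - v) = P u - P v" for u v c
    by (simp_all add: P_def proj_on_add proj_on_scaleC proj_on_diff)
  have P_idem: "P (P u) = P u" for u
    unfolding P_def by (rule proj_on_eq[OF E1(1,2) proj_on_in_span])
  have Q_norm: "norm (Q v) \<le> norm v" for v unfolding Q_def by (rule norm_proj_on_le[OF E0(1,2)])
  have P_norm: "norm (P v) \<le> norm v" for v unfolding P_def by (rule norm_proj_on_le[OF E1(1,2)])

  define Y where "Y v = Q (P (Q v))" for v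
  have Y: "positive_contraction Y"
    unfolding positive_contraction_def
  proof (intro conjI allI)
    show "bounded_linear Y"
    proof (rule bounded_linear_intro[where K = 1])
      show "Y (u + v) = Y u + Y v" for u v by (simp add: Y_def Q_lin P_lin)
      show "Y (r *\<^sub>R u) = r *\<^sub>R Y u" for r u by (simp add: Y_def scaleR_scaleC Q_lin P_lin)
      show "norm (Y u) \<le> norm u * 1" for u
        unfolding Y_def using Q_norm[of "P (Q u)"] P_norm[of "Q u"] Q_norm[of u] by linarith
    qed
    show "Y (c *\<^sub>C u) = c *\<^sub>C Y u" for c u by (simp add: Y_def Q_lin P_lin)
    show "cinner (Y u) v = cinner u (Y v)" for u v by (simp add: Y_def Q_sym P_sym)
    have q: "Re (cinner (Y u) u) = (norm (P (Q u)))\<^sup>2" for u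
    proof -
      have "cinner (Y u) u = cinner (P (Q u)) (P (Q u))"
        unfolding Y_def Q_sym by (subst P_idem[symmetric]) (rule P_sym)
      then show ?thesis by (simp add: norm_sq_eq_Re_cinner)
    qed
    show "0 \<le> Re (cinner (Y u) u)" for u by (simp add: q)
    show "Re (cinner (Y u) u) \<le> Re (cinner u u)" for u
      unfolding q norm_sq_eq_Re_cinner[symmetric]
      by (rule power_mono[OF order_trans[OF P_norm Q_norm]]) simp
  qed

  \<comment> \<open>The self-adjoint operator\<close>
  have "\<exists>t\<in>ch.span Bs. \<forall>v\<in>bi_upper. cinner t (x v) = cinner s (z_op P v (x v) + \<alpha>)"
    if "s \<in> ch.span Bs" for s
    using that
  proof (induction rule: ch.span_induct_alt)
    case base
    then show ?case by (intro bexI[of _ 0]) (auto simp: ch.span_zero)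
  next
    case (step c b y)
    then obtain t where t: "t \<in> ch.span Bs" "\<forall>v\<in>bi_upper. cinner t (x v) = cinner y (z_op P v (x v) + \<alpha>)" by blast
    let ?z = "zb b"
    have z: "?z \<in> bi_upper" "x ?z = b" using zb step by auto
    have "cinner (Q (z_op P ?z b + \<alpha>)) (x v) = cinner b (z_op P v (x v) + \<alpha>)" if v: "v \<in> bi_upper" for v
    proof -
      have "cinner (Q (z_op P ?z b + \<alpha>)) (x v) = cinner (z_op P ?z b) (x v) + cinner \<alpha> (x v)"
        by (simp add: Q_sym Q_id[OF xS[OF v]] cinner_add_left)
      also have "cinner \<alpha> (x v) = cnj (h v)" unfolding h_eq[OF v] by (rule cinner_commute)
      also have "cinner (z_op P ?z b) (x v) + cnj (h v) = cinner b (z_op P v (x v)) + h ?z"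
        using ker'[OF z(1) v] z(2) by (simp add: algebra_simps)
      also have "h ?z = cinner b \<alpha>" using h_eq[OF z(1)] z(2) by simp
      finally show ?thesis by (simp add: cinner_add_right)
    qed
    then show ?case using t Q_span
      by (intro bexI[of _ "c *\<^sub>C Q (z_op P ?z b + \<alpha>) + t"])
        (auto simp: cinner_add_left cinner_scaleC_left intro!: ch.span_add ch.span_scale)
  qed
  then have "\<forall>s. \<exists>t. s \<in> ch.span Bs \<longrightarrow> t \<in> ch.span Bs \<and>
      (\<forall>v\<in>bi_upper. cinner t (x v) = cinner s (z_op P v (x v) + \<alpha>))" by blast
  then obtain A0 where "\<forall>s. s \<in> ch.span Bs \<longrightarrow> A0 s \<in> ch.span Bs \<and>
      (\<forall>v\<in>bi_upper. cinner (A0 s) (x v) = cinner s (z_op P v (x v) + \<alpha>))" by (rule choice[THEN exE])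
  then have A0: "\<And>s. s \<in> ch.span Bs \<Longrightarrow> A0 s \<in> ch.span Bs"
    "\<And>s v. s \<in> ch.span Bs \<Longrightarrow> v \<in> bi_upper \<Longrightarrow> cinner (A0 s) (x v) = cinner s (z_op P v (x v) + \<alpha>)" by blast+
  have A0x: "A0 (x v) = Q (z_op P v (x v) + \<alpha>)" if v: "v \<in> bi_upper" for v
  proof (rule span_ext[OF A0(1)[OF xS[OF v]] Q_span])
    fix w assume w: "w \<in> bi_upper"
    have "cinner \<alpha> (x w) = cnj (h w)" unfolding h_eq[OF w] by (rule cinner_commute)
    then show "cinner (A0 (x v)) (x w) = cinner (Q (z_op P v (x v) + \<alpha>)) (x w)"
      using ker'[OF v w] h_eq[OF v]
      by (simp add: A0(2)[OF xS[OF v] w] Q_sym Q_id[OF xS[OF w]] cinner_add_left cinner_add_right algebra_simps)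
  qed
  \<comment> \<open>Composition with the projection extends the operator by zero to the complement
    of the span, so that it is everywhere defined.\<close>
  define A where "A v = A0 (Q v)" for v
  have A_add: "A (u + v) = A u + A v" for u v
    unfolding A_def
  proof (rule span_ext[OF A0(1)[OF Q_span] ch.span_add[OF A0(1)[OF Q_span] A0(1)[OF Q_span]]])
    fix z assume z: "z \<in> bi_upper"
    show "cinner (A0 (Q (u + v))) (x z) = cinner (A0 (Q u) + A0 (Q v)) (x z)"
      by (simp only: cinner_add_left A0(2)[OF Q_span z]) (simp only: Q_lin cinner_add_left)
  qed
  have A_scale: "A (c *\<^sub>C u) = c *\<^sub>C A u" for c u
    unfolding A_def
  proof (rule span_ext[OF A0(1)[OF Q_span] ch.span_scale[OF A0(1)[OF Q_span]]])
    fix z assume z: "z \<in> bi_upper"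
    show "cinner (A0 (Q (c *\<^sub>C u))) (x z) = cinner (c *\<^sub>C A0 (Q u)) (x z)"
      by (simp only: cinner_scaleC_left A0(2)[OF Q_span z]) (simp only: Q_lin cinner_scaleC_left)
  qed
  have A_span: "A v \<in> ch.span Bs" for v unfolding A_def by (rule A0(1)[OF Q_span])
  have sym0: "cinner (A0 s) y = cinner s (A0 y)" if s: "s \<in> ch.span Bs" and y: "y \<in> ch.span Bs" for s y
  proof -
    have d: "cinner s (A0 b) = cinner (A0 s) b" if b: "b \<in> Bs" for b
    proof -
      have z: "zb b \<in> bi_upper" "b = x (zb b)" using zb b by auto
      have "cinner (A0 s) (x (zb b)) = cinner s (z_op P (zb b) (x (zb b)) + \<alpha>)" by (rule A0(2)[OF s z(1)])
      also have "\<dots> = cinner (Q s) (z_op P (zb b) (x (zb b)) + \<alpha>)" by (simp add: Q_id[OF s])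
      also have "\<dots> = cinner s (A0 (x (zb b)))" unfolding A0x[OF z(1)] by (rule Q_sym)
      finally show ?thesis using z(2) by simp
    qed
    obtain c where c: "y = (\<Sum>b\<in>Bs. c b *\<^sub>C b)" using y ch.span_finite[OF finBs] by auto
    have "A y = (\<Sum>b\<in>Bs. c b *\<^sub>C A b)"
    proof -
      have "A 0 = 0" using A_scale[of 0 0] by simp
      then have "A (\<Sum>b\<in>F. c b *\<^sub>C b) = (\<Sum>b\<in>F. c b *\<^sub>C A b)" for F
        by (induction F rule: infinite_finite_induct) (auto simp: A_add A_scale)
      then show ?thesis by (simp add: c)
    qed
    then have "A0 y = (\<Sum>b\<in>Bs. c b *\<^sub>C A0 b)"
      unfolding A_def Q_id[OF y] by (simp add: Q_id ch.span_base)
    then show ?thesis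
      by (subst c) (simp add: cinner_sum_right d)
  qed
  have A_sym: "cinner (A u) v = cinner u (A v)" for u v
  proof -
    have "cinner (A u) v = cinner (Q (A u)) v" using Q_id[OF A_span] by simp
    also have "\<dots> = cinner (A0 (Q u)) (Q v)" by (simp add: Q_sym A_def)
    also have "\<dots> = cinner (Q u) (A v)" unfolding A_def by (rule sym0[OF Q_span Q_span])
    also have "\<dots> = cinner u (A v)" by (simp add: Q_sym Q_id[OF A_span])
    finally show ?thesis .
  qed
  have x_eq: "A (x z) - z_op Y z (x z) = \<alpha>" if z: "z \<in> bi_upper" for z
  proof -
    have "A (x z) = Q (z_op P z (x z)) + \<alpha>"
      by (simp add: A_def Q_id[OF xS[OF z]] A0x[OF z] Q_lin Q_id[OF \<alpha>(1)])
    moreover have "z_op Y z (x z) = Q (z_op P z (x z))"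
      by (simp add: z_op_def Y_def Q_id[OF xS[OF z]] Q_lin)
    ultimately show ?thesis by simp
  qed

  \<comment> \<open>Eigenbasis of \<open>Y\<close> and passage to the moment sequence\<close>
  obtain E ev where E: "finite E" "orthonormal E" "ch.span E = ch.span Bs"
    "\<And>e. e \<in> E \<Longrightarrow> Y e = complex_of_real (ev e) *\<^sub>C e"
  proof (rule eigenbasis_exists[of Y Bs])
    show "Y (u + v) = Y u + Y v" "Y (c *\<^sub>C u) = c *\<^sub>C Y u" for u v c
      by (simp_all add: positive_contraction_linear[OF Y])
    show "cinner (Y u) v = cinner u (Y v)" for u v by (simp add: Y_def Q_sym P_sym)
    show "Y u \<in> ch.span Bs" for u unfolding Y_def by (rule Q_span)
  qed (use finBs in blast)+
  interpret finite_realization E ev A Y \<alpha> x h \<rho>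
  proof
    show "A v \<in> ch.span E" for v using A_span E(3) by simp
    show "\<alpha> \<in> ch.span E" using \<alpha>(1) E(3) by simp
    show "((\<lambda>t. complex_of_real (t ^ K) *
       (h (\<i> * of_real t, \<i> * of_real (t * s)) - (\<Sum>n | 1 \<le> fst n + snd n \<and> fst n + snd n \<le> K.
          complex_of_real (\<rho> n) / ((\<i> * of_real t) ^ fst n * (\<i> * of_real (t * s)) ^ snd n)))) \<longlongrightarrow> 0) at_top"
      if "0 < s" "1 \<le> K" for s K by (rule asym[OF that])
  qed (use E Y A_add A_scale A_sym x_eq h_eq in auto)
  show ?thesis using infinite_HVMS_avec representation finite_rank_avec by blast
qed

section \<open>Rational functions with real asymptotic expansions\<close>

definition poly_fun :: "nat \<Rightarrow> nat \<Rightarrow> (nat \<times> nat \<Rightarrow> complex) \<Rightarrow> complex \<times> complex \<Rightarrow> complex" where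
  "poly_fun n m c z = (\<Sum>a\<in>{..n} \<times> {..m}. c a * (fst z ^ fst a * snd z ^ snd a))"

lemma is_poly2_monomial: "is_poly2 (\<lambda>z. fst z ^ i * snd z ^ j)"
proof -
  have "is_poly2 (\<lambda>z. fst z ^ i)" by (induction i) (auto intro: is_poly2_mult)
  moreover have "is_poly2 (\<lambda>z. snd z ^ j)" by (induction j) (auto intro: is_poly2_mult)
  ultimately show ?thesis by (rule is_poly2_mult)
qed

lemma is_poly2_poly_fun: "is_poly2 (poly_fun n m c)"
  unfolding poly_fun_def[abs_def] by (intro is_poly2_sum is_poly2_mult is_poly2_const is_poly2_monomial)

text \<open>One coefficient family serves all large boxes, so that numerator and denominator can
  share a box.\<close>

lemma poly_fun_exists:
  assumes "is_poly2 f"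
  shows "\<exists>N c. \<forall>n\<ge>N. \<forall>m\<ge>N. f = poly_fun n m c"
proof -
  obtain p where f: "f = poly2 p" using assms is_poly2_def by blast
  define N where "N = degree p + (\<Sum>j\<le>degree p. degree (coeff p j))"
  have dN: "degree (coeff p j) \<le> N" for j
  proof (cases "j \<le> degree p")
    case True
    then have "degree (coeff p j) \<le> (\<Sum>j\<le>degree p. degree (coeff p j))"
      by (intro member_le_sum) auto
    then show ?thesis by (simp add: N_def)
  qed (simp add: coeff_eq_0)
  define c where "c a = coeff (coeff p (snd a)) (fst a)" for a
  have "f = poly_fun n m c" if nm: "N \<le> n" "N \<le> m" for n m
  proof (rule ext)
    fix z :: "complex \<times> complex"
    have "poly p [:snd z:] = (\<Sum>j\<le>m. coeff p j * [:snd z:] ^ j)"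
      unfolding poly_altdef by (rule sum.mono_neutral_left) (use nm in \<open>auto simp: coeff_eq_0 N_def\<close>)
    then have "f z = (\<Sum>j\<le>m. poly (coeff p j) (fst z) * snd z ^ j)"
      by (simp add: f poly2_def poly_sum)
    also have "\<dots> = (\<Sum>j\<le>m. (\<Sum>i\<le>n. c (i, j) * fst z ^ i) * snd z ^ j)"
    proof (intro sum.cong refl)
      fix j
      have "poly (coeff p j) (fst z) = (\<Sum>i\<le>n. c (i, j) * fst z ^ i)"
        unfolding poly_altdef c_def
        by (rule sum.mono_neutral_cong_left) (use nm dN[of j] in \<open>auto simp: coeff_eq_0\<close>)
      then show "poly (coeff p j) (fst z) * snd z ^ j = (\<Sum>i\<le>n. c (i, j) * fst z ^ i) * snd z ^ j" by simp
    qed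
    also have "\<dots> = (\<Sum>i\<le>n. \<Sum>j\<le>m. c (i, j) * (fst z ^ i * snd z ^ j))"
      by (subst sum.swap) (simp add: sum_distrib_right mult.assoc)
    also have "\<dots> = poly_fun n m c z"
      by (simp add: poly_fun_def sum.cartesian_product case_prod_unfold)
    finally show "f z = poly_fun n m c z" .
  qed
  then show ?thesis by blast
qed

lemma is_poly2_nonzero_on_product:
  assumes f: "is_poly2 f" "f z0 \<noteq> 0" and "infinite S" "infinite T"
  obtains a b where "a \<in> S" "b \<in> T" "f (a, b) \<noteq> 0"
proof -
  obtain p where p: "f = poly2 p" using f is_poly2_def by blast
  have "p \<noteq> 0" using f(2) p by (auto simp: poly2_def)
  then have "finite {q. poly p q = 0}" by (rule poly_roots_finite)
  then have "finite {b. poly p [:b:] = 0}"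
    by (rule finite_subset[rotated, OF finite_vimageI[of _ "\<lambda>b. [:b:]"]]) (auto simp: inj_on_def)
  then obtain b where b: "b \<in> T" "poly p [:b:] \<noteq> 0"
    using assms(4) by (metis (mono_tags, lifting) finite_subset mem_Collect_eq subsetI)
  then have "finite {a. poly (poly p [:b:]) a = 0}" by (intro poly_roots_finite)
  then obtain a where "a \<in> S" "poly (poly p [:b:]) a \<noteq> 0"
    using assms(3) by (metis (mono_tags, lifting) finite_subset mem_Collect_eq subsetI)
  then show ?thesis using that[of a b] b p by (simp add: poly2_def)
qed

lemma infinite_upper_half_plane: "infinite upper_half_plane"
proof -
  have "\<i> \<in> upper_half_plane" by (simp add: upper_half_plane_def)
  then show ?thesis using open_upper_half_plane
    by (metis empty_iff finite_imp_not_open)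
qed

lemma holomorphic_zero_off_finite:
  assumes f: "f holomorphic_on upper_half_plane" and X: "finite X"
    and 0: "\<And>w. w \<in> upper_half_plane \<Longrightarrow> w \<notin> X \<Longrightarrow> f w = 0" and w: "w \<in> upper_half_plane"
  shows "f w = 0"
proof -
  have "isCont f w"
    using holomorphic_on_imp_continuous_on[OF f] w open_upper_half_plane continuous_on_eq_continuous_at by blast
  then have "(f \<longlongrightarrow> f w) (at w)" by (simp add: isCont_def)
  moreover have "\<forall>\<^sub>F y in at w. f y = 0"
  proof -
    have "\<forall>\<^sub>F y in at w. y \<in> upper_half_plane"
      using open_upper_half_plane w by (auto simp: eventually_at_topological)
    moreover have "\<forall>\<^sub>F y in at w. y \<notin> X"
      using islimpt_finite[OF X] islimpt_iff_eventually by blast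
    ultimately show ?thesis by eventually_elim (rule 0)
  qed
  ultimately have "((\<lambda>_. 0) \<longlongrightarrow> f w) (at w)" by (rule Lim_transform_eventually)
  then show ?thesis by (simp add: tendsto_const_iff)
qed

text \<open>\<open>rational2\<close> is silent on the zeros of the denominator. There the slices of
  \<open>q h - p\<close> vanish by continuity, since they vanish off a finite set, first in one
  variable and then in the other.\<close>

lemma rational2_poly_multiple:
  assumes hol: "holomorphic2_on h bi_upper" and "rational2 h"
  obtains p q where "is_poly2 p" "is_poly2 q" "\<exists>z. q z \<noteq> 0" "\<And>z. z \<in> bi_upper \<Longrightarrow> q z * h z = p z"
proof -
  obtain P Q where Q: "Q \<noteq> 0" and h: "\<And>z. z \<in> bi_upper \<Longrightarrow> poly2 Q z \<noteq> 0 \<Longrightarrow> h z = poly2 P z / poly2 Q z"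
    using assms(2) unfolding rational2_def by blast
  have pq: "is_poly2 (poly2 P)" "is_poly2 (poly2 Q)" by (auto simp: is_poly2_def)
  have hol': "holomorphic2_on (\<lambda>z. poly2 Q z * h z - poly2 P z) bi_upper"
    by (rule holomorphic2_on_poly_combination[OF hol pq(2,1)])
  have "finite {q. poly Q q = 0}" using Q by (rule poly_roots_finite)
  then have fin: "finite {b. poly Q [:b:] = 0}"
    by (rule finite_subset[rotated, OF finite_vimageI[of _ "\<lambda>b. [:b:]"]]) (auto simp: inj_on_def)
  have 1: "poly2 Q (a, b) * h (a, b) - poly2 P (a, b) = 0"
    if "a \<in> upper_half_plane" "b \<in> upper_half_plane" "b \<notin> {b. poly Q [:b:] = 0}" for a b
  proof (rule holomorphic_zero_off_finite[OF holomorphic2_on_slices(1)[OF hol' that(2)] _ _ that(1)])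
    show "finite {a. poly (poly Q [:b:]) a = 0}" using that(3) by (intro poly_roots_finite) simp
    fix w assume "w \<in> upper_half_plane" "w \<notin> {a. poly (poly Q [:b:]) a = 0}"
    then show "poly2 Q (w, b) * h (w, b) - poly2 P (w, b) = 0"
      using h[of "(w, b)"] that(2) by (simp add: poly2_def)
  qed
  have 2: "poly2 Q (a, b) * h (a, b) - poly2 P (a, b) = 0"
    if "a \<in> upper_half_plane" "b \<in> upper_half_plane" for a b
    by (rule holomorphic_zero_off_finite[OF holomorphic2_on_slices(2)[OF hol' that(1)] fin 1[OF that(1)] that(2)])
  have "\<exists>z. poly2 Q z \<noteq> 0"
  proof -
    have "\<not> UNIV \<subseteq> {b. poly Q [:b:] = 0}" using fin infinite_UNIV_char_0 finite_subset by blast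
    then obtain b where b: "poly Q [:b:] \<noteq> 0" by blast
    then have "finite {a. poly (poly Q [:b:]) a = 0}" by (rule poly_roots_finite)
    then have "\<not> UNIV \<subseteq> {a. poly (poly Q [:b:]) a = 0}" using infinite_UNIV_char_0 finite_subset by blast
    then obtain a where "poly (poly Q [:b:]) a \<noteq> 0" by blast
    then show ?thesis by (intro exI[of _ "(a, b)"]) (simp add: poly2_def)
  qed
  then show ?thesis using that[OF pq] 2 by auto
qed

text \<open>On polynomials this conjugates the coefficients.\<close>

definition star :: "(complex \<times> complex \<Rightarrow> complex) \<Rightarrow> complex \<times> complex \<Rightarrow> complex" where
  "star f z = cnj (f (cnj (fst z), cnj (snd z)))"

lemma star_poly_fun: "star (poly_fun n m c) = poly_fun n m (\<lambda>a. cnj (c a))"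
  by (simp add: star_def poly_fun_def fun_eq_iff)

lemma is_poly2_star: "is_poly2 f \<Longrightarrow> is_poly2 (star f)"
  using poly_fun_exists[of f] star_poly_fun is_poly2_poly_fun by (metis order_refl)

lemma is_poly2_on_line:
  assumes "is_poly2 f"
  shows "\<exists>p. \<forall>\<tau>. f (\<tau>, \<tau> * c) = poly p \<tau>"
proof -
  obtain n m a where f: "f = poly_fun n m a" using poly_fun_exists[OF assms] by (metis order_refl)
  have "f (\<tau>, \<tau> * c) = poly (\<Sum>b\<in>{..n} \<times> {..m}. monom (a b * c ^ snd b) (fst b + snd b)) \<tau>" for \<tau>
    by (simp add: f poly_fun_def poly_sum poly_monom power_add power_mult_distrib mult_ac)
  then show ?thesis by blast
qed

lemma poly_on_imaginary_axis_lim: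
  assumes "degree p \<le> e"
  shows "((\<lambda>t. poly p (\<i> * complex_of_real t) / (\<i> * of_real t) ^ e) \<longlongrightarrow> coeff p e) at_top"
proof -
  have inf: "filterlim (\<lambda>t. \<i> * complex_of_real t) at_infinity at_top"
    unfolding filterlim_at_infinity_conv_norm_at_top by (simp add: norm_mult filterlim_abs_real)
  have "((\<lambda>t. coeff p k / (\<i> * complex_of_real t) ^ (e - k)) \<longlongrightarrow> (if k = e then coeff p k else 0)) at_top"
    if "k \<le> e" for k
  proof (cases "k = e")
    case False
    then have "0 < e - k" using that by simp
    then have "filterlim (\<lambda>t. (\<i> * complex_of_real t) ^ (e - k)) at_infinity at_top"
      by (intro filterlim_compose[OF filterlim_power_at_infinity inf]) simp
    then show ?thesis using False by (simp add: tendsto_divide_0[OF tendsto_const])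
  qed simp
  then have "((\<lambda>t. \<Sum>k\<le>e. coeff p k / (\<i> * complex_of_real t) ^ (e - k)) \<longlongrightarrow>
      (\<Sum>k\<le>e. if k = e then coeff p k else 0)) at_top"
    by (intro tendsto_sum) auto
  moreover have "\<forall>\<^sub>F t in at_top. (\<Sum>k\<le>e. coeff p k / (\<i> * complex_of_real t) ^ (e - k)) =
      poly p (\<i> * complex_of_real t) / (\<i> * of_real t) ^ e"
    using eventually_gt_at_top[of 0]
  proof eventually_elim
    case (elim t)
    have "poly p (\<i> * complex_of_real t) = (\<Sum>k\<le>e. coeff p k * (\<i> * of_real t) ^ k)"
      unfolding poly_altdef by (rule sum.mono_neutral_left) (use assms in \<open>auto simp: coeff_eq_0\<close>)
    moreover have "coeff p k * (\<i> * of_real t) ^ k / (\<i> * of_real t) ^ e = coeff p k / (\<i> * complex_of_real t) ^ (e - k)"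
      if "k \<le> e" for k
    proof -
      have "(\<i> * complex_of_real t) ^ e = (\<i> * complex_of_real t) ^ k * (\<i> * complex_of_real t) ^ (e - k)"
        unfolding power_add[symmetric] using that by simp
      then show ?thesis using elim by simp
    qed
    ultimately show ?case by (simp add: sum_divide_distrib)
  qed
  ultimately have "((\<lambda>t. poly p (\<i> * complex_of_real t) / (\<i> * of_real t) ^ e) \<longlongrightarrow>
      (\<Sum>k\<le>e. if k = e then coeff p k else 0)) at_top"
    by (rule Lim_transform_eventually)
  then show ?thesis by simp
qed

lemma degree_less_if_small:
  assumes "E \<noteq> 0" and eq: "\<And>t. 0 < t \<Longrightarrow> poly E (\<i> * complex_of_real t) = g t * poly Q (\<i> * complex_of_real t)"
    and g: "(g \<longlongrightarrow> 0) at_top"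
  shows "degree E < degree Q"
proof (rule ccontr)
  assume "\<not> degree E < degree Q"
  then have Q: "degree Q \<le> degree E" by simp
  have "((\<lambda>t. g t * (poly Q (\<i> * complex_of_real t) / (\<i> * of_real t) ^ degree E)) \<longlongrightarrow> 0 * coeff Q (degree E)) at_top"
    by (intro tendsto_mult g poly_on_imaginary_axis_lim Q)
  moreover have "\<forall>\<^sub>F t in at_top. g t * (poly Q (\<i> * complex_of_real t) / (\<i> * of_real t) ^ degree E) =
      poly E (\<i> * complex_of_real t) / (\<i> * of_real t) ^ degree E"
    using eventually_gt_at_top[of 0] by eventually_elim (simp add: eq)
  ultimately have "((\<lambda>t. poly E (\<i> * complex_of_real t) / (\<i> * of_real t) ^ degree E) \<longlongrightarrow> 0) at_top"
    using Lim_transform_eventually by fastforce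
  with poly_on_imaginary_axis_lim[OF order_refl, of E] have "lead_coeff E = 0"
    using tendsto_unique trivial_limit_at_top_linorder by blast
  then show False using assms(1) by simp
qed

lemma degree_map_poly_cnj: "degree (map_poly cnj p) = degree p"
  by (rule degree_map_poly) auto

text \<open>A rational function \<open>p / q\<close> of one variable with a real expansion \<open>S / X\<^sup>K\<close> at infinity has
  real coefficients: the error \<open>p X\<^sup>K - q S\<close> has degree below that of \<open>q\<close>, so multiplying by the
  conjugate of \<open>q\<close> and taking the imaginary part cancels \<open>S\<close>.\<close>

lemma real_expansion_real_fraction:
  fixes p q S :: "complex poly"
  assumes eq: "\<And>t. 0 < t \<Longrightarrow> poly (p * monom 1 (Suc (2 * degree q)) - q * S) (\<i> * complex_of_real t) =
      g t * poly q (\<i> * complex_of_real t)"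
    and g: "(g \<longlongrightarrow> 0) at_top" and S: "map_poly cnj S = S"
  shows "p * map_poly cnj q = map_poly cnj p * q"
proof (rule ccontr)
  assume ne: "p * map_poly cnj q \<noteq> map_poly cnj p * q"
  let ?K = "Suc (2 * degree q)"
  let ?c = "map_poly cnj :: complex poly \<Rightarrow> complex poly"
  define E where "E = p * monom 1 ?K - q * S"
  have cE: "?c E = ?c p * monom 1 ?K - ?c q * S"
  proof (rule poly_ext)
    fix x
    have "poly S x = cnj (poly S (cnj x))" using S poly_map_poly_cnj[of S x] by simp
    then show "poly (?c E) x = poly (?c p * monom 1 ?K - ?c q * S) x"
      by (simp only: E_def poly_map_poly_cnj poly_diff poly_mult poly_monom complex_cnj_diff
        complex_cnj_mult complex_cnj_power complex_cnj_one complex_cnj_cnj)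
  qed
  have id: "?c q * E - q * ?c E = monom 1 ?K * (p * ?c q - ?c p * q)"
    unfolding cE by (simp add: E_def algebra_simps)
  have D: "p * ?c q - ?c p * q \<noteq> 0" using ne by simp
  then have "?c q * E - q * ?c E \<noteq> 0" unfolding id by (simp add: monom_eq_0_iff)
  then have E0: "E \<noteq> 0" by auto
  have dE: "degree E < degree q" by (rule degree_less_if_small[OF E0 eq[folded E_def] g])
  have "degree (?c q * E - q * ?c E) \<le> 2 * degree q"
  proof (rule degree_diff_le)
    show "degree (?c q * E) \<le> 2 * degree q"
      using degree_mult_le[of "?c q" E] dE by (simp add: degree_map_poly_cnj)
    show "degree (q * ?c E) \<le> 2 * degree q"
      using degree_mult_le[of q "?c E"] dE by (simp add: degree_map_poly_cnj)
  qed
  moreover have "degree (monom 1 ?K * (p * ?c q - ?c p * q)) \<ge> ?K"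
    using D by (simp add: degree_mult_eq degree_monom_eq monom_eq_0_iff)
  ultimately show False unfolding id by simp
qed

lemma L_infinity_asymptotics:
  assumes "h \<in> L_infinity"
  obtains \<rho> :: "nat \<times> nat \<Rightarrow> real" where
    "\<And>s K. 0 < s \<Longrightarrow> 1 \<le> K \<Longrightarrow> ((\<lambda>t. complex_of_real (t ^ K) *
       (h (\<i> * of_real t, \<i> * of_real (t * s)) - (\<Sum>n | 1 \<le> fst n + snd n \<and> fst n + snd n \<le> K.
          complex_of_real (\<rho> n) / ((\<i> * of_real t) ^ fst n * (\<i> * of_real (t * s)) ^ snd n)))) \<longlongrightarrow> 0) at_top"
proof -
  obtain \<rho> :: "nat \<times> nat \<Rightarrow> real" where \<rho>: "\<And>K c. 1 \<le> K \<Longrightarrow> c > 0 \<Longrightarrow>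
     ((\<lambda>z. complex_of_real (norm z ^ K) *
          (h z - (\<Sum>n | 1 \<le> fst n + snd n \<and> fst n + snd n \<le> K.
                    complex_of_real (\<rho> n) / (fst z ^ fst n * snd z ^ snd n))))
       \<longlongrightarrow> 0) (inf at_infinity (principal (nontangential_region c)))"
    using assms unfolding L_infinity_def by blast
  show ?thesis
  proof (rule that)
    fix s :: real and K :: nat assume s: "0 < s" and K: "1 \<le> K"
    define z where "z t = (\<i> * complex_of_real t, \<i> * complex_of_real (t * s))" for t
    define \<kappa> where "\<kappa> = sqrt (1 + s\<^sup>2)"
    have \<kappa>: "0 < \<kappa>" using s by (simp add: \<kappa>_def add_pos_pos)
    have nz: "norm (z t) = t * \<kappa>" if "0 < t" for t
    proof -
      have "norm (z t) = sqrt (t\<^sup>2 * (1 + s\<^sup>2))"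
        using that s by (simp add: z_def norm_Pair norm_mult power_mult_distrib algebra_simps)
      then show ?thesis using that by (simp add: real_sqrt_mult \<kappa>_def)
    qed
    \<comment> \<open>Smallest aperture containing the ray, where \<open>norm z\<close> is
      \<open>t * \<kappa>\<close> and the smaller imaginary part is
      \<open>t * min 1 s\<close>.\<close>
    define c where "c = \<kappa> / min 1 s"
    have c: "0 < c" using \<kappa> s by (simp add: c_def)
    have "filterlim z (inf at_infinity (principal (nontangential_region c))) at_top"
      unfolding filterlim_inf filterlim_principal
    proof
      show "filterlim z at_infinity at_top"
        unfolding filterlim_at_infinity_conv_norm_at_top
      proof (rule filterlim_at_top_mono)
        show "filterlim (\<lambda>t. \<kappa> * t) at_top at_top"
          by (rule filterlim_tendsto_pos_mult_at_top[OF tendsto_const \<kappa> filterlim_ident])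
        show "\<forall>\<^sub>F t in at_top. \<kappa> * t \<le> norm (z t)"
          using eventually_gt_at_top[of 0] by eventually_elim (simp add: nz)
      qed
      show "\<forall>\<^sub>F t in at_top. z t \<in> nontangential_region c"
        using eventually_gt_at_top[of 0]
      proof eventually_elim
        case (elim t)
        have "min (Im (fst (z t))) (Im (snd (z t))) = t * min 1 s"
          using elim by (simp add: z_def min_mult_distrib_left)
        moreover have "c * (t * min 1 s) = t * \<kappa>" using s by (simp add: c_def)
        ultimately show ?case
          using elim s nz[OF elim] by (auto simp: nontangential_region_def upper_half_plane_def z_def)
      qed
    qed
    from filterlim_compose[OF \<rho>[OF K c] this]
    have 1: "((\<lambda>t. complex_of_real (norm (z t) ^ K) *
          (h (z t) - (\<Sum>n | 1 \<le> fst n + snd n \<and> fst n + snd n \<le> K.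
                    complex_of_real (\<rho> n) / (fst (z t) ^ fst n * snd (z t) ^ snd n)))) \<longlongrightarrow> 0) at_top" .
    have "((\<lambda>t. 1 / complex_of_real (\<kappa> ^ K) * (complex_of_real (norm (z t) ^ K) *
          (h (z t) - (\<Sum>n | 1 \<le> fst n + snd n \<and> fst n + snd n \<le> K.
                    complex_of_real (\<rho> n) / (fst (z t) ^ fst n * snd (z t) ^ snd n))))) \<longlongrightarrow>
          1 / complex_of_real (\<kappa> ^ K) * 0) at_top"
      by (rule tendsto_mult[OF tendsto_const 1])
    moreover have "\<forall>\<^sub>F t in at_top. 1 / complex_of_real (\<kappa> ^ K) * (complex_of_real (norm (z t) ^ K) *
          (h (z t) - (\<Sum>n | 1 \<le> fst n + snd n \<and> fst n + snd n \<le> K.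
                    complex_of_real (\<rho> n) / (fst (z t) ^ fst n * snd (z t) ^ snd n)))) =
        complex_of_real (t ^ K) *
       (h (\<i> * of_real t, \<i> * of_real (t * s)) - (\<Sum>n | 1 \<le> fst n + snd n \<and> fst n + snd n \<le> K.
          complex_of_real (\<rho> n) / ((\<i> * of_real t) ^ fst n * (\<i> * of_real (t * s)) ^ snd n)))"
      using eventually_gt_at_top[of 0]
    proof eventually_elim
      case (elim t)
      have "complex_of_real (norm (z t) ^ K) = complex_of_real (\<kappa> ^ K) * complex_of_real (t ^ K)"
        by (simp add: nz[OF elim] power_mult_distrib)
      then show ?case using \<kappa> by (simp add: z_def)
    qed
    ultimately show "((\<lambda>t. complex_of_real (t ^ K) *
       (h (\<i> * of_real t, \<i> * of_real (t * s)) - (\<Sum>n | 1 \<le> fst n + snd n \<and> fst n + snd n \<le> K.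
          complex_of_real (\<rho> n) / ((\<i> * of_real t) ^ fst n * (\<i> * of_real (t * s)) ^ snd n)))) \<longlongrightarrow> 0) at_top"
      using Lim_transform_eventually by fastforce
  qed
qed

text \<open>On every ray the real expansion makes the fraction equal to its conjugate, so the
  polynomial \<open>r\<close> vanishes on all rays and hence everywhere. Extending the fraction by
  \<open>star q\<close> then gives real numerator and denominator.\<close>

lemma real_fraction:
  assumes hol: "holomorphic2_on h bi_upper" and rat: "rational2 h"
    and asym: "\<And>s K. 0 < s \<Longrightarrow> 1 \<le> K \<Longrightarrow> ((\<lambda>t. complex_of_real (t ^ K) *
       (h (\<i> * of_real t, \<i> * of_real (t * s)) - (\<Sum>n | 1 \<le> fst n + snd n \<and> fst n + snd n \<le> K.
          complex_of_real (\<rho> n) / ((\<i> * of_real t) ^ fst n * (\<i> * of_real (t * s)) ^ snd n)))) \<longlongrightarrow> 0) at_top"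
  shows "\<exists>n m (a :: nat \<times> nat \<Rightarrow> real) (b :: nat \<times> nat \<Rightarrow> real) \<omega>.
    (\<forall>z\<in>bi_upper. poly_fun n m (\<lambda>c. of_real (b c)) z * h z = poly_fun n m (\<lambda>c. of_real (a c)) z) \<and>
    \<omega> \<in> bi_upper \<and> poly_fun n m (\<lambda>c. of_real (b c)) \<omega> \<noteq> 0"
proof -
  obtain p q where pq: "is_poly2 p" "is_poly2 q" "\<exists>z. q z \<noteq> 0"
    and h: "\<And>z. z \<in> bi_upper \<Longrightarrow> q z * h z = p z"
    using rational2_poly_multiple[OF hol rat] by blast
  have ps: "is_poly2 (star p)" "is_poly2 (star q)" using pq is_poly2_star by auto
  define r where "r z = p z * star q z - star p z * q z" for z
  have r: "is_poly2 r" unfolding r_def[abs_def] using pq ps by (intro is_poly2_diff is_poly2_mult)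
  have line: "r (\<tau>, \<tau> * of_real s) = 0" if s: "0 < s" for s \<tau>
  proof -
    obtain P where P: "\<And>\<tau>. p (\<tau>, \<tau> * of_real s) = poly P \<tau>" using is_poly2_on_line[OF pq(1)] by blast
    obtain Q where Q: "\<And>\<tau>. q (\<tau>, \<tau> * of_real s) = poly Q \<tau>" using is_poly2_on_line[OF pq(2)] by blast
    have Ps: "star p (\<tau>, \<tau> * of_real s) = poly (map_poly cnj P) \<tau>" for \<tau>
      by (simp add: star_def P)
    have Qs: "star q (\<tau>, \<tau> * of_real s) = poly (map_poly cnj Q) \<tau>" for \<tau>
      by (simp add: star_def Q)
    define K where "K = Suc (2 * degree Q)"
    define rr where "rr j = (\<Sum>i\<le>Suc j. \<rho> (i, Suc j - i) / s ^ (Suc j - i))" for j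
    define S where "S = (\<Sum>j<K. monom (complex_of_real (rr j)) (K - Suc j))"
    define g where "g t = \<i> ^ K * (complex_of_real (t ^ K) *
       (h (\<i> * of_real t, \<i> * of_real (t * s)) - (\<Sum>n | 1 \<le> fst n + snd n \<and> fst n + snd n \<le> K.
          complex_of_real (\<rho> n) / ((\<i> * of_real t) ^ fst n * (\<i> * of_real (t * s)) ^ snd n))))" for t
    have "P * map_poly cnj Q = map_poly cnj P * Q"
    proof (rule real_expansion_real_fraction)
      have "(g \<longlongrightarrow> \<i> ^ K * 0) at_top"
        unfolding g_def[abs_def] by (intro tendsto_mult tendsto_const asym s) (simp add: K_def)
      then show "(g \<longlongrightarrow> 0) at_top" by simp
      show "map_poly cnj S = S"
        by (rule poly_ext) (simp add: S_def poly_sum poly_monom)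
      fix t :: real assume t: "0 < t"
      define \<tau> where "\<tau> = \<i> * complex_of_real t"
      have \<tau>: "\<tau> \<noteq> 0" using t by (simp add: \<tau>_def)
      have sum: "(\<Sum>n | 1 \<le> fst n + snd n \<and> fst n + snd n \<le> K.
          complex_of_real (\<rho> n) / (\<tau> ^ fst n * (\<tau> * of_real s) ^ snd n)) = (\<Sum>j<K. complex_of_real (rr j) / \<tau> ^ Suc j)"
        unfolding sum_multi_indices
      proof (rule sum.cong[OF refl])
        fix j
        have "complex_of_real (\<rho> (i, Suc j - i)) / (\<tau> ^ i * (\<tau> * of_real s) ^ (Suc j - i)) =
            complex_of_real (\<rho> (i, Suc j - i) / s ^ (Suc j - i)) / \<tau> ^ Suc j" if "i \<le> Suc j" for i
        proof -
          have "\<tau> ^ Suc j = \<tau> ^ i * \<tau> ^ (Suc j - i)" unfolding power_add[symmetric] using that by simp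
          then show ?thesis by (simp add: power_mult_distrib mult_ac del: power_Suc)
        qed
        then show "(\<Sum>i\<le>Suc j. complex_of_real (\<rho> (i, Suc j - i)) / (\<tau> ^ fst (i, Suc j - i) *
            (\<tau> * of_real s) ^ snd (i, Suc j - i))) = complex_of_real (rr j) / \<tau> ^ Suc j"
          unfolding rr_def of_real_sum sum_divide_distrib by (intro sum.cong) (auto simp del: power_Suc)
      qed
      have poly_S: "poly S \<tau> = \<tau> ^ K * (\<Sum>j<K. complex_of_real (rr j) / \<tau> ^ Suc j)"
        unfolding S_def poly_sum sum_distrib_left
      proof (rule sum.cong[OF refl])
        fix j assume "j \<in> {..<K}"
        then have "\<tau> ^ K = \<tau> ^ (K - Suc j) * \<tau> ^ Suc j" unfolding power_add[symmetric] by simp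
        then show "poly (monom (complex_of_real (rr j)) (K - Suc j)) \<tau> = \<tau> ^ K * (complex_of_real (rr j) / \<tau> ^ Suc j)"
          using \<tau> by (simp add: poly_monom del: power_Suc)
      qed
      have zU: "(\<tau>, \<tau> * of_real s) \<in> bi_upper" using t s by (simp add: \<tau>_def upper_half_plane_def)
      have "poly (P * monom 1 K - Q * S) \<tau> = \<tau> ^ K * (h (\<tau>, \<tau> * of_real s) - (\<Sum>j<K. complex_of_real (rr j) / \<tau> ^ Suc j)) * poly Q \<tau>"
        using h[OF zU] unfolding P Q by (simp add: poly_S poly_monom algebra_simps del: sum.lessThan_Suc)
      moreover have "g t = \<tau> ^ K * (h (\<tau>, \<tau> * of_real s) - (\<Sum>j<K. complex_of_real (rr j) / \<tau> ^ Suc j))"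
      proof -
        have e1: "\<i> * complex_of_real (t * s) = \<tau> * of_real s" by (simp add: \<tau>_def)
        have e2: "\<i> ^ K * complex_of_real (t ^ K) = \<tau> ^ K" by (simp add: \<tau>_def power_mult_distrib)
        have "g t = \<i> ^ K * (complex_of_real (t ^ K) *
            (h (\<tau>, \<tau> * of_real s) - (\<Sum>j<K. complex_of_real (rr j) / \<tau> ^ Suc j)))"
          unfolding g_def e1 \<tau>_def[symmetric] sum by (rule refl)
        then show ?thesis by (simp only: mult.assoc[symmetric] e2)
      qed
      ultimately show "poly (P * monom 1 (Suc (2 * degree Q)) - Q * S) (\<i> * complex_of_real t) =
          g t * poly Q (\<i> * complex_of_real t)" unfolding K_def[symmetric] \<tau>_def[symmetric] by simp
    qed
    from arg_cong[OF this, of "\<lambda>p. poly p \<tau>"] show ?thesis by (simp add: r_def P Q Ps Qs)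
  qed
  have r0: "r z = 0" for z
  proof (rule ccontr)
    assume "r z \<noteq> 0"
    moreover have inf: "infinite (complex_of_real ` {0<..})"
    proof
      assume "finite (complex_of_real ` {0<..})"
      then have "finite {0::real<..}" by (rule finite_imageD) (auto simp: inj_on_def)
      then show False using infinite_Ioi by blast
    qed
    ultimately obtain x y where "x \<in> complex_of_real ` {0<..}" "y \<in> complex_of_real ` {0<..}" "r (x, y) \<noteq> 0"
      using is_poly2_nonzero_on_product[OF r _ inf inf] by metis
    then obtain x' y' where "0 < x'" "0 < y'" "r (complex_of_real x', complex_of_real y') \<noteq> 0" by auto
    then show False using line[of "y' / x'" "complex_of_real x'"] by simp
  qed
  \<comment> \<open>Since \<open>r\<close> is zero, both terms of the average agree; averaging makes
    the invariance under \<open>star\<close> evident.\<close>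
  define P where "P z = (p z * star q z + star p z * q z) / 2" for z
  define Q where "Q z = q z * star q z" for z
  have QP: "Q z * h z = P z" if "z \<in> bi_upper" for z
  proof -
    have "P z = p z * star q z" using r0[of z] by (simp add: P_def r_def)
    moreover have "Q z * h z = (q z * h z) * star q z" by (simp add: Q_def mult_ac)
    ultimately show ?thesis using h[OF that] by simp
  qed
  have sP: "star P = P" and sQ: "star Q = Q"
    by (simp_all add: P_def Q_def star_def fun_eq_iff mult.commute add.commute)
  have polyPQ: "is_poly2 P" "is_poly2 Q"
    unfolding P_def[abs_def] Q_def[abs_def] divide_inverse
    by (intro is_poly2_mult is_poly2_add is_poly2_const pq ps)+
  obtain N1 c1 where c1: "\<And>n m. N1 \<le> n \<Longrightarrow> N1 \<le> m \<Longrightarrow> P = poly_fun n m c1" using poly_fun_exists[OF polyPQ(1)] by blast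
  obtain N2 c2 where c2: "\<And>n m. N2 \<le> n \<Longrightarrow> N2 \<le> m \<Longrightarrow> Q = poly_fun n m c2" using poly_fun_exists[OF polyPQ(2)] by blast
  define n where "n = max N1 N2"
  have re: "f = poly_fun n n (\<lambda>a. of_real (Re (c a)))" if "f = poly_fun n n c" "star f = f" for f c
  proof (rule ext)
    fix z
    have "f z = (poly_fun n n c z + poly_fun n n (\<lambda>a. cnj (c a)) z) / 2"
      using that star_poly_fun[of n n c] by simp
    also have "\<dots> = poly_fun n n (\<lambda>a. (c a + cnj (c a)) / 2) z"
      by (simp add: poly_fun_def sum.distrib[symmetric] sum_divide_distrib ring_distribs)
    also have "(\<lambda>a. (c a + cnj (c a)) / 2) = (\<lambda>a. complex_of_real (Re (c a)))"
      by (simp add: complex_add_cnj fun_eq_iff)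
    finally show "f z = poly_fun n n (\<lambda>a. of_real (Re (c a))) z" .
  qed
  have rP: "P = poly_fun n n (\<lambda>a. of_real (Re (c1 a)))" using c1 sP by (intro re) (auto simp: n_def)
  have rQ: "Q = poly_fun n n (\<lambda>a. of_real (Re (c2 a)))" using c2 sQ by (intro re) (auto simp: n_def)
  have "\<exists>z. Q z \<noteq> 0"
  proof -
    obtain z where z: "q z \<noteq> 0" using pq(3) by blast
    then have z': "star q (cnj (fst z), cnj (snd z)) \<noteq> 0" by (simp add: star_def)
    obtain A where A: "q = poly2 A" using pq(2) is_poly2_def by blast
    obtain B where B: "star q = poly2 B" using ps(2) is_poly2_def by blast
    have "A \<noteq> 0" "B \<noteq> 0" using z z' A B by (auto simp: poly2_def)
    then have AB: "A * B \<noteq> 0" by simp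
    have Q_eq: "Q = poly2 (A * B)"
    proof (rule ext)
      fix z
      show "Q z = poly2 (A * B) z"
        unfolding Q_def fun_cong[OF A, of z] fun_cong[OF B, of z] by (simp add: poly2_def)
    qed
    have "finite {b. poly (A * B) [:b:] = 0}"
      using poly_roots_finite[OF AB]
      by (rule finite_subset[rotated, OF finite_vimageI[of _ "\<lambda>b. [:b:]"]]) (auto simp: inj_on_def)
    then have "\<not> UNIV \<subseteq> {b. poly (A * B) [:b:] = 0}" using infinite_UNIV_char_0 finite_subset by blast
    then obtain b where b: "poly (A * B) [:b:] \<noteq> 0" by blast
    then have "finite {a. poly (poly (A * B) [:b:]) a = 0}" by (rule poly_roots_finite)
    then have "\<not> UNIV \<subseteq> {a. poly (poly (A * B) [:b:]) a = 0}" using infinite_UNIV_char_0 finite_subset by blast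
    then obtain a where "poly (poly (A * B) [:b:]) a \<noteq> 0" by blast
    then show ?thesis unfolding Q_eq by (intro exI[of _ "(a, b)"]) (simp add: poly2_def)
  qed
  then obtain w1 w2 where "w1 \<in> upper_half_plane" "w2 \<in> upper_half_plane" "Q (w1, w2) \<noteq> 0"
    using is_poly2_nonzero_on_product[OF polyPQ(2) _ infinite_upper_half_plane infinite_upper_half_plane] by metis
  then show ?thesis using QP rP rQ
    by (intro exI[of _ n] exI[of _ "\<lambda>a. Re (c1 a)"] exI[of _ "\<lambda>a. Re (c2 a)"] exI[of _ "(w1, w2)"]) simp
qed

section \<open>The Cayley transform of a real rational Pick function\<close>

text \<open>The sign \<open>(-1)\<^sup>n\<close> is the one of products of \<open>n\<close> linear factors \<open>a - cnj a X\<close>.\<close>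

definition self_reflective :: "nat \<Rightarrow> complex poly \<Rightarrow> bool" where
  "self_reflective n p \<longleftrightarrow> degree p \<le> n \<and> (\<forall>k\<le>n. coeff p (n - k) = (- 1) ^ n * cnj (coeff p k))"

lemma self_reflective_1: "self_reflective 0 1"
  by (simp add: self_reflective_def)

lemma self_reflective_mult:
  assumes p: "self_reflective n p"
  shows "self_reflective (Suc n) ([:a, - cnj a:] * p)"
proof -
  have d: "degree p \<le> n" and r: "\<And>k. k \<le> n \<Longrightarrow> coeff p (n - k) = (- 1) ^ n * cnj (coeff p k)"
    using p by (auto simp: self_reflective_def)
  have c: "coeff ([:a, - cnj a:] * p) k = a * coeff p k - cnj a * (case k of 0 \<Rightarrow> 0 | Suc j \<Rightarrow> coeff p j)" for k
    by (simp add: coeff_pCons split: nat.split)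
  have "coeff ([:a, - cnj a:] * p) (Suc n - k) = (- 1) ^ Suc n * cnj (coeff ([:a, - cnj a:] * p) k)"
    if k: "k \<le> Suc n" for k
  proof (cases k)
    case 0
    have "coeff p (Suc n) = 0" using d by (intro coeff_eq_0) simp
    moreover have "coeff p n = (- 1) ^ n * cnj (coeff p 0)" using r[of 0] by simp
    ultimately show ?thesis unfolding c using 0 by simp
  next
    case (Suc j)
    show ?thesis
    proof (cases "j = n")
      case True
      have "coeff p (Suc n) = 0" using d by (intro coeff_eq_0) simp
      moreover have "coeff p 0 = (- 1) ^ n * cnj (coeff p n)" using r[of n] by simp
      ultimately show ?thesis unfolding c using Suc True by simp
    next
      case False
      then have j: "j < n" using k Suc by simp
      then obtain i where i: "n - j = Suc i" by (cases "n - j") auto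
      have 1: "coeff p (n - j) = (- 1) ^ n * cnj (coeff p j)" using r[of j] j by simp
      have "n - Suc j = i" using i by simp
      then have 2: "coeff p i = (- 1) ^ n * cnj (coeff p (Suc j))" using r[of "Suc j"] j by simp
      have "Suc n - k = Suc i" using Suc i j by simp
      then show ?thesis unfolding c using Suc 1 2 i by (simp add: algebra_simps)
    qed
  qed
  moreover have "degree ([:a, - cnj a:] * p) \<le> Suc n"
    using degree_mult_le[of "[:a, - cnj a:]" p] degree_pCons_le[of a "[:- cnj a:]"] d by simp
  ultimately show ?thesis by (simp add: self_reflective_def)
qed

lemma self_reflective_power:
  "self_reflective n p \<Longrightarrow> self_reflective (i + n) ([:a, - cnj a:] ^ i * p)"
proof (induction i)
  case (Suc i)
  then show ?case using self_reflective_mult[of "i + n" "[:a, - cnj a:] ^ i * p" a] by (simp only: power_Suc mult.assoc add_Suc)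
qed simp

text \<open>Numerator of the \<open>i\<close>-th power of the Cayley transform once the denominator
  (1 - x)^n is cleared.\<close>

definition cayley_basis :: "complex \<Rightarrow> nat \<Rightarrow> nat \<Rightarrow> complex poly" where
  "cayley_basis w n i = [:w, - cnj w:] ^ i * [:1, - 1:] ^ (n - i)"

lemma self_reflective_cayley_basis: "i \<le> n \<Longrightarrow> self_reflective n (cayley_basis w n i)"
  using self_reflective_power[OF self_reflective_power[OF self_reflective_1, of "n - i" 1], of i w]
  by (simp add: cayley_basis_def)

lemma poly_eq_sum_coeff: "degree p \<le> n \<Longrightarrow> poly p x = (\<Sum>k\<le>n. coeff p k * x ^ k)"
  for p :: "complex poly"
  unfolding poly_altdef by (rule sum.mono_neutral_left) (auto simp: coeff_eq_0)

definition cayley_coeff :: "complex \<times> complex \<Rightarrow> nat \<Rightarrow> nat \<Rightarrow> (nat \<times> nat \<Rightarrow> complex) \<Rightarrow> nat \<times> nat \<Rightarrow> complex" where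
  "cayley_coeff w n m a c = (\<Sum>d\<in>{..n} \<times> {..m}. a d *
     (coeff (cayley_basis (fst w) n (fst d)) (fst c) * coeff (cayley_basis (snd w) m (snd d)) (snd c)))"

text \<open>All basis polynomials are self-reflective with the same sign, so conjugating
  coefficients on the half-plane side is reflecting them on the disk side. A quotient conj(u)/u thus
  becomes a reflected polynomial over the polynomial itself.\<close>

lemma cayley_coeff_reflect:
  assumes "fst c \<le> n" "snd c \<le> m"
  shows "cayley_coeff w n m (\<lambda>d. cnj (a d)) c =
    (- 1) ^ (n + m) * cnj (cayley_coeff w n m a (n - fst c, m - snd c))"
proof -
  have sq: "((- 1) ^ k * (- 1) ^ k :: complex) = 1" for k by (simp flip: power_mult_distrib)
  have "cnj (cayley_coeff w n m a (n - fst c, m - snd c)) = (\<Sum>d\<in>{..n} \<times> {..m}. cnj (a d) *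
     (cnj (coeff (cayley_basis (fst w) n (fst d)) (n - fst c)) * cnj (coeff (cayley_basis (snd w) m (snd d)) (m - snd c))))"
    by (simp add: cayley_coeff_def)
  also have "\<dots> = (\<Sum>d\<in>{..n} \<times> {..m}. (- 1) ^ (n + m) * (cnj (a d) *
     (coeff (cayley_basis (fst w) n (fst d)) (fst c) * coeff (cayley_basis (snd w) m (snd d)) (snd c))))"
  proof (rule sum.cong[OF refl])
    fix d assume d: "d \<in> {..n} \<times> {..m}"
    have "cnj (coeff (cayley_basis (fst w) n (fst d)) (n - fst c)) = (- 1) ^ n * coeff (cayley_basis (fst w) n (fst d)) (fst c)"
      using self_reflective_cayley_basis[of "fst d" n "fst w"] d assms by (auto simp: self_reflective_def)
    moreover have "cnj (coeff (cayley_basis (snd w) m (snd d)) (m - snd c)) = (- 1) ^ m * coeff (cayley_basis (snd w) m (snd d)) (snd c)"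
      using self_reflective_cayley_basis[of "snd d" m "snd w"] d assms by (auto simp: self_reflective_def)
    ultimately show "cnj (a d) * (cnj (coeff (cayley_basis (fst w) n (fst d)) (n - fst c)) * cnj (coeff (cayley_basis (snd w) m (snd d)) (m - snd c))) =
      (- 1) ^ (n + m) * (cnj (a d) * (coeff (cayley_basis (fst w) n (fst d)) (fst c) * coeff (cayley_basis (snd w) m (snd d)) (snd c)))"
      by (simp add: power_add mult_ac)
  qed
  also have "\<dots> = (- 1) ^ (n + m) * cayley_coeff w n m (\<lambda>d. cnj (a d)) c"
    by (simp add: cayley_coeff_def sum_distrib_left)
  finally have "(- 1) ^ (n + m) * cnj (cayley_coeff w n m a (n - fst c, m - snd c)) =
      ((- 1) ^ (n + m) * (- 1) ^ (n + m)) * cayley_coeff w n m (\<lambda>d. cnj (a d)) c"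
    by (simp only: mult.assoc)
  then show ?thesis unfolding sq by simp
qed

text \<open>Maps the disk to the upper half-plane and 0 to \<open>w\<close>, for \<open>w\<close> in
  the upper half-plane. The free base point allows a point where the denominator of \<open>h\<close>
  is nonzero to correspond to the origin.\<close>

definition cayley :: "complex \<Rightarrow> complex \<Rightarrow> complex" where
  "cayley w x = (w - cnj w * x) / (1 - x)"

lemma poly_cayley_basis:
  assumes "x \<noteq> 1" "i \<le> n"
  shows "poly (cayley_basis w n i) x = (1 - x) ^ n * cayley w x ^ i"
proof -
  have "(1 - x) ^ n = (1 - x) ^ (n - i) * (1 - x) ^ i" unfolding power_add[symmetric] using assms(2) by simp
  moreover have "(1 - x) * cayley w x = w - cnj w * x" using assms(1) by (simp add: cayley_def)
  ultimately have "(1 - x) ^ n * cayley w x ^ i = (1 - x) ^ (n - i) * (w - cnj w * x) ^ i"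
    by (simp add: mult.assoc flip: power_mult_distrib)
  then show ?thesis by (simp add: cayley_basis_def mult.commute)
qed

lemma poly_fun_cayley:
  assumes "fst x \<noteq> 1" "snd x \<noteq> 1"
  shows "poly_fun n m (cayley_coeff w n m a) x =
    (1 - fst x) ^ n * (1 - snd x) ^ m * poly_fun n m a (cayley (fst w) (fst x), cayley (snd w) (snd x))"
proof -
  have summand: "(\<Sum>c\<in>{..n} \<times> {..m}. coeff (cayley_basis (fst w) n (fst d)) (fst c) * coeff (cayley_basis (snd w) m (snd d)) (snd c) *
      (fst x ^ fst c * snd x ^ snd c)) = (1 - fst x) ^ n * (1 - snd x) ^ m *
      (cayley (fst w) (fst x) ^ fst d * cayley (snd w) (snd x) ^ snd d)" if d: "d \<in> {..n} \<times> {..m}" for d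
  proof -
    have deg: "degree (cayley_basis (fst w) n (fst d)) \<le> n" "degree (cayley_basis (snd w) m (snd d)) \<le> m"
      using self_reflective_cayley_basis[of "fst d" n "fst w"] self_reflective_cayley_basis[of "snd d" m "snd w"] d
      by (auto simp: self_reflective_def)
    have "(\<Sum>c\<in>{..n} \<times> {..m}. coeff (cayley_basis (fst w) n (fst d)) (fst c) * coeff (cayley_basis (snd w) m (snd d)) (snd c) *
      (fst x ^ fst c * snd x ^ snd c)) = (\<Sum>i\<le>n. \<Sum>j\<le>m. (coeff (cayley_basis (fst w) n (fst d)) i * fst x ^ i) *
        (coeff (cayley_basis (snd w) m (snd d)) j * snd x ^ j))"
      by (simp add: sum.cartesian_product case_prod_unfold mult_ac)
    also have "\<dots> = poly (cayley_basis (fst w) n (fst d)) (fst x) * poly (cayley_basis (snd w) m (snd d)) (snd x)"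
      by (simp add: poly_eq_sum_coeff[OF deg(1)] poly_eq_sum_coeff[OF deg(2)] sum_product)
    finally show ?thesis using d assms by (auto simp: poly_cayley_basis mult_ac)
  qed
  have "poly_fun n m (cayley_coeff w n m a) x = (\<Sum>d\<in>{..n} \<times> {..m}. a d *
      (\<Sum>c\<in>{..n} \<times> {..m}. coeff (cayley_basis (fst w) n (fst d)) (fst c) * coeff (cayley_basis (snd w) m (snd d)) (snd c) *
      (fst x ^ fst c * snd x ^ snd c)))"
    unfolding poly_fun_def cayley_coeff_def sum_distrib_left sum_distrib_right
    by (subst sum.swap) (simp add: mult.assoc)
  also have "\<dots> = (\<Sum>d\<in>{..n} \<times> {..m}. a d * ((1 - fst x) ^ n * (1 - snd x) ^ m *
      (cayley (fst w) (fst x) ^ fst d * cayley (snd w) (snd x) ^ snd d)))"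
    by (rule sum.cong[OF refl]) (simp only: summand)
  finally show ?thesis by (simp add: poly_fun_def sum_distrib_left mult_ac)
qed

lemma cayley_upper:
  assumes w: "w \<in> upper_half_plane" and x: "x \<in> ball 0 1"
  shows "cayley w x \<in> upper_half_plane"
proof -
  have x1: "x \<noteq> 1" using x by auto
  have "cayley w x = (w - cnj w * x) * cnj (1 - x) / (cmod (1 - x))\<^sup>2"
    using complex_div_cnj[of "w - cnj w * x" "1 - x"] by (simp add: cayley_def)
  also have "(w - cnj w * x) * cnj (1 - x) = (w - (w * cnj x + cnj (w * cnj x))) + cnj w * complex_of_real ((cmod x)\<^sup>2)"
    unfolding complex_norm_square by (simp add: algebra_simps)
  finally have "Im (cayley w x) = (Im w * (1 - (cmod x)\<^sup>2)) / (cmod (1 - x))\<^sup>2"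
    by (simp add: Im_divide_of_real algebra_simps flip: of_real_power)
  moreover have "(cmod x)\<^sup>2 < 1" using x by (simp add: abs_square_less_1)
  ultimately show ?thesis using w x1 by (simp add: upper_half_plane_def)
qed

definition icayley :: "complex \<Rightarrow> complex \<Rightarrow> complex" where
  "icayley w z = (z - w) / (z - cnj w)"

lemma icayley:
  assumes w: "w \<in> upper_half_plane" and z: "z \<in> upper_half_plane"
  shows "z - cnj w \<noteq> 0" "icayley w z \<in> ball 0 1" "cayley w (icayley w z) = z"
proof -
  show zw: "z - cnj w \<noteq> 0" using w z by (auto simp: upper_half_plane_def complex_eq_iff)
  have "(cmod (z - w))\<^sup>2 < (cmod (z - cnj w))\<^sup>2"
    unfolding cmod_power2 using w z by (simp add: upper_half_plane_def power2_eq_square algebra_simps)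
  then have "cmod (z - w) < cmod (z - cnj w)" by (rule power_less_imp_less_base) simp
  then show "icayley w z \<in> ball 0 1" using zw by (simp add: icayley_def norm_divide)
  have ww: "w - cnj w \<noteq> 0" using w by (auto simp: upper_half_plane_def complex_eq_iff)
  have 1: "1 - icayley w z = (w - cnj w) / (z - cnj w)" using zw by (simp add: icayley_def field_simps)
  have 2: "w - cnj w * icayley w z = z * (w - cnj w) / (z - cnj w)" using zw by (simp add: icayley_def field_simps)
  show "cayley w (icayley w z) = z" unfolding cayley_def 1 2 using zw ww by simp
qed

lemma holomorphic_cayley: "cayley w holomorphic_on ball 0 1"
  unfolding cayley_def[abs_def] by (intro holomorphic_intros) auto

text \<open>Turns the disk factor into the half-plane factor \<open>z - cnj v\<close> up to a
  function of z times a function of v, which a rescaling of the vectors absorbs.\<close>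

lemma one_minus_icayley:
  assumes w: "w \<in> upper_half_plane" and z: "z \<in> upper_half_plane" and v: "v \<in> upper_half_plane"
  shows "1 - icayley w z * cnj (icayley w v) =
    - 2 * \<i> * complex_of_real (Im w) * (z - cnj v) / ((z - cnj w) * cnj (v - cnj w))"
proof -
  have nz: "z - cnj w \<noteq> 0" "cnj (v - cnj w) \<noteq> 0" using icayley(1)[OF w z] icayley(1)[OF w v] by auto
  have "w - cnj w = 2 * \<i> * complex_of_real (Im w)" by (simp add: complex_eq_iff)
  then have 1: "- 2 * \<i> * complex_of_real (Im w) = cnj w - w" by (simp add: algebra_simps)
  have "1 - icayley w z * cnj (icayley w v) = ((z - cnj w) * cnj (v - cnj w) - (z - w) * cnj (v - w)) / ((z - cnj w) * cnj (v - cnj w))"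
  proof -
    have "1 - a / b * (c / d) = (b * d - a * c) / (b * d)" if "b \<noteq> 0" "d \<noteq> 0" for a b c d :: complex
      using that by (simp add: field_simps)
    from this[OF nz, of "z - w" "cnj (v - w)"] show ?thesis
      by (simp only: icayley_def complex_cnj_divide)
  qed
  also have "(z - cnj w) * cnj (v - cnj w) - (z - w) * cnj (v - w) = (cnj w - w) * (z - cnj v)"
    by (simp add: algebra_simps)
  finally show ?thesis unfolding 1 .
qed

section \<open>The Hardy space of the bidisk as square-summable double sequences\<close>

text \<open>Taylor coefficients of an element of the Hardy space: \<open>prod_encode\<close> turns
  \<open>ell2\<close>, indexed by natural numbers, into double sequences.\<close>

definition crd :: "ell2 \<Rightarrow> nat \<times> nat \<Rightarrow> complex" where
  "crd x a = Rep_ell2 x (prod_encode a)"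

definition of_crd :: "(nat \<times> nat \<Rightarrow> complex) \<Rightarrow> ell2" where
  "of_crd g = Abs_ell2 (\<lambda>i. g (prod_decode i))"

definition square_summable :: "(nat \<times> nat \<Rightarrow> complex) \<Rightarrow> bool" where
  "square_summable g \<longleftrightarrow> (\<lambda>a. (cmod (g a))\<^sup>2) summable_on UNIV"

lemma summable_decode_iff:
  fixes g :: "nat \<times> nat \<Rightarrow> real"
  assumes "\<And>a. 0 \<le> g a"
  shows "summable (\<lambda>i. g (prod_decode i)) \<longleftrightarrow> g summable_on UNIV"
proof -
  have "summable (\<lambda>i. g (prod_decode i)) \<longleftrightarrow> (\<lambda>i. g (prod_decode i)) summable_on UNIV"
    by (rule summable_on_UNIV_nonneg_real_iff[symmetric]) (rule assms)
  also have "\<dots> \<longleftrightarrow> g summable_on UNIV"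
    by (rule summable_on_reindex_bij_betw[OF bij_prod_decode])
  finally show ?thesis .
qed

lemma crd_of_crd: "square_summable g \<Longrightarrow> crd (of_crd g) = g"
  unfolding square_summable_def
  by (subst (asm) summable_decode_iff[symmetric]) (auto simp: crd_def of_crd_def Abs_ell2_inverse fun_eq_iff)

lemma square_summable_crd: "square_summable (crd x)"
proof -
  have "summable (\<lambda>i. (cmod (crd x (prod_decode i)))\<^sup>2)" using Rep_ell2[of x] by (simp add: crd_def)
  then show ?thesis unfolding square_summable_def by (subst (asm) summable_decode_iff) auto
qed

lemma crd_eqI: "(\<And>a. crd x a = crd y a) \<Longrightarrow> x = y"
proof -
  assume a: "\<And>a. crd x a = crd y a"
  have "Rep_ell2 x i = Rep_ell2 y i" for i using a[of "prod_decode i"] by (simp add: crd_def)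
  then show ?thesis by (metis Rep_ell2_inject ext)
qed

lemma crd_add: "crd (x + y) a = crd x a + crd y a"
  by (simp add: crd_def plus_ell2.rep_eq)

lemma crd_scaleC: "crd (c *\<^sub>C x) a = c * crd x a"
  by (simp add: crd_def scaleC_ell2_def ell2_scaleC.rep_eq)

lemma crd_zero: "crd 0 a = 0"
  by (simp add: crd_def zero_ell2.rep_eq)

lemma crd_sum: "crd (\<Sum>i\<in>I. x i) a = (\<Sum>i\<in>I. crd (x i) a)"
  by (induction I rule: infinite_finite_induct) (auto simp: crd_add crd_zero)

lemma cinner_has_sum: "((\<lambda>a. crd x a * cnj (crd y a)) has_sum cinner x y) UNIV"
proof -
  let ?f = "\<lambda>i. Rep_ell2 x i * cnj (Rep_ell2 y i)"
  have s: "summable (\<lambda>i. (cmod (Rep_ell2 x i))\<^sup>2)" "summable (\<lambda>i. (cmod (Rep_ell2 y i))\<^sup>2)"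
    using Rep_ell2[of x] Rep_ell2[of y] by auto
  have n: "summable (\<lambda>i. norm (?f i))"
  proof (rule summable_comparison_test'[OF summable_add[OF s]])
    fix i
    show "norm (norm (?f i)) \<le> (cmod (Rep_ell2 x i))\<^sup>2 + (cmod (Rep_ell2 y i))\<^sup>2"
      using sum_squares_bound[of "cmod (Rep_ell2 x i)" "cmod (Rep_ell2 y i)"]
        mult_nonneg_nonneg[of "cmod (Rep_ell2 x i)" "cmod (Rep_ell2 y i)"]
      by (simp add: norm_mult del: mult_nonneg_nonneg)
  qed
  have "?f sums cinner x y"
    using summable_norm_cancel[OF n] by (simp add: cinner_ell2_def ell2_cinner.rep_eq summable_sums)
  then have "(?f has_sum cinner x y) UNIV" by (rule norm_summable_imp_has_sum[OF n])
  then have "((\<lambda>a. ?f (prod_encode a)) has_sum cinner x y) UNIV"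
    by (subst has_sum_reindex_bij_betw[OF bij_prod_encode])
  then show ?thesis by (simp add: crd_def)
qed

lemma norm_sq_has_sum: "((\<lambda>a. (cmod (crd x a))\<^sup>2) has_sum (norm x)\<^sup>2) UNIV"
proof -
  have "((\<lambda>a. Re (crd x a * cnj (crd x a))) has_sum Re (cinner x x)) UNIV"
    by (rule has_sum_Re[OF cinner_has_sum])
  moreover have "Re (crd x a * cnj (crd x a)) = (cmod (crd x a))\<^sup>2" for a
    by (simp only: complex_norm_square[symmetric] Re_complex_of_real)
  ultimately show ?thesis by (simp add: norm_sq_eq_Re_cinner)
qed

text \<open>For an injective index map, \<open>push\<close> moves coefficients along it and
  \<open>pull\<close> is its adjoint. For \<open>s1\<close> and \<open>s2\<close> they are the
  coordinate shifts and their backward shifts.\<close>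

definition pull :: "(nat \<times> nat \<Rightarrow> nat \<times> nat) \<Rightarrow> ell2 \<Rightarrow> ell2" where
  "pull \<sigma> x = of_crd (\<lambda>a. crd x (\<sigma> a))"

definition push :: "(nat \<times> nat \<Rightarrow> nat \<times> nat) \<Rightarrow> ell2 \<Rightarrow> ell2" where
  "push \<sigma> x = of_crd (\<lambda>a. if a \<in> range \<sigma> then crd x (inv \<sigma> a) else 0)"

lemma crd_pull:
  assumes "inj \<sigma>"
  shows "crd (pull \<sigma> x) a = crd x (\<sigma> a)"
proof -
  have "(\<lambda>a. (cmod (crd x a))\<^sup>2) summable_on range \<sigma>"
    using square_summable_crd[of x] unfolding square_summable_def
    by (rule summable_on_subset_banach) auto
  then have "((\<lambda>a. (cmod (crd x a))\<^sup>2) \<circ> \<sigma>) summable_on UNIV"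
    by (subst (asm) summable_on_reindex[OF assms])
  then have "square_summable (\<lambda>a. crd x (\<sigma> a))" by (simp add: square_summable_def o_def)
  then show ?thesis by (simp add: pull_def crd_of_crd)
qed

lemma crd_push:
  assumes "inj \<sigma>"
  shows "crd (push \<sigma> x) a = (if a \<in> range \<sigma> then crd x (inv \<sigma> a) else 0)"
proof -
  let ?g = "\<lambda>a. if a \<in> range \<sigma> then crd x (inv \<sigma> a) else 0"
  have "((\<lambda>a. (cmod (?g a))\<^sup>2) \<circ> \<sigma>) summable_on UNIV"
    using square_summable_crd[of x] assms by (simp add: square_summable_def o_def)
  then have "(\<lambda>a. (cmod (?g a))\<^sup>2) summable_on range \<sigma>"
    by (subst summable_on_reindex[OF assms])
  then have "(\<lambda>a. (cmod (?g a))\<^sup>2) summable_on UNIV"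
    by (subst summable_on_cong_neutral[where T = "range \<sigma>" and g = "\<lambda>a. (cmod (?g a))\<^sup>2"]) auto
  then have "square_summable ?g" by (simp add: square_summable_def)
  then show ?thesis by (simp add: push_def crd_of_crd)
qed

lemma pull_push: "inj \<sigma> \<Longrightarrow> pull \<sigma> (push \<sigma> x) = x"
  by (rule crd_eqI) (simp add: crd_pull crd_push)

lemma cinner_push:
  assumes "inj \<sigma>"
  shows "cinner (push \<sigma> x) y = cinner x (pull \<sigma> y)"
proof -
  have "((\<lambda>a. crd (push \<sigma> x) a * cnj (crd y a)) has_sum cinner (push \<sigma> x) y) (range \<sigma>)"
    using cinner_has_sum[of "push \<sigma> x" y]
    by (subst has_sum_cong_neutral[where T = UNIV and g = "\<lambda>a. crd (push \<sigma> x) a * cnj (crd y a)"])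
      (auto simp: crd_push[OF assms])
  then have "((\<lambda>a. crd x a * cnj (crd (pull \<sigma> y) a)) has_sum cinner (push \<sigma> x) y) UNIV"
    using assms by (subst (asm) has_sum_reindex[OF assms]) (simp add: o_def crd_push crd_pull)
  then show ?thesis using cinner_has_sum has_sum_unique by blast
qed

definition s1 :: "nat \<times> nat \<Rightarrow> nat \<times> nat" where "s1 a = (Suc (fst a), snd a)"
definition s2 :: "nat \<times> nat \<Rightarrow> nat \<times> nat" where "s2 a = (fst a, Suc (snd a))"

lemma inj_s1: "inj s1" and inj_s2: "inj s2"
  by (auto simp: inj_def s1_def s2_def prod_eq_iff)

lemma crd_push_s1: "crd (push s1 x) a = (if fst a = 0 then 0 else crd x (fst a - 1, snd a))"
proof (cases a)
  case (Pair i j)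
  show ?thesis
  proof (cases i)
    case 0
    then have "a \<notin> range s1" using Pair by (auto simp: s1_def)
    then show ?thesis using Pair 0 by (simp add: crd_push[OF inj_s1])
  next
    case (Suc l)
    then have "a = s1 (l, j)" using Pair by (simp add: s1_def)
    then have "crd (push s1 x) a = crd x (l, j)" by (simp add: crd_push[OF inj_s1] inv_f_f[OF inj_s1])
    then show ?thesis using Pair Suc by simp
  qed
qed

lemma crd_push_s2: "crd (push s2 x) a = (if snd a = 0 then 0 else crd x (fst a, snd a - 1))"
proof (cases a)
  case (Pair i j)
  show ?thesis
  proof (cases j)
    case 0
    then have "a \<notin> range s2" using Pair by (auto simp: s2_def)
    then show ?thesis using Pair 0 by (simp add: crd_push[OF inj_s2])
  next
    case (Suc l)
    then have "a = s2 (i, l)" using Pair by (simp add: s2_def)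
    then have "crd (push s2 x) a = crd x (i, l)" by (simp add: crd_push[OF inj_s2] inv_f_f[OF inj_s2])
    then show ?thesis using Pair Suc by simp
  qed
qed

lemma crd_pull_s1: "crd (pull s1 x) a = crd x (Suc (fst a), snd a)"
  and crd_pull_s2: "crd (pull s2 x) a = crd x (fst a, Suc (snd a))"
  by (simp_all add: crd_pull inj_s1 inj_s2) (simp_all add: s1_def s2_def)

definition vac :: ell2 where "vac = of_crd (\<lambda>a. if a = (0, 0) then 1 else 0)"

lemma crd_vac: "crd vac a = (if a = (0, 0) then 1 else 0)"
proof -
  have "(\<lambda>a. (cmod (if a = (0, 0) then 1 else (0::complex)))\<^sup>2) summable_on {(0, 0)}" by simp
  then have "(\<lambda>a. (cmod (if a = (0, 0) then 1 else (0::complex)))\<^sup>2) summable_on (UNIV :: (nat \<times> nat) set)"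
    by (subst summable_on_cong_neutral[where T = "{(0, 0)}" and
          g = "\<lambda>a. (cmod (if a = (0, 0) then 1 else (0::complex)))\<^sup>2"]) auto
  then show ?thesis unfolding vac_def by (subst crd_of_crd) (auto simp: square_summable_def)
qed

lemma crd_shift: "crd ((push s1 ^^ j) ((push s2 ^^ k) x)) a = shift_coeff (j, k) (crd x) a"
proof -
  have 2: "crd ((push s2 ^^ k) x) a = (if k \<le> snd a then crd x (fst a, snd a - k) else 0)" for a
    by (induction k arbitrary: a) (auto simp: crd_push_s2)
  have "crd ((push s1 ^^ j) y) a = (if j \<le> fst a then crd y (fst a - j, snd a) else 0)" for y a
    by (induction j arbitrary: a) (auto simp: crd_push_s1)
  then show ?thesis by (simp add: 2 shift_coeff_def)
qed

lemma cinner_crd_vac: "cinner x ((push s1 ^^ j) ((push s2 ^^ k) vac)) = crd x (j, k)"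
proof -
  have eq: "crd ((push s1 ^^ j) ((push s2 ^^ k) vac)) a = (if a = (j, k) then 1 else 0)" for a
    unfolding crd_shift by (cases a) (auto simp: shift_coeff_def crd_vac)
  have "((\<lambda>a. crd x a * (if a = (j, k) then 1 else 0)) has_sum
      cinner x ((push s1 ^^ j) ((push s2 ^^ k) vac))) UNIV"
    using cinner_has_sum[of x "(push s1 ^^ j) ((push s2 ^^ k) vac)"]
    by (simp only: eq if_distrib[of cnj] complex_cnj_one complex_cnj_zero)
  then show ?thesis using has_sum_delta[of "crd x" "(j, k)"] has_sum_unique by blast
qed

interpretation hardy: bishift "push s1" "push s2" "pull s1" "pull s2" vac
proof
  show "cinner (push s1 x) y = cinner x (pull s1 y)" "cinner (push s2 x) y = cinner x (pull s2 y)" for x y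
    by (simp_all add: cinner_push inj_s1 inj_s2)
  show "pull s1 (push s1 x) = x" "pull s2 (push s2 x) = x" for x by (simp_all add: pull_push inj_s1 inj_s2)
  show "push s1 (push s2 x) = push s2 (push s1 x)" "push s1 (pull s2 x) = pull s2 (push s1 x)"
    "push s2 (pull s1 x) = pull s1 (push s2 x)" for x
    by (rule crd_eqI, simp add: crd_push_s1 crd_push_s2 crd_pull_s1 crd_pull_s2)+
  show "pull s1 vac = 0" "pull s2 vac = 0"
    by (rule crd_eqI, simp add: crd_pull_s1 crd_pull_s2 crd_vac crd_zero)+
  have "cinner vac vac = 1" using cinner_crd_vac[of vac 0 0] by (simp add: crd_vac)
  then have "(norm vac)\<^sup>2 = 1" by (simp add: norm_sq_eq_Re_cinner)
  then show "norm vac = 1" by (metis norm_ge_zero power2_eq_1_iff abs_of_nonneg abs_1 abs_minus)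
  show "x = 0" if "\<And>j k. cinner x ((push s1 ^^ j) ((push s2 ^^ k) vac)) = 0" for x
    by (rule crd_eqI) (use that cinner_crd_vac crd_zero in \<open>metis surj_pair\<close>)
qed

text \<open>An antiunitary map, which exchanges the entries of the inner product: the disk
  decomposition has the conjugated point in the first entry, the half-plane identity in the
  second.\<close>

definition conj_ell2 :: "ell2 \<Rightarrow> ell2" where "conj_ell2 x = of_crd (\<lambda>a. cnj (crd x a))"

lemma crd_conj: "crd (conj_ell2 x) a = cnj (crd x a)"
proof -
  have "square_summable (\<lambda>a. cnj (crd x a))" using square_summable_crd[of x] by (simp add: square_summable_def)
  then show ?thesis by (simp add: conj_ell2_def crd_of_crd)
qed

lemma cinner_conj: "cinner (conj_ell2 x) (conj_ell2 y) = cinner y x"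
proof -
  have "((\<lambda>a. crd y a * cnj (crd x a)) has_sum cinner (conj_ell2 x) (conj_ell2 y)) UNIV"
    using cinner_has_sum[of "conj_ell2 x" "conj_ell2 y"] by (simp add: crd_conj mult.commute)
  then show ?thesis using cinner_has_sum has_sum_unique by blast
qed

lemma conj_ell2_span: "x \<in> ch.span B \<Longrightarrow> conj_ell2 x \<in> ch.span (conj_ell2 ` B)"
proof (induction rule: ch.span_induct_alt)
  case base
  have "conj_ell2 0 = 0" by (rule crd_eqI) (simp add: crd_conj crd_zero)
  then show ?case by (simp add: ch.span_zero)
next
  case (step c b y)
  have "conj_ell2 (c *\<^sub>C b + y) = cnj c *\<^sub>C conj_ell2 b + conj_ell2 y"
    by (rule crd_eqI) (simp add: crd_conj crd_add crd_scaleC)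
  moreover have "conj_ell2 b \<in> ch.span (conj_ell2 ` B)" using step by (intro ch.span_base imageI)
  ultimately show ?case using step.IH by (simp only: ch.span_add ch.span_scale)
qed

section \<open>The realization of a rational function\<close>

lemma finite_subset_box:
  assumes "finite (F :: (nat \<times> nat) set)"
  obtains K where "F \<subseteq> {..<K} \<times> {..<K}"
proof -
  obtain K1 K2 where "fst ` F \<subseteq> {..<K1}" "snd ` F \<subseteq> {..<K2}"
    using assms finite_nat_bounded[of "fst ` F"] finite_nat_bounded[of "snd ` F"] by auto
  then have "F \<subseteq> {..<max K1 K2} \<times> {..<max K1 K2}" by fastforce
  then show ?thesis using that by blast
qed

theorem HVMS_if_rational2:
  assumes h: "h \<in> L_infinity" and rat: "rational2 h"
  shows "\<exists>(\<alpha> :: nat \<times> nat \<Rightarrow> ell2) Y D A. infinite_HVMS \<alpha> Y D A \<and>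
    (\<forall>z\<in>bi_upper. h z = cinner (resolvent D A Y z (\<alpha> (1, 0) + \<alpha> (0, 1))) (\<alpha> (1, 0) + \<alpha> (0, 1))) \<and>
    finite_rank (\<lambda>m n. gram1 \<alpha> Y m n + gram2 \<alpha> Y m n)"
proof -
  have hol: "holomorphic2_on h bi_upper" and pos: "\<And>z. z \<in> bi_upper \<Longrightarrow> 0 \<le> Im (h z)"
    using h by (auto simp: L_infinity_def pick2_def)
  obtain \<rho> :: "nat \<times> nat \<Rightarrow> real" where asym: "\<And>s K. 0 < s \<Longrightarrow> 1 \<le> K \<Longrightarrow> ((\<lambda>t. complex_of_real (t ^ K) *
       (h (\<i> * of_real t, \<i> * of_real (t * s)) - (\<Sum>n | 1 \<le> fst n + snd n \<and> fst n + snd n \<le> K.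
          complex_of_real (\<rho> n) / ((\<i> * of_real t) ^ fst n * (\<i> * of_real (t * s)) ^ snd n)))) \<longlongrightarrow> 0) at_top"
    using L_infinity_asymptotics[OF h] by blast
  have "\<exists>n m (a :: nat \<times> nat \<Rightarrow> real) (b :: nat \<times> nat \<Rightarrow> real) \<omega>.
    (\<forall>z\<in>bi_upper. poly_fun n m (\<lambda>c. of_real (b c)) z * h z = poly_fun n m (\<lambda>c. of_real (a c)) z) \<and>
    \<omega> \<in> bi_upper \<and> poly_fun n m (\<lambda>c. of_real (b c)) \<omega> \<noteq> 0"
    by (rule real_fraction[OF hol rat asym])
  then obtain n m and a b :: "nat \<times> nat \<Rightarrow> real" and \<omega> where
    ab': "\<forall>z\<in>bi_upper. poly_fun n m (\<lambda>c. of_real (b c)) z * h z = poly_fun n m (\<lambda>c. of_real (a c)) z"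
    and \<omega>: "\<omega> \<in> bi_upper" "poly_fun n m (\<lambda>c. of_real (b c)) \<omega> \<noteq> 0"
    by (elim exE conjE) (rule that)
  have ab: "poly_fun n m (\<lambda>c. of_real (b c)) z * h z = poly_fun n m (\<lambda>c. of_real (a c)) z"
    if "z \<in> bi_upper" for z using ab' that by (rule bspec)
  have \<omega>1: "fst \<omega> \<in> upper_half_plane" and \<omega>2: "snd \<omega> \<in> upper_half_plane" using \<omega>(1) by auto
  have hi: "h z + \<i> \<noteq> 0" if "z \<in> bi_upper" for z
    using pos[OF that] by (auto simp: complex_eq_iff)

  \<comment> \<open>The Cayley transform of \<open>h\<close> and its Taylor coefficients\<close>
  define Z where "Z x = (cayley (fst \<omega>) (fst x), cayley (snd \<omega>) (snd x))" for x
  have ZU: "Z x \<in> bi_upper" if "x \<in> bidisk" for x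
    using that cayley_upper[OF \<omega>1] cayley_upper[OF \<omega>2] by (auto simp: Z_def)
  define \<Phi> where "\<Phi> z = (h z - \<i>) / (h z + \<i>)" for z
  define F where "F x = \<Phi> (Z x)" for x
  have F1: "cmod (F x) \<le> 1" if x: "x \<in> bidisk" for x
  proof -
    have "(cmod (h (Z x) - \<i>))\<^sup>2 \<le> (cmod (h (Z x) + \<i>))\<^sup>2"
      unfolding cmod_power2 using pos[OF ZU[OF x]] by (simp add: power2_eq_square algebra_simps)
    then have "cmod (h (Z x) - \<i>) \<le> cmod (h (Z x) + \<i>)" by (rule power2_le_imp_le) simp
    then show ?thesis using hi[OF ZU[OF x]] by (simp add: F_def \<Phi>_def norm_divide)
  qed
  have sl1: "(\<lambda>x. F (x, y)) holomorphic_on ball 0 1" if y: "y \<in> ball 0 1" for y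
  proof -
    have "(\<lambda>x. h (x, cayley (snd \<omega>) y)) \<circ> cayley (fst \<omega>) holomorphic_on ball 0 1"
      by (rule holomorphic_on_compose_gen[OF holomorphic_cayley holomorphic2_on_slices(1)[OF hol]])
        (use cayley_upper \<omega>1 \<omega>2 y in auto)
    then show ?thesis unfolding F_def \<Phi>_def Z_def o_def
      by (intro holomorphic_intros) (use hi cayley_upper \<omega>1 \<omega>2 y in auto)
  qed
  have sl2: "(\<lambda>y. F (x, y)) holomorphic_on ball 0 1" if x: "x \<in> ball 0 1" for x
  proof -
    have "(\<lambda>y. h (cayley (fst \<omega>) x, y)) \<circ> cayley (snd \<omega>) holomorphic_on ball 0 1"
      by (rule holomorphic_on_compose_gen[OF holomorphic_cayley holomorphic2_on_slices(2)[OF hol]])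
        (use cayley_upper \<omega>1 \<omega>2 x in auto)
    then show ?thesis unfolding F_def \<Phi>_def Z_def o_def
      by (intro holomorphic_intros) (use hi cayley_upper \<omega>1 \<omega>2 x in auto)
  qed
  obtain c :: "nat \<times> nat \<Rightarrow> complex" where c1: "\<And>a. cmod (c a) \<le> 1"
    and cF: "\<And>z. z \<in> bidisk \<Longrightarrow> ((\<lambda>a. c a * (fst z ^ fst a * snd z ^ snd a)) has_sum F z) UNIV"
    using double_taylor[of F, OF sl1 sl2 F1] by blast

  \<comment> \<open>The denominator polynomial and its reflection\<close>
  define u where "u d = complex_of_real (a d) + \<i> * complex_of_real (b d)" for d
  define p where "p = cayley_coeff \<omega> n m u"
  define \<epsilon> :: complex where "\<epsilon> = (- 1) ^ (n + m)"
  define pt where "pt k = (if k \<in> {..n} \<times> {..m} then \<epsilon> * cnj (p (n - fst k, m - snd k)) else 0)" for k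
  \<comment> \<open>With h = a/b for real polynomials, h + \<i> = u/b, and h - \<i> is the
    polynomial with conjugated coefficients over b; so their quotient is conj(u)/u.\<close>
  have poly_u: "poly_fun n m u z = poly_fun n m (\<lambda>c. of_real (a c)) z + \<i> * poly_fun n m (\<lambda>c. of_real (b c)) z"
    and poly_cu: "poly_fun n m (\<lambda>d. cnj (u d)) z = poly_fun n m (\<lambda>c. of_real (a c)) z - \<i> * poly_fun n m (\<lambda>c. of_real (b c)) z" for z
    by (simp_all add: poly_fun_def u_def sum.distrib sum_subtractf sum_distrib_left algebra_simps)
  have p_eq: "poly_fun n m p x * F x = poly_fun n m pt x" if x: "x \<in> bidisk" for x
  proof -
    have ne: "fst x \<noteq> 1" "snd x \<noteq> 1" using x by auto
    have "poly_fun n m pt x = poly_fun n m (cayley_coeff \<omega> n m (\<lambda>d. cnj (u d))) x"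
      unfolding poly_fun_def
      by (intro sum.cong refl) (auto simp: pt_def p_def \<epsilon>_def cayley_coeff_reflect[of _ n m \<omega> u])
    also have "\<dots> = (1 - fst x) ^ n * (1 - snd x) ^ m * poly_fun n m (\<lambda>d. cnj (u d)) (Z x)"
      unfolding poly_fun_cayley[OF ne] Z_def by (rule refl)
    also have "poly_fun n m (\<lambda>d. cnj (u d)) (Z x) = poly_fun n m u (Z x) * F x"
      unfolding poly_cu poly_u ab[OF ZU[OF x], symmetric] F_def \<Phi>_def
      using hi[OF ZU[OF x]] by (simp add: field_simps)
    finally show ?thesis by (simp add: p_def poly_fun_cayley[OF ne] Z_def)
  qed
  have p0: "p (0, 0) \<noteq> 0"
  proof -
    have z: "(0::complex) ^ i = (if i = 0 then 1 else 0)" for i by simp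
    have "poly_fun n m p (0, 0) = (\<Sum>k\<in>{..n} \<times> {..m}. if k = (0, 0) then p k else 0)"
      unfolding poly_fun_def z by (intro sum.cong refl) (auto simp: z)
    also have "\<dots> = p (0, 0)" by simp
    \<comment> \<open>The Cayley transform sends the origin to \<omega>, which was chosen off the
      zeros of the denominator.\<close>
    finally have "p (0, 0) = poly_fun n m u \<omega>"
      using poly_fun_cayley[of "(0, 0)" n m \<omega> u] by (simp add: p_def cayley_def)
    also have "\<dots> = poly_fun n m (\<lambda>c. of_real (b c)) \<omega> * (h \<omega> + \<i>)"
      unfolding poly_u ab[OF \<omega>(1), symmetric] by (simp add: algebra_simps)
    finally show ?thesis using \<omega>(2) hi[OF \<omega>(1)] by simp
  qed
  have conv: "conv_coeff ({..n} \<times> {..m}) p c k = pt k" for k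
  proof -
    let ?C = "\<lambda>k. conv_coeff ({..n} \<times> {..m}) p c k - pt k"
    define M where "M = (\<Sum>b\<in>{..n} \<times> {..m}. cmod (p b)) + (\<Sum>b\<in>{..n} \<times> {..m}. cmod (pt b))"
    have "?C k = 0"
    proof (rule double_series_zero[of ?C M])
      fix k
      have "cmod (pt k) \<le> (\<Sum>b\<in>{..n} \<times> {..m}. cmod (pt b))"
      proof (cases "k \<in> {..n} \<times> {..m}")
        case True
        then show ?thesis by (intro member_le_sum[of k _ "\<lambda>b. cmod (pt b)"]) auto
      next
        case False
        then show ?thesis unfolding pt_def by (simp only: if_False norm_zero) (simp add: sum_nonneg)
      qed
      then show "cmod (?C k) \<le> M"
        using norm_triangle_ineq4[of "conv_coeff ({..n} \<times> {..m}) p c k" "pt k"]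
          conv_coeff_bound[of c "{..n} \<times> {..m}" p k] c1 by (simp add: M_def)
    next
      fix z :: "complex \<times> complex" assume z: "z \<in> bidisk"
      have 1: "((\<lambda>a. conv_coeff ({..n} \<times> {..m}) p c a * (fst z ^ fst a * snd z ^ snd a)) has_sum
          (poly_fun n m p z * F z)) UNIV"
        unfolding poly_fun_def by (rule has_sum_conv_coeff[OF cF[OF z]]) simp
      have "((\<lambda>a. pt a * (fst z ^ fst a * snd z ^ snd a)) has_sum poly_fun n m pt z) ({..n} \<times> {..m})"
        unfolding poly_fun_def by (rule has_sum_finite) simp
      moreover have "((\<lambda>a. pt a * (fst z ^ fst a * snd z ^ snd a)) has_sum poly_fun n m pt z) UNIV \<longleftrightarrow>
          ((\<lambda>a. pt a * (fst z ^ fst a * snd z ^ snd a)) has_sum poly_fun n m pt z) ({..n} \<times> {..m})"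
        by (rule has_sum_cong_neutral) (auto simp: pt_def)
      ultimately have "((\<lambda>a. pt a * (fst z ^ fst a * snd z ^ snd a)) has_sum poly_fun n m pt z) UNIV" by blast
      then have "((\<lambda>a. - (pt a * (fst z ^ fst a * snd z ^ snd a))) has_sum - poly_fun n m pt z) UNIV"
        by (simp add: has_sum_uminus)
      from has_sum_add[OF 1 this]
      show "((\<lambda>a. ?C a * (fst z ^ fst a * snd z ^ snd a)) has_sum 0) UNIV"
        by (simp add: left_diff_distrib p_eq[OF z])
    qed
    then show ?thesis by simp
  qed

  \<comment> \<open>The inner function as an element of the Hardy space\<close>
  have contr: "(\<Sum>a\<in>{..<K} \<times> {..<K}. (cmod (conv_coeff B q c a))\<^sup>2) \<le> (\<Sum>b\<in>B. (cmod (q b))\<^sup>2)"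
    if "finite B" for K B q
    by (rule contractive_multiplier[OF c1 cF F1 that])
  have "square_summable c"
    unfolding square_summable_def
  proof (rule nonneg_bounded_partial_sums_imp_summable_on[of _ _ 1])
    have "(\<Sum>a\<in>A. (cmod (c a))\<^sup>2) \<le> 1" if A: "finite A" for A
    proof -
      obtain K where K: "A \<subseteq> {..<K} \<times> {..<K}" using finite_subset_box[OF A] by blast
      \<comment> \<open>The multiplier bound for the constant polynomial 1 bounds the square sum of
        the Taylor coefficients.\<close>
      have "conv_coeff {(0, 0)} (\<lambda>_. 1) c a = c a" for a by (simp add: conv_coeff_def shift_coeff_def)
      then have "(\<Sum>a\<in>{..<K} \<times> {..<K}. (cmod (c a))\<^sup>2) \<le> 1"
        using contr[of "{(0, 0)}" "\<lambda>_. 1" K] by simp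
      moreover have "(\<Sum>a\<in>A. (cmod (c a))\<^sup>2) \<le> (\<Sum>a\<in>{..<K} \<times> {..<K}. (cmod (c a))\<^sup>2)"
        using K by (intro sum_mono2) auto
      ultimately show ?thesis by linarith
    qed
    then show "\<forall>\<^sub>F A in finite_subsets_at_top UNIV. (\<Sum>a\<in>A. (cmod (c a))\<^sup>2) \<le> 1"
      by (intro eventually_finite_subsets_at_top_weakI) auto
  qed auto
  define f where "f = of_crd c"
  have crd_f: "crd f = c" unfolding f_def by (rule crd_of_crd) fact
  have crd_orbit: "crd (hardy.orbit g k) l = shift_coeff k (crd g) l" for g k l
    by (simp add: hardy.orbit_def crd_shift)
  interpret R: rational_inner "push s1" "push s2" "pull s1" "pull s2" vac f n m p \<epsilon>
  proof
    fix A :: "(nat \<times> nat) set" and q :: "nat \<times> nat \<Rightarrow> complex" assume A: "finite A"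
    let ?x = "\<Sum>a\<in>A. q a *\<^sub>C hardy.orbit f a"
    have x: "crd ?x l = conv_coeff A q c l" for l
      by (simp add: crd_sum crd_scaleC crd_orbit crd_f conv_coeff_def)
    show "(norm ?x)\<^sup>2 \<le> (\<Sum>a\<in>A. (cmod (q a))\<^sup>2)"
    proof (rule has_sum_le_finite_sums[OF norm_sq_has_sum])
      fix G :: "(nat \<times> nat) set" assume "finite G"
      then obtain K where K: "G \<subseteq> {..<K} \<times> {..<K}" using finite_subset_box by blast
      have "(\<Sum>a\<in>G. (cmod (crd ?x a))\<^sup>2) \<le> (\<Sum>a\<in>{..<K} \<times> {..<K}. (cmod (crd ?x a))\<^sup>2)"
        using K by (intro sum_mono2) auto
      also have "\<dots> \<le> (\<Sum>a\<in>A. (cmod (q a))\<^sup>2)" unfolding x by (rule contr[OF A])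
      finally show "(\<Sum>a\<in>G. (cmod (crd ?x a))\<^sup>2) \<le> (\<Sum>a\<in>A. (cmod (q a))\<^sup>2)" .
    qed
  next
    show "p (0, 0) \<noteq> 0" by (rule p0)
    show "cmod \<epsilon> = 1" by (simp add: \<epsilon>_def norm_power)
    show "(\<Sum>k\<in>{..n} \<times> {..m}. p k *\<^sub>C hardy.orbit f k) =
      (\<Sum>k\<in>{..n} \<times> {..m}. (\<epsilon> * cnj (p (n - fst k, m - snd k))) *\<^sub>C hardy.orbit vac k)"
    proof (rule crd_eqI)
      fix l
      have "crd (\<Sum>k\<in>{..n} \<times> {..m}. p k *\<^sub>C hardy.orbit f k) l = pt l"
        unfolding conv[symmetric] by (simp add: crd_sum crd_scaleC crd_orbit crd_f conv_coeff_def)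
      moreover have "crd (\<Sum>k\<in>{..n} \<times> {..m}. (\<epsilon> * cnj (p (n - fst k, m - snd k))) *\<^sub>C hardy.orbit vac k) l = pt l"
      proof -
        have vac_orbit: "crd (hardy.orbit vac k) l = (if k = l then 1 else 0)" for k
          unfolding crd_orbit by (cases k; cases l) (auto simp: shift_coeff_def crd_vac)
        have "(\<Sum>k\<in>{..n} \<times> {..m}. \<epsilon> * cnj (p (n - fst k, m - snd k)) * (if k = l then 1 else 0)) =
            (\<Sum>k\<in>{..n} \<times> {..m}. if k = l then \<epsilon> * cnj (p (n - fst k, m - snd k)) else 0)"
          by (rule sum.cong) auto
        also have "\<dots> = pt l" by (subst sum.delta) (auto simp: pt_def)
        finally show ?thesis unfolding crd_sum crd_scaleC vac_orbit .
      qed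
      ultimately show "crd (\<Sum>k\<in>{..n} \<times> {..m}. p k *\<^sub>C hardy.orbit f k) l =
        crd (\<Sum>k\<in>{..n} \<times> {..m}. (\<epsilon> * cnj (p (n - fst k, m - snd k))) *\<^sub>C hardy.orbit vac k) l"
        by (rule trans[OF _ sym])
    qed
  qed
  have eval: "cinner f (hardy.k x) = F x" if x: "x \<in> bidisk" for x
  proof -
    have "cinner f (hardy.orbit vac k) = c k" for k
      using cinner_crd_vac[of f "fst k" "snd k"] by (simp add: hardy.orbit_def crd_f)
    then have "((\<lambda>a. c a * (fst x ^ fst a * snd x ^ snd a)) has_sum cinner f (hardy.k x)) UNIV"
      using hardy.evaluation_has_sum[OF x, of f] by simp
    then show ?thesis using cF[OF x] has_sum_unique by blast
  qed
  obtain B1 B2 :: "ell2 set" and t1 t2 where B: "finite B1" "finite B2"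
    "\<And>x y. x \<in> B1 \<Longrightarrow> y \<in> B2 \<Longrightarrow> cinner x y = 0"
    and t1: "\<And>\<eta>. \<eta> \<in> bidisk \<Longrightarrow> t1 \<eta> \<in> ch.span B1" and t2: "\<And>\<eta>. \<eta> \<in> bidisk \<Longrightarrow> t2 \<eta> \<in> ch.span B2"
    and agler: "\<And>\<eta> \<zeta>. \<eta> \<in> bidisk \<Longrightarrow> \<zeta> \<in> bidisk \<Longrightarrow> 1 - cinner f (hardy.k \<zeta>) * cnj (cinner f (hardy.k \<eta>)) =
      (1 - fst \<zeta> * cnj (fst \<eta>)) * cinner (t1 \<eta>) (t1 \<zeta>) + (1 - snd \<zeta> * cnj (snd \<eta>)) * cinner (t2 \<eta>) (t2 \<zeta>)"
    using R.agler_decomposition by blast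

  \<comment> \<open>Transport of the decomposition to the half-planes\<close>
  define X where "X z = (icayley (fst \<omega>) (fst z), icayley (snd \<omega>) (snd z))" for z
  have XD: "X z \<in> bidisk" if "z \<in> bi_upper" for z
    using that icayley(2)[OF \<omega>1] icayley(2)[OF \<omega>2] by (auto simp: X_def)
  have FX: "F (X z) = \<Phi> z" if "z \<in> bi_upper" for z
    using that icayley(3)[OF \<omega>1] icayley(3)[OF \<omega>2] by (auto simp: F_def Z_def X_def)
  \<comment> \<open>The factor 2\<i> relating \<open>h z - cnj (h v)\<close> to the defect of \<Phi>
    and the factor -2\<i> Im \<omega> of the Cayley transform multiply to 4 Im \<omega>; each entry
    of the inner product takes the square root.\<close>
  define r1 where "r1 z = 2 * complex_of_real (sqrt (Im (fst \<omega>))) / ((fst z - cnj (fst \<omega>)) * (1 - \<Phi> z))" for z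
  define r2 where "r2 z = 2 * complex_of_real (sqrt (Im (snd \<omega>))) / ((snd z - cnj (snd \<omega>)) * (1 - \<Phi> z))" for z
  define x1 where "x1 z = r1 z *\<^sub>C conj_ell2 (t1 (X z))" for z
  define x2 where "x2 z = r2 z *\<^sub>C conj_ell2 (t2 (X z))" for z
  show ?thesis
  proof (rule HVMS_from_kernel[of "conj_ell2 ` B1" "conj_ell2 ` B2" x1 x2 h \<rho>])
    show "finite (conj_ell2 ` B1)" "finite (conj_ell2 ` B2)" using B by auto
    show "cinner x y = 0" if "x \<in> conj_ell2 ` B1" "y \<in> conj_ell2 ` B2" for x y
      using that B(3) cinner_eq_0_sym[where 'a = ell2, THEN iffD1] by (force simp: cinner_conj)
    show "x1 z \<in> ch.span (conj_ell2 ` B1)" if "z \<in> bi_upper" for z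
      unfolding x1_def by (intro ch.span_scale conj_ell2_span t1 XD that)
    show "x2 z \<in> ch.span (conj_ell2 ` B2)" if "z \<in> bi_upper" for z
      unfolding x2_def by (intro ch.span_scale conj_ell2_span t2 XD that)
    show "h z - cnj (h v) = (fst z - cnj (fst v)) * cinner (x1 z) (x1 v) + (snd z - cnj (snd v)) * cinner (x2 z) (x2 v)"
      if z: "z \<in> bi_upper" and v: "v \<in> bi_upper" for z v
    proof -
      have zc: "fst z \<in> upper_half_plane" "snd z \<in> upper_half_plane" "fst v \<in> upper_half_plane" "snd v \<in> upper_half_plane"
        using z v by auto
      have ph: "1 - \<Phi> y = 2 * \<i> / (h y + \<i>)" if "y \<in> bi_upper" for y
        using hi[OF that] by (simp add: \<Phi>_def field_simps)
      have nz: "1 - \<Phi> z \<noteq> 0" "1 - cnj (\<Phi> v) \<noteq> 0"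
      proof -
        show "1 - \<Phi> z \<noteq> 0" using ph[OF z] hi[OF z] by simp
        have "1 - \<Phi> v \<noteq> 0" using ph[OF v] hi[OF v] by simp
        then show "1 - cnj (\<Phi> v) \<noteq> 0" by (metis complex_cnj_cancel_iff complex_cnj_diff complex_cnj_one complex_cnj_zero)
      qed
      have hy: "h y = \<i> * (1 + \<Phi> y) / (1 - \<Phi> y)" if "y \<in> bi_upper" for y
      proof -
        have "1 + \<Phi> y = 2 * h y / (h y + \<i>)" using hi[OF that] by (simp add: \<Phi>_def field_simps)
        then show ?thesis unfolding ph[OF that] using hi[OF that] by simp
      qed
      have hv: "cnj (h v) = - \<i> * (1 + cnj (\<Phi> v)) / (1 - cnj (\<Phi> v))"
        using arg_cong[OF hy[OF v], of cnj] by simp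
      have diff: "h z - cnj (h v) = 2 * \<i> * (1 - \<Phi> z * cnj (\<Phi> v)) / ((1 - \<Phi> z) * (1 - cnj (\<Phi> v)))"
        unfolding hy[OF z] hv using nz by (simp add: field_simps)
      define T1 T2 where "T1 = cinner (t1 (X v)) (t1 (X z))" and "T2 = cinner (t2 (X v)) (t2 (X z))"
      have ag: "1 - \<Phi> z * cnj (\<Phi> v) = - 2 * \<i> * complex_of_real (Im (fst \<omega>)) * (fst z - cnj (fst v)) /
          ((fst z - cnj (fst \<omega>)) * cnj (fst v - cnj (fst \<omega>))) * T1 +
          - 2 * \<i> * complex_of_real (Im (snd \<omega>)) * (snd z - cnj (snd v)) /
          ((snd z - cnj (snd \<omega>)) * cnj (snd v - cnj (snd \<omega>))) * T2"
        using agler[OF XD[OF v] XD[OF z]] unfolding eval[OF XD[OF v]] eval[OF XD[OF z]] FX[OF v] FX[OF z]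
        unfolding one_minus_icayley[OF \<omega>1 zc(1,3), symmetric] one_minus_icayley[OF \<omega>2 zc(2,4), symmetric]
        by (simp add: X_def T1_def T2_def)
      have sq: "complex_of_real (sqrt y) * complex_of_real (sqrt y) = complex_of_real y" if "0 < y" for y
        using that by (simp flip: of_real_mult)
      have i1: "cinner (x1 z) (x1 v) = 4 * complex_of_real (Im (fst \<omega>)) /
          ((fst z - cnj (fst \<omega>)) * cnj (fst v - cnj (fst \<omega>)) * ((1 - \<Phi> z) * (1 - cnj (\<Phi> v)))) * T1"
        using sq[of "Im (fst \<omega>)"] \<omega>1
        by (simp add: x1_def r1_def cinner_scaleC_left cinner_conj T1_def upper_half_plane_def mult_ac)
      have i2: "cinner (x2 z) (x2 v) = 4 * complex_of_real (Im (snd \<omega>)) /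
          ((snd z - cnj (snd \<omega>)) * cnj (snd v - cnj (snd \<omega>)) * ((1 - \<Phi> z) * (1 - cnj (\<Phi> v)))) * T2"
        using sq[of "Im (snd \<omega>)"] \<omega>2
        by (simp add: x2_def r2_def cinner_scaleC_left cinner_conj T2_def upper_half_plane_def mult_ac)
      have two: "2 * \<i> * (- 2 * \<i> * I * d / g * T) / w = d * (4 * I / (g * w) * T)" for I d g T w :: complex
      proof -
        have "2 * \<i> * (- 2 * \<i> * I * d / g * T) = 4 * I * d / g * T" by (simp add: mult_ac)
        then show ?thesis by simp
      qed
      show ?thesis
        unfolding diff ag distrib_left add_divide_distrib two i1 i2 by (rule refl)
    qed
    show "((\<lambda>t. complex_of_real (t ^ K) *
       (h (\<i> * of_real t, \<i> * of_real (t * s)) - (\<Sum>n | 1 \<le> fst n + snd n \<and> fst n + snd n \<le> K.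
          complex_of_real (\<rho> n) / ((\<i> * of_real t) ^ fst n * (\<i> * of_real (t * s)) ^ snd n)))) \<longlongrightarrow> 0) at_top"
      if "0 < s" "1 \<le> K" for s K by (rule asym[OF that])
  qed
qed

text \<open>The two directions are stated over different spaces: the moment sequence given may live
  in any Hilbert space, the one produced lives in the Hardy space model. Choosing
  \<open>ell2\<close> in the first gives a literal equivalence.\<close>

theorem theorem6p6:
  fixes h :: "complex \<times> complex \<Rightarrow> complex"
  assumes "h \<in> L_infinity"
  shows
    "((\<exists>(\<alpha> :: nat \<times> nat \<Rightarrow> 'a::complex_hilbert) Y D A.
         infinite_HVMS \<alpha> Y D A \<and>
         (\<forall>z\<in>bi_upper. h z =
            cinner (resolvent D A Y z (\<alpha> (1, 0) + \<alpha> (0, 1))) (\<alpha> (1, 0) + \<alpha> (0, 1))) \<and>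
         finite_rank (\<lambda>m n. gram1 \<alpha> Y m n + gram2 \<alpha> Y m n))
      \<longrightarrow> rational2 h)
     \<and>
     (rational2 h \<longrightarrow>
      (\<exists>(\<alpha> :: nat \<times> nat \<Rightarrow> ell2) Y D A.
         infinite_HVMS \<alpha> Y D A \<and>
         (\<forall>z\<in>bi_upper. h z =
            cinner (resolvent D A Y z (\<alpha> (1, 0) + \<alpha> (0, 1))) (\<alpha> (1, 0) + \<alpha> (0, 1))) \<and>
         finite_rank (\<lambda>m n. gram1 \<alpha> Y m n + gram2 \<alpha> Y m n)))"
proof (intro conjI impI)
  have hol: "holomorphic2_on h bi_upper" using assms by (simp add: L_infinity_def pick2_def)
  assume "\<exists>(\<alpha> :: nat \<times> nat \<Rightarrow> 'a) Y D A.
         infinite_HVMS \<alpha> Y D A \<and>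
         (\<forall>z\<in>bi_upper. h z =
            cinner (resolvent D A Y z (\<alpha> (1, 0) + \<alpha> (0, 1))) (\<alpha> (1, 0) + \<alpha> (0, 1))) \<and>
         finite_rank (\<lambda>m n. gram1 \<alpha> Y m n + gram2 \<alpha> Y m n)"
  then show "rational2 h" using rational2_if_finite_rank_HVMS[OF hol] by blast
qed (rule HVMS_if_rational2[OF assms])

end
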